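(* Let $n>2$, $a=\pm1$, and let $M\subset SF(n+1,k,a)$ be a complete connected hypersurface with constant mean curvature $H$ and two non-constant principal curvatures $\lambda$ (multiplicity $n-1$) and $\mu$ (multiplicity $1$), with $\lambda>\mu$, $ad=1$, $bd=-1$; let $C$ be its associated constant and $g=w\circ\gamma$ for an integral curve $\gamma:\mathbb{R}\to M$ of $e_n$. Then: (1) $H\notin[-\frac{2\sqrt{n-1}}{n},1]$, and every other real value of $H$ occurs for such hypersurfaces; (2) if $H<-1$: $C\le r_1(H)$, and $g$ is of type 2 if $C=r_1(H)$ and of type 3 if $C<r_1(H)$; (3) if $H=-1$: $0<C\le r_1(-1)$, and $g$ is of type 3 if $C<r_1(-1)$ and of type 2 if $C=r_1(-1)$; (4) if $-1<H<-\frac{2\sqrt{n-1}}{n}$: $r_2(H)<C\le r_1(H)$, and $g$ is of type 5 if $C=r_1(H)$ and of type 1 if $r_2(H)<C<r_1(H)$; (5) if $H>1$: $C\le r_1(H)$, and $g$ is of type 2 if $C=r_1(H)$ and of type 3 if $C<r_1(H)$.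
   Context: Space forms: $\mathbb{R}^m_j$ is $\mathbb{R}^m$ with $\langle v,w\rangle=-\sum_{i\le j}v_iw_i+\sum_{i>j}v_iw_i$; $SF(n+1,k,1)=\{x\in\mathbb{R}^{n+2}_k:\langle x,x\rangle=1\}$, $SF(n+1,k,-1)=\{x\in\mathbb{R}^{n+2}_{k+1}:\langle x,x\rangle=-1\}$. A hypersurface $M$ has two principal curvatures $\lambda$ (multiplicity $n-1$), $\mu$ (multiplicity $1$): there is a global Gauss map $\nu$ with $\langle\nu,\nu\rangle=b\in\{\pm1\}$, a global field $e_n$ with $\langle e_n,e_n\rangle=d\in\{\pm1\}$, $\lambda\ne\mu$ smooth, and local frames $e_1,\dots,e_n$ ($|\langle e_i,e_j\rangle|=\delta_{ij}$) with $Ae_i=\lambda e_i$ ($i<n$), $Ae_n=\mu e_n$, $A(v)=-\bar\nabla_v\nu$. Constant mean curvature: $(n-1)\lambda+\mu=nH$. $w=(\lambda-H)^{-1/n}$; associated constant $C=(e_n(w))^2+dw^2(a+b\lambda^2)$ (constant on $M$); $g=w\circ\gamma$ satisfies $(g')^2=f(g)$ with $f(v)=C-dv^2(a+b(H+v^{-n})^2)=C-v^2+H^2v^2+v^{2-2n}+2Hv^{2-n}$. $q_1(H)=\left(\frac{\sqrt{H^2n^2-4n+4}-H(n-2)}{2(n-1)}\right)^{-1/n}$ (for $H\le-\frac{2\sqrt{n-1}}{n}$ or $H>1$), $q_2(H)=\left(\frac{-\sqrt{H^2n^2-4n+4}-H(n-2)}{2(n-1)}\right)^{-1/n}$ (for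 $-1<H\le-\frac{2\sqrt{n-1}}{n}$); $r_i(H)=d\,q_i^2\big(a+b(H+q_i^{-n})^2\big)=q_i^2\big(1-(H+q_i^{-n})^2\big)$, the value of $C$ with $f(q_i)=0$. Types: type 1: $g$ periodic with range $[v_1,v_2]$, max and min attained infinitely often; type 2: $g$ injective with range $(v_1,\infty)$; type 3: range $[v_1,\infty)$, $v_1$ attained once, other values twice; type 4: range $[v_1,v_2)$, $v_1$ attained once, other values twice; type 5: range $(v_1,v_2]$, $v_2$ attained once, other values twice. *)

theory Defs
  imports "HOL-Analysis.Analysis"
begin

text \<open>The ambient space R^(n+2) is (real, 'm) vec with CARD('m) = n+2; the index type is
  linearly ordered so that "the first j coordinates" makes sense.\<close>

definition first_idx :: "nat \<Rightarrow> 'm::{finite,linorder} \<Rightarrow> bool" where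
  "first_idx j i \<longleftrightarrow> card {i'. i' < i} < j"

definition pinner :: "nat \<Rightarrow> (real, 'm::{finite,linorder}) vec \<Rightarrow> (real, 'm) vec \<Rightarrow> real" where
  "pinner j v w = (\<Sum>i\<in>UNIV. (if first_idx j i then -1 else 1) * (v$i * w$i))"

definition sf_index :: "nat \<Rightarrow> real \<Rightarrow> nat" where
  "sf_index k a = (if a = 1 then k else k + 1)"

definition SF :: "nat \<Rightarrow> real \<Rightarrow> ((real, 'm::{finite,linorder}) vec) set" where
  "SF k a = (if a = 1 then {x. pinner k x x = 1} else {x. pinner (k + 1) x x = -1})"

fun iterdd :: "('a::real_normed_vector \<Rightarrow> 'b::real_normed_vector) \<Rightarrow> 'a list \<Rightarrow> 'a \<Rightarrow> 'b" where
  "iterdd f [] = f"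
| "iterdd f (v # vs) = (\<lambda>x. frechet_derivative (iterdd f vs) (at x) v)"

definition Cinf_on :: "'a::real_normed_vector set \<Rightarrow> ('a \<Rightarrow> 'b::real_normed_vector) \<Rightarrow> bool" where
  "Cinf_on U f \<longleftrightarrow> open U \<and> (\<forall>vs. \<forall>x\<in>U. iterdd f vs differentiable (at x))"

definition codim2_submanifold :: "((real, 'm::finite) vec) set \<Rightarrow> bool" where
  "codim2_submanifold M \<longleftrightarrow>
     (\<forall>p\<in>M. \<exists>W (F :: (real, 'm) vec \<Rightarrow> real^2). open W \<and> p \<in> W \<and> Cinf_on W F \<and>
        M \<inter> W = {x\<in>W. F x = 0} \<and> (\<forall>x\<in>W. surj (frechet_derivative F (at x))))"

definition tangent_space :: "((real, 'm::finite) vec) set \<Rightarrow> (real, 'm) vec \<Rightarrow> ((real, 'm) vec) set" where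
  "tangent_space M p = {v. \<exists>c e. 0 < e \<and> (\<forall>t\<in>{-e<..<e}. c t \<in> M) \<and> c 0 = p \<and>
                          (c has_vector_derivative v) (at 0)}"

definition Cinf_fun_on :: "((real, 'm::finite) vec) set \<Rightarrow> ((real, 'm) vec \<Rightarrow> 'b::real_normed_vector) \<Rightarrow> bool" where
  "Cinf_fun_on M f \<longleftrightarrow>
     (\<forall>p\<in>M. \<exists>W F. open W \<and> p \<in> W \<and> Cinf_on W F \<and> (\<forall>x\<in>M \<inter> W. F x = f x))"

definition Mderiv :: "((real, 'm::finite) vec) set \<Rightarrow> ((real, 'm) vec \<Rightarrow> 'b::real_normed_vector) \<Rightarrow> (real, 'm) vec \<Rightarrow> (real, 'm) vec \<Rightarrow> 'b" where
  "Mderiv M f p v = (THE y. \<exists>W F. open W \<and> p \<in> W \<and> Cinf_on W F \<and> (\<forall>x\<in>M \<inter> W. F x = f x) \<and>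
                              frechet_derivative F (at p) v = y)"

text \<open>Shape operator A(v) = - (ambient derivative of nu along v); for a hypersurface of
  SF this derivative is already tangent to SF, so it equals the space form connection.\<close>
definition shape_op :: "((real, 'm::finite) vec) set \<Rightarrow> ((real, 'm) vec \<Rightarrow> (real, 'm) vec) \<Rightarrow> (real, 'm) vec \<Rightarrow> (real, 'm) vec \<Rightarrow> (real, 'm) vec" where
  "shape_op M \<nu> p v = - Mderiv M \<nu> p v"

definition two_pc_hypersurface ::
  "nat \<Rightarrow> real \<Rightarrow> ((real, 'm::{finite,linorder}) vec) set \<Rightarrow> ((real, 'm) vec \<Rightarrow> (real, 'm) vec) \<Rightarrow> ((real, 'm) vec \<Rightarrow> (real, 'm) vec)
    \<Rightarrow> ((real, 'm) vec \<Rightarrow> real) \<Rightarrow> ((real, 'm) vec \<Rightarrow> real) \<Rightarrow> real \<Rightarrow> real \<Rightarrow> bool" where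
  "two_pc_hypersurface k a M \<nu> en lam mu b d \<longleftrightarrow>
     (let j = sf_index k a; n = CARD('m) - 2 in
       (a = 1 \<or> a = -1) \<and> (b = 1 \<or> b = -1) \<and> (d = 1 \<or> d = -1) \<and>
       M \<subseteq> SF k a \<and> codim2_submanifold M \<and>
       Cinf_fun_on M \<nu> \<and>
       (\<forall>p\<in>M. pinner j (\<nu> p) (\<nu> p) = b \<and> pinner j (\<nu> p) p = 0 \<and>
               (\<forall>v\<in>tangent_space M p. pinner j (\<nu> p) v = 0)) \<and>
       Cinf_fun_on M en \<and>
       (\<forall>p\<in>M. en p \<in> tangent_space M p \<and> pinner j (en p) (en p) = d) \<and>
       Cinf_fun_on M lam \<and> Cinf_fun_on M mu \<and> (\<forall>p\<in>M. lam p \<noteq> mu p) \<and>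
       (\<forall>p\<in>M. \<exists>e :: nat \<Rightarrow> (real, 'm) vec.
          (\<forall>i<n. e i \<in> tangent_space M p) \<and>
          (\<forall>i<n. \<forall>i'<n. \<bar>pinner j (e i) (e i')\<bar> = (if i = i' then 1 else 0)) \<and>
          e (n - 1) = en p \<and>
          (\<forall>i<n - 1. shape_op M \<nu> p (e i) = lam p *\<^sub>R e i) \<and>
          shape_op M \<nu> p (en p) = mu p *\<^sub>R en p))"

text \<open>Geodesic completeness of the induced (nondegenerate) metric: every geodesic is
  defined on all of R; a curve in M is a geodesic iff its ambient acceleration is normal to M.\<close>
definition geod_complete :: "nat \<Rightarrow> ((real, 'm::{finite,linorder}) vec) set \<Rightarrow> bool" where
  "geod_complete j M \<longleftrightarrow>
     (\<forall>p\<in>M. \<forall>v\<in>tangent_space M p. \<exists>c c' c''. c 0 = p \<and> c' 0 = v \<and>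
        (\<forall>t. c t \<in> M \<and> (c has_vector_derivative c' t) (at t) \<and>
             (c' has_vector_derivative c'' t) (at t) \<and>
             (\<forall>u\<in>tangent_space M (c t). pinner j (c'' t) u = 0)))"

definition integral_curve :: "((real, 'm::finite) vec) set \<Rightarrow> ((real, 'm) vec \<Rightarrow> (real, 'm) vec) \<Rightarrow> (real \<Rightarrow> (real, 'm) vec) \<Rightarrow> bool" where
  "integral_curve M X \<gamma> \<longleftrightarrow> (\<forall>t. \<gamma> t \<in> M \<and> (\<gamma> has_vector_derivative X (\<gamma> t)) (at t))"

definition q1 :: "nat \<Rightarrow> real \<Rightarrow> real" where
  "q1 n H = ((sqrt (H^2 * (real n)^2 - 4 * real n + 4) - H * (real n - 2)) / (2 * (real n - 1)))
              powr (- 1 / real n)"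

definition q2 :: "nat \<Rightarrow> real \<Rightarrow> real" where
  "q2 n H = ((- sqrt (H^2 * (real n)^2 - 4 * real n + 4) - H * (real n - 2)) / (2 * (real n - 1)))
              powr (- 1 / real n)"

definition r1 :: "nat \<Rightarrow> real \<Rightarrow> real" where
  "r1 n H = (q1 n H)^2 * (1 - (H + q1 n H powr (- real n))^2)"

definition r2 :: "nat \<Rightarrow> real \<Rightarrow> real" where
  "r2 n H = (q2 n H)^2 * (1 - (H + q2 n H powr (- real n))^2)"

definition g_type1 :: "(real \<Rightarrow> real) \<Rightarrow> bool" where
  "g_type1 g \<longleftrightarrow> (\<exists>T>0. \<forall>t. g (t + T) = g t) \<and>
     (\<exists>v1 v2. range g = {v1..v2} \<and> infinite {t. g t = v1} \<and> infinite {t. g t = v2})"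

definition g_type2 :: "(real \<Rightarrow> real) \<Rightarrow> bool" where
  "g_type2 g \<longleftrightarrow> inj g \<and> (\<exists>v1. range g = {v1<..})"

definition g_type3 :: "(real \<Rightarrow> real) \<Rightarrow> bool" where
  "g_type3 g \<longleftrightarrow> (\<exists>v1. range g = {v1..} \<and> card {t. g t = v1} = 1 \<and>
     (\<forall>v\<in>{v1<..}. card {t. g t = v} = 2))"

definition g_type4 :: "(real \<Rightarrow> real) \<Rightarrow> bool" where
  "g_type4 g \<longleftrightarrow> (\<exists>v1 v2. range g = {v1..<v2} \<and> card {t. g t = v1} = 1 \<and>
     (\<forall>v\<in>{v1<..<v2}. card {t. g t = v} = 2))"

definition g_type5 :: "(real \<Rightarrow> real) \<Rightarrow> bool" where
  "g_type5 g \<longleftrightarrow> (\<exists>v1 v2. range g = {v1<..v2} \<and> card {t. g t = v2} = 1 \<and>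
     (\<forall>v\<in>{v1<..<v2}. card {t. g t = v} = 2))"

definition thm_hyps ::
  "nat \<Rightarrow> real \<Rightarrow> ((real, 'm::{finite,linorder}) vec) set \<Rightarrow> ((real, 'm) vec \<Rightarrow> (real, 'm) vec) \<Rightarrow> ((real, 'm) vec \<Rightarrow> (real, 'm) vec)
    \<Rightarrow> ((real, 'm) vec \<Rightarrow> real) \<Rightarrow> ((real, 'm) vec \<Rightarrow> real) \<Rightarrow> real \<Rightarrow> real \<Rightarrow> real \<Rightarrow> bool" where
  "thm_hyps k a M \<nu> en lam mu b d H \<longleftrightarrow>
     two_pc_hypersurface k a M \<nu> en lam mu b d \<and> connected M \<and> geod_complete (sf_index k a) M \<and>
     \<not> (\<exists>c. \<forall>p\<in>M. lam p = c) \<and> \<not> (\<exists>c. \<forall>p\<in>M. mu p = c) \<and>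
     (\<forall>p\<in>M. lam p > mu p) \<and> a * d = 1 \<and> b * d = -1 \<and>
     (\<forall>p\<in>M. (real (CARD('m) - 2) - 1) * lam p + mu p = real (CARD('m) - 2) * H)"

end

theory Submission
  imports Defs
begin

text \<open>The Codazzi equation shows that \<open>\<lambda>\<close> varies only along \<open>e\<^sub>n\<close>; together with the Gauss equation it
  turns the restriction \<open>g\<close> of \<open>w = (\<lambda> - H)\<^sup>-\<^sup>1\<^sup>/\<^sup>n\<close> to an integral curve into the position of a particle
  on \<open>(0,\<infinity>)\<close> with \<open>g'\<^sup>2 = f(g)\<close> and force \<open>f'/2\<close>. The signs of the roots of \<open>f'\<close> decide the shape of the
  motion, and completeness of \<open>M\<close> makes it last for all times; since \<open>\<lambda>\<close> is not constant, the particle never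
  rests, which excludes \<open>H \<in> [-2\<surd>(n - 1)/n, 1]\<close> (collapse into \<open>0\<close> or an equilibrium) and the values of
  \<open>C\<close> not listed. Conversely, the motion homoclinic to \<open>q\<^sub>1(H)\<close>, with \<open>C = r\<^sub>1(H)\<close>, is the profile of a complete
  rotation hypersurface.\<close>

section \<open>Differential calculus\<close>

text \<open>In indefinite signature geodesic completeness does not hand over integral curves of e_n.
  What saves the argument is that \<lambda> reacts only to the e_n-component m of a velocity, and
  along a geodesic m' = \<kappa> (1 - m^2) with \<kappa> = w'/w, so m = 1 persists. Equilibria have
  to be excluded on all of M rather than on one curve: by Gronwall an equilibrium value of w spreads
  along every path, hence over the connected M. For the examples C = r1(H) is taken because it is
  admissible for every remaining H and its orbit stays above q1(H), which keeps the radius away from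
  0. Dividing w by sqrt |r1| turns C into \<epsilon> = 1 or -1; this sign makes the axis plane
  Lorentzian or definite and so fixes the signature. For H < 0 the radius may turn back, but
  \<lambda> < 0 makes the hyperbolic angle monotone; for H > 1 the angle is circular, but the radius
  is monotone. Hence there are two different global charts. The hypothesis n > 2 supplies a second
  direction in the leaves, without which the integrability conditions would not annihilate the leaf
  derivatives of \<lambda> and \<kappa>.\<close>

lemma second_derivative_symmetric:
  fixes f :: "'a::real_normed_vector \<Rightarrow> real"
  assumes W: "open W" "p \<in> W" and f': "\<And>x. x \<in> W \<Longrightarrow> (f has_derivative f' x) (at x)"
    and A: "((\<lambda>x. f' x u) has_derivative A) (at p)" and B: "((\<lambda>x. f' x v) has_derivative B) (at p)"
  shows "A v = B u"
proof -
  \<comment> \<open>The second difference is symmetric in \<open>u\<close> and \<open>v\<close>.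
    Divided by \<open>h^2\<close> it tends to \<open>A v\<close> and, with the roles exchanged, to
    \<open>B u\<close>.\<close>
  define D where "D h = f (p + h *\<^sub>R u + h *\<^sub>R v) - f (p + h *\<^sub>R u) - f (p + h *\<^sub>R v) + f p" for h :: real
  \<comment> \<open>The mean value theorem in the direction \<open>u\<close> leaves a difference of
    two values of \<open>f' _ u\<close>, each within \<open>e\<close> times a norm of its linear
    approximation at \<open>p\<close>. So differentiability of \<open>f' _ u\<close> at the single
    point \<open>p\<close> suffices.\<close>
  have key: "\<forall>e>0. \<exists>d>0. \<forall>h. 0 < h \<and> h < d \<longrightarrow>
      \<bar>(f (p + h *\<^sub>R u + h *\<^sub>R v) - f (p + h *\<^sub>R u) - f (p + h *\<^sub>R v) + f p) / h\<^sup>2 - A v\<bar>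
        \<le> e * (2 * norm u + norm v)"
    if A: "((\<lambda>x. f' x u) has_derivative A) (at p)" for A u v
  proof (intro allI impI)
    fix e :: real assume e: "e > 0"
    have lA: "linear A" using A has_derivative_linear by blast
    obtain d1 where d1: "d1 > 0" "\<And>y. norm (y - p) < d1 \<Longrightarrow> norm (f' y u - f' p u - A (y - p)) \<le> e * norm (y - p)"
      using A[unfolded has_derivative_at_alt] e by (metis real_norm_def)
    obtain d2 where d2: "d2 > 0" "ball p d2 \<subseteq> W" using W open_contains_ball by blast
    define d where "d = min d1 d2 / (norm u + norm v + 1)"
    have nn: "norm u + norm v + 1 > 0" using norm_ge_zero[of u] norm_ge_zero[of v] by linarith
    have dpos: "d > 0" unfolding d_def using d1 d2 nn by simp
    have small: "norm (s *\<^sub>R u + t *\<^sub>R v) < min d1 d2" if "\<bar>s\<bar> < d" "\<bar>t\<bar> < d" for s t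
    proof -
      have "norm (s *\<^sub>R u + t *\<^sub>R v) \<le> \<bar>s\<bar> * norm u + \<bar>t\<bar> * norm v"
        by (metis norm_triangle_ineq norm_scaleR)
      also have "\<dots> \<le> d * norm u + d * norm v" using that by (intro add_mono mult_right_mono) auto
      also have "\<dots> < d * (norm u + norm v + 1)" using dpos by (simp add: algebra_simps)
      also have "\<dots> = min d1 d2" unfolding d_def using nn by simp
      finally show ?thesis .
    qed
    show "\<exists>d>0. \<forall>h. 0 < h \<and> h < d \<longrightarrow>
      \<bar>(f (p + h *\<^sub>R u + h *\<^sub>R v) - f (p + h *\<^sub>R u) - f (p + h *\<^sub>R v) + f p) / h\<^sup>2 - A v\<bar>
        \<le> e * (2 * norm u + norm v)"
    proof (intro exI conjI allI impI, rule dpos)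
      fix h :: real assume h: "0 < h \<and> h < d"
      define k where "k s = f (p + s *\<^sub>R u + h *\<^sub>R v) - f (p + s *\<^sub>R u)" for s
      have inW: "p + s *\<^sub>R u + t *\<^sub>R v \<in> W" if "\<bar>s\<bar> < d" "\<bar>t\<bar> < d" for s t
        using small[OF that] d2 by (auto simp: dist_norm subset_iff norm_minus_commute algebra_simps)
      have dk: "(k has_real_derivative (f' (p + s *\<^sub>R u + h *\<^sub>R v) u - f' (p + s *\<^sub>R u) u)) (at s)"
        if "0 \<le> s" "s \<le> h" for s
      proof -
        have 1: "(f has_derivative f' (p + s *\<^sub>R u + h *\<^sub>R v)) (at (p + s *\<^sub>R u + h *\<^sub>R v))"
          using f' inW[of s h] that h by auto
        have 2: "(f has_derivative f' (p + s *\<^sub>R u)) (at (p + s *\<^sub>R u))"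
          using f' inW[of s 0] that h by auto
        have "((\<lambda>s. f (p + s *\<^sub>R u + h *\<^sub>R v)) has_derivative (\<lambda>x. f' (p + s *\<^sub>R u + h *\<^sub>R v) (x *\<^sub>R u))) (at s)"
          by (rule has_derivative_compose[where g=f and f="\<lambda>s. p + s *\<^sub>R u + h *\<^sub>R v" and x=s, OF _ 1]) (auto intro!: derivative_eq_intros)
        moreover have "((\<lambda>s. f (p + s *\<^sub>R u)) has_derivative (\<lambda>x. f' (p + s *\<^sub>R u) (x *\<^sub>R u))) (at s)"
          by (rule has_derivative_compose[where g=f and f="\<lambda>s. p + s *\<^sub>R u" and x=s, OF _ 2]) (auto intro!: derivative_eq_intros)
        ultimately have "(k has_derivative (\<lambda>x. f' (p + s *\<^sub>R u + h *\<^sub>R v) (x *\<^sub>R u) - f' (p + s *\<^sub>R u) (x *\<^sub>R u))) (at s)"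
          unfolding k_def by (rule has_derivative_diff)
        moreover have "f' (p + s *\<^sub>R u + h *\<^sub>R v) (x *\<^sub>R u) - f' (p + s *\<^sub>R u) (x *\<^sub>R u)
            = (f' (p + s *\<^sub>R u + h *\<^sub>R v) u - f' (p + s *\<^sub>R u) u) * x" for x
          using 1 2 by (simp add: linear_cmul[OF has_derivative_linear] algebra_simps)
        ultimately show ?thesis by (simp add: has_field_derivative_def)
      qed
      obtain \<xi> where xi: "0 < \<xi>" "\<xi> < h" and
        kh: "k h - k 0 = (h - 0) * (f' (p + \<xi> *\<^sub>R u + h *\<^sub>R v) u - f' (p + \<xi> *\<^sub>R u) u)"
        using MVT2[of 0 h k "\<lambda>s. f' (p + s *\<^sub>R u + h *\<^sub>R v) u - f' (p + s *\<^sub>R u) u"] dk h by auto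
      let ?y1 = "p + \<xi> *\<^sub>R u + h *\<^sub>R v" and ?y2 = "p + \<xi> *\<^sub>R u"
      have y1: "\<bar>f' ?y1 u - f' p u - A (\<xi> *\<^sub>R u + h *\<^sub>R v)\<bar> \<le> e * norm (\<xi> *\<^sub>R u + h *\<^sub>R v)"
        using d1(2)[of ?y1] small[of \<xi> h] xi h by (simp add: add.assoc)
      have y2: "\<bar>f' ?y2 u - f' p u - A (\<xi> *\<^sub>R u)\<bar> \<le> e * norm (\<xi> *\<^sub>R u)"
        using d1(2)[of ?y2] small[of \<xi> 0] xi h by auto
      have "A (\<xi> *\<^sub>R u + h *\<^sub>R v) - A (\<xi> *\<^sub>R u) = h * A v"
        using lA by (simp add: linear_add linear_cmul)
      then have "\<bar>f' ?y1 u - f' ?y2 u - h * A v\<bar> \<le> e * (norm (\<xi> *\<^sub>R u + h *\<^sub>R v) + norm (\<xi> *\<^sub>R u))"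
        using y1 y2 by (simp add: algebra_simps abs_le_iff)
      also have "\<dots> \<le> e * (h * (2 * norm u + norm v))"
      proof (rule mult_left_mono)
        have "norm (\<xi> *\<^sub>R u + h *\<^sub>R v) \<le> \<xi> * norm u + h * norm v"
          using norm_triangle_ineq[of "\<xi> *\<^sub>R u" "h *\<^sub>R v"] xi h by simp
        moreover have "\<xi> * norm u \<le> h * norm u" using xi by (simp add: mult_right_mono)
        ultimately show "norm (\<xi> *\<^sub>R u + h *\<^sub>R v) + norm (\<xi> *\<^sub>R u) \<le> h * (2 * norm u + norm v)"
          using xi by (simp add: algebra_simps)
      qed (use e in simp)
      finally have *: "\<bar>f' ?y1 u - f' ?y2 u - h * A v\<bar> \<le> e * (h * (2 * norm u + norm v))" .
      have "(f (p + h *\<^sub>R u + h *\<^sub>R v) - f (p + h *\<^sub>R u) - f (p + h *\<^sub>R v) + f p) / h\<^sup>2 - A v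
          = (f' ?y1 u - f' ?y2 u - h * A v) / h"
      proof -
        have "f (p + h *\<^sub>R u + h *\<^sub>R v) - f (p + h *\<^sub>R u) - f (p + h *\<^sub>R v) + f p = h * (f' ?y1 u - f' ?y2 u)"
          using kh unfolding k_def by simp
        then show ?thesis using h by (simp add: diff_divide_distrib power2_eq_square)
      qed
      also have "\<bar>\<dots>\<bar> \<le> e * (2 * norm u + norm v)"
        using * h by (simp add: abs_divide pos_divide_le_eq mult_ac)
      finally show "\<bar>(f (p + h *\<^sub>R u + h *\<^sub>R v) - f (p + h *\<^sub>R u) - f (p + h *\<^sub>R v) + f p) / h\<^sup>2 - A v\<bar>
        \<le> e * (2 * norm u + norm v)" .
    qed
  qed
  show ?thesis
  proof (rule ccontr)
    assume ne: "A v \<noteq> B u"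
    define N where "N = 2 * norm u + norm v + (2 * norm v + norm u) + 1"
    have N: "N > 0" unfolding N_def using norm_ge_zero[of u] norm_ge_zero[of v] by linarith
    define e where "e = \<bar>A v - B u\<bar> / (2 * N)"
    have e: "e > 0" using ne N unfolding e_def by simp
    obtain d where d: "d > 0" "\<And>h. 0 < h \<and> h < d \<Longrightarrow> \<bar>D h / h\<^sup>2 - A v\<bar> \<le> e * (2 * norm u + norm v)"
      using key[OF A, of v] e unfolding D_def by blast
    obtain d' where d': "d' > 0" "\<And>h. 0 < h \<and> h < d' \<Longrightarrow> \<bar>D h / h\<^sup>2 - B u\<bar> \<le> e * (2 * norm v + norm u)"
    proof -
      have "f (p + h *\<^sub>R v + h *\<^sub>R u) - f (p + h *\<^sub>R v) - f (p + h *\<^sub>R u) + f p = D h" for h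
        unfolding D_def by (simp add: add_ac)
      then show thesis using key[OF B, of u] e that by fastforce
    qed
    define h where "h = min d d' / 2"
    have "0 < h" "h < d" "h < d'" using d(1) d'(1) unfolding h_def by auto
    then have "\<bar>A v - B u\<bar> \<le> e * (2 * norm u + norm v) + e * (2 * norm v + norm u)"
      using d(2)[of h] d'(2)[of h] by (simp add: abs_le_iff)
    also have "\<dots> \<le> e * N" unfolding N_def using e by (simp add: algebra_simps)
    also have "\<dots> = \<bar>A v - B u\<bar> / 2" unfolding e_def using N by simp
    finally show False using ne by simp
  qed
qed

lemma second_derivative_symmetric_euclidean:
  fixes f :: "'a::real_normed_vector \<Rightarrow> 'b::euclidean_space"
  assumes W: "open W" "p \<in> W" and f': "\<And>x. x \<in> W \<Longrightarrow> (f has_derivative f' x) (at x)"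
    and A: "((\<lambda>x. f' x u) has_derivative A) (at p)" and B: "((\<lambda>x. f' x v) has_derivative B) (at p)"
  shows "A v = B u"
proof (rule euclidean_eqI)
  fix b :: 'b assume "b \<in> Basis"
  show "A v \<bullet> b = B u \<bullet> b"
    by (rule second_derivative_symmetric[OF W has_derivative_inner_left[OF f']
          has_derivative_inner_left[OF A] has_derivative_inner_left[OF B]])
qed

subsection \<open>Smooth functions\<close>

lemma frechet_derivative_cong_open:
  assumes "open U" "x \<in> U" "\<And>y. y \<in> U \<Longrightarrow> f y = g y"
  shows "frechet_derivative f (at x) = frechet_derivative g (at x)"
proof -
  have "(f has_derivative D) (at x) \<longleftrightarrow> (g has_derivative D) (at x)" for D
    using has_derivative_transform_within_open[of f D x UNIV U g]
      has_derivative_transform_within_open[of g D x UNIV U f] assms by auto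
  then show ?thesis by (simp add: frechet_derivative_def)
qed

lemma differentiable_cong_open:
  assumes "open U" "x \<in> U" "\<And>y. y \<in> U \<Longrightarrow> f y = g y" "f differentiable at x"
  shows "g differentiable at x"
  using assms(4) has_derivative_transform_within_open[of f _ x UNIV U g] assms(1-3)
  unfolding differentiable_def by blast

text \<open>\<open>Cinf_on\<close> iterates derivatives on the outside of a list of directions; this
  recursion peels off the innermost one instead. Product, chain and inverse rules then follow by
  induction on the order, for all functions at once. The derivatives of order below \<open>k\<close>
  are differentiable; continuity of the k-th one is not part of the notion.\<close>

fun Ck_on :: "nat \<Rightarrow> 'a::real_normed_vector set \<Rightarrow> ('a \<Rightarrow> 'b::real_normed_vector) \<Rightarrow> bool" where
  "Ck_on 0 U f = True"
| "Ck_on (Suc k) U f = ((\<forall>x\<in>U. f differentiable at x) \<and>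
     (\<forall>v. Ck_on k U (\<lambda>x. frechet_derivative f (at x) v)))"

lemma iterdd_append: "iterdd f (vs @ [v]) = iterdd (\<lambda>x. frechet_derivative f (at x) v) vs"
  by (induction vs) auto

lemma Ck_on_iff: "Ck_on k U f \<longleftrightarrow> (\<forall>vs. length vs < k \<longrightarrow> (\<forall>x\<in>U. iterdd f vs differentiable at x))"
proof (induction k arbitrary: f)
  case (Suc k)
  have "(\<forall>vs. length vs < Suc k \<longrightarrow> (\<forall>x\<in>U. iterdd f vs differentiable at x)) \<longleftrightarrow>
    (\<forall>x\<in>U. f differentiable at x) \<and>
    (\<forall>v. \<forall>vs. length vs < k \<longrightarrow> (\<forall>x\<in>U. iterdd f (vs @ [v]) differentiable at x))"
  proof (intro iffI conjI allI impI ballI)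
    fix x assume *: "\<forall>vs. length vs < Suc k \<longrightarrow> (\<forall>x\<in>U. iterdd f vs differentiable at x)" "x \<in> U"
    show "f differentiable at x" using *(1)[rule_format, of "[]" x] *(2) by simp
  next
    fix v :: 'a and vs :: "'a list" and x assume *: "\<forall>vs. length vs < Suc k \<longrightarrow> (\<forall>x\<in>U. iterdd f vs differentiable at x)"
      "length vs < k" "x \<in> U"
    show "iterdd f (vs @ [v]) differentiable at x" using *(1)[rule_format, of "vs @ [v]" x] *(2,3) by simp
  next
    fix vs :: "'a list" and x assume *: "(\<forall>x\<in>U. f differentiable at x) \<and>
      (\<forall>v vs. length vs < k \<longrightarrow> (\<forall>x\<in>U. iterdd f (vs @ [v]) differentiable at x))"
      "length vs < Suc k" "x \<in> U"
    show "iterdd f vs differentiable at x"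
    proof (cases vs rule: rev_cases)
      case Nil then show ?thesis using * by simp
    next
      case (snoc ys y) then show ?thesis using *(1)[THEN conjunct2, rule_format, of ys x y] *(2,3) by simp
    qed
  qed
  then show ?case by (simp add: Suc.IH iterdd_append)
qed simp

lemma Cinf_on_iff: "Cinf_on U f \<longleftrightarrow> open U \<and> (\<forall>k. Ck_on k U f)"
  unfolding Cinf_on_def Ck_on_iff by (meson lessI)

lemma Cinf_onI: "open U \<Longrightarrow> (\<And>k. Ck_on k U f) \<Longrightarrow> Cinf_on U f"
  by (simp add: Cinf_on_iff)

lemma Cinf_on_open: "Cinf_on U f \<Longrightarrow> open U"
  and Cinf_on_Ck: "Cinf_on U f \<Longrightarrow> Ck_on k U f"
  by (auto simp: Cinf_on_iff)

lemma Ck_on_cong: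
  assumes "open U" "\<And>x. x \<in> U \<Longrightarrow> f x = g x" "Ck_on k U f" shows "Ck_on k U g"
  using assms(2,3)
proof (induction k arbitrary: f g)
  case (Suc k)
  have "g differentiable at x" if "x \<in> U" for x
    using differentiable_cong_open[OF assms(1) that Suc.prems(1)] Suc.prems(2) that by simp
  moreover have "Ck_on k U (\<lambda>x. frechet_derivative g (at x) v)" for v
  proof (rule Suc.IH)
    show "Ck_on k U (\<lambda>x. frechet_derivative f (at x) v)" using Suc.prems(2) by simp
    show "frechet_derivative f (at x) v = frechet_derivative g (at x) v" if "x \<in> U" for x
      using frechet_derivative_cong_open[OF assms(1) that Suc.prems(1)] by simp
  qed
  ultimately show ?case by simp
qed simp

lemma Ck_on_Suc_I:
  assumes "open U" "\<And>x. x \<in> U \<Longrightarrow> (f has_derivative f' x) (at x)" "\<And>v. Ck_on k U (\<lambda>x. f' x v)"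
  shows "Ck_on (Suc k) U f"
proof -
  have "Ck_on k U (\<lambda>x. frechet_derivative f (at x) v)" for v
    by (rule Ck_on_cong[OF assms(1) _ assms(3)[of v]]) (simp add: frechet_derivative_at[OF assms(2), symmetric])
  then show ?thesis using assms(2) by (auto simp: differentiable_def)
qed

lemma Ck_on_has_derivative:
  "Ck_on (Suc k) U f \<Longrightarrow> x \<in> U \<Longrightarrow> (f has_derivative frechet_derivative f (at x)) (at x)"
  using frechet_derivative_works by auto

lemma Ck_on_mono: "Ck_on (Suc k) U f \<Longrightarrow> Ck_on k U f"
  unfolding Ck_on_iff using less_SucI by blast

lemma Ck_on_subset: "Ck_on k U f \<Longrightarrow> V \<subseteq> U \<Longrightarrow> Ck_on k V f"
  unfolding Ck_on_iff by blast

lemma Cinf_on_subset: "Cinf_on U f \<Longrightarrow> open V \<Longrightarrow> V \<subseteq> U \<Longrightarrow> Cinf_on V f"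
  by (simp add: Cinf_on_iff Ck_on_subset[of _ U])

lemma Cinf_on_has_derivative:
  "Cinf_on U f \<Longrightarrow> x \<in> U \<Longrightarrow> (f has_derivative frechet_derivative f (at x)) (at x)"
  by (rule Ck_on_has_derivative[OF Cinf_on_Ck[of U f "Suc 0"]])

lemma Cinf_on_frechet: "Cinf_on U f \<Longrightarrow> Cinf_on U (\<lambda>x. frechet_derivative f (at x) v)"
  unfolding Cinf_on_iff using Ck_on.simps(2)[of _ U f] by blast

lemma Ck_on_const [simp]: "Ck_on k U (\<lambda>x. c)"
proof (induction k arbitrary: c)
  case (Suc k)
  then show ?case by (simp add: frechet_derivative_const)
qed simp

lemma Ck_on_bounded_linear_id:
  assumes "open U" "bounded_linear f" shows "Ck_on k U f"
proof (cases k)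
  case (Suc l)
  show ?thesis unfolding Suc
    by (rule Ck_on_Suc_I[where f'="\<lambda>x. f"]) (use assms bounded_linear_imp_has_derivative in auto)
qed simp

lemma Ck_on_add:
  assumes "open U" "Ck_on k U f" "Ck_on k U g" shows "Ck_on k U (\<lambda>x. f x + g x)"
  using assms(2,3)
proof (induction k arbitrary: f g)
  case (Suc k)
  show ?case
    by (rule Ck_on_Suc_I[OF assms(1) has_derivative_add[OF Ck_on_has_derivative[OF Suc.prems(1)] Ck_on_has_derivative[OF Suc.prems(2)]]])
       (use Suc.prems in \<open>simp_all add: Suc.IH\<close>)
qed simp

lemma Ck_on_bilinear:
  assumes "open U" "bounded_bilinear h" "Ck_on k U f" "Ck_on k U g" shows "Ck_on k U (\<lambda>x. h (f x) (g x))"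
  using assms(3,4)
proof (induction k arbitrary: f g)
  case (Suc k)
  show ?case
  proof (rule Ck_on_Suc_I[OF assms(1) bounded_bilinear.FDERIV[OF assms(2) Ck_on_has_derivative[OF Suc.prems(1)] Ck_on_has_derivative[OF Suc.prems(2)]]])
    fix v
    show "Ck_on k U (\<lambda>x. h (f x) (frechet_derivative g (at x) v) + h (frechet_derivative f (at x) v) (g x))"
      using Suc.prems[THEN Ck_on_mono] Suc.prems[unfolded Ck_on.simps]
      by (intro Ck_on_add[OF assms(1)] Suc.IH) blast+
  qed
qed simp

lemma Ck_on_linear:
  assumes "open U" "bounded_linear h" "Ck_on k U f" shows "Ck_on k U (\<lambda>x. h (f x))"
  using assms(3)
proof (induction k arbitrary: f)
  case (Suc k)
  show ?case
    by (rule Ck_on_Suc_I[OF assms(1) bounded_linear.has_derivative[OF assms(2) Ck_on_has_derivative[OF Suc.prems]]])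
       (use Suc.prems in \<open>simp_all add: Suc.IH\<close>)
qed simp

lemmas Ck_on_mult = Ck_on_bilinear[OF _ bounded_bilinear_mult]
lemmas Ck_on_scaleR = Ck_on_bilinear[OF _ bounded_bilinear_scaleR]
lemmas Ck_on_minus = Ck_on_linear[OF _ bounded_linear_minus[OF bounded_linear_ident]]

lemma Ck_on_diff:
  assumes "open U" "Ck_on k U f" "Ck_on k U g" shows "Ck_on k U (\<lambda>x. f x - g x)"
  using Ck_on_add[OF assms(1,2) Ck_on_minus[OF assms(1,3)]] by simp

lemma Ck_on_power:
  fixes f :: "'a::real_normed_vector \<Rightarrow> real"
  assumes "open U" "Ck_on k U f" shows "Ck_on k U (\<lambda>x. f x ^ m)"
  by (induction m) (auto intro: Ck_on_mult[OF assms(1)] assms(2))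

lemma Ck_on_real_I:
  fixes f :: "real \<Rightarrow> 'b::real_normed_vector"
  assumes "open U" "\<And>x. x \<in> U \<Longrightarrow> (f has_vector_derivative f' x) (at x)" "Ck_on k U f'"
  shows "Ck_on (Suc k) U f"
  by (rule Ck_on_Suc_I[OF assms(1) assms(2)[unfolded has_vector_derivative_def]])
     (use Ck_on_scaleR[OF assms(1) Ck_on_const assms(3)] in auto)

text \<open>With a real intermediate variable the derivative of the composition is a scalar multiple
  of \<open>\<phi>' (f x)\<close>, so the product rule and the induction hypothesis for
  \<open>\<phi>'\<close> close the induction.\<close>

lemma Ck_on_compose_real:
  fixes f :: "'a::real_normed_vector \<Rightarrow> real" and \<phi> :: "real \<Rightarrow> 'b::real_normed_vector"
  assumes U: "open U" and V: "open V" and "f ` U \<subseteq> V" "Ck_on k V \<phi>" "Ck_on k U f"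
  shows "Ck_on k U (\<lambda>x. \<phi> (f x))"
  using assms(3-)
proof (induction k arbitrary: f \<phi>)
  case (Suc k)
  have dphi: "(\<phi> has_derivative frechet_derivative \<phi> (at (f x))) (at (f x))" if "x \<in> U" for x
    using Ck_on_has_derivative[OF Suc.prems(2)] Suc.prems(1) that by blast
  show ?case
  proof (rule Ck_on_Suc_I[OF U has_derivative_compose[OF Ck_on_has_derivative[OF Suc.prems(3)] dphi]])
    fix v :: 'a
    have "Ck_on k U (\<lambda>x. frechet_derivative f (at x) v *\<^sub>R frechet_derivative \<phi> (at (f x)) 1)"
      using Suc.prems Ck_on_mono[OF Suc.prems(3)]
      by (intro Ck_on_scaleR[OF U] Suc.IH[where \<phi>="\<lambda>y. frechet_derivative \<phi> (at y) 1"]) auto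
    then show "Ck_on k U (\<lambda>x. frechet_derivative \<phi> (at (f x)) (frechet_derivative f (at x) v))"
    proof (rule Ck_on_cong[OF U, rotated])
      fix x assume "x \<in> U"
      then have "linear (frechet_derivative \<phi> (at (f x)))" using dphi has_derivative_linear by blast
      from linear_cmul[OF this, of "frechet_derivative f (at x) v" 1]
      show "frechet_derivative f (at x) v *\<^sub>R frechet_derivative \<phi> (at (f x)) 1 = frechet_derivative \<phi> (at (f x)) (frechet_derivative f (at x) v)"
        by simp
    qed
  qed
qed simp

lemma Ck_on_powr_real: "Ck_on k {0<..} (\<lambda>x::real. x powr r)"
proof (induction k arbitrary: r)
  case (Suc k)
  have "Ck_on k {0<..} (\<lambda>x::real. r * x powr (r - 1))"
    by (intro Ck_on_mult Suc) auto
  then show ?case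
    by (rule Ck_on_real_I[rotated 2]) (auto intro!: derivative_eq_intros simp flip: has_real_derivative_iff_has_vector_derivative)
qed simp

lemma Ck_on_powr:
  fixes f :: "'a::real_normed_vector \<Rightarrow> real"
  assumes "open U" "Ck_on k U f" "\<And>x. x \<in> U \<Longrightarrow> f x > 0" shows "Ck_on k U (\<lambda>x. f x powr r)"
  by (rule Ck_on_compose_real[OF assms(1) _ _ Ck_on_powr_real assms(2)]) (use assms(3) in auto)

lemma Ck_on_inverse_pos:
  fixes f :: "'a::real_normed_vector \<Rightarrow> real"
  assumes "open U" "Ck_on k U f" "\<And>x. x \<in> U \<Longrightarrow> f x > 0" shows "Ck_on k U (\<lambda>x. inverse (f x))"
  by (rule Ck_on_cong[OF assms(1) _ Ck_on_powr[OF assms, of "-1"]]) (use assms(3) in \<open>force simp: powr_minus\<close>)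

lemma Ck_on_inverse:
  fixes f :: "'a::real_normed_vector \<Rightarrow> real"
  assumes "open U" "Ck_on k U f" "\<And>x. x \<in> U \<Longrightarrow> f x \<noteq> 0" shows "Ck_on k U (\<lambda>x. inverse (f x))"
proof -
  \<comment> \<open>Writing 1/f = f / f^2 reduces the reciprocal of a nonvanishing function to that
    of a positive one.\<close>
  have "Ck_on k U (\<lambda>x. f x * inverse ((f x)^2))"
    by (intro Ck_on_mult[OF assms(1)] Ck_on_inverse_pos Ck_on_power assms) (use assms(3) in auto)
  then show ?thesis
    by (rule Ck_on_cong[OF assms(1), rotated]) (use assms(3) in \<open>simp add: power2_eq_square\<close>)
qed

lemma Ck_on_divide:
  fixes f g :: "'a::real_normed_vector \<Rightarrow> real"
  assumes "open U" "Ck_on k U f" "Ck_on k U g" "\<And>x. x \<in> U \<Longrightarrow> g x \<noteq> 0" shows "Ck_on k U (\<lambda>x. f x / g x)"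
  using Ck_on_mult[OF assms(1,2) Ck_on_inverse[OF assms(1,3,4)]] by (simp add: divide_inverse)

lemma Cinf_fun_onI: "Cinf_on W F \<Longrightarrow> M \<subseteq> W \<Longrightarrow> (\<And>x. x \<in> M \<Longrightarrow> F x = f x) \<Longrightarrow> Cinf_fun_on M f"
  unfolding Cinf_fun_on_def using Cinf_on_open by blast

section \<open>One-dimensional conservative dynamics\<close>

lemma DERIV_reverse:
  assumes "(h has_real_derivative D) (at (c - t))"
  shows "((\<lambda>s. h (c - s)) has_real_derivative - D) (at (t :: real))"
proof -
  have "((\<lambda>s. c - s) has_real_derivative - 1) (at t)" by (auto intro!: derivative_eq_intros)
  from DERIV_chain2[of h D "\<lambda>s. c - s", OF assms this] show ?thesis by simp
qed

lemma gronwall_zero: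
  fixes E :: "real \<Rightarrow> real"
  assumes "a \<le> b" and dE: "\<And>t. a \<le> t \<Longrightarrow> t \<le> b \<Longrightarrow> (E has_real_derivative E' t) (at t)"
    and le: "\<And>t. a \<le> t \<Longrightarrow> t \<le> b \<Longrightarrow> E' t \<le> K * E t"
    and "\<And>t. E t \<ge> 0" and "E a = 0"
  shows "E b = 0"
proof -
  have "E b * exp (- K * b) \<le> E a * exp (- K * a)"
  proof (rule DERIV_nonpos_imp_nonincreasing[OF \<open>a \<le> b\<close>])
    fix t assume t: "a \<le> t" "t \<le> b"
    have "((\<lambda>t. E t * exp (- K * t)) has_real_derivative (E' t - K * E t) * exp (- K * t)) (at t)"
      by (auto intro!: derivative_eq_intros dE t simp: algebra_simps)
    moreover have "(E' t - K * E t) * exp (- K * t) \<le> 0"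
      using le[OF t] by (intro mult_nonpos_nonneg) auto
    ultimately show "\<exists>y. ((\<lambda>t. E t * exp (- K * t)) has_real_derivative y) (at t) \<and> y \<le> 0" by blast
  qed
  then have "E b * exp (- K * b) \<le> 0" using assms(5) by simp
  then have "E b \<le> 0" by (simp add: mult_le_0_iff)
  then show ?thesis using assms(4)[of b] by linarith
qed

lemma gronwall_zero_abs:
  fixes E :: "real \<Rightarrow> real"
  assumes dE: "\<And>t. (E has_real_derivative E' t) (at t)" and le: "\<And>t. \<bar>E' t\<bar> \<le> K * E t"
    and pos: "\<And>t. E t \<ge> 0" and z: "E a = 0"
  shows "E t = 0"
proof (cases "a \<le> t")
  case True
  show ?thesis by (rule gronwall_zero[OF True dE _ pos z, where K=K]) (use le in \<open>simp add: abs_le_iff\<close>)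
next
  case False
  have d: "((\<lambda>s. E (-s)) has_real_derivative - E' (-s)) (at s)" for s
    using DERIV_reverse[of E "E' (-s)" 0 s] dE by simp
  have "(\<lambda>s. E (-s)) (-t) = 0"
    by (rule gronwall_zero[where a="-a" and E="\<lambda>s. E (-s)", OF _ d, where K=K])
       (use False le pos z in \<open>simp_all add: abs_le_iff\<close>)
  then show ?thesis by simp
qed

lemma linear_ode_zero:
  fixes y :: "real \<Rightarrow> real"
  assumes dy: "\<And>t. (y has_real_derivative \<alpha> t * y t) (at t)" and c: "continuous_on UNIV \<alpha>" and "y 0 = 0"
  shows "y t = 0"
proof -
  have fwd: "y t = 0" if "0 \<le> t" and dy: "\<And>t. (y has_real_derivative \<alpha> t * y t) (at t)"
    and c: "continuous_on UNIV \<alpha>" and "y 0 = 0" for y \<alpha> :: "real \<Rightarrow> real" and t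
  proof -
    have "\<exists>r\<in>{0..t}. \<forall>s\<in>{0..t}. \<alpha> s \<le> \<alpha> r"
      by (intro continuous_attains_sup continuous_on_subset[OF c]) (use \<open>0 \<le> t\<close> in auto)
    then obtain K where K: "\<And>s. 0 \<le> s \<Longrightarrow> s \<le> t \<Longrightarrow> \<alpha> s \<le> K" by (meson atLeastAtMost_iff)
    have "(y t)^2 = 0"
    proof (rule gronwall_zero[OF \<open>0 \<le> t\<close>, where E="\<lambda>t. (y t)^2" and K="2*K" and E'="\<lambda>t. 2 * \<alpha> t * (y t)^2"])
      show "((\<lambda>t. (y t)\<^sup>2) has_real_derivative 2 * \<alpha> s * (y s)\<^sup>2) (at s)" for s
        by (auto intro!: derivative_eq_intros dy simp: power2_eq_square)
      show "2 * \<alpha> s * (y s)\<^sup>2 \<le> 2 * K * (y s)\<^sup>2" if "0 \<le> s" "s \<le> t" for s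
        using K[OF that] by (intro mult_right_mono) auto
    qed (use \<open>y 0 = 0\<close> in auto)
    then show ?thesis by simp
  qed
  show ?thesis
  proof (cases "0 \<le> t")
    case True then show ?thesis using fwd[OF _ dy c \<open>y 0 = 0\<close>] by blast
  next
    case False
    have d: "((\<lambda>s. y (-s)) has_real_derivative (- \<alpha> (-s)) * y (-s)) (at s)" for s
      using DERIV_reverse[of y "\<alpha> (-s) * y (-s)" 0 s] dy by simp
    have "continuous_on UNIV (\<lambda>s. - \<alpha> (- s))"
      by (intro continuous_intros continuous_on_compose2[OF c]) auto
    from fwd[OF _ d this, of "-t"] False \<open>y 0 = 0\<close> show ?thesis by simp
  qed
qed

lemma nonzero_const_sign:
  fixes h :: "real \<Rightarrow> real"
  assumes c: "\<And>t. isCont h t" and nz: "\<And>t. t \<in> I \<Longrightarrow> h t \<noteq> 0" and I: "is_interval I"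
    and ab: "a \<in> I" "b \<in> I" and "h a > 0"
  shows "h b > 0"
proof (rule ccontr)
  assume "\<not> h b > 0"
  then have hb: "h b \<le> 0" by simp
  have "\<exists>x. min a b \<le> x \<and> x \<le> max a b \<and> h x = 0"
  proof (cases "a \<le> b")
    case True then show ?thesis using IVT2[of h b 0 a] hb \<open>h a > 0\<close> c by (auto simp: min_def max_def)
  next
    case False then show ?thesis using IVT[of h b 0 a] hb \<open>h a > 0\<close> c by (auto simp: min_def max_def)
  qed
  then obtain x where x: "min a b \<le> x" "x \<le> max a b" "h x = 0" by blast
  have "x \<in> I" by (rule mem_is_interval_1_I[OF I _ _ x(1,2)]) (use ab in \<open>auto simp: min_def max_def\<close>)
  then show False using nz x(3) by blast
qed

lemma derivative_small_of_tendsto: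
  fixes h :: "real \<Rightarrow> real"
  assumes d: "\<And>t. (h has_real_derivative h' t) (at t)" and lim: "(h \<longlongrightarrow> l) at_top" and "e > 0"
  shows "\<exists>\<xi>>T. \<bar>h' \<xi>\<bar> < e"
proof -
  have "eventually (\<lambda>t. dist (h t) l < e/2) at_top" using lim \<open>e > 0\<close> tendstoD half_gt_zero by blast
  then obtain N where N: "\<And>t. t \<ge> N \<Longrightarrow> dist (h t) l < e/2" unfolding eventually_at_top_linorder by blast
  define s where "s = max N T + 1"
  obtain \<xi> where xi: "s < \<xi>" "\<xi> < s + 1" "h (s + 1) - h s = (s + 1 - s) * h' \<xi>"
    using MVT2[of s "s+1" h h'] d by auto
  have "dist (h (s+1)) l < e/2" "dist (h s) l < e/2" using N unfolding s_def by auto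
  then have "\<bar>h' \<xi>\<bar> < e" using xi(3) by (simp add: dist_real_def abs_if split: if_splits)
  moreover have "\<xi> > T" using xi(1) unfolding s_def by auto
  ultimately show ?thesis by blast
qed

text \<open>Motion of a particle with velocity \<open>g'\<close>, force \<open>F\<close> and \<open>g'\<^sup>2 = f(g)\<close>, confined to \<open>S\<close>.\<close>

definition energy_motion :: "real set \<Rightarrow> (real \<Rightarrow> real) \<Rightarrow> (real \<Rightarrow> real) \<Rightarrow> (real \<Rightarrow> real) \<Rightarrow> (real \<Rightarrow> real) \<Rightarrow> bool" where
  "energy_motion S f F g g' \<longleftrightarrow> (\<forall>x\<in>S. isCont f x \<and> isCont F x) \<and>
     (\<forall>t. g t \<in> S \<and> (g has_real_derivative g' t) (at t) \<and> (g' has_real_derivative F (g t)) (at t) \<and> (g' t)^2 = f (g t))"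

lemma energy_motionD:
  assumes "energy_motion S f F g g'"
  shows "x \<in> S \<Longrightarrow> isCont f x" "x \<in> S \<Longrightarrow> isCont F x" "g t \<in> S" "(g has_real_derivative g' t) (at t)"
    "(g' has_real_derivative F (g t)) (at t)" "(g' t)^2 = f (g t)" "isCont g t" "isCont g' t" "f (g t) \<ge> 0"
    "g' t = 0 \<longleftrightarrow> f (g t) = 0"
proof -
  show "(g' t)^2 = f (g t)" using assms unfolding energy_motion_def by blast
  then show "f (g t) \<ge> 0" "g' t = 0 \<longleftrightarrow> f (g t) = 0" by (metis zero_le_power2, metis power_zero_numeral zero_eq_power2)
qed (use assms DERIV_isCont in \<open>unfold energy_motion_def, blast+\<close>)

lemma energy_motion_reverse:
  assumes "energy_motion S f F g g'" shows "energy_motion S f F (\<lambda>t. g (c - t)) (\<lambda>t. - g' (c - t))"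
proof -
  have "((\<lambda>t. g (c - t)) has_real_derivative - g' (c - t)) (at t)" for t
    by (rule DERIV_reverse[OF energy_motionD(4)[OF assms]])
  moreover have "((\<lambda>t. - g' (c - t)) has_real_derivative F (g (c - t))) (at t)" for t
    using DERIV_minus[OF DERIV_reverse[OF energy_motionD(5)[OF assms], of c t]] by simp
  ultimately show ?thesis using assms unfolding energy_motion_def by auto
qed

text \<open>Mirroring the position turns descending motions into ascending ones, so statements about
  positive velocity are enough; the force changes sign and the domain is mirrored.\<close>

lemma energy_motion_reflect:
  assumes "energy_motion S f F g g'"
  shows "energy_motion (uminus ` S) (\<lambda>x. f (- x)) (\<lambda>x. - F (- x)) (\<lambda>t. - g t) (\<lambda>t. - g' t)"
proof -
  have "isCont (\<lambda>x. f (- x)) (- x) \<and> isCont (\<lambda>x. - F (- x)) (- x)" if "x \<in> S" for x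
  proof
    show "isCont (\<lambda>x. f (- x)) (- x)" using isCont_o2[of "-x" uminus f] energy_motionD(1)[OF assms that] by simp
    show "isCont (\<lambda>x. - F (- x)) (- x)" using isCont_o2[of "-x" uminus F] energy_motionD(2)[OF assms that] by simp
  qed
  moreover have "((\<lambda>t. - g t) has_real_derivative - g' t) (at t)" "((\<lambda>t. - g' t) has_real_derivative - F (g t)) (at t)" for t
    by (auto intro!: derivative_eq_intros energy_motionD(4,5)[OF assms])
  ultimately show ?thesis using assms unfolding energy_motion_def by auto
qed

text \<open>A limit of a motion is an equilibrium. Late times with small velocity rule out
  \<open>f L > 0\<close>; then \<open>g'\<close> itself tends to 0, and the same argument applied to
  \<open>g'\<close> rules out \<open>F L \<noteq> 0\<close>.\<close>

lemma energy_motion_limit_critical: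
  assumes m: "energy_motion S f F g g'" and lim: "(g \<longlongrightarrow> L) at_top" and L: "L \<in> S"
  shows "f L = 0" "F L = 0"
proof -
  note D = energy_motionD[OF m]
  have fl: "((\<lambda>t. f (g t)) \<longlongrightarrow> f L) at_top" and Fl: "((\<lambda>t. F (g t)) \<longlongrightarrow> F L) at_top"
    using isCont_tendsto_compose[OF _ lim] D(1,2)[OF L] by blast+
  show f0: "f L = 0"
  proof (rule ccontr)
    assume "f L \<noteq> 0"
    moreover have "f L \<ge> 0" using tendsto_lowerbound[OF fl, of 0] D(9) by simp
    ultimately have p: "f L > 0" by simp
    then have "eventually (\<lambda>t. f (g t) > f L / 2) at_top" using order_tendstoD(1)[OF fl, of "f L / 2"] by simp
    then obtain N where N: "\<And>t. t \<ge> N \<Longrightarrow> f (g t) > f L / 2" unfolding eventually_at_top_linorder by blast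
    obtain \<xi> where xi: "\<xi> > N" "\<bar>g' \<xi>\<bar> < sqrt (f L / 2)"
      using derivative_small_of_tendsto[OF D(4) lim, of "sqrt (f L / 2)" N] p by auto
    have "(g' \<xi>)^2 < f L / 2"
      using xi(2) p by (metis abs_ge_zero power2_abs real_less_rsqrt real_sqrt_less_iff real_sqrt_abs)
    then show False using N[of \<xi>] xi(1) D(6)[of \<xi>] by simp
  qed
  have "((\<lambda>t. (g' t)^2) \<longlongrightarrow> 0) at_top" using fl f0 D(6) by simp
  then have "(g' \<longlongrightarrow> 0) at_top"
    using tendsto_real_sqrt[of "\<lambda>t. (g' t)^2" 0 at_top] by (simp add: tendsto_rabs_zero_iff)
  note gl = derivative_small_of_tendsto[OF D(5) this]
  show "F L = 0"
  proof (rule ccontr)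
    assume "F L \<noteq> 0"
    then have p: "\<bar>F L\<bar> > 0" by simp
    have "eventually (\<lambda>t. \<bar>F (g t)\<bar> > \<bar>F L\<bar> / 2) at_top"
      using order_tendstoD(1)[OF tendsto_rabs[OF Fl], of "\<bar>F L\<bar> / 2"] p by simp
    then obtain N where N: "\<And>t. t \<ge> N \<Longrightarrow> \<bar>F (g t)\<bar> > \<bar>F L\<bar> / 2" unfolding eventually_at_top_linorder by blast
    obtain \<xi> where "\<xi> > N" "\<bar>F (g \<xi>)\<bar> < \<bar>F L\<bar> / 2" using gl[of "\<bar>F L\<bar> / 2" N] p by auto
    then show False using N[of \<xi>] by simp
  qed
qed

lemma increasing_bounded_tendsto:
  fixes g :: "real \<Rightarrow> real"
  assumes mono: "\<And>s t. t0 \<le> s \<Longrightarrow> s \<le> t \<Longrightarrow> g s \<le> g t" and bd: "\<And>t. t0 \<le> t \<Longrightarrow> g t \<le> B"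
  obtains L where "(g \<longlongrightarrow> L) at_top" "\<And>t. t0 \<le> t \<Longrightarrow> g t \<le> L" "L \<le> B"
proof
  define L where "L = Sup (g ` {t0..})"
  have bdd: "bdd_above (g ` {t0..})" using bd by (auto simp: bdd_above_def)
  show up: "g t \<le> L" if "t0 \<le> t" for t unfolding L_def using cSup_upper[OF _ bdd] that by auto
  show "L \<le> B" unfolding L_def by (rule cSup_least) (use bd in auto)
  show "(g \<longlongrightarrow> L) at_top"
  proof (rule order_tendstoI)
    fix a assume "a < L"
    then obtain s where "s \<ge> t0" "a < g s" unfolding L_def using less_cSup_iff[OF _ bdd, of a] by auto
    then show "\<forall>\<^sub>F x in at_top. a < g x" unfolding eventually_at_top_linorder using mono by (meson less_le_trans)
  next
    fix a assume "L < a"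
    then show "\<forall>\<^sub>F x in at_top. g x < a" unfolding eventually_at_top_linorder using up by (meson le_less_trans)
  qed
qed

lemma increasing_of_pos_velocity:
  assumes m: "energy_motion S f F g g'" and p: "\<And>t. t0 < t \<Longrightarrow> g' t > 0" and st: "t0 \<le> s" "s < t"
  shows "g s < g t"
proof (rule DERIV_pos_imp_increasing_open[OF st(2)])
  show "\<exists>y. (g has_real_derivative y) (at x) \<and> 0 < y" if "s < x" for x
    using energy_motionD(4)[OF m] p[of x] that st(1) by (meson le_less_trans)
  show "continuous_on {s..t} g" by (intro continuous_at_imp_continuous_on ballI energy_motionD(7)[OF m])
qed

text \<open>An ascending motion that never reaches \<open>y\<close> is trapped below it and
  converges; its limit would be an equilibrium in the interval where none exists.\<close>

lemma motion_reaches: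
  assumes m: "energy_motion S f F g g'" and p: "\<And>t. t0 < t \<Longrightarrow> g' t > 0"
    and y: "g t0 < y" "{g t0<..y} \<subseteq> S" "\<And>x. g t0 < x \<Longrightarrow> x \<le> y \<Longrightarrow> \<not> (f x = 0 \<and> F x = 0)"
  shows "\<exists>t>t0. g t = y"
proof (rule ccontr)
  assume no: "\<not> ?thesis"
  note D = energy_motionD[OF m]
  have bd: "g t \<le> y" if "t0 \<le> t" for t
  proof (rule ccontr)
    assume "\<not> g t \<le> y"
    then have "\<exists>s\<ge>t0. s \<le> t \<and> g s = y" by (intro IVT) (use y(1) that D(7) in auto)
    then show False using no y(1) by (metis less_eq_real_def less_irrefl)
  qed
  have inc: "g s \<le> g t" if "t0 \<le> s" "s \<le> t" for s t
    using increasing_of_pos_velocity[OF m p that(1), of t] that(2) by (cases "s = t") auto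
  obtain L where L: "(g \<longlongrightarrow> L) at_top" "\<And>t. t0 \<le> t \<Longrightarrow> g t \<le> L" "L \<le> y"
    using increasing_bounded_tendsto[of t0 g y] inc bd by blast
  have "g t0 < g (t0 + 1)" using increasing_of_pos_velocity[OF m p, of t0 t0 "t0+1"] by simp
  then have "g t0 < L" using L(2)[of "t0 + 1"] by simp
  moreover from this have "L \<in> S" using y(2) L(3) by auto
  ultimately show False using energy_motion_limit_critical[OF m L(1)] y(3) L(3) by blast
qed

text \<open>The particle cannot fall towards \<open>0\<close>: there its acceleration points downwards, so it would
  leave \<open>(0,\<infinity>)\<close> in finite time.\<close>

lemma no_collapse:
  assumes m: "energy_motion {0<..} f F g g'" and f: "\<And>x. 0 < x \<Longrightarrow> x < v \<Longrightarrow> f x > 0"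
    and d: "\<delta> > 0" "\<And>x. 0 < x \<Longrightarrow> x < \<delta> \<Longrightarrow> F x < 0"
  shows "g t \<ge> v"
proof (rule ccontr)
  have main: False if m: "energy_motion {0<..} f F g g'" and neg: "g' t0 < 0" and lt: "g t0 < v" for g g' t0
  proof -
    note D = energy_motionD[OF m]
    have neg: "g' t < 0" if "t0 \<le> t" for t
    proof (rule ccontr)
      assume nn: "\<not> g' t < 0"
      \<comment> \<open>At the first zero of \<open>g'\<close> the particle has only descended, so
        it is still below \<open>v\<close>, where \<open>f > 0\<close> forbids zero velocity. Hence
        a descent that begins below \<open>v\<close> never stops.\<close>
      define Z where "Z = {s \<in> {t0..t}. g' s = 0}"
      have "\<exists>s\<ge>t0. s \<le> t \<and> g' s = 0" by (intro IVT) (use neg nn that D(8) in auto)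
      then have ne: "Z \<noteq> {}" unfolding Z_def by auto
      have "closed Z" unfolding Z_def
        by (intro continuous_closed_preimage_constant continuous_at_imp_continuous_on ballI D(8)) auto
      then have "compact Z" unfolding Z_def
        by (metis (no_types, lifting) bounded_closed_interval bounded_subset compact_eq_bounded_closed mem_Collect_eq subsetI)
      then obtain s where s: "s \<in> Z" "\<And>r. r \<in> Z \<Longrightarrow> s \<le> r" using compact_attains_inf[OF _ ne] by blast
      have s0: "t0 < s" "s \<le> t" "g' s = 0" using s(1) neg unfolding Z_def by (auto simp: less_le)
      have "g' r < 0" if r: "t0 \<le> r" "r < s" for r
      proof -
        have "- g' r > 0"
          by (rule nonzero_const_sign[of "\<lambda>t. - g' t" "{t0..<s}" t0 r])
             (use r s s0 neg D(8) in \<open>auto simp: Z_def is_interval_1 intro!: continuous_intros\<close>, force)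
        then show ?thesis by simp
      qed
      then have "g s < g t0"
        using DERIV_neg_imp_decreasing_open[of t0 s g] s0 D(4,7) by (meson continuous_at_imp_continuous_on less_imp_le)
      then show False using f[of "g s"] D(3)[of s] lt D(10)[of s] s0(3) by simp
    qed
    have mr: "energy_motion (uminus ` {0<..}) (\<lambda>x. f (- x)) (\<lambda>x. - F (- x)) (\<lambda>t. - g t) (\<lambda>t. - g' t)"
      by (rule energy_motion_reflect[OF m])
    have dec: "g t \<le> g s" if "t0 \<le> s" "s \<le> t" for s t
      using increasing_of_pos_velocity[OF mr, of t0 s t] neg that by (cases "s = t") auto
    obtain L where L: "((\<lambda>t. - g t) \<longlongrightarrow> L) at_top" "\<And>t. t0 \<le> t \<Longrightarrow> - g t \<le> L" "L \<le> 0"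
      using increasing_bounded_tendsto[of t0 "\<lambda>t. - g t" 0] dec D(3) by (metis greaterThan_iff less_imp_le neg_le_0_iff_le neg_le_iff_le)
    have "L = 0"
    proof (rule ccontr)
      assume "L \<noteq> 0"
      then have "L \<in> uminus ` {0<..}" using L(3) by (auto intro!: image_eqI[of L _ "-L"])
      from energy_motion_limit_critical(1)[OF mr L(1) this] f[of "-L"] L(2)[of t0] lt L(3) \<open>L \<noteq> 0\<close> show False by simp
    qed
    then have "((\<lambda>t. g t) \<longlongrightarrow> 0) at_top" using tendsto_minus[OF L(1)] by simp
    then have "eventually (\<lambda>t. g t < \<delta>) at_top" using d(1) order_tendstoD(2) by blast
    then obtain N where N: "\<And>t. t \<ge> N \<Longrightarrow> g t < \<delta>" unfolding eventually_at_top_linorder by blast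
    define t1 where "t1 = max N t0"
    have slope: "g' t \<le> g' t1" if "t1 \<le> t" for t
      by (rule DERIV_nonpos_imp_nonincreasing[OF that])
         (use D(3,5) d(2) N in \<open>force simp: t1_def\<close>)
    \<comment> \<open>The time at which the tangent line at \<open>t1\<close> reaches 0. Below
      \<open>\<delta>\<close> the motion is concave and stays under this line, hence it would have
      left (0,\<infinity>) by time \<open>s\<close>.\<close>
    define s where "s = t1 + g t1 / (- g' t1)"
    have n1: "g' t1 < 0" using neg unfolding t1_def by simp
    then have st: "t1 < s" unfolding s_def using D(3)[of t1] by (simp add: divide_pos_neg)
    obtain \<xi> where xi: "t1 < \<xi>" "g s - g t1 = (s - t1) * g' \<xi>" using MVT2[OF st, of g g'] D(4) by auto
    have "(s - t1) * g' \<xi> \<le> (s - t1) * g' t1" using slope[of \<xi>] xi(1) st by (intro mult_left_mono) auto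
    also have "\<dots> = - g t1" unfolding s_def using n1 by simp
    finally show False using xi(2) D(3)[of s] by simp
  qed
  assume "\<not> g t \<ge> v"
  then have lt: "g t < v" by simp
  then have "g' t \<noteq> 0" using energy_motionD[OF m] f by (metis greaterThan_iff less_irrefl)
  then consider "g' t < 0" | "g' t > 0" by linarith
  then show False
  proof cases
    case 1 then show False using main[OF m] lt by blast
  next
    \<comment> \<open>An ascent below \<open>v\<close> is a descent in reversed time.\<close>
    case 2 then show False using main[OF energy_motion_reverse[OF m, of 0], of "-t"] lt by simp
  qed
qed

subsection \<open>Shapes of the motion\<close>

text \<open>Without zeros of \<open>f\<close> above \<open>q\<close> the velocity keeps its sign and
  no value above \<open>q\<close> can be a limit, so everything above \<open>q\<close> is swept out
  exactly once.\<close>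

lemma motion_monotone_type:
  assumes m: "energy_motion S f F g g'" and gq: "\<And>t. g t > q" and S: "{q<..} \<subseteq> S"
    and f: "\<And>x. x > q \<Longrightarrow> f x > 0"
  shows "g_type2 g"
proof -
  have main: "g_type2 g" if m: "energy_motion S f F g g'" and gq: "\<And>t. g t > q" and p0: "g' 0 > 0" for g g'
  proof -
    note D = energy_motionD[OF m]
    have nz: "g' t \<noteq> 0" for t using D(10) f gq by (metis less_irrefl)
    have p: "g' t > 0" for t
      by (rule nonzero_const_sign[of g' UNIV 0 t]) (use D nz p0 in auto)
    have inc: "g s < g t" if "s < t" for s t using increasing_of_pos_velocity[OF m p, of s s t] that by simp
    have "inj g" by (rule injI) (metis inc less_irrefl linorder_neqE)
    moreover have "y \<in> range g" if y: "y > q" for y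
    proof -
      consider "g 0 = y" | "g 0 < y" | "g 0 > y" by linarith
      then show ?thesis
      proof cases
        case 2
        have "\<exists>t>0. g t = y"
        proof (rule motion_reaches[OF m _ 2])
          show "\<not> (f x = 0 \<and> F x = 0)" if "g 0 < x" for x using f[of x] gq[of 0] that by simp
        qed (use p S gq[of 0] in auto)
        then show ?thesis by blast
      next
        case 3
        \<comment> \<open>Values below \<open>g 0\<close> are reached in the past: reversing time
          and then mirroring the position makes this an ascent again.\<close>
        note mr = energy_motion_reflect[OF energy_motion_reverse[OF m, of 0]]
        have "\<exists>t>0. - g (0 - t) = - y"
        proof (rule motion_reaches[OF mr])
          show "{- g (0 - 0)<..- y} \<subseteq> uminus ` S"
            using S y by (force intro!: image_eqI[of _ uminus "- _"])
          show "\<not> (f (- x) = 0 \<and> - F (- x) = 0)" if "x \<le> - y" for x using f[of "-x"] y that by simp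
        qed (use p 3 in auto)
        then show ?thesis by auto
      qed auto
    qed
    then have "range g = {q<..}" using gq by auto
    ultimately show ?thesis unfolding g_type2_def by blast
  qed
  have "g' 0 \<noteq> 0" using energy_motionD(10)[OF m] f gq by (metis less_irrefl)
  then consider "g' 0 > 0" | "g' 0 < 0" by linarith
  then show ?thesis
  proof cases
    case 1 then show ?thesis using main[OF m gq] by blast
  next
    case 2
    have "g_type2 (\<lambda>t. g (0 - t))" using main[OF energy_motion_reverse[OF m, of 0]] gq 2 by simp
    moreover have "range (\<lambda>t. g (0 - t)) = range g" by (auto simp: image_iff) (metis minus_minus)
    ultimately show ?thesis unfolding g_type2_def inj_def by (metis diff_0 minus_minus)
  qed
qed

text \<open>Here \<open>v\<close> is a turning point at which the force pushes back into
  \<open>J\<close>, and \<open>J\<close> is an interval beginning just above \<open>v\<close> in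
  which the particle cannot stop. Its other end is left open on purpose: \<open>J\<close> is a half
  line for type 3 and, after reflection, a bounded open interval for type 5.\<close>

lemma motion_turning:
  assumes m: "energy_motion S f F g g'" and v: "v \<in> S" "f v = 0" "F v > 0"
    and J: "J \<subseteq> S" "\<And>x y. x \<in> J \<Longrightarrow> v < y \<Longrightarrow> y \<le> x \<Longrightarrow> y \<in> J" "\<And>x. x \<in> J \<Longrightarrow> v < x"
      "\<And>x. x \<in> J \<Longrightarrow> f x > 0"
    and gJ: "\<And>t. g t \<in> insert v J"
  shows "range g = insert v J" "card {t. g t = v} = 1" "\<And>x. x \<in> J \<Longrightarrow> card {t. g t = x} = 2"
proof -
  \<comment> \<open>A motion that avoids \<open>v\<close> descends forever in one of the two time
    directions and would converge to an equilibrium in \<open>insert v J\<close>.\<close>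
  have hit_dec: False if m: "energy_motion S f F g g'" and gJ: "\<And>t. g t \<in> J" and n: "g' 0 < 0" for g g'
  proof -
    note D = energy_motionD[OF m]
    have nz: "g' t \<noteq> 0" for t using D(10) J(4) gJ by (metis less_irrefl)
    have n: "- g' t > 0" for t
      by (rule nonzero_const_sign[of "\<lambda>t. - g' t" UNIV 0 t]) (use D nz n in auto)
    note mr = energy_motion_reflect[OF m]
    have dec: "g t \<le> g s" if "0 \<le> s" "s \<le> t" for s t
      using increasing_of_pos_velocity[OF mr n, of 0 s t] that by (cases "s = t") auto
    obtain L where L: "((\<lambda>t. - g t) \<longlongrightarrow> L) at_top" "\<And>t. 0 \<le> t \<Longrightarrow> - g t \<le> L" "L \<le> - v"
      using increasing_bounded_tendsto[of 0 "\<lambda>t. - g t" "- v"] dec J(3)[OF gJ] by (metis less_imp_le neg_le_iff_le)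
    have "- L \<in> insert v J" using J(2)[OF gJ[of 0], of "-L"] L(2)[of 0] L(3) by force
    then have LS: "L \<in> uminus ` S" using J(1) v(1) by (force intro!: image_eqI[of L uminus "-L"])
    from energy_motion_limit_critical[OF mr L(1) LS] have "f (-L) = 0" "F (-L) = 0" by auto
    then show False using \<open>- L \<in> insert v J\<close> v(3) J(4) by fastforce
  qed
  have "\<exists>t. g t = v"
  proof (rule ccontr)
    assume "\<not> ?thesis"
    then have gJ': "g t \<in> J" for t using gJ[of t] by auto
    then have "g' 0 \<noteq> 0" using energy_motionD(10)[OF m] J(4) by (metis less_irrefl)
    then show False
      using hit_dec[OF m gJ'] hit_dec[OF energy_motion_reverse[OF m, of 0]] gJ' by force
  qed
  then obtain t1 where t1: "g t1 = v" by blast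
  note D = energy_motionD[OF m]
  \<comment> \<open>Between two visits of \<open>v\<close> consider the maximum. If it equals
    \<open>v\<close>, the particle rests there against \<open>F v > 0\<close>; otherwise it is a
    point of \<open>J\<close> with zero velocity, where \<open>f > 0\<close>.\<close>
  have uniq: False if t: "g a = v" "g b = v" "a < b" for a b
  proof -
    have "continuous_on {a..b} g" using D(7) continuous_at_imp_continuous_on by blast
    then obtain s where s: "s \<in> {a..b}" "\<And>t. t \<in> {a..b} \<Longrightarrow> g t \<le> g s"
      using continuous_attains_sup[of "{a..b}" g] t(3) by auto
    show False
    proof (cases "g s = v")
      case True
      have gv: "g t = v" if "t \<in> {a..b}" for t using s(2)[OF that] gJ[of t] J(3) True by force
      then have g0: "g' t = 0" if "t \<in> {a..b}" for t using D(10) v(2) that by simp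
      define c where "c = (a+b)/2"
      have c: "a < c" "c < b" using t(3) unfolding c_def by auto
      have "(g' has_real_derivative 0) (at c)"
        by (rule DERIV_cong_ev[THEN iffD1, OF refl _ refl, of "\<lambda>_. 0"])
           (use c g0 in \<open>auto simp: eventually_nhds intro!: exI[of _ "{a<..<b}"]\<close>)
      then have "F (g c) = 0" using DERIV_unique D(5) by blast
      then show False using v(3) gv[of c] c by simp
    next
      case False
      then have sJ: "g s \<in> J" "s \<noteq> a" "s \<noteq> b" using gJ[of s] t by auto
      have "g' s = 0"
        by (rule DERIV_local_max[OF D(4), of "min (s - a) (b - s)"]) (use s sJ in \<open>auto simp: abs_if split: if_splits\<close>)
      then show False using D(10) J(4)[OF sJ(1)] by simp
    qed
  qed
  then have only: "g t = v \<longleftrightarrow> t = t1" for t using t1 by (metis linorder_neqE)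
  then have "{t. g t = v} = {t1}" by auto
  then show "card {t. g t = v} = 1" by simp
  \<comment> \<open>After the turning time the velocity has no zero, and it is positive because the
    particle has risen above \<open>v\<close>; so each value of \<open>J\<close> is passed once.
    Time reversal supplies the other passage.\<close>
  have half: "\<exists>!t. t > t1 \<and> g t = x" if m: "energy_motion S f F g g'" and t1: "g t1 = v"
    and gJ: "\<And>t. t > t1 \<Longrightarrow> g t \<in> J" and x: "x \<in> J" for g g' t1 x
  proof -
    note D = energy_motionD[OF m]
    have nz: "g' t \<noteq> 0" if "t > t1" for t using D(10) J(4)[OF gJ[OF that]] by (metis less_irrefl)
    obtain \<xi> where xi: "t1 < \<xi>" "g (t1 + 1) - g t1 = (t1 + 1 - t1) * g' \<xi>"
      using MVT2[of t1 "t1+1" g g'] D(4) by auto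
    then have "g' \<xi> > 0" using J(3)[OF gJ[of "t1+1"]] t1 by simp
    then have p: "g' t > 0" if "t > t1" for t
      using nonzero_const_sign[of g' "{t1<..}" \<xi> t] D(8) nz xi(1) that by (auto simp: is_interval_1)
    have ex: "\<exists>t>t1. g t = x"
    proof (rule motion_reaches[OF m p])
      show "{g t1<..x} \<subseteq> S" using J(1,2) x t1 by auto
      show "\<not> (f y = 0 \<and> F y = 0)" if "g t1 < y" "y \<le> x" for y using J(4)[OF J(2)[OF x]] that t1 by fastforce
    qed (use t1 J(3) x in auto)
    have inc: "g s < g t" if "t1 < s" "s < t" for s t using increasing_of_pos_velocity[OF m p, of t1 s t] that by simp
    show ?thesis using ex by (metis inc linorder_neqE less_irrefl)
  qed
  have two: "\<exists>s1 s2. s1 < t1 \<and> t1 < s2 \<and> {t. g t = x} = {s1, s2}" if x: "x \<in> J" for x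
  proof -
    have gJ': "g t \<in> J" if "t \<noteq> t1" for t using gJ[of t] only[of t] that by simp
    have "\<exists>!t. t > t1 \<and> g t = x" using half[of g g' t1 x, OF m t1 _ x] gJ' by simp
    then obtain s2 where c2: "t1 < s2 \<and> g s2 = x" and u: "\<forall>t. t1 < t \<and> g t = x \<longrightarrow> t = s2" by (rule ex1E)
    from c2 have s2: "t1 < s2" "g s2 = x" by auto
    have "\<exists>!t. t > - t1 \<and> g (0 - t) = x"
      using half[of "\<lambda>t. g (0 - t)" "\<lambda>t. - g' (0 - t)" "- t1" x, OF energy_motion_reverse[OF m, of 0] _ _ x] t1 gJ' by simp
    then obtain s where c: "- t1 < s \<and> g (0 - s) = x" and us: "\<forall>t. - t1 < t \<and> g (0 - t) = x \<longrightarrow> t = s"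
      by (rule ex1E)
    from c have s: "- t1 < s" "g (- s) = x" by auto
    have left: "t = - s" if "t < t1" "g t = x" for t using us[rule_format, of "-t"] that by simp
    have "x \<noteq> v" using J(3)[OF x] by simp
    have "t \<in> {- s, s2}" if "g t = x" for t
      using u[rule_format, of t] left[of t] that t1 \<open>x \<noteq> v\<close> by (cases t t1 rule: linorder_cases) auto
    then have "{t. g t = x} = {- s, s2}" using s2(2) s(2) by auto
    then show ?thesis using s(1) s2(1) by (intro exI[of _ "- s"] exI[of _ s2]) auto
  qed
  show "card {t. g t = x} = 2" if x: "x \<in> J" for x
  proof -
    obtain s1 s2 where "s1 < t1" "t1 < s2" "{t. g t = x} = {s1, s2}" using two[OF x] by blast
    then show ?thesis by simp
  qed
  show "range g = insert v J"
  proof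
    show "range g \<subseteq> insert v J" using gJ by blast
    show "insert v J \<subseteq> range g" using two t1 by (auto simp: image_iff) (metis (mono_tags, lifting) insertI1 mem_Collect_eq)
  qed
qed

section \<open>Uniqueness, reflection symmetry and periodic motions\<close>

text \<open>Gronwall's argument for the squared distance in the phase plane. The Lipschitz bound is
  asked for along the two orbits only, because the forces considered later are singular at
  0.\<close>

lemma motion_unique:
  assumes d: "\<And>t. (g has_real_derivative g' t) (at t)" "\<And>t. (g' has_real_derivative F (g t)) (at t)"
    "\<And>t. (h has_real_derivative h' t) (at t)" "\<And>t. (h' has_real_derivative F (h t)) (at t)"
    and lip: "\<And>t. \<bar>F (g t) - F (h t)\<bar> \<le> K * \<bar>g t - h t\<bar>"
    and eq: "g t0 = h t0" "g' t0 = h' t0"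
  shows "g t = h t"
proof -
  define E where "E t = (g t - h t)^2 + (g' t - h' t)^2" for t
  define E' where "E' t = 2 * (g t - h t) * (g' t - h' t) + 2 * (g' t - h' t) * (F (g t) - F (h t))" for t
  have "E t = 0"
  proof (rule gronwall_zero_abs[where K="1 + \<bar>K\<bar>" and E=E and E'=E' and a=t0])
    show "(E has_real_derivative E' t) (at t)" for t unfolding E_def E'_def
      by (auto intro!: derivative_eq_intros d simp: algebra_simps)
    show "\<bar>E' t\<bar> \<le> (1 + \<bar>K\<bar>) * E t" for t
    proof -
      let ?x = "\<bar>g t - h t\<bar>" and ?y = "\<bar>g' t - h' t\<bar>"
      have "K * ?x \<le> \<bar>K\<bar> * ?x" by (rule mult_right_mono) auto
      then have l: "\<bar>F (g t) - F (h t)\<bar> \<le> \<bar>K\<bar> * ?x" using lip[of t] by linarith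
      have "\<bar>E' t\<bar> \<le> 2 * ?x * ?y + 2 * ?y * \<bar>F (g t) - F (h t)\<bar>"
        unfolding E'_def by (rule order_trans[OF abs_triangle_ineq]) (simp only: abs_mult abs_numeral order_refl)
      also have "\<dots> \<le> 2 * ?x * ?y + 2 * ?y * (\<bar>K\<bar> * ?x)" using l by (intro add_left_mono mult_left_mono) auto
      also have "\<dots> = (1 + \<bar>K\<bar>) * (2 * ?x * ?y)" by (simp add: algebra_simps)
      also have "\<dots> \<le> (1 + \<bar>K\<bar>) * (?x^2 + ?y^2)"
        by (rule mult_left_mono) (use sum_squares_bound[of ?x ?y] in auto)
      also have "\<dots> = (1 + \<bar>K\<bar>) * E t" unfolding E_def by simp
      finally show ?thesis .
    qed
    show "E t \<ge> 0" for t unfolding E_def by simp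
    show "E t0 = 0" unfolding E_def using eq by simp
  qed
  then show ?thesis unfolding E_def by (simp add: sum_power2_eq_zero_iff)
qed

text \<open>At an instant of rest the time-reversed motion has the same position and velocity, so
  uniqueness identifies it with the original.\<close>

lemma motion_symmetric:
  assumes m: "energy_motion S f F g g'" and lip: "\<And>x y. x \<in> S \<Longrightarrow> y \<in> S \<Longrightarrow> \<bar>F x - F y\<bar> \<le> K * \<bar>x - y\<bar>"
    and z: "g' t0 = 0"
  shows "g (2 * t0 - t) = g t"
proof -
  note D = energy_motionD[OF m] and R = energy_motionD[OF energy_motion_reverse[OF m, of "2*t0"]]
  show ?thesis
    by (rule motion_unique[where g="\<lambda>t. g (2*t0 - t)" and h=g, OF R(4) R(5) D(4) D(5), where K=K and ?t0.0=t0])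
       (use D(3) lip z in auto)
qed

text \<open>The motion is symmetric about every instant at which it is at an end of the interval.
  Symmetries about an instant at \<open>v1\<close> and one at \<open>v2\<close> compose to a
  translation, which is the period.\<close>

lemma motion_periodic_type:
  assumes m: "energy_motion S f F g g'" and lip: "\<And>x y. x \<in> S \<Longrightarrow> y \<in> S \<Longrightarrow> \<bar>F x - F y\<bar> \<le> K * \<bar>x - y\<bar>"
    and S: "S = {v1..v2}" and v: "v1 < v2" "f v1 = 0" "F v1 \<noteq> 0" "f v2 = 0" "F v2 \<noteq> 0"
    and f: "\<And>x. v1 < x \<Longrightarrow> x < v2 \<Longrightarrow> f x > 0"
  shows "g_type1 g"
proof -
  note D = energy_motionD[OF m]
  have gb: "v1 \<le> g t" "g t \<le> v2" for t using D(3)[of t] S by auto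
  have crit: "\<not> (f x = 0 \<and> F x = 0)" if "x \<in> S" for x
    using v f[of x] that S by (cases "x = v1"; cases "x = v2") auto
  \<comment> \<open>Otherwise the velocity has constant sign from \<open>t0\<close> on, and the
    bounded monotone motion converges to an equilibrium in \<open>S\<close>.\<close>
  have zero_ex: "\<exists>t>t0. g' t = 0" for t0
  proof (rule ccontr)
    assume "\<not> ?thesis"
    then have nz: "g' t \<noteq> 0" if "t > t0" for t using that by blast
    have up: False if m: "energy_motion S' f' F' g g'" "\<And>t. t > t0 \<Longrightarrow> g' t > 0"
      "\<And>t. g t \<le> b" "\<And>t. a \<le> g t" "S' = {a..b}" "\<And>x. x \<in> S' \<Longrightarrow> \<not> (f' x = 0 \<and> F' x = 0)"
      for g g' f' F' S' and a b :: real
    proof -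
      have inc: "g s \<le> g t" if "t0 \<le> s" "s \<le> t" for s t
        using increasing_of_pos_velocity[OF m(1) m(2), of t0 s t] that by (cases "s = t") auto
      obtain L where L: "(g \<longlongrightarrow> L) at_top" "\<And>t. t0 \<le> t \<Longrightarrow> g t \<le> L" "L \<le> b"
        using increasing_bounded_tendsto[of t0 g b] inc m(3) by blast
      have "L \<in> S'" using L(2)[of t0] L(3) m(4)[of t0] m(5) by simp
      then show False using energy_motion_limit_critical[OF m(1) L(1)] m(6) by blast
    qed
    consider "g' (t0 + 1) > 0" | "- g' (t0 + 1) > 0" using nz[of "t0+1"] by fastforce
    then show False
    proof cases
      case 1
      have p: "g' t > 0" if "t > t0" for t
        by (rule nonzero_const_sign[of g' "{t0<..}" "t0 + 1" t]) (use 1 D(8) nz that in \<open>auto simp: is_interval_1\<close>)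
      show False by (rule up[OF m p gb(2) gb(1) S crit])
    next
      case 2
      have p: "- g' t > 0" if "t > t0" for t
        by (rule nonzero_const_sign[of "\<lambda>t. - g' t" "{t0<..}" "t0 + 1" t]) (use 2 D(8) nz that in \<open>auto simp: is_interval_1\<close>)
      have S': "uminus ` S = {- v2..- v1}" using S by simp
      have "\<not> (f (- x) = 0 \<and> - F (- x) = 0)" if "x \<in> uminus ` S" for x using crit that by force
      then show False using up[OF energy_motion_reflect[OF m] p _ _ S'] gb by simp
    qed
  qed
  have ends: "g t = v1 \<or> g t = v2" if "g' t = 0" for t using D(10)[of t] that f[of "g t"] gb[of t] by fastforce
  have ends': "g' t = 0" if "g t = v1 \<or> g t = v2" for t using D(10)[of t] v that by auto
  obtain t1 where t1: "g' t1 = 0" using zero_ex[of 0] by blast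
  obtain t2 where t2: "t1 < t2" "g' t2 = 0" using zero_ex[of t1] by blast
  have cont: "continuous_on {t1..t2} g" using D(7) continuous_at_imp_continuous_on by blast
  \<comment> \<open>Zero velocity on a whole interval makes the force vanish there as well, and the
    particle would sit at an equilibrium.\<close>
  have notconst: False if "\<And>t. t \<in> {t1..t2} \<Longrightarrow> g' t = 0"
  proof -
    define c where "c = (t1+t2)/2"
    have c: "t1 < c" "c < t2" using t2 unfolding c_def by auto
    have "(g' has_real_derivative 0) (at c)"
      by (rule DERIV_cong_ev[THEN iffD1, OF refl _ refl, of "\<lambda>_. 0"])
         (use c that in \<open>auto simp: eventually_nhds intro!: exI[of _ "{t1<..<t2}"]\<close>)
    then have "F (g c) = 0" using DERIV_unique D(5) by blast
    then show False using crit[OF D(3)] D(10)[of c] that[of c] c by auto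
  qed
  \<comment> \<open>If the motion is at the same end at both times of rest, its extremum in between
    is another rest position. It cannot be that end again, so it is the opposite one.\<close>
  have both: "\<exists>ta tb. g ta = v1 \<and> g tb = v2"
  proof -
    consider "g t1 = v1" "g t2 = v1" | "g t1 = v2" "g t2 = v2" | "g t1 \<noteq> g t2" using ends t1 t2 by metis
    then show ?thesis
    proof cases
      case 1
      obtain s where s: "s \<in> {t1..t2}" "\<And>t. t \<in> {t1..t2} \<Longrightarrow> g t \<le> g s"
        using continuous_attains_sup[of "{t1..t2}" g] t2(1) cont by auto
      have "g s \<noteq> v1" using notconst ends' s(2) gb(1) by (metis order_antisym)
      then have "s \<noteq> t1" "s \<noteq> t2" using 1 by auto
      then have "t1 < s" "s < t2" using s(1) by auto
      then have "g' s = 0" using s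
        by (intro DERIV_local_max[OF D(4), of "min (s - t1) (t2 - s)" s]) (auto simp: abs_if less_le split: if_splits)
      then show ?thesis using ends \<open>g s \<noteq> v1\<close> 1 by blast
    next
      case 2
      obtain s where s: "s \<in> {t1..t2}" "\<And>t. t \<in> {t1..t2} \<Longrightarrow> g s \<le> g t"
        using continuous_attains_inf[of "{t1..t2}" g] t2(1) cont by auto
      have "g s \<noteq> v2" using notconst ends' s(2) gb(2) by (metis order_antisym)
      then have "s \<noteq> t1" "s \<noteq> t2" using 2 by auto
      then have "t1 < s" "s < t2" using s(1) by auto
      then have "g' s = 0" using s
        by (intro DERIV_local_min[OF D(4), of "min (s - t1) (t2 - s)" s]) (auto simp: abs_if less_le split: if_splits)
      then show ?thesis using ends \<open>g s \<noteq> v2\<close> 2 by blast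
    next
      case 3 then show ?thesis using ends t1 t2 by metis
    qed
  qed
  then obtain ta tb where ab: "g ta = v1" "g tb = v2" by blast
  have sym: "g (2 * ta - t) = g t" "g (2 * tb - t) = g t" for t
    using motion_symmetric[OF m lip] ends' ab by blast+
  \<comment> \<open>Twice the distance of the two centres of symmetry.\<close>
  define T where "T = 2 * \<bar>ta - tb\<bar>"
  have "ta \<noteq> tb" using ab v(1) by auto
  then have Tpos: "T > 0" unfolding T_def by simp
  have per: "g (t + T) = g t" for t
  proof (cases "ta \<ge> tb")
    case True
    have "t + T = 2 * ta - (2 * tb - t)" unfolding T_def using True by simp
    then show ?thesis by (simp only: sym)
  next
    case False
    then have "t + T = 2 * tb - (2 * ta - t)" unfolding T_def by simp
    then show ?thesis by (simp only: sym)
  qed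
  have pern: "g (t + real n * T) = g t" for t n
  proof (induction n)
    case (Suc n)
    have "t + real (Suc n) * T = (t + real n * T) + T" by (simp add: algebra_simps)
    then show ?case by (simp only: per Suc)
  qed simp
  have inf: "infinite {t. g t = g s}" for s
  proof -
    have "inj (\<lambda>n. s + real n * T)" using Tpos by (auto intro!: injI)
    then have "infinite (range (\<lambda>n. s + real n * T))" by (rule range_inj_infinite)
    moreover have "range (\<lambda>n. s + real n * T) \<subseteq> {t. g t = g s}" using pern by auto
    ultimately show ?thesis using infinite_super by blast
  qed
  have "range g = {v1..v2}"
  proof
    show "range g \<subseteq> {v1..v2}" using gb by auto
    have "connected (range g)" using D(7) by (intro connected_continuous_image continuous_at_imp_continuous_on) auto
    then show "{v1..v2} \<subseteq> range g" using ab connected_contains_Icc[of "range g" v1 v2] by blast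
  qed
  then show ?thesis unfolding g_type1_def using Tpos per inf[of ta] inf[of tb] ab by metis
qed

subsection \<open>The potential of the constant mean curvature equation\<close>

text \<open>With \<open>\<lambda> = H + v\<^sup>-\<^sup>n\<close> the energy is \<open>f\<close> of the informal statement for \<open>ad = 1\<close>, \<open>bd = -1\<close>,
  namely \<open>C - v\<^sup>2 (1 - \<lambda>\<^sup>2)\<close>, and the force is \<open>f'/2 = v (\<lambda>\<mu> - 1)\<close>.\<close>

definition cmc_energy :: "nat \<Rightarrow> real \<Rightarrow> real \<Rightarrow> real \<Rightarrow> real" where
  "cmc_energy n H C v = C - v^2 + v^2 * (H + inverse v ^ n)^2"

definition cmc_force :: "nat \<Rightarrow> real \<Rightarrow> real \<Rightarrow> real" where
  "cmc_force n H v = v * ((H + inverse v ^ n) * (H - (real n - 1) * inverse v ^ n) - 1)"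

lemma DERIV_inverse_power:
  assumes "v > (0::real)" "n > 0"
  shows "((\<lambda>v. inverse v ^ n) has_real_derivative - real n * inverse v ^ n / v) (at v)"
proof -
  obtain m where m: "n = Suc m" using assms(2) gr0_implies_Suc by blast
  have "((\<lambda>v. inverse v ^ n) has_real_derivative real n * (- (inverse v * 1 * inverse v) * inverse v ^ (n - 1))) (at v)"
    using assms(1) by (auto intro!: derivative_eq_intros simp del: power_inverse)
  then show ?thesis unfolding m by (simp add: divide_inverse algebra_simps del: power_inverse)
qed

lemma DERIV_cmc_energy:
  assumes "v > 0" "n > 0"
  shows "(cmc_energy n H C has_real_derivative 2 * cmc_force n H v) (at v)"
proof -
  let ?X = "inverse v ^ n"
  have "((\<lambda>v. C - v^2 + v^2 * (H + inverse v ^ n)^2) has_real_derivative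
     - 2 * v + (2 * v * (H + ?X)^2 + v^2 * (2 * (H + ?X) * (- real n * ?X / v)))) (at v)"
    by (rule derivative_eq_intros DERIV_inverse_power[OF assms] refl | simp)+
  moreover have "- 2 * v + (2 * v * (H + ?X)^2 + v^2 * (2 * (H + ?X) * (- real n * ?X / v))) = 2 * cmc_force n H v"
  proof -
    have "v^2 * (2 * (H + ?X) * (- real n * ?X / v)) = v * (2 * (H + ?X) * (- real n * ?X))"
      using assms by (simp add: power2_eq_square)
    then show ?thesis unfolding cmc_force_def by (simp add: algebra_simps power2_eq_square)
  qed
  ultimately show ?thesis unfolding cmc_energy_def[abs_def] by simp
qed

lemma DERIV_cmc_force:
  assumes "v > 0" "n > 0"
  shows "(cmc_force n H has_real_derivative (H^2 - 1) + (real n - 1) * (real n - 2) * H * inverse v ^ n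
      + (real n - 1) * (2 * real n - 1) * (inverse v ^ n)^2) (at v)"
proof -
  define X where "X v = inverse v ^ n" for v :: real
  define D where "D = - real n * X v / v"
  have dX: "(X has_real_derivative D) (at v)"
    using DERIV_inverse_power[OF assms] unfolding X_def D_def .
  have "((\<lambda>v. v * ((H + X v) * (H - (real n - 1) * X v) - 1)) has_real_derivative
     ((H + X v) * (H - (real n - 1) * X v) - 1) + v * (D * (H - (real n - 1) * X v) + (H + X v) * (- (real n - 1) * D))) (at v)"
    by (rule derivative_eq_intros dX refl)+ (simp add: algebra_simps)
  moreover have "v * (D * (H - (real n - 1) * X v) + (H + X v) * (- (real n - 1) * D))
      = - real n * X v * (H - (real n - 1) * X v) + (H + X v) * ((real n - 1) * real n * X v)"
    unfolding D_def using assms by (simp add: field_simps)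
  then have "((H + X v) * (H - (real n - 1) * X v) - 1) + v * (D * (H - (real n - 1) * X v) + (H + X v) * (- (real n - 1) * D))
      = (H^2 - 1) + (real n - 1) * (real n - 2) * H * X v + (real n - 1) * (2 * real n - 1) * (X v)^2"
    by (simp add: algebra_simps power2_eq_square)
  ultimately show ?thesis unfolding cmc_force_def[abs_def] X_def[symmetric] by (simp only:)
qed

lemma inverse_power_strict_antimono:
  assumes "0 < u" "u < (v::real)" "n > 0" shows "inverse v ^ n < inverse u ^ n"
  using assms by (intro power_strict_mono) auto

text \<open>The derivative of the force is a quadratic polynomial in \<open>inverse v ^ n\<close>,
  which stays bounded away from 0.\<close>

lemma cmc_force_lipschitz:
  assumes "lo > 0" "n > 2"
  obtains K where "\<And>x y. lo \<le> x \<Longrightarrow> lo \<le> y \<Longrightarrow> \<bar>cmc_force n H x - cmc_force n H y\<bar> \<le> K * \<bar>x - y\<bar>"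
proof
  define B where "B = \<bar>H^2 - 1\<bar> + (real n - 1) * (real n - 2) * \<bar>H\<bar> * inverse lo ^ n + (real n - 1) * (2 * real n - 1) * (inverse lo ^ n)^2"
  fix x y :: real assume xy: "lo \<le> x" "lo \<le> y"
  have "norm (cmc_force n H x - cmc_force n H y) \<le> B * norm (x - y)"
  proof (rule field_differentiable_bound[of "{lo..}"])
    fix z assume z: "z \<in> {lo..}"
    then have zp: "z > 0" using assms by auto
    show "(cmc_force n H has_real_derivative (H^2 - 1) + (real n - 1) * (real n - 2) * H * inverse z ^ n
      + (real n - 1) * (2 * real n - 1) * (inverse z ^ n)^2) (at z within {lo..})"
      using DERIV_cmc_force[OF zp, of n H] assms has_field_derivative_at_within by auto
    have X: "0 \<le> inverse z ^ n" "inverse z ^ n \<le> inverse lo ^ n"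
      using z assms zp by (auto intro!: power_mono)
    have "\<bar>(real n - 1) * (real n - 2) * H * inverse z ^ n\<bar> \<le> (real n - 1) * (real n - 2) * \<bar>H\<bar> * inverse lo ^ n"
      using assms X by (simp add: abs_mult mult_left_mono)
    moreover have "\<bar>(real n - 1) * (2 * real n - 1) * (inverse z ^ n)^2\<bar> \<le> (real n - 1) * (2 * real n - 1) * (inverse lo ^ n)^2"
      using assms X by (simp add: abs_mult mult_left_mono power_mono)
    ultimately show "norm ((H^2 - 1) + (real n - 1) * (real n - 2) * H * inverse z ^ n
      + (real n - 1) * (2 * real n - 1) * (inverse z ^ n)^2) \<le> B" unfolding B_def real_norm_def by linarith
  qed (use xy in auto)
  then show "\<bar>cmc_force n H x - cmc_force n H y\<bar> \<le> B * \<bar>x - y\<bar>" by simp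
qed

text \<open>Near 0 the energy behaves like v^(2-2n) and the force like -(n-1) v^(1-2n): the particle
  is drawn into the singularity and has energy to get there.\<close>

lemma cmc_near_zero:
  assumes "n > 2"
  obtains \<delta> where "\<delta> > 0" "\<And>v. 0 < v \<Longrightarrow> v < \<delta> \<Longrightarrow> cmc_energy n H C v > 0" "\<And>v. 0 < v \<Longrightarrow> v < \<delta> \<Longrightarrow> cmc_force n H v < 0"
proof
  \<comment> \<open>The choice makes \<open>inverse v\<close>, and with it
    \<open>inverse v ^ n\<close> and \<open>v * inverse v ^ n\<close>, exceed |H| + |C| + 2. Then (H
    v + v X)^2 is at least |C| + 4 with X = \<open>inverse v ^ n\<close>, which outweighs
    \<open>C - v^2\<close>.\<close>
  define \<delta> where "\<delta> = inverse (\<bar>H\<bar> + \<bar>C\<bar> + 2)"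
  show "\<delta> > 0" unfolding \<delta>_def by simp
  fix v :: real assume v: "0 < v" "v < \<delta>"
  let ?X = "inverse v ^ n"
  have iv: "inverse v > \<bar>H\<bar> + \<bar>C\<bar> + 2" using v less_imp_inverse_less[of v \<delta>] unfolding \<delta>_def by simp
  have v1: "v < 1" using v(1) iv one_less_inverse_iff[of v] by linarith
  have yv: "v * ?X = inverse v ^ (n - 1)" using v assms
    by (cases n) (simp_all del: power_inverse)
  have y: "v * ?X \<ge> inverse v" unfolding yv using iv power_increasing[of 1 "n-1" "inverse v"] assms by simp
  have X: "?X \<ge> inverse v" using iv power_increasing[of 1 n "inverse v"] assms by simp
  have "\<bar>H * v\<bar> \<le> \<bar>H\<bar>" using v v1 by (simp add: abs_mult mult_left_le)
  then have "H * v + v * ?X \<ge> \<bar>C\<bar> + 2" using y iv by linarith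
  then have "(H * v + v * ?X)^2 \<ge> (\<bar>C\<bar> + 2)^2" by (intro power_mono) auto
  moreover have "(\<bar>C\<bar> + 2)^2 \<ge> \<bar>C\<bar> + 4" by (simp add: power2_eq_square algebra_simps)
  moreover have "v^2 < 1" using v v1 by (simp add: power_less_one_iff)
  moreover have "v^2 * (H + ?X)^2 = (H * v + v * ?X)^2" by (simp add: power2_eq_square algebra_simps)
  ultimately show "cmc_energy n H C v > 0" unfolding cmc_energy_def by linarith
  have X2: "?X > \<bar>H\<bar> + 1" using X iv by linarith
  have "2 * ?X \<le> (real n - 1) * ?X" using assms X2 by (intro mult_right_mono) auto
  then have "(H + ?X) * (H - (real n - 1) * ?X) < 0" using X2 by (intro mult_pos_neg) linarith+
  then show "cmc_force n H v < 0" unfolding cmc_force_def using v by (intro mult_pos_neg) auto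
qed

lemma cmc_energy_increasing:
  assumes "n > 0" "0 < a" "a < b" "\<And>x. a < x \<Longrightarrow> x < b \<Longrightarrow> cmc_force n H x > 0"
  shows "cmc_energy n H C a < cmc_energy n H C b"
proof (rule DERIV_pos_imp_increasing_open[OF \<open>a < b\<close>])
  show "\<exists>y. (cmc_energy n H C has_real_derivative y) (at x) \<and> 0 < y" if "a < x" "x < b" for x
    using DERIV_cmc_energy[of x n H C] assms(4)[OF that] assms(1,2) that by (intro exI[of _ "2 * cmc_force n H x"]) auto
  show "continuous_on {a..b} (cmc_energy n H C)"
    by (intro continuous_at_imp_continuous_on ballI DERIV_isCont[OF DERIV_cmc_energy]) (use assms in auto)
qed

lemma cmc_energy_decreasing:
  assumes "n > 0" "0 < a" "a < b" "\<And>x. a < x \<Longrightarrow> x < b \<Longrightarrow> cmc_force n H x < 0"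
  shows "cmc_energy n H C b < cmc_energy n H C a"
proof (rule DERIV_neg_imp_decreasing_open[OF \<open>a < b\<close>])
  show "\<exists>y. (cmc_energy n H C has_real_derivative y) (at x) \<and> y < 0" if "a < x" "x < b" for x
    using DERIV_cmc_energy[of x n H C] assms(4)[OF that] assms(1,2) that by (intro exI[of _ "2 * cmc_force n H x"]) auto
  show "continuous_on {a..b} (cmc_energy n H C)"
    by (intro continuous_at_imp_continuous_on ballI DERIV_isCont[OF DERIV_cmc_energy]) (use assms in auto)
qed

lemma cmc_energy_nonincreasing:
  assumes "n > 0" "0 < a" "a \<le> b" "\<And>x. a \<le> x \<Longrightarrow> x \<le> b \<Longrightarrow> cmc_force n H x \<le> 0"
  shows "cmc_energy n H C b \<le> cmc_energy n H C a"
proof (rule DERIV_nonpos_imp_nonincreasing[OF \<open>a \<le> b\<close>])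
  show "\<exists>y. (cmc_energy n H C has_real_derivative y) (at x) \<and> y \<le> 0" if "a \<le> x" "x \<le> b" for x
    using DERIV_cmc_energy[of x n H C] assms(4)[OF that] assms(1,2) that by (intro exI[of _ "2 * cmc_force n H x"]) auto
qed

lemma cmc_energy_zero_between:
  assumes "n > 0" "0 < a" "a < b" "cmc_energy n H C a * cmc_energy n H C b < 0"
  obtains v where "a < v" "v < b" "cmc_energy n H C v = 0"
proof -
  have c: "isCont (cmc_energy n H C) x" if "a \<le> x" for x
    by (rule DERIV_isCont[OF DERIV_cmc_energy]) (use that assms in auto)
  have "\<exists>v. a \<le> v \<and> v \<le> b \<and> cmc_energy n H C v = 0"
  proof (cases "cmc_energy n H C a < 0")
    case True
    then have "cmc_energy n H C b > 0" using assms(4) by (simp add: mult_less_0_iff)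
    then show ?thesis using True assms c by (intro IVT) auto
  next
    case False
    then have "cmc_energy n H C b < 0" "cmc_energy n H C a > 0" using assms(4) by (auto simp: mult_less_0_iff)
    then show ?thesis using assms c by (intro IVT2) auto
  qed
  then obtain v where v: "a \<le> v" "v \<le> b" "cmc_energy n H C v = 0" by blast
  moreover have "v \<noteq> a" "v \<noteq> b" using v(3) assms(4) by auto
  ultimately show thesis using that[of v] by simp
qed

abbreviation cmc_motion :: "nat \<Rightarrow> real \<Rightarrow> real \<Rightarrow> (real \<Rightarrow> real) \<Rightarrow> (real \<Rightarrow> real) \<Rightarrow> bool" where
  "cmc_motion n H C \<equiv> energy_motion {0<..} (cmc_energy n H C) (cmc_force n H)"

text \<open>The form in which non-constancy of \<lambda> enters the dynamics: zero energy together
  with zero force characterizes an equilibrium.\<close>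

definition never_critical :: "nat \<Rightarrow> real \<Rightarrow> real \<Rightarrow> (real \<Rightarrow> real) \<Rightarrow> bool" where
  "never_critical n H C g \<longleftrightarrow> (\<forall>t. \<not> (cmc_energy n H C (g t) = 0 \<and> cmc_force n H (g t) = 0))"

text \<open>The energy is positive near 0. A motion in (0,\<infinity>) that lasts for all times
  needs a barrier against collapse, and only a zero of the energy can be one; the least zero keeps
  the whole motion above it.\<close>

lemma cmc_motion_above_least_zero:
  assumes n: "n > 2" and m: "cmc_motion n H C g g'" and nc: "never_critical n H C g"
  obtains z where "z > 0" "cmc_energy n H C z = 0" "\<And>v. 0 < v \<Longrightarrow> v < z \<Longrightarrow> cmc_energy n H C v > 0" "\<And>t. g t > z"
proof -
  note D = energy_motionD[OF m]
  obtain \<delta> where d: "\<delta> > 0" "\<And>v. 0 < v \<Longrightarrow> v < \<delta> \<Longrightarrow> cmc_energy n H C v > 0" "\<And>v. 0 < v \<Longrightarrow> v < \<delta> \<Longrightarrow> cmc_force n H v < 0"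
    using cmc_near_zero[OF n] by blast
  have n0: "n > 0" using n by simp
  note nocol = no_collapse[OF m _ d(1) d(3)]
  have c: "isCont (cmc_energy n H C) x" if "x > 0" for x by (rule DERIV_isCont[OF DERIV_cmc_energy[OF that n0]])
  have "\<exists>v>0. cmc_energy n H C v = 0"
  proof (rule ccontr)
    assume no: "\<not> ?thesis"
    have "cmc_energy n H C x > 0" if "x > 0" for x
    proof (rule ccontr)
      assume "\<not> cmc_energy n H C x > 0"
      then have neg: "cmc_energy n H C x < 0" using no that by fastforce
      define u where "u = min (\<delta>/2) (x/2)"
      have u: "0 < u" "u < \<delta>" "u < x" unfolding u_def using d(1) that by auto
      have "cmc_energy n H C u * cmc_energy n H C x < 0" using d(2)[OF u(1,2)] neg by (simp add: mult_pos_neg)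
      then show False using cmc_energy_zero_between[OF n0 u(1,3)] no u(1) by (metis less_trans)
    qed
    \<comment> \<open>With a positive energy everywhere \<open>no_collapse\<close> applies to every
      bound, in particular to one above the position itself.\<close>
    then have "g 0 \<ge> g 0 + 1" by (intro nocol)
    then show False by simp
  qed
  then obtain v where v: "v > 0" "cmc_energy n H C v = 0" by blast
  define Z where "Z = {x \<in> {\<delta>..v}. cmc_energy n H C x = 0}"
  have vd: "v \<ge> \<delta>" using d(2)[of v] v by (metis less_irrefl linorder_not_le)
  then have "Z \<noteq> {}" unfolding Z_def using v by auto
  moreover have "compact Z"
  proof -
    have "closed Z" unfolding Z_def
      by (intro continuous_closed_preimage_constant continuous_at_imp_continuous_on ballI c) (use d(1) in auto)
    moreover have "bounded Z" by (rule bounded_subset[OF bounded_closed_interval[of \<delta> v]]) (auto simp: Z_def)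
    ultimately show ?thesis by (simp add: compact_eq_bounded_closed)
  qed
  ultimately obtain z where z: "z \<in> Z" "\<And>x. x \<in> Z \<Longrightarrow> z \<le> x" using compact_attains_inf[of Z] by blast
  have z0: "z \<ge> \<delta>" "z > 0" "cmc_energy n H C z = 0" "z \<le> v" using z(1) d(1) unfolding Z_def by auto
  have below: "cmc_energy n H C x > 0" if x: "0 < x" "x < z" for x
  proof (rule ccontr)
    assume a: "\<not> cmc_energy n H C x > 0"
    have xd: "x \<ge> \<delta>" using d(2)[of x] a x by (metis linorder_not_le)
    show False
    proof (cases "cmc_energy n H C x = 0")
      case True then show False using z(2)[of x] xd x z0 unfolding Z_def by auto
    next
      case False
      then have neg: "cmc_energy n H C x < 0" using a by simp
      define u where "u = \<delta>/2"
      have u: "0 < u" "u < \<delta>" "u < x" unfolding u_def using d(1) xd by auto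
      have "cmc_energy n H C u * cmc_energy n H C x < 0" using d(2)[OF u(1,2)] neg by (simp add: mult_pos_neg)
      then obtain y where y: "u < y" "y < x" "cmc_energy n H C y = 0" using cmc_energy_zero_between[OF n0 u(1,3)] by blast
      then have "y \<ge> \<delta>" using d(2)[of y] u(1) by (metis less_irrefl less_trans linorder_not_le)
      then show False using z(2)[of y] y x z0 unfolding Z_def by auto
    qed
  qed
  have ge: "g t \<ge> z" for t by (rule nocol[OF below])
  have "g t > z" for t
  proof (rule ccontr)
    assume "\<not> g t > z"
    then have gz: "g t = z" using ge[of t] by simp
    then have Fz: "cmc_force n H z \<noteq> 0" and g0: "g' t = 0" using nc z0(3) D(10) unfolding never_critical_def by metis+
    \<comment> \<open>A positive force at \<open>z\<close> would mean an increasing energy, hence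
      negative values just below \<open>z\<close>, where it is known to be positive.\<close>
    have "\<not> cmc_force n H z > 0"
    proof
      assume "cmc_force n H z > 0"
      then obtain e where e: "e > 0" "\<And>h. 0 < h \<Longrightarrow> h < e \<Longrightarrow> cmc_energy n H C (z - h) < cmc_energy n H C z"
        using DERIV_pos_inc_left[OF DERIV_cmc_energy[OF z0(2) n0, of H C]] by auto
      define h where "h = min (e/2) (z/2)"
      have h: "0 < h" "h < e" "h < z" unfolding h_def using e(1) z0(2) by auto
      show False using e(2)[OF h(1,2)] below[of "z - h"] h z0(3) by simp
    qed
    then have "cmc_force n H (g t) < 0" using Fz gz by simp
    then obtain e where e: "e > 0" "\<And>h. 0 < h \<Longrightarrow> h < e \<Longrightarrow> g' (t + h) < g' t"
      using DERIV_neg_dec_right[OF D(5)[of t]] by auto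
    \<comment> \<open>At rest at \<open>z\<close> with a strictly negative force the particle would
      fall below the barrier \<open>z\<close> at once.\<close>
    have "g (t + e/2) < g t"
    proof (rule DERIV_neg_imp_decreasing_open[where f=g and a=t])
      show "\<exists>y. (g has_real_derivative y) (at x) \<and> y < 0" if "t < x" "x < t + e/2" for x
        using D(4)[of x] e(2)[of "x - t"] g0 that by (intro exI[of _ "g' x"]) auto
      show "continuous_on {t..t + e/2} g" by (intro continuous_at_imp_continuous_on ballI D(7))
    qed (use e in auto)
    then show False using ge[of "t + e/2"] gz by simp
  qed
  then show thesis using that z0 below by blast
qed

section \<open>Critical points of the potential and excluded values of H\<close>

text \<open>The critical points in the variable X = v^(-n): \<open>cmc_root1\<close> and
  \<open>cmc_root2\<close> are the roots of (H + X) (H - (n-1) X) = 1, so that q1 and q2 are their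
  powers with exponent -1/n. Larger X means smaller v.\<close>

definition cmc_root1 :: "nat \<Rightarrow> real \<Rightarrow> real" where
  "cmc_root1 n H = (sqrt (H^2 * (real n)^2 - 4 * real n + 4) - H * (real n - 2)) / (2 * (real n - 1))"

definition cmc_root2 :: "nat \<Rightarrow> real \<Rightarrow> real" where
  "cmc_root2 n H = (- sqrt (H^2 * (real n)^2 - 4 * real n + 4) - H * (real n - 2)) / (2 * (real n - 1))"

lemma cmc_force_factor:
  assumes "n > 2" "H^2 * (real n)^2 - 4 * real n + 4 \<ge> 0"
  shows "cmc_force n H v = v * (- (real n - 1) * (inverse v ^ n - cmc_root1 n H) * (inverse v ^ n - cmc_root2 n H))"
proof -
  define s where "s = sqrt (H^2 * (real n)^2 - 4 * real n + 4)"
  have s2: "s^2 = H^2 * (real n)^2 - 4 * real n + 4" unfolding s_def using assms(2) by simp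
  define N where "N = real n - 1"
  have N: "N \<noteq> 0" "real n = N + 1" unfolding N_def using assms by auto
  have "- N * (X - (s - H * (real n - 2)) / (2 * N)) * (X - (- s - H * (real n - 2)) / (2 * N))
     = (H + X) * (H - N * X) - 1" for X
  proof -
    have "- N * (X - (s - H * (real n - 2)) / (2 * N)) * (X - (- s - H * (real n - 2)) / (2 * N))
      = - ((2 * N * X + H * (real n - 2))^2 - s^2) / (4 * N)"
      using N(1) by (simp add: field_simps power2_eq_square)
    also have "\<dots> = (H + X) * (H - N * X) - 1"
      using N(1) unfolding s2 N(2) by (simp add: field_simps power2_eq_square)
    finally show ?thesis .
  qed
  then show ?thesis unfolding cmc_force_def cmc_root1_def cmc_root2_def s_def[symmetric] N_def[symmetric] by simp
qed

lemma powr_root_facts: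
  assumes "x > (0::real)" "n > 0" "q = x powr (- 1 / real n)"
  shows "q > 0" "inverse q ^ n = x" "q powr (- real n) = x"
proof -
  show "q > 0" using assms by simp
  have "inverse q = x powr (1 / real n)" unfolding assms(3) by (simp add: powr_minus)
  then show "inverse q ^ n = x" using assms by (simp add: powr_realpow[symmetric] powr_powr)
  show "q powr (- real n) = x" unfolding assms(3) using assms by (simp add: powr_powr)
qed

text \<open>Zero energy at all times means zero velocity and therefore zero force: an
  equilibrium.\<close>

lemma cmc_motion_positive_energy:
  assumes m: "cmc_motion n H C g g'" and nc: "never_critical n H C g"
  obtains t where "cmc_energy n H C (g t) > 0"
proof -
  note D = energy_motionD[OF m]
  have "\<exists>t. cmc_energy n H C (g t) > 0"
  proof (rule ccontr)
    assume "\<not> ?thesis"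
    then have z: "cmc_energy n H C (g t) = 0" for t using D(9)[of t] by (metis less_eq_real_def)
    then have "g' t = 0" for t using D(10) by blast
    then have "g' = (\<lambda>_. 0)" by blast
    then have "((\<lambda>_. 0) has_real_derivative cmc_force n H (g 0)) (at 0)" using D(5)[of 0] by simp
    then have "cmc_force n H (g 0) = 0" using DERIV_unique DERIV_const by blast
    then show False using z[of 0] nc unfolding never_critical_def by blast
  qed
  then show thesis using that by blast
qed

text \<open>If the force were nowhere positive, the energy could not increase beyond its least zero
  \<open>z\<close>. But the particle lives above \<open>z\<close> and has positive energy at some
  time.\<close>

lemma cmc_motion_exists_downhill:
  assumes n: "n > 2" and m: "cmc_motion n H C g g'" and nc: "never_critical n H C g"
  shows "\<exists>v>0. cmc_force n H v > 0"
proof (rule ccontr)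
  assume "\<not> ?thesis"
  then have le: "cmc_force n H v \<le> 0" if "v > 0" for v using that by (meson not_le)
  obtain z where z: "z > 0" "cmc_energy n H C z = 0" "\<And>t. g t > z"
    using cmc_motion_above_least_zero[OF n m nc] by metis
  obtain t where "cmc_energy n H C (g t) > 0" using cmc_motion_positive_energy[OF m nc] by blast
  moreover have "cmc_energy n H C (g t) \<le> cmc_energy n H C z"
    by (rule cmc_energy_nonincreasing) (use n z(1) z(3)[of t] le in auto)
  ultimately show False using z(2) by simp
qed

text \<open>For these H the quadratic that gives the sign of the force has no positive value at X >
  0: for H \<ge> 0 because all its terms are nonpositive, for H < 0 because its discriminant H^2 n^2
  - 4(n-1) is.\<close>

lemma cmc_motion_H_excluded:
  assumes n: "n > 2" and m: "cmc_motion n H C g g'" and nc: "never_critical n H C g"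
  shows "H \<notin> {- 2 * sqrt (real n - 1) / real n .. 1}"
proof
  assume H: "H \<in> {- 2 * sqrt (real n - 1) / real n .. 1}"
  obtain v where v: "v > 0" "cmc_force n H v > 0" using cmc_motion_exists_downhill[OF n m nc] by blast
  define X where "X = inverse v ^ n"
  have X: "X > 0" unfolding X_def using v by simp
  have "(H + X) * (H - (real n - 1) * X) - 1 > 0" using v unfolding cmc_force_def X_def by (simp add: zero_less_mult_iff)
  then have p: "H^2 - 1 - (real n - 2) * H * X - (real n - 1) * X^2 > 0" by (simp add: algebra_simps power2_eq_square)
  have q: "(real n - 1) * X^2 > 0" using n X by simp
  show False
  proof (cases "H \<ge> 0")
    case True
    then have "H^2 \<le> 1" using H by (simp add: power_le_one)
    moreover have "(real n - 2) * H * X \<ge> 0" using True X n by simp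
    ultimately show False using p q by linarith
  next
    case False
    have "- 2 * sqrt (real n - 1) / real n * real n \<le> H * real n" using H by (intro mult_right_mono) auto
    then have "- 2 * sqrt (real n - 1) \<le> H * real n" using n by simp
    then have "(- (H * real n))^2 \<le> (2 * sqrt (real n - 1))^2" using False by (intro power_mono) (auto simp: mult_nonpos_nonneg)
    then have d: "(H * real n)^2 \<le> 4 * (real n - 1)" using n by (simp add: power_mult_distrib)
    \<comment> \<open>Completing the square in X.\<close>
    have "4 * (real n - 1) * (H^2 - 1 - (real n - 2) * H * X - (real n - 1) * X^2)
      = - ((2 * (real n - 1) * X + (real n - 2) * H)^2) + ((H * real n)^2 - 4 * (real n - 1))"
      by (simp add: algebra_simps power2_eq_square)
    also have "\<dots> \<le> 0" using d zero_le_power2[of "2 * (real n - 1) * X + (real n - 2) * H"] by linarith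
    finally show False using p n by (simp add: mult_le_0_iff)
  qed
qed

section \<open>Shape of the energy and type of the motion\<close>

text \<open>The energy falls up to \<open>q\<close> and rises afterwards. A zero can only be present
  if the minimum \<open>C - r\<close> is not positive, and the motion takes place to the right of
  \<open>q\<close>: with minimum 0 it comes from \<open>q\<close> asymptotically or tends to it,
  with a negative minimum it turns at the second zero. The last conjunct is kept for the bound 0 < C
  at H = -1.\<close>

lemma cmc_motion_single_well:
  assumes n: "n > 2" and m: "cmc_motion n H C g g'" and nc: "never_critical n H C g"
    and q: "q > 0" and r: "cmc_energy n H C q = C - r"
    and neg: "\<And>v. 0 < v \<Longrightarrow> v < q \<Longrightarrow> cmc_force n H v < 0"
    and pos: "\<And>v. q < v \<Longrightarrow> cmc_force n H v > 0"
  shows "C \<le> r \<and> (C = r \<longrightarrow> g_type2 g) \<and> (C < r \<longrightarrow> g_type3 g) \<and> (\<exists>v>q. cmc_energy n H C v > 0)"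
proof -
  have n0: "n > 0" using n by simp
  note D = energy_motionD[OF m]
  obtain z where z: "z > 0" "cmc_energy n H C z = 0" "\<And>v. 0 < v \<Longrightarrow> v < z \<Longrightarrow> cmc_energy n H C v > 0" "\<And>t. g t > z"
    using cmc_motion_above_least_zero[OF n m nc] by metis
  have inc: "cmc_energy n H C a < cmc_energy n H C b" if "q \<le> a" "a < b" for a b
    by (rule cmc_energy_increasing[OF n0]) (use that q pos in auto)
  have dec: "cmc_energy n H C b < cmc_energy n H C a" if "0 < a" "a < b" "b \<le> q" for a b
    by (rule cmc_energy_decreasing[OF n0]) (use that neg in auto)
  have zq: "z \<le> q" using z(3)[OF q] inc[of q z] z(2) by fastforce
  have "C \<le> r" using dec[of z q] z(1,2) zq r by (cases "z = q") auto
  obtain t0 where t0: "cmc_energy n H C (g t0) > 0" using cmc_motion_positive_energy[OF m nc] by blast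
  have gq: "g t0 > q"
  proof (rule ccontr)
    assume "\<not> g t0 > q"
    then show False using dec[of z "g t0"] z(1,2) z(4)[of t0] t0 by auto
  qed
  have t2: "g_type2 g" if "C = r"
  proof -
    have "z = q" using dec[of z q] z(1,2) zq r that by (cases "z = q") auto
    show ?thesis
      by (rule motion_monotone_type[OF m, of q]) (use z(4) \<open>z = q\<close> q inc[of q] r that in auto)
  qed
  have t3: "g_type3 g" if "C < r"
  proof -
    \<comment> \<open>The turning point is the zero between the negative minimum and a position of
      positive energy. Between the least zero and it the energy is negative, so the motion stays at
      or above it.\<close>
    have "cmc_energy n H C q * cmc_energy n H C (g t0) < 0" using t0 r that by (simp add: mult_neg_pos)
    then obtain v where v: "q < v" "v < g t0" "cmc_energy n H C v = 0"
      using cmc_energy_zero_between[OF n0 q gq] by blast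
    have gv: "g t \<ge> v" for t
    proof (rule ccontr)
      assume "\<not> g t \<ge> v"
      then have "cmc_energy n H C (g t) < 0"
        using dec[of z "g t"] inc[of "g t" v] z(1,2) z(4)[of t] v by (cases "g t \<le> q") auto
      then show False using D(9)[of t] by simp
    qed
    have p: "cmc_energy n H C x > 0" if "x > v" for x using inc[of v x] v that by simp
    have J: "insert v {v<..} = {v..}" by auto
    have "g t \<in> insert v {v<..}" for t using gv[of t] by auto
    from motion_turning[OF m _ v(3) pos[OF v(1)] _ _ _ _ this] p v(1) q
    have "range g = {v..}" "card {t. g t = v} = 1" "\<And>x. x > v \<Longrightarrow> card {t. g t = x} = 2"
      unfolding J by auto
    then show ?thesis unfolding g_type3_def by auto
  qed
  show ?thesis using \<open>C \<le> r\<close> t2 t3 gq t0 by blast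
qed

text \<open>Here the energy has a minimum \<open>C - r\<close> at \<open>q\<close>, a maximum
  \<open>C - r'\<close> at \<open>q'\<close>, and becomes negative far out. The motion is confined
  to the hump around \<open>q'\<close>: its left end is the equilibrium \<open>q\<close> when C = r
  and a turning point when C < r, its right end is always a turning point.\<close>

lemma cmc_motion_double_well:
  assumes n: "n > 2" and m: "cmc_motion n H C g g'" and nc: "never_critical n H C g"
    and q: "q > 0" "q < q'" and r: "cmc_energy n H C q = C - r" "cmc_energy n H C q' = C - r'"
    and neg: "\<And>v. 0 < v \<Longrightarrow> v < q \<Longrightarrow> cmc_force n H v < 0"
    and pos: "\<And>v. q < v \<Longrightarrow> v < q' \<Longrightarrow> cmc_force n H v > 0"
    and neg': "\<And>v. q' < v \<Longrightarrow> cmc_force n H v < 0"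
    and ev: "\<exists>v>q'. cmc_energy n H C v < 0"
  shows "r' < C \<and> C \<le> r \<and> (C = r \<longrightarrow> g_type5 g) \<and> (C < r \<longrightarrow> g_type1 g)"
proof -
  have n0: "n > 0" using n by simp
  note D = energy_motionD[OF m]
  obtain z where z: "z > 0" "cmc_energy n H C z = 0" "\<And>v. 0 < v \<Longrightarrow> v < z \<Longrightarrow> cmc_energy n H C v > 0" "\<And>t. g t > z"
    using cmc_motion_above_least_zero[OF n m nc] by metis
  have inc: "cmc_energy n H C a < cmc_energy n H C b" if "q \<le> a" "a < b" "b \<le> q'" for a b
    by (rule cmc_energy_increasing[OF n0]) (use that q pos in auto)
  have dec: "cmc_energy n H C b < cmc_energy n H C a" if "0 < a" "a < b" "b \<le> q" for a b
    by (rule cmc_energy_decreasing[OF n0]) (use that neg in auto)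
  have dec': "cmc_energy n H C b < cmc_energy n H C a" if "q' \<le> a" "a < b" for a b
    by (rule cmc_energy_decreasing[OF n0]) (use that q neg' in auto)
  obtain t0 where t0: "cmc_energy n H C (g t0) > 0" using cmc_motion_positive_energy[OF m nc] by blast
  have zq: "z \<le> q"
  proof (rule ccontr)
    assume "\<not> z \<le> q"
    then have "z > q'" using z(3)[OF q(1)] inc[of q z] z(2) by fastforce
    then show False using dec'[of z "g t0"] z(2) z(4)[of t0] t0 by simp
  qed
  have "C \<le> r" using dec[of z q] z(1,2) zq r by (cases "z = q") auto
  have gq: "g t0 > q"
  proof (rule ccontr)
    assume "\<not> g t0 > q"
    then show False using dec[of z "g t0"] z(1,2) z(4)[of t0] t0 by auto
  qed
  \<comment> \<open>Beyond \<open>q\<close> the energy is maximal at \<open>q'\<close>, and it is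
    positive at \<open>g t0\<close>; this is the bound r' < C.\<close>
  have eq': "cmc_energy n H C q' > 0"
    using inc[of "g t0" q'] dec'[of q' "g t0"] gq t0 by (cases "g t0" q' rule: linorder_cases) auto
  obtain u where u: "u > q'" "cmc_energy n H C u < 0" using ev by blast
  have "cmc_energy n H C q' * cmc_energy n H C u < 0" using eq' u by (simp add: mult_pos_neg)
  then obtain v2 where v2: "q' < v2" "cmc_energy n H C v2 = 0"
    using cmc_energy_zero_between[OF n0 _ u(1)] q by (metis less_trans)
  have gv2: "g t \<le> v2" for t using dec'[of v2 "g t"] v2 D(9)[of t] by fastforce
  have t5: "g_type5 g" if Cr: "C = r"
  proof -
    have "z = q" using dec[of z q] z(1,2) zq r Cr by (cases "z = q") auto
    have p: "cmc_energy n H C x > 0" if "q < x" "x < v2" for x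
    proof (cases "x \<le> q'")
      case True then show ?thesis using inc[of q x] that r(1) Cr by simp
    next
      case False then show ?thesis using dec'[of x v2] that v2 by simp
    qed
    \<comment> \<open>The turning point \<open>v2\<close> is an upper end here. Reflection makes it
      the lower end that \<open>motion_turning\<close> expects, and the open end \<open>- q\<close>
      is the equilibrium that is never reached.\<close>
    note mr = energy_motion_reflect[OF m]
    define J where "J = {- v2<..<- q}"
    have gJ: "- g t \<in> insert (- v2) J" for t using gv2[of t] z(4)[of t] \<open>z = q\<close> unfolding J_def by auto
    have JS: "J \<subseteq> uminus ` {0<..}"
    proof
      fix x assume "x \<in> J" then show "x \<in> uminus ` {0<..}" using q unfolding J_def by (intro image_eqI[of _ _ "-x"]) auto
    qed
    have vS: "- v2 \<in> uminus ` {0<..}" using v2 q by auto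
    have T: "range (\<lambda>t. - g t) = insert (- v2) J" "card {t. - g t = - v2} = 1" "\<And>x. x \<in> J \<Longrightarrow> card {t. - g t = x} = 2"
      by (rule motion_turning[OF mr vS _ _ JS _ _ _ gJ]; use v2 neg' p in \<open>auto simp: J_def\<close>)+
    have "range g = uminus ` range (\<lambda>t. - g t)" by (simp add: image_image)
    also have "\<dots> = {q<..v2}" unfolding T(1) J_def using v2 q by (auto simp: image_iff intro!: bexI[of _ "- _"]) 
    finally have "range g = {q<..v2}" .
    moreover have "card {t. g t = x} = 2" if "x \<in> {q<..<v2}" for x using T(3)[of "-x"] that unfolding J_def by simp
    ultimately show ?thesis unfolding g_type5_def using T(2) by (intro exI[of _ q] exI[of _ v2]) auto
  qed
  have t1: "g_type1 g" if Cr: "C < r"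
  proof -
    have "cmc_energy n H C q * cmc_energy n H C q' < 0" using eq' r Cr by (simp add: mult_neg_pos)
    then obtain v1 where v1: "q < v1" "v1 < q'" "cmc_energy n H C v1 = 0"
      using cmc_energy_zero_between[OF n0 q] by blast
    have gv1: "g t \<ge> v1" for t
    proof (rule ccontr)
      assume "\<not> g t \<ge> v1"
      then have "cmc_energy n H C (g t) < 0"
        using dec[of z "g t"] inc[of "g t" v1] z(1,2) z(4)[of t] v1 by (cases "g t \<le> q") auto
      then show False using D(9)[of t] by simp
    qed
    have p: "cmc_energy n H C x > 0" if "v1 < x" "x < v2" for x
    proof (cases "x \<le> q'")
      case True then show ?thesis using inc[of v1 x] that v1 by simp
    next
      case False then show ?thesis using dec'[of x v2] that v2 by simp
    qed
    \<comment> \<open>Restricting the motion to the compact interval makes the force Lipschitz on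
      its domain, as symmetry and periodicity require.\<close>
    have mm: "energy_motion {v1..v2} (cmc_energy n H C) (cmc_force n H) g g'"
      using m gv1 gv2 v1 q unfolding energy_motion_def by auto
    obtain K where K: "\<And>x y. v1 \<le> x \<Longrightarrow> v1 \<le> y \<Longrightarrow> \<bar>cmc_force n H x - cmc_force n H y\<bar> \<le> K * \<bar>x - y\<bar>"
      using cmc_force_lipschitz[OF _ n, of v1 H] v1 q by (metis less_trans)
    have K': "\<bar>cmc_force n H x - cmc_force n H y\<bar> \<le> K * \<bar>x - y\<bar>" if "x \<in> {v1..v2}" "y \<in> {v1..v2}" for x y
      using K that by simp
    have "v1 < v2" "cmc_force n H v1 \<noteq> 0" "cmc_force n H v2 \<noteq> 0"
      using v1 v2 pos[OF v1(1,2)] neg'[OF v2(1)] by auto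
    then show ?thesis using motion_periodic_type[OF mm K' refl _ v1(3) _ v2(2) _ p] by blast
  qed
  show ?thesis using \<open>C \<le> r\<close> t5 t1 eq' r(2) by auto
qed

text \<open>Outside the excluded interval the discriminant is positive, and the roots have product
  (1 - H^2)/(n-1). So a second critical point v > 0 exists exactly for |H| < 1; there its X stays
  below -H, which later gives \<lambda>^2 \<le> H^2 far out.\<close>

lemma cmc_root_props:
  assumes n: "n > 2" and H: "H \<notin> {- 2 * sqrt (real n - 1) / real n .. 1}"
  shows "H^2 * (real n)^2 - 4 * real n + 4 > 0" "cmc_root1 n H > 0" "cmc_root2 n H < cmc_root1 n H"
    "\<not> (- 1 < H \<and> H < 1) \<Longrightarrow> cmc_root2 n H \<le> 0"
    "- 1 < H \<and> H < 1 \<Longrightarrow> cmc_root2 n H > 0 \<and> cmc_root2 n H < - H"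
proof -
  define N where "N = real n - 1"
  have N: "N \<ge> 2" "real n = N + 1" unfolding N_def using n by auto
  define s where "s = sqrt (H^2 * (real n)^2 - 4 * real n + 4)"
  have big: "(H * real n)^2 > 4 * N"
  proof (cases "H > 1")
    case True
    have "H^2 > 1" using True by (simp add: one_less_power)
    then have "(H * real n)^2 \<ge> (real n)^2"
      using mult_right_mono[of 1 "H^2" "(real n)^2"] by (simp add: power_mult_distrib)
    moreover have "(real n)^2 - 4 * N = (N - 1)^2" unfolding N(2) by (simp add: algebra_simps power2_eq_square)
    moreover have "(N - 1)^2 > 0" using N(1) by simp
    ultimately show ?thesis by linarith
  next
    case False
    then have "H < - 2 * sqrt N / real n" using H unfolding N_def by auto
    then have "H * real n < - 2 * sqrt N / real n * real n" using n by (intro mult_strict_right_mono) auto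
    then have "- (H * real n) > 2 * sqrt N" using n by simp
    then have "(- (H * real n))^2 > (2 * sqrt N)^2" using N by (intro power_strict_mono) auto
    then show ?thesis using N by (simp add: power_mult_distrib)
  qed
  then show disc: "H^2 * (real n)^2 - 4 * real n + 4 > 0" unfolding N_def by (simp add: power_mult_distrib)
  then have s: "s > 0" "s^2 = H^2 * (real n)^2 - 4 * real n + 4" unfolding s_def by auto
  \<comment> \<open>Up to a negative factor this is the product of the roots; its sign decides on
    which side of \<open>s\<close> the term H (n-2) lies.\<close>
  have prod: "s^2 - (H * (real n - 2))^2 = 4 * N * (H^2 - 1)"
    unfolding s(2) N(2) by (simp add: algebra_simps power2_eq_square)
  have R1: "cmc_root1 n H = (s - H * (real n - 2)) / (2 * N)" and R2: "cmc_root2 n H = (- s - H * (real n - 2)) / (2 * N)"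
    unfolding cmc_root1_def cmc_root2_def s_def N_def by auto
  have n2: "real n - 2 > 0" using n by simp
  have nb: "- 2 * sqrt (real n - 1) / real n < 0" using n by (simp add: divide_neg_pos)
  show "cmc_root1 n H > 0"
  proof (cases "H > 0")
    case True
    then have "H > 1" using H nb by auto
    then have "H^2 > 1" by (simp add: one_less_power)
    then have "4 * N * (H^2 - 1) > 0" using N by simp
    then have "s^2 > (H * (real n - 2))^2" using prod by simp
    then have "s > H * (real n - 2)" using s(1) by (simp add: power2_less_imp_less)
    then show ?thesis unfolding R1 using N by simp
  next
    case False
    then have "H * (real n - 2) \<le> 0" using n2 by (simp add: mult_nonpos_nonneg)
    then show ?thesis unfolding R1 using s N by simp
  qed
  show "cmc_root2 n H < cmc_root1 n H" unfolding R1 R2 using s N by (simp add: divide_strict_right_mono)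
  show "cmc_root2 n H \<le> 0" if "\<not> (- 1 < H \<and> H < 1)"
  proof -
    have "\<bar>H\<bar> \<ge> 1" using that by auto
    then have "H^2 \<ge> 1" by (metis abs_ge_zero one_le_power power2_abs)
    then have "4 * N * (H^2 - 1) \<ge> 0" using N by simp
    then have "(H * (real n - 2))^2 \<le> s^2" using prod by simp
    then have "\<bar>H * (real n - 2)\<bar> \<le> s" using s(1) by (metis abs_le_square_iff abs_of_pos)
    then show ?thesis unfolding R2 using N by (simp add: divide_le_0_iff)
  qed
  show "cmc_root2 n H > 0 \<and> cmc_root2 n H < - H" if h: "- 1 < H \<and> H < 1"
  proof
    have Hn: "H < 0" using H h nb by auto
    have "H^2 < 1" using h by (simp add: abs_square_less_1 abs_less_iff)
    then have "4 * N * (H^2 - 1) < 0" using N by (simp add: mult_pos_neg)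
    then have "s^2 < (- (H * (real n - 2)))^2" using prod by simp
    moreover have "- (H * (real n - 2)) \<ge> 0" using Hn n2 by (simp add: mult_nonpos_nonneg)
    ultimately have "s < - (H * (real n - 2))" by (rule power2_less_imp_less)
    then show "cmc_root2 n H > 0" unfolding R2 using N by simp
    have "- H * (real n - 2) \<le> - H * (2 * N)" using Hn N by (intro mult_left_mono) auto
    then have "- s - H * (real n - 2) < - H * (2 * N)" using s(1) by simp
    then show "cmc_root2 n H < - H" unfolding R2 using N by (simp add: pos_divide_less_eq)
  qed
qed

lemma q_facts:
  assumes n: "n > 2"
  shows "cmc_root1 n H > 0 \<Longrightarrow> q1 n H > 0 \<and> inverse (q1 n H) ^ n = cmc_root1 n H \<and> cmc_energy n H C (q1 n H) = C - r1 n H"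
    and "cmc_root2 n H > 0 \<Longrightarrow> q2 n H > 0 \<and> inverse (q2 n H) ^ n = cmc_root2 n H \<and> cmc_energy n H C (q2 n H) = C - r2 n H"
proof -
  show "cmc_root1 n H > 0 \<Longrightarrow> q1 n H > 0 \<and> inverse (q1 n H) ^ n = cmc_root1 n H \<and> cmc_energy n H C (q1 n H) = C - r1 n H"
    using powr_root_facts[of "cmc_root1 n H" n "q1 n H"] n unfolding cmc_energy_def r1_def q1_def[folded cmc_root1_def]
    by (simp add: algebra_simps del: power_inverse)
  show "cmc_root2 n H > 0 \<Longrightarrow> q2 n H > 0 \<and> inverse (q2 n H) ^ n = cmc_root2 n H \<and> cmc_energy n H C (q2 n H) = C - r2 n H"
    using powr_root_facts[of "cmc_root2 n H" n "q2 n H"] n unfolding cmc_energy_def r2_def q2_def[folded cmc_root2_def]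
    by (simp add: algebra_simps del: power_inverse)
qed

lemma cmc_force_sign:
  assumes n: "n > 2" and H: "H \<notin> {- 2 * sqrt (real n - 1) / real n .. 1}" and v: "v > 0"
  shows "v < q1 n H \<Longrightarrow> cmc_force n H v < 0"
    and "q1 n H < v \<Longrightarrow> cmc_root2 n H < inverse v ^ n \<Longrightarrow> cmc_force n H v > 0"
    and "inverse v ^ n < cmc_root2 n H \<Longrightarrow> cmc_force n H v < 0"
proof -
  note R = cmc_root_props[OF n H]
  note Q = q_facts(1)[OF n R(2), THEN conjunct1] q_facts(1)[OF n R(2), THEN conjunct2, THEN conjunct1]
  have n0: "n > 0" using n by simp
  note F = cmc_force_factor[OF n less_imp_le[OF R(1)], of v]
  let ?X = "inverse v ^ n"
  define b where "b = (?X - cmc_root1 n H) * (?X - cmc_root2 n H)"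
  define c where "c = v * (real n - 1)"
  have "cmc_force n H v = - (c * b)"
    unfolding F b_def c_def by (simp add: algebra_simps del: power_inverse)
  moreover have "c > 0" unfolding c_def using v n by simp
  ultimately have "cmc_force n H v < 0 \<longleftrightarrow> b > 0" "cmc_force n H v > 0 \<longleftrightarrow> b < 0"
    by (simp_all add: zero_less_mult_iff mult_less_0_iff)
  note sgn = this[unfolded b_def]
  show "cmc_force n H v < 0" if "v < q1 n H"
    using inverse_power_strict_antimono[OF v that n0] R(3) unfolding sgn Q(2) by (intro mult_pos_pos) auto
  show "cmc_force n H v > 0" if "q1 n H < v" "cmc_root2 n H < ?X"
    using inverse_power_strict_antimono[OF Q(1) that(1) n0] that(2) unfolding sgn Q(2) by (intro mult_neg_pos) auto
  show "cmc_force n H v < 0" if "?X < cmc_root2 n H"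
    using that R(3) unfolding sgn by (intro mult_neg_neg) auto
qed

theorem cmc_motion_classification:
  assumes n: "n > 2" and m: "cmc_motion n H C g g'" and nc: "never_critical n H C g"
  shows "\<not> (- 1 < H \<and> H < - 2 * sqrt (real n - 1) / real n) \<Longrightarrow>
      C \<le> r1 n H \<and> (C = r1 n H \<longrightarrow> g_type2 g) \<and> (C < r1 n H \<longrightarrow> g_type3 g)"
    and "H = - 1 \<Longrightarrow> 0 < C"
    and "- 1 < H \<and> H < - 2 * sqrt (real n - 1) / real n \<Longrightarrow>
      r2 n H < C \<and> C \<le> r1 n H \<and> (C = r1 n H \<longrightarrow> g_type5 g) \<and> (C < r1 n H \<longrightarrow> g_type1 g)"
proof -
  have n0: "n > 0" using n by simp
  note H = cmc_motion_H_excluded[OF n m nc]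
  note R = cmc_root_props[OF n H]
  note Q1 = q_facts(1)[OF n R(2)]
  note S = cmc_force_sign[OF n H]
  have neg_b: "- 2 * sqrt (real n - 1) / real n < 0" using n by (simp add: divide_neg_pos)
  \<comment> \<open>With |H| \<ge> 1 the second root is not positive, and q1 is the only critical
    point.\<close>
  have A: "C \<le> r1 n H \<and> (C = r1 n H \<longrightarrow> g_type2 g) \<and> (C < r1 n H \<longrightarrow> g_type3 g) \<and> (\<exists>v>q1 n H. cmc_energy n H C v > 0)"
    if "\<not> (- 1 < H \<and> H < - 2 * sqrt (real n - 1) / real n)"
  proof -
    have "\<not> (- 1 < H \<and> H < 1)" using that H by auto
    then have R2: "cmc_root2 n H \<le> 0" using R(4) by blast
    show ?thesis
    proof (rule cmc_motion_single_well[OF n m nc])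
      show "cmc_force n H v > 0" if "q1 n H < v" for v
      proof (rule S(2)[OF _ that])
        show v: "0 < v" by (rule less_trans[OF Q1[THEN conjunct1] that])
        have "inverse v ^ n > 0" using v by simp
        then show "cmc_root2 n H < inverse v ^ n" using R2 by linarith
      qed
    qed (use Q1 S(1) in auto)
  qed
  then show "C \<le> r1 n H \<and> (C = r1 n H \<longrightarrow> g_type2 g) \<and> (C < r1 n H \<longrightarrow> g_type3 g)"
    if "\<not> (- 1 < H \<and> H < - 2 * sqrt (real n - 1) / real n)" using that by blast
  \<comment> \<open>At a point of positive energy beyond q1 the value of X is below
    \<open>cmc_root1\<close> = (n-2)/(n-1) < 1. Then \<lambda> = X - 1 lies in (-1,0), and C > v^2
    (1 - \<lambda>^2) is positive.\<close>
  show "0 < C" if H1: "H = - 1"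
  proof -
    obtain v where v: "v > q1 n H" "cmc_energy n H C v > 0" using A H1 by auto
    have q: "q1 n H > 0" "inverse (q1 n H) ^ n = cmc_root1 n H" using Q1 by auto
    have "sqrt (H^2 * (real n)^2 - 4 * real n + 4) = real n - 2"
      using n H1 by (intro real_sqrt_unique) (auto simp: power2_eq_square algebra_simps)
    note sq = this
    have "cmc_root1 n H = (real n - 2) / (real n - 1)" unfolding cmc_root1_def sq using H1 n by (simp add: field_simps)
    also have "\<dots> < 1" using n by (simp add: field_simps)
    finally have X: "inverse v ^ n < 1" using inverse_power_strict_antimono[OF q(1) v(1) n0] q(2) by linarith
    have X0: "inverse v ^ n > 0" using v(1) q(1) by (intro zero_less_power) auto
    have "C > v^2 * (1 - (- 1 + inverse v ^ n)^2)" using v(2) unfolding cmc_energy_def H1 by (simp add: algebra_simps)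
    moreover have "(- 1 + inverse v ^ n)^2 \<le> 1" using X X0 by (simp add: abs_square_le_1 abs_le_iff)
    then have "v^2 * (1 - (- 1 + inverse v ^ n)^2) \<ge> 0" by simp
    ultimately show ?thesis by linarith
  qed
  show "r2 n H < C \<and> C \<le> r1 n H \<and> (C = r1 n H \<longrightarrow> g_type5 g) \<and> (C < r1 n H \<longrightarrow> g_type1 g)"
    if h: "- 1 < H \<and> H < - 2 * sqrt (real n - 1) / real n"
  proof -
    have h1: "- 1 < H \<and> H < 1" using h neg_b by linarith
    have R2: "cmc_root2 n H > 0" "cmc_root2 n H < - H" using R(5)[OF h1] by auto
    have Q1': "q1 n H > 0" "inverse (q1 n H) ^ n = cmc_root1 n H" "\<And>C. cmc_energy n H C (q1 n H) = C - r1 n H"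
      using q_facts(1)[OF n R(2)] by blast+
    have Q2: "q2 n H > 0" "inverse (q2 n H) ^ n = cmc_root2 n H" "\<And>C. cmc_energy n H C (q2 n H) = C - r2 n H"
      using q_facts(2)[OF n R2(1)] by blast+
    have q12: "q1 n H < q2 n H"
    proof (rule ccontr)
      assume "\<not> ?thesis"
      then have "inverse (q1 n H) ^ n \<le> inverse (q2 n H) ^ n" using Q2(1) by (intro power_mono) auto
      then show False unfolding Q1'(2) Q2(2) using R(3) by linarith
    qed
    have Xq2: "v < q2 n H \<longleftrightarrow> inverse v ^ n > cmc_root2 n H" "q2 n H < v \<longleftrightarrow> inverse v ^ n < cmc_root2 n H" if "v > 0" for v
      using inverse_power_strict_antimono[of v "q2 n H" n] inverse_power_strict_antimono[of "q2 n H" v n] Q2(1,2) n0 that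
      by (cases v "q2 n H" rule: linorder_cases; simp del: power_inverse)+
    have "\<exists>v>q2 n H. cmc_energy n H C v < 0"
    proof -
      have H2: "1 - H^2 > 0" using h1 by (simp add: abs_square_less_1 abs_less_iff)
      \<comment> \<open>Beyond q2 one has \<lambda>^2 \<le> H^2 < 1, so the energy is at most C -
        v^2 (1 - H^2). The third summand makes this negative, the first ensures v \<le> v^2, the
        second places \<open>v\<close> beyond q2.\<close>
      define v where "v = 1 + q2 n H + \<bar>C\<bar> / (1 - H^2)"
      have v: "v > q2 n H" "v > 1" "v > \<bar>C\<bar> / (1 - H^2)" unfolding v_def using Q2(1) H2
        by (auto simp: add_pos_nonneg add_nonneg_pos)
      have X: "0 < inverse v ^ n" "inverse v ^ n < - H" using Xq2(2)[of v] v R2 by auto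
      have "(H + inverse v ^ n)^2 \<le> H^2" using X by (simp add: abs_le_square_iff[symmetric])
      then have "v^2 * (H + inverse v ^ n)^2 \<le> v^2 * H^2" by (rule mult_left_mono) simp
      moreover have "\<bar>C\<bar> < v * (1 - H^2)" using v(3) H2 by (simp add: pos_divide_less_eq)
      moreover have "v * (1 - H^2) \<le> v^2 * (1 - H^2)" using v(2) H2 by (intro mult_right_mono) (auto simp: power2_eq_square)
      ultimately have "cmc_energy n H C v < 0" unfolding cmc_energy_def by (simp add: algebra_simps)
      then show ?thesis using v(1) by blast
    qed
    moreover have "cmc_force n H v > 0" if "q1 n H < v" "v < q2 n H" for v
    proof -
      have "v > 0" using Q1'(1) that(1) by linarith
      then show ?thesis using S(2)[of v] Xq2(1) that by blast
    qed
    moreover have "cmc_force n H v < 0" if "q2 n H < v" for v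
    proof -
      have "v > 0" using Q2(1) that(1) by linarith
      then show ?thesis using S(3)[of v] Xq2(2) that by blast
    qed
    ultimately show ?thesis
      using cmc_motion_double_well[OF n m nc Q1'(1) q12 Q1'(3) Q2(3) S(1)] by blast
  qed
qed

section \<open>Submanifolds of codimension two\<close>

text \<open>Joins nearby points by paths in \<open>M\<close> of bounded speed, so that differential
  equations known along curves yield statements on relative neighbourhoods. The parameter interval
  exceeds [0,1] a little in order that two-sided derivatives exist at both end points.\<close>

lemma codim2_local_paths:
  fixes M :: "(real, 'm::finite) vec set"
  assumes "codim2_submanifold M" and p: "p \<in> M"
  obtains W where "open W" "p \<in> W"
    "\<And>x. x \<in> M \<inter> W \<Longrightarrow> \<exists>c c' \<delta> K. \<delta> > 0 \<and> c 0 = p \<and> c 1 = x \<and>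
       (\<forall>t\<in>{-\<delta><..<1+\<delta>}. c t \<in> M \<and> (c has_vector_derivative c' t) (at t) \<and> norm (c' t) \<le> K)"
proof -
  obtain W and F :: "(real, 'm) vec \<Rightarrow> real^2" where W: "open W" "p \<in> W" "Cinf_on W F" "M \<inter> W = {x\<in>W. F x = 0}"
    and srj: "\<forall>x\<in>W. surj (frechet_derivative F (at x))"
    using assms(1)[unfolded codim2_submanifold_def, rule_format, OF p] by (elim exE conjE)
  define D where "D x = frechet_derivative F (at x)" for x
  have dF: "(F has_derivative D x) (at x)" if "x \<in> W" for x
    unfolding D_def by (rule Cinf_on_has_derivative[OF W(3) that])
  have linD: "linear (D x)" if "x \<in> W" for x using dF[OF that] has_derivative_linear by blast
  obtain R where R: "linear R" "D p \<circ> R = id"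
    using linear_surjective_right_inverse[OF linD[OF W(2)]] srj[rule_format, OF W(2)] unfolding D_def by blast
  have DR: "D p (R y) = y" for y using R(2) by (metis comp_apply id_apply)
  have bR: "bounded_linear R" using R(1) linear_conv_bounded_linear by blast
  have bD: "bounded_linear (D x)" if "x \<in> W" for x using dF[OF that] has_derivative_bounded_linear by blast
  \<comment> \<open>A straightening map: \<open>D p (f x) = F x\<close> and its derivative at
    \<open>p\<close> is the identity. In its coordinates \<open>M\<close> is the linear space on
    which \<open>D p\<close> vanishes, hence line segments lie in it.\<close>
  define f where "f x = x - R (D p x) + R (F x)" for x
  define f' where "f' x = Blinfun (\<lambda>u. u - R (D p u) + R (D x u))" for x
  have f'_apply: "blinfun_apply (f' x) u = u - R (D p u) + R (D x u)" if "x \<in> W" for x u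
    unfolding f'_def
    using bounded_linear_Blinfun_apply[OF bounded_linear_add[OF bounded_linear_sub[OF bounded_linear_ident
      bounded_linear_compose[OF bR bD[OF W(2)]]] bounded_linear_compose[OF bR bD[OF that]]]] by simp
  have df: "(f has_derivative blinfun_apply (f' x)) (at x)" if x: "x \<in> W" for x
  proof -
    have "((\<lambda>x. x - R (D p x) + R (F x)) has_derivative (\<lambda>u. u - R (D p u) + R (D x u))) (at x)"
      by (rule has_derivative_add[OF has_derivative_diff[OF has_derivative_ident bounded_linear.has_derivative[OF bR
          bounded_linear_imp_has_derivative[OF bD[OF W(2)]]]] bounded_linear.has_derivative[OF bR dF[OF x]]])
    moreover have "blinfun_apply (f' x) = (\<lambda>u. u - R (D p u) + R (D x u))" using f'_apply[OF x] by blast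
    ultimately show ?thesis unfolding f_def[abs_def] by simp
  qed
  have cf': "continuous_on W f'"
  proof (rule continuous_on_blinfun_componentwise)
    fix i :: "(real, 'm) vec" assume "i \<in> Basis"
    have "continuous_on W (\<lambda>x. i - R (D p i) + R (D x i))"
    proof (intro continuous_intros bounded_linear.continuous_on[OF bR])
      show "continuous_on W (\<lambda>x. D x i)" unfolding D_def
        by (intro continuous_at_imp_continuous_on ballI
            has_derivative_continuous[OF Cinf_on_has_derivative[OF Cinf_on_frechet[OF W(3)]]])
    qed
    then show "continuous_on W (\<lambda>x. blinfun_apply (f' x) i)"
      using f'_apply by (subst continuous_on_cong[OF refl]) auto
  qed
  have f'p: "f' p = id_blinfun" by (rule blinfun_eqI) (simp add: f'_apply W(2))
  have "id_blinfun o\<^sub>L f' p = id_blinfun" unfolding f'p by (rule blinfun_eqI) simp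
  from inverse_function_theorem[OF W(1) df cf' W(2) this]
  obtain U' V g g' where U: "open U'" "U' \<subseteq> W" "p \<in> U'" "open V" "f p \<in> V" "homeomorphism U' V f g"
    and g': "\<And>y. y \<in> V \<Longrightarrow> (g has_derivative (g' y)) (at y)"
      "\<And>y. y \<in> V \<Longrightarrow> g' y = inv (blinfun_apply (f' (g y)))"
      "\<And>y. y \<in> V \<Longrightarrow> bij (blinfun_apply (f' (g y)))"
    by metis
  have gf: "g (f x) = x" "f x \<in> V" if "x \<in> U'" for x using U(6) that unfolding homeomorphism_def by auto
  have fg: "f (g y) = y" "g y \<in> U'" if "y \<in> V" for y using U(6) that unfolding homeomorphism_def by auto
  have cg: "continuous_on V g" and cfU: "continuous_on U' f" using U(6) unfolding homeomorphism_def by auto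
  \<comment> \<open>Keeping \<open>f'\<close> within 1/2 of the identity bounds the velocities of
    pulled-back segments by twice the length of the segment.\<close>
  have "isCont f' p" using cf' W(2) continuous_on_eq_continuous_at[OF W(1), of f'] by simp
  then obtain r where r: "r > 0" "\<And>x. dist x p < r \<Longrightarrow> dist (f' x) (f' p) < 1/2"
    unfolding continuous_at_eps_delta using half_gt_zero[OF zero_less_one] by blast
  define V' where "V' = V \<inter> g -` ball p r"
  have "open V'" unfolding V'_def by (rule continuous_open_preimage[OF cg U(4)]) simp
  moreover have "f p \<in> V'" unfolding V'_def using U(5) gf[OF U(3)] r(1) by simp
  ultimately obtain s where s: "s > 0" "ball (f p) s \<subseteq> V'" using open_contains_ball by blast
  define W' where "W' = U' \<inter> f -` ball (f p) s"
  have oW': "open W'" unfolding W'_def by (rule continuous_open_preimage[OF cfU U(1)]) simp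
  have pW': "p \<in> W'" unfolding W'_def using U(3) s(1) by simp
  have Df: "D p (f x) = F x" for x unfolding f_def
    using linD[OF W(2)] by (simp add: linear_add linear_diff DR)
  show thesis
  proof (rule that[OF oW' pW'])
    fix x assume x: "x \<in> M \<inter> W'"
    then have xU: "x \<in> U'" and fx: "dist (f p) (f x) < s" unfolding W'_def by auto
    define \<xi> where "\<xi> = f x - f p"
    have nxi: "norm \<xi> < s" using fx unfolding \<xi>_def by (simp add: dist_norm norm_minus_commute)
    \<comment> \<open>Small enough that the segment prolonged by \<open>\<delta>\<close> at either
      end stays in the ball of radius \<open>s\<close>.\<close>
    define \<delta> where "\<delta> = (s - norm \<xi>) / (norm \<xi> + 1)"
    have npos: "norm \<xi> + 1 > 0" using norm_ge_zero[of \<xi>] by linarith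
    have d: "\<delta> > 0" unfolding \<delta>_def using nxi npos by simp
    define y where "y t = f p + t *\<^sub>R \<xi>" for t :: real
    have yV: "y t \<in> V'" if ht: "t \<in> {-\<delta><..<1+\<delta>}" for t
    proof -
      have "\<delta> * norm \<xi> \<le> s - norm \<xi>" unfolding \<delta>_def using nxi npos
        by (simp add: divide_le_eq mult_left_mono)
      moreover have "\<bar>t\<bar> * norm \<xi> \<le> (1 + \<delta>) * norm \<xi>" using ht d by (intro mult_right_mono) auto
      moreover have "\<bar>t\<bar> * norm \<xi> < (1 + \<delta>) * norm \<xi>" if "norm \<xi> > 0"
        using that ht d by (intro mult_strict_right_mono) auto
      ultimately have "\<bar>t\<bar> * norm \<xi> < s"
        using s(1) by (cases "norm \<xi> > 0") (simp_all add: algebra_simps)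
      then have "y t \<in> ball (f p) s" unfolding y_def by (simp add: dist_norm)
      then show ?thesis using s(2) by blast
    qed
    define c where "c t = g (y t)" for t
    define c' where "c' t = g' (y t) \<xi>" for t
    have c01: "c 0 = p" "c 1 = x" unfolding c_def y_def \<xi>_def using gf U(3) xU by auto
    have F0: "F p = 0" "F x = 0" using W(4) p x W(2) xU U(2) by auto
    have path: "c t \<in> M \<and> (c has_vector_derivative c' t) (at t) \<and> norm (c' t) \<le> 2 * norm \<xi>" if t: "t \<in> {-\<delta><..<1+\<delta>}" for t
    proof -
      have V: "y t \<in> V" "dist (g (y t)) p < r" using yV[OF t] unfolding V'_def by (auto simp: dist_commute)
      have cU: "c t \<in> W" using fg(2)[OF V(1)] U(2) unfolding c_def by auto
      \<comment> \<open>Both end points of the segment have \<open>D p\<close>-value 0, so by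
        linearity the whole line has, which means that its preimage lies on
        \<open>M\<close>.\<close>
      have "F (c t) = D p (y t)" using Df[of "c t"] fg(1)[OF V(1)] unfolding c_def by simp
      also have "\<dots> = D p (f p) + t *\<^sub>R (D p (f x) - D p (f p))"
        unfolding y_def \<xi>_def using linD[OF W(2)] by (simp add: linear_add linear_cmul linear_diff)
      also have "\<dots> = 0" unfolding Df F0 by simp
      finally have "c t \<in> M" using W(4) cU by auto
      have "(y has_derivative (\<lambda>s. s *\<^sub>R \<xi>)) (at t)" unfolding y_def by (auto intro!: derivative_eq_intros)
      from has_derivative_compose[OF this g'(1)[OF V(1)]]
      have "(c has_derivative (\<lambda>s. g' (y t) (s *\<^sub>R \<xi>))) (at t)" unfolding c_def .
      moreover have "g' (y t) (s *\<^sub>R \<xi>) = s *\<^sub>R c' t" for s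
        unfolding c'_def using g'(1)[OF V(1)] has_derivative_linear linear_cmul by blast
      ultimately have dc: "(c has_vector_derivative c' t) (at t)" unfolding has_vector_derivative_def by simp
      have "blinfun_apply (f' (c t)) (c' t) = \<xi>"
        unfolding c'_def c_def g'(2)[OF V(1)] using g'(3)[OF V(1)] by (simp add: bij_is_surj surj_f_inv_f)
      then have "c' t = \<xi> + blinfun_apply (f' p - f' (c t)) (c' t)"
        by (simp add: blinfun.diff_left f'p)
      also have "norm \<dots> \<le> norm \<xi> + norm (f' p - f' (c t)) * norm (c' t)"
        by (rule order_trans[OF norm_triangle_ineq]) (simp add: norm_blinfun)
      also have "norm (f' p - f' (c t)) * norm (c' t) \<le> 1/2 * norm (c' t)"
        using r(2)[OF V(2)] unfolding c_def by (intro mult_right_mono) (auto simp: dist_norm norm_minus_commute)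
      finally have "norm (c' t) \<le> 2 * norm \<xi>" by simp
      then show ?thesis using \<open>c t \<in> M\<close> dc by blast
    qed
    then show "\<exists>c c' \<delta> K. \<delta> > 0 \<and> c 0 = p \<and> c 1 = x \<and>
       (\<forall>t\<in>{-\<delta><..<1+\<delta>}. c t \<in> M \<and> (c has_vector_derivative c' t) (at t) \<and> norm (c' t) \<le> K)"
      using d c01 by blast
  qed
qed

lemma tangent_space_of_curve:
  assumes "open S" "t \<in> S" "\<And>s. s \<in> S \<Longrightarrow> c s \<in> M" "(c has_vector_derivative v) (at t)"
  shows "v \<in> tangent_space M (c t)"
proof -
  obtain e where e: "e > 0" "ball t e \<subseteq> S" using assms(1,2) open_contains_ball by blast
  have "((\<lambda>s. t + s) has_vector_derivative 1) (at 0)" by (auto intro!: derivative_eq_intros)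
  from vector_diff_chain_at[OF this, of c v] assms(4)
  have "((\<lambda>s. c (t + s)) has_vector_derivative v) (at 0)" by (simp add: o_def)
  moreover have "c (t + s) \<in> M" if "s \<in> {-e<..<e}" for s
    using that e(2) assms(3)[of "t + s"] by (auto simp: subset_iff dist_real_def)
  ultimately show ?thesis unfolding tangent_space_def using e(1)
    by (intro CollectI exI[of _ "\<lambda>s. c (t + s)"] exI[of _ e]) auto
qed

lemma extension_derivative_along_curve:
  assumes "open W" "c t \<in> W" "\<And>x. x \<in> M \<inter> W \<Longrightarrow> F x = f x" "(F has_derivative D) (at (c t))"
    and "open S" "t \<in> S" "\<And>s. s \<in> S \<Longrightarrow> c s \<in> M" "(c has_vector_derivative v) (at t)"
  shows "((\<lambda>s. f (c s)) has_vector_derivative D v) (at t)"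
proof -
  have "((F \<circ> c) has_derivative (D \<circ> (\<lambda>x. x *\<^sub>R v))) (at t)"
    using diff_chain_at[of c "\<lambda>x. x *\<^sub>R v" t F D] assms(4,8) unfolding has_vector_derivative_def by blast
  moreover have "D (x *\<^sub>R v) = x *\<^sub>R D v" for x
    using assms(4) has_derivative_linear linear_cmul by blast
  ultimately have "((\<lambda>s. F (c s)) has_vector_derivative D v) (at t)"
    unfolding has_vector_derivative_def by (simp add: o_def)
  then have dF: "((\<lambda>s. F (c s)) has_vector_derivative D v) (at t)" .
  have "isCont c t" using assms(8) has_vector_derivative_continuous by blast
  then have "\<exists>S'. open S' \<and> t \<in> S' \<and> (\<forall>s\<in>S'. c s \<in> W)"
    using assms(1,2) continuous_at_open[of t c] by simp
  then obtain S' where S': "open S'" "t \<in> S'" "\<And>s. s \<in> S' \<Longrightarrow> c s \<in> W" by auto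
  show ?thesis
  proof (rule has_vector_derivative_transform_within_open[OF dF, of "S \<inter> S'"])
    show "F (c s) = f (c s)" if "s \<in> S \<inter> S'" for s using assms(3)[of "c s"] assms(7)[of s] S'(3)[of s] that by simp
  qed (use assms(5,6) S' in auto)
qed

section \<open>Pseudo-Euclidean inner products\<close>

lemma bounded_bilinear_pinner: "bounded_bilinear (pinner j)"
proof -
  have "bilinear (pinner j :: (real, 'm::{finite,linorder}) vec \<Rightarrow> _)"
    unfolding bilinear_def pinner_def
    by (auto intro!: linearI simp: algebra_simps sum.distrib sum_distrib_left)
  then show ?thesis by (simp add: bilinear_conv_bounded_bilinear)
qed

lemma pinner_commute: "pinner j u v = pinner j v u"
  unfolding pinner_def by (simp add: mult.commute)

lemmas pinner_simps =
  bounded_bilinear.add_left[OF bounded_bilinear_pinner] bounded_bilinear.add_right[OF bounded_bilinear_pinner]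
  bounded_bilinear.diff_left[OF bounded_bilinear_pinner] bounded_bilinear.diff_right[OF bounded_bilinear_pinner]
  bounded_bilinear.minus_left[OF bounded_bilinear_pinner] bounded_bilinear.minus_right[OF bounded_bilinear_pinner]
  bounded_bilinear.scaleR_left[OF bounded_bilinear_pinner] bounded_bilinear.scaleR_right[OF bounded_bilinear_pinner]
  bounded_bilinear.zero_left[OF bounded_bilinear_pinner] bounded_bilinear.zero_right[OF bounded_bilinear_pinner]

lemmas pinner_sum_left = bounded_bilinear.sum_left[OF bounded_bilinear_pinner]

lemma pinner_has_vector_derivative:
  assumes "(f has_vector_derivative f') (at t within s)" "(g has_vector_derivative g') (at t within s)"
  shows "((\<lambda>t. pinner j (f t) (g t)) has_vector_derivative (pinner j (f t) g' + pinner j f' (g t))) (at t within s)"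
  using bounded_bilinear.has_vector_derivative[OF bounded_bilinear_pinner assms] .

text \<open>Self-products are 1 or -1, so they are their own inverses and the family is linearly
  independent; by its cardinality it is a basis.\<close>

lemma pseudo_orthonormal_expansion:
  fixes f :: "nat \<Rightarrow> (real, 'm::{finite,linorder}) vec"
  assumes orth: "\<And>i i'. i < CARD('m) \<Longrightarrow> i' < CARD('m) \<Longrightarrow> \<bar>pinner j (f i) (f i')\<bar> = (if i = i' then 1 else 0)"
  shows "v = (\<Sum>i<CARD('m). (pinner j v (f i) * pinner j (f i) (f i)) *\<^sub>R f i)"
proof -
  let ?N = "CARD('m)"
  have pick: "pinner j (\<Sum>i<?N. c i *\<^sub>R f i) (f i') = c i' * pinner j (f i') (f i')" if "i' < ?N" for c i'
  proof -
    have "pinner j (\<Sum>i<?N. c i *\<^sub>R f i) (f i') = (\<Sum>i<?N. c i * pinner j (f i) (f i'))"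
      by (simp add: pinner_sum_left pinner_simps)
    also have "\<dots> = (\<Sum>i<?N. if i = i' then c i' * pinner j (f i') (f i') else 0)"
      by (intro sum.cong refl) (use orth that in force)
    finally show ?thesis using that by simp
  qed
  have sq: "pinner j (f i) (f i) * pinner j (f i) (f i) = 1" if "i < ?N" for i
    using orth[OF that that] by (metis abs_mult_self_eq mult_1)
  have inj: "inj_on f {..<?N}"
  proof (rule inj_onI)
    fix x y assume xy: "x \<in> {..<?N}" "y \<in> {..<?N}" "f x = f y"
    show "x = y" using orth[of x y] orth[of x x] xy by (auto split: if_splits)
  qed
  have "independent (f ` {..<?N})"
  proof (rule independent_if_scalars_zero)
    fix h x assume h: "(\<Sum>x\<in>f ` {..<?N}. h x *\<^sub>R x) = 0" and x: "x \<in> f ` {..<?N}"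
    obtain i where i: "i < ?N" "x = f i" using x by auto
    have "(\<Sum>i<?N. h (f i) *\<^sub>R f i) = 0" using h sum.reindex[OF inj, of "\<lambda>x. h x *\<^sub>R x"] by simp
    then have "h (f i) * pinner j (f i) (f i) = 0" using pick[OF i(1), of "\<lambda>i. h (f i)"] by (simp add: pinner_simps)
    then show "h x = 0" using orth[OF i(1) i(1)] i(2) by auto
  qed simp
  moreover have "card (f ` {..<?N}) = ?N" using card_image[OF inj] by simp
  ultimately have "UNIV \<subseteq> span (f ` {..<?N})"
    by (intro card_ge_dim_independent) auto
  then have "v \<in> span (f ` {..<?N})" by blast
  then obtain h where h: "v = (\<Sum>x\<in>f ` {..<?N}. h x *\<^sub>R x)" using span_finite[of "f ` {..<?N}"] by auto
  then have v: "v = (\<Sum>i<?N. h (f i) *\<^sub>R f i)" using sum.reindex[OF inj, of "\<lambda>x. h x *\<^sub>R x"] by simp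
  have "h (f i) = pinner j v (f i) * pinner j (f i) (f i)" if "i < ?N" for i
    using pick[OF that, of "\<lambda>i. h (f i)"] v sq[OF that] by (simp add: mult.assoc)
  then have "(\<Sum>i<?N. h (f i) *\<^sub>R f i) = (\<Sum>i<?N. (pinner j v (f i) * pinner j (f i) (f i)) *\<^sub>R f i)"
    by (intro sum.cong) auto
  then show ?thesis using v by simp
qed

text \<open>The operator field is known to be differentiable only when applied to fixed vectors.
  Expanding \<open>V x\<close> in the standard basis reduces the claim to finitely many
  products.\<close>

lemma has_derivative_linear_apply:
  fixes L :: "'a::real_normed_vector \<Rightarrow> (real, 'm::finite) vec \<Rightarrow> 'b::real_normed_vector"
  assumes W: "open W" "p \<in> W" and lin: "\<And>x. x \<in> W \<Longrightarrow> linear (L x)"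
    and dL: "\<And>v. ((\<lambda>x. L x v) has_derivative (\<lambda>u. L' u v)) (at p)" and linL': "\<And>u. linear (L' u)"
    and dV: "(V has_derivative V') (at p)"
  shows "((\<lambda>x. L x (V x)) has_derivative (\<lambda>u. L' u (V p) + L p (V' u))) (at p)"
proof -
  have ex: "(\<Sum>i\<in>UNIV. v $ i *\<^sub>R K (axis i 1)) = K v" if "linear K" for v and K :: "(real, 'm) vec \<Rightarrow> 'b"
  proof -
    have "v = (\<Sum>i\<in>UNIV. v $ i *\<^sub>R axis i 1)" by (simp add: basis_expansion scalar_mult_eq_scaleR[symmetric])
    then have "K v = K (\<Sum>i\<in>UNIV. v $ i *\<^sub>R axis i 1)" by simp
    also have "\<dots> = (\<Sum>i\<in>UNIV. v $ i *\<^sub>R K (axis i 1))" using that by (simp add: linear_sum linear_cmul)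
    finally show ?thesis by simp
  qed
  have dVi: "((\<lambda>x. V x $ i) has_derivative (\<lambda>u. V' u $ i)) (at p)" for i
    using bounded_linear.has_derivative[OF bounded_linear_vec_nth dV] .
  have "((\<lambda>x. \<Sum>i\<in>UNIV. V x $ i *\<^sub>R L x (axis i 1)) has_derivative
      (\<lambda>u. \<Sum>i\<in>UNIV. V p $ i *\<^sub>R L' u (axis i 1) + V' u $ i *\<^sub>R L p (axis i 1))) (at p)"
    by (intro has_derivative_sum has_derivative_scaleR dVi dL)
  moreover have "(\<lambda>u. \<Sum>i\<in>UNIV. V p $ i *\<^sub>R L' u (axis i 1) + V' u $ i *\<^sub>R L p (axis i 1)) = (\<lambda>u. L' u (V p) + L p (V' u))"
    by (simp add: sum.distrib ex lin[OF W(2)] linL')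
  ultimately have "((\<lambda>x. \<Sum>i\<in>UNIV. V x $ i *\<^sub>R L x (axis i 1)) has_derivative (\<lambda>u. L' u (V p) + L p (V' u))) (at p)" by simp
  then show ?thesis
    by (rule has_derivative_transform_within_open[OF _ W]) (simp add: ex lin)
qed

section \<open>Hypersurfaces with two principal curvatures\<close>

locale cmc_hypersurface =
  fixes n k :: nat and a b d H :: real and M :: "(real, 'm::{finite,linorder}) vec set"
    and \<nu> en :: "(real, 'm) vec \<Rightarrow> (real, 'm) vec" and lam mu :: "(real, 'm) vec \<Rightarrow> real"
  assumes card_index: "CARD('m) = n + 2" and n_gt: "n > 2" and a_sign: "a = 1 \<or> a = -1"
    and hyps: "thm_hyps k a M \<nu> en lam mu b d H"
begin

abbreviation ip :: "(real, 'm) vec \<Rightarrow> (real, 'm) vec \<Rightarrow> real" where "ip \<equiv> pinner (sf_index k a)"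

lemma aa [simp]: "a * a = 1" "a * (a * x) = x"
  using a_sign by auto

lemma d_eq: "d = a" and b_eq: "b = - a"
  using hyps a_sign unfolding thm_hyps_def by auto

lemma two_pc: "two_pc_hypersurface k a M \<nu> en lam mu b d"
  using hyps unfolding thm_hyps_def by blast

lemma submanifold: "codim2_submanifold M"
  using two_pc unfolding two_pc_hypersurface_def Let_def by blast

lemma smooth: "Cinf_fun_on M \<nu>" "Cinf_fun_on M en" "Cinf_fun_on M lam" "Cinf_fun_on M mu"
  using two_pc unfolding two_pc_hypersurface_def Let_def by blast+

lemma ip_self: assumes "p \<in> M" shows "ip p p = a"
proof -
  have "p \<in> SF k a" using two_pc assms unfolding two_pc_hypersurface_def Let_def by blast
  then show ?thesis using a_sign unfolding SF_def sf_index_def by auto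
qed

lemma ip_normal:
  assumes "p \<in> M" shows "ip (\<nu> p) (\<nu> p) = - a" "ip (\<nu> p) p = 0" "v \<in> tangent_space M p \<Longrightarrow> ip (\<nu> p) v = 0"
proof -
  have "\<forall>p\<in>M. ip (\<nu> p) (\<nu> p) = b \<and> ip (\<nu> p) p = 0 \<and> (\<forall>v\<in>tangent_space M p. ip (\<nu> p) v = 0)"
    using two_pc unfolding two_pc_hypersurface_def Let_def by blast
  then show "ip (\<nu> p) (\<nu> p) = - a" "ip (\<nu> p) p = 0" "v \<in> tangent_space M p \<Longrightarrow> ip (\<nu> p) v = 0"
    using assms b_eq by auto
qed

lemma en_tangent: assumes "p \<in> M" shows "en p \<in> tangent_space M p" "ip (en p) (en p) = a"
proof -
  have "\<forall>p\<in>M. en p \<in> tangent_space M p \<and> ip (en p) (en p) = d"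
    using two_pc unfolding two_pc_hypersurface_def Let_def by blast
  then show "en p \<in> tangent_space M p" "ip (en p) (en p) = a" using assms d_eq by auto
qed

lemma lam_gt: "p \<in> M \<Longrightarrow> lam p > mu p"
  and mu_eq: "p \<in> M \<Longrightarrow> mu p = real n * H - (real n - 1) * lam p"
proof -
  assume p: "p \<in> M"
  show "lam p > mu p" using hyps p unfolding thm_hyps_def by blast
  have "(real (CARD('m) - 2) - 1) * lam p + mu p = real (CARD('m) - 2) * H"
    using hyps p unfolding thm_hyps_def by blast
  then show "mu p = real n * H - (real n - 1) * lam p" using card_index by simp
qed

lemma lam_minus_mu: assumes "p \<in> M" shows "lam p - mu p = real n * (lam p - H)" "lam p > H"
proof -
  show e: "lam p - mu p = real n * (lam p - H)" using mu_eq[OF assms] by (simp add: algebra_simps)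
  have "real n * (lam p - H) > 0" using lam_gt[OF assms] e by simp
  then show "lam p > H" using n_gt by (simp add: zero_less_mult_iff)
qed

text \<open>A linear description of the tangent space. The velocities in
  \<open>tangent_space\<close> do not visibly form a vector space, but they lie in
  \<open>T p\<close> and, by the frame, span it.\<close>

definition T :: "(real, 'm) vec \<Rightarrow> (real, 'm) vec set" where
  "T p = {v. ip v p = 0 \<and> ip v (\<nu> p) = 0}"

lemma tangent_in_T: assumes "p \<in> M" "v \<in> tangent_space M p" shows "v \<in> T p"
proof -
  obtain c e where c: "0 < e" "\<And>t. t \<in> {-e<..<e} \<Longrightarrow> c t \<in> M" "c 0 = p" "(c has_vector_derivative v) (at 0)"
    using assms(2) unfolding tangent_space_def by blast
  have "((\<lambda>t. ip (c t) (c t)) has_vector_derivative (ip (c 0) v + ip v (c 0))) (at 0)"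
    by (rule pinner_has_vector_derivative[OF c(4) c(4)])
  then have "((\<lambda>t. a) has_vector_derivative (ip (c 0) v + ip v (c 0))) (at 0)"
    by (rule has_vector_derivative_transform_within_open[where S="{-e<..<e}"]) (use c ip_self in auto)
  then have "ip (c 0) v + ip v (c 0) = 0"
    using vector_derivative_unique_at[OF _ has_vector_derivative_const] by blast
  then have "ip v p = 0" using c(3) pinner_commute[of _ p v] by simp
  then show ?thesis unfolding T_def using ip_normal(3)[OF assms] pinner_commute[of _ v] by simp
qed

lemma frame:
  assumes p: "p \<in> M"
  obtains e where "\<And>i. i < n \<Longrightarrow> e i \<in> tangent_space M p" "e (n - 1) = en p"
    "\<And>i i'. i < n \<Longrightarrow> i' < n \<Longrightarrow> \<bar>ip (e i) (e i')\<bar> = (if i = i' then 1 else 0)"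
    "\<And>i. i < n - 1 \<Longrightarrow> Mderiv M \<nu> p (e i) = - lam p *\<^sub>R e i" "Mderiv M \<nu> p (en p) = - mu p *\<^sub>R en p"
    "\<And>v. v = (\<Sum>i<n. (ip v (e i) * ip (e i) (e i)) *\<^sub>R e i) + (a * ip v p) *\<^sub>R p - (a * ip v (\<nu> p)) *\<^sub>R \<nu> p"
proof -
  have "\<exists>e. (\<forall>i<n. e i \<in> tangent_space M p) \<and>
          (\<forall>i<n. \<forall>i'<n. \<bar>ip (e i) (e i')\<bar> = (if i = i' then 1 else 0)) \<and>
          e (n - 1) = en p \<and>
          (\<forall>i<n - 1. shape_op M \<nu> p (e i) = lam p *\<^sub>R e i) \<and>
          shape_op M \<nu> p (en p) = mu p *\<^sub>R en p"
    using two_pc p card_index unfolding two_pc_hypersurface_def Let_def by simp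
  then obtain e where e: "\<And>i. i < n \<Longrightarrow> e i \<in> tangent_space M p"
          "\<And>i i'. i < n \<Longrightarrow> i' < n \<Longrightarrow> \<bar>ip (e i) (e i')\<bar> = (if i = i' then 1 else 0)"
          "e (n - 1) = en p"
          "\<And>i. i < n - 1 \<Longrightarrow> shape_op M \<nu> p (e i) = lam p *\<^sub>R e i"
          "shape_op M \<nu> p (en p) = mu p *\<^sub>R en p" by blast
  \<comment> \<open>The tangent frame completed by \<open>p\<close> and its normal, with
    self-products a and -a, is a pseudo-orthonormal basis of the ambient space.\<close>
  define f where "f i = (if i < n then e i else if i = n then p else \<nu> p)" for i
  have eT: "ip (e i) p = 0" "ip (e i) (\<nu> p) = 0" "ip p (e i) = 0" "ip (\<nu> p) (e i) = 0" if "i < n" for i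
    using tangent_in_T[OF p e(1)[OF that]] pinner_commute[of _ p "e i"] pinner_commute[of _ "\<nu> p" "e i"]
    unfolding T_def by auto
  have pn: "ip p (\<nu> p) = 0" using ip_normal(2)[OF p] pinner_commute by metis
  have orth: "\<bar>ip (f i) (f i')\<bar> = (if i = i' then 1 else 0)" if "i < CARD('m)" "i' < CARD('m)" for i i'
    using that e(2)[of i i'] eT ip_self[OF p] ip_normal(1,2)[OF p] pn a_sign unfolding f_def card_index by auto
  have ex: "v = (\<Sum>i<n. (ip v (e i) * ip (e i) (e i)) *\<^sub>R e i) + (a * ip v p) *\<^sub>R p - (a * ip v (\<nu> p)) *\<^sub>R \<nu> p" for v
  proof -
    have "v = (\<Sum>i<CARD('m). (ip v (f i) * ip (f i) (f i)) *\<^sub>R f i)"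
      by (rule pseudo_orthonormal_expansion[OF orth])
    also have "\<dots> = (\<Sum>i<n. (ip v (f i) * ip (f i) (f i)) *\<^sub>R f i) + (ip v (f n) * ip (f n) (f n)) *\<^sub>R f n
       + (ip v (f (Suc n)) * ip (f (Suc n)) (f (Suc n))) *\<^sub>R f (Suc n)" unfolding card_index by simp
    also have "\<dots> = (\<Sum>i<n. (ip v (e i) * ip (e i) (e i)) *\<^sub>R e i) + (a * ip v p) *\<^sub>R p - (a * ip v (\<nu> p)) *\<^sub>R \<nu> p"
      unfolding f_def using ip_self[OF p] ip_normal(1)[OF p] by (simp add: mult.commute)
    finally show ?thesis .
  qed
  show thesis
  proof (rule that[OF e(1) e(3) e(2) _ _ ex])
    show "Mderiv M \<nu> p (e i) = - lam p *\<^sub>R e i" if "i < n - 1" for i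
      using e(4)[OF that] unfolding shape_op_def by (metis minus_minus scaleR_minus_left)
    show "Mderiv M \<nu> p (en p) = - mu p *\<^sub>R en p"
      using e(5) unfolding shape_op_def by (metis minus_minus scaleR_minus_left)
  qed
qed

text \<open>Each vector of \<open>T p\<close> is a combination of frame vectors, and these are
  velocities of curves in \<open>M\<close>.\<close>

lemma linear_eq_on_T:
  assumes p: "p \<in> M" and "linear D1" "linear D2" and v: "v \<in> T p"
    and eq: "\<And>v. v \<in> tangent_space M p \<Longrightarrow> D1 v = D2 v"
  shows "D1 v = (D2 v :: 'b::real_normed_vector)"
proof -
  obtain e where e: "\<And>i. i < n \<Longrightarrow> e i \<in> tangent_space M p"
    and ex: "\<And>v. v = (\<Sum>i<n. (ip v (e i) * ip (e i) (e i)) *\<^sub>R e i) + (a * ip v p) *\<^sub>R p - (a * ip v (\<nu> p)) *\<^sub>R \<nu> p"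
    by (rule frame[OF p]) (rule that; assumption)
  define x where "x i = ip v (e i) * ip (e i) (e i)" for i
  have vx: "v = (\<Sum>i<n. x i *\<^sub>R e i)"
    using ex[of v] v unfolding T_def x_def by simp
  have "D1 (\<Sum>i<n. x i *\<^sub>R e i) = D2 (\<Sum>i<n. x i *\<^sub>R e i)"
    using assms(2,3) eq e by (simp add: linear_sum linear_cmul)
  then show ?thesis unfolding vx[symmetric] .
qed

text \<open>This is what makes \<open>Mderiv\<close> well defined: velocities of curves see only the
  values on \<open>M\<close>, and they span \<open>T p\<close>.\<close>

lemma extension_derivative_unique:
  fixes F1 F2 :: "(real, 'm) vec \<Rightarrow> 'b::real_normed_vector"
  assumes p: "p \<in> M" and W: "open W" "p \<in> W" and eq: "\<And>x. x \<in> M \<inter> W \<Longrightarrow> F1 x = F2 x"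
    and D: "(F1 has_derivative D1) (at p)" "(F2 has_derivative D2) (at p)" and v: "v \<in> T p"
  shows "D1 v = D2 v"
proof (rule linear_eq_on_T[OF p _ _ v])
  show "linear D1" "linear D2" using D has_derivative_linear by blast+
  fix v assume "v \<in> tangent_space M p"
  then obtain c e where c: "0 < e" "\<And>t. t \<in> {-e<..<e} \<Longrightarrow> c t \<in> M" "c 0 = p" "(c has_vector_derivative v) (at 0)"
    unfolding tangent_space_def by blast
  have S: "open {-e<..<e}" "0 \<in> {-e<..<e}" using c(1) by auto
  have "((\<lambda>s. F2 (c s)) has_vector_derivative D1 v) (at 0)"
    by (rule extension_derivative_along_curve[where F=F1 and W=W, OF W(1) _ _ _ S c(2) c(4)]) (use W c(3) eq D in auto)
  moreover have "((\<lambda>s. F2 (c s)) has_vector_derivative D2 v) (at 0)"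
    by (rule extension_derivative_along_curve[where F=F2 and W=W, OF W(1) _ _ _ S c(2) c(4)]) (use W c(3) D in auto)
  ultimately show "D1 v = D2 v" using vector_derivative_unique_at by blast
qed

lemma Mderiv_extension:
  assumes p: "p \<in> M" and W: "p \<in> W" "Cinf_on W F" "\<And>x. x \<in> M \<inter> W \<Longrightarrow> F x = f x" and v: "v \<in> T p"
  shows "Mderiv M f p v = frechet_derivative F (at p) v"
  unfolding Mderiv_def
proof (rule the_equality)
  show "\<exists>W' F'. open W' \<and> p \<in> W' \<and> Cinf_on W' F' \<and> (\<forall>x\<in>M \<inter> W'. F' x = f x) \<and> frechet_derivative F' (at p) v = frechet_derivative F (at p) v"
    using W Cinf_on_open[OF W(2)] by blast
  fix y assume "\<exists>W' F'. open W' \<and> p \<in> W' \<and> Cinf_on W' F' \<and> (\<forall>x\<in>M \<inter> W'. F' x = f x) \<and> frechet_derivative F' (at p) v = y"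
  then obtain W' F' where W': "open W'" "p \<in> W'" "Cinf_on W' F'" "\<And>x. x \<in> M \<inter> W' \<Longrightarrow> F' x = f x"
    and y: "frechet_derivative F' (at p) v = y" by blast
  have "frechet_derivative F' (at p) v = frechet_derivative F (at p) v"
    by (rule extension_derivative_unique[OF p _ _ _ Cinf_on_has_derivative[OF W'(3,2)] Cinf_on_has_derivative[OF W(2,1)] v, of "W \<inter> W'"])
       (use W W' Cinf_on_open[OF W(2)] in auto)
  then show "y = frechet_derivative F (at p) v" using y by simp
qed

text \<open>One neighbourhood for the extensions of all four fields. Off \<open>M\<close> the
  extensions are unrelated, so identities between the fields can be differentiated only in the
  directions of \<open>T p\<close>.\<close>

definition local_extension :: "(real, 'm) vec set \<Rightarrow> ((real, 'm) vec \<Rightarrow> (real, 'm) vec) \<Rightarrow> ((real, 'm) vec \<Rightarrow> (real, 'm) vec)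
    \<Rightarrow> ((real, 'm) vec \<Rightarrow> real) \<Rightarrow> ((real, 'm) vec \<Rightarrow> real) \<Rightarrow> bool" where
  "local_extension W N E L K \<longleftrightarrow> open W \<and> Cinf_on W N \<and> Cinf_on W E \<and> Cinf_on W L \<and> Cinf_on W K \<and>
     (\<forall>x\<in>M \<inter> W. N x = \<nu> x \<and> E x = en x \<and> L x = lam x \<and> K x = mu x)"

lemma local_extension_exists:
  assumes "p \<in> M" obtains W N E L K where "p \<in> W" "local_extension W N E L K"
proof -
  obtain W1 N where 1: "open W1" "p \<in> W1" "Cinf_on W1 N" "\<forall>x\<in>M \<inter> W1. N x = \<nu> x"
    using smooth(1) assms unfolding Cinf_fun_on_def by blast
  obtain W2 E where 2: "open W2" "p \<in> W2" "Cinf_on W2 E" "\<forall>x\<in>M \<inter> W2. E x = en x"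
    using smooth(2) assms unfolding Cinf_fun_on_def by blast
  obtain W3 L where 3: "open W3" "p \<in> W3" "Cinf_on W3 L" "\<forall>x\<in>M \<inter> W3. L x = lam x"
    using smooth(3) assms unfolding Cinf_fun_on_def by blast
  obtain W4 K where 4: "open W4" "p \<in> W4" "Cinf_on W4 K" "\<forall>x\<in>M \<inter> W4. K x = mu x"
    using smooth(4) assms unfolding Cinf_fun_on_def by blast
  define W where "W = W1 \<inter> W2 \<inter> W3 \<inter> W4"
  have W: "open W" "p \<in> W" "W \<subseteq> W1" "W \<subseteq> W2" "W \<subseteq> W3" "W \<subseteq> W4" unfolding W_def using 1 2 3 4 by auto
  have "local_extension W N E L K" unfolding local_extension_def
    using Cinf_on_subset[OF 1(3) W(1,3)] Cinf_on_subset[OF 2(3) W(1,4)] Cinf_on_subset[OF 3(3) W(1,5)]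
      Cinf_on_subset[OF 4(3) W(1,6)] W 1(4) 2(4) 3(4) 4(4) by blast
  then show thesis using that W(2) by blast
qed

text \<open>The shape operator is \<lambda> times the identity except along e_n; the rank-one term
  replaces \<lambda> by \<mu> there, with the factor a coming from <e_n,e_n> = a.\<close>

lemma normal_derivative:
  assumes ext: "local_extension W N E L K" and p: "p \<in> M" "p \<in> W" and v: "v \<in> T p"
  shows "frechet_derivative N (at p) v = - lam p *\<^sub>R v + (a * (lam p - mu p) * ip v (en p)) *\<^sub>R en p"
proof -
  have N: "Cinf_on W N" "\<And>x. x \<in> M \<inter> W \<Longrightarrow> N x = \<nu> x" using ext unfolding local_extension_def by auto
  obtain e where e: "\<And>i. i < n \<Longrightarrow> e i \<in> tangent_space M p" "e (n - 1) = en p"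
    "\<And>i i'. i < n \<Longrightarrow> i' < n \<Longrightarrow> \<bar>ip (e i) (e i')\<bar> = (if i = i' then 1 else 0)"
    "\<And>i. i < n - 1 \<Longrightarrow> Mderiv M \<nu> p (e i) = - lam p *\<^sub>R e i" "Mderiv M \<nu> p (en p) = - mu p *\<^sub>R en p"
    and ex: "\<And>v. v = (\<Sum>i<n. (ip v (e i) * ip (e i) (e i)) *\<^sub>R e i) + (a * ip v p) *\<^sub>R p - (a * ip v (\<nu> p)) *\<^sub>R \<nu> p"
    by (rule frame[OF p(1)]) (rule that; assumption)
  define D where "D = frechet_derivative N (at p)"
  define D2 where "D2 v = - lam p *\<^sub>R v + (a * (lam p - mu p) * ip v (en p)) *\<^sub>R en p" for v
  have linD: "linear D" unfolding D_def using Cinf_on_has_derivative[OF N(1) p(2)] has_derivative_linear by blast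
  have linD2: "linear D2" unfolding D2_def by (rule linearI) (simp_all add: pinner_simps algebra_simps)
  have eq: "D (e i) = D2 (e i)" if i: "i < n" for i
  proof -
    have D: "D (e i) = Mderiv M \<nu> p (e i)"
      unfolding D_def using Mderiv_extension[OF p(1,2) N tangent_in_T[OF p(1) e(1)[OF i]]] by simp
    show ?thesis
    proof (cases "i = n - 1")
      case True
      then show ?thesis unfolding D D2_def using e(2,5) en_tangent(2)[OF p(1)] by (simp add: algebra_simps)
    next
      case False
      then have "ip (e i) (en p) = 0" using e(3)[of i "n - 1"] i e(2) by simp
      then show ?thesis unfolding D D2_def using e(4)[of i] False i by simp
    qed
  qed
  define x where "x i = ip v (e i) * ip (e i) (e i)" for i
  have vx: "v = (\<Sum>i<n. x i *\<^sub>R e i)" using ex[of v] v unfolding T_def x_def by simp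
  have "D (\<Sum>i<n. x i *\<^sub>R e i) = D2 (\<Sum>i<n. x i *\<^sub>R e i)"
    using linD linD2 eq by (simp add: linear_sum linear_cmul)
  then have "D v = D2 v" unfolding vx[symmetric] .
  then show ?thesis unfolding D_def D2_def .
qed

text \<open>Integrability: if \<open>dG(v) = B(v)\<close> for tangent \<open>v\<close>, then the derivative of \<open>B\<close> is symmetric.
  Both arguments are extended to tangent fields by orthogonal projection; these extensions have
  symmetric mutual derivatives at \<open>p\<close> because the shape operator is self-adjoint.\<close>

lemma derivative_symmetric:
  fixes G :: "(real, 'm) vec \<Rightarrow> (real, 'm) vec"
  assumes ext: "local_extension W N E L K" and p: "p \<in> M" "p \<in> W" and G: "Cinf_on W G"
    and B: "\<And>x v. x \<in> M \<Longrightarrow> x \<in> W \<Longrightarrow> v \<in> T x \<Longrightarrow> frechet_derivative G (at x) v = B x v"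
    and linB: "\<And>x. linear (B x)" and dB: "\<And>v. ((\<lambda>x. B x v) has_derivative (\<lambda>u. B' u v)) (at p)"
    and linB': "\<And>u. linear (B' u)" and uv: "u \<in> T p" "v \<in> T p"
  shows "B' u v = B' v u"
proof -
  have W: "open W" and N: "Cinf_on W N" "\<And>x. x \<in> M \<inter> W \<Longrightarrow> N x = \<nu> x"
    using ext unfolding local_extension_def by auto
  define D where "D x = frechet_derivative G (at x)" for x
  define D2 where "D2 u v = frechet_derivative (\<lambda>x. D x v) (at p) u" for u v
  define DN where "DN = frechet_derivative N (at p)"
  have dG: "(G has_derivative D x) (at x)" if "x \<in> W" for x unfolding D_def by (rule Cinf_on_has_derivative[OF G that])
  have dD: "((\<lambda>x. D x v) has_derivative (\<lambda>u. D2 u v)) (at p)" for v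
    unfolding D2_def D_def by (rule Cinf_on_has_derivative[OF Cinf_on_frechet[OF G] p(2)])
  have linD: "linear (D x)" if "x \<in> W" for x using dG[OF that] has_derivative_linear by blast
  have sym: "D2 u v = D2 v u" for u v
    by (rule second_derivative_symmetric_euclidean[OF W p(2) dG dD dD])
  have linD2: "linear (D2 u)" for u
  proof (rule linearI)
    have lin: "linear (\<lambda>u. D2 u v)" for v using dD has_derivative_linear by blast
    show "D2 u (x + y) = D2 u x + D2 u y" for x y using linear_add[OF lin] sym by metis
    show "D2 u (c *\<^sub>R x) = c *\<^sub>R D2 u x" for c x using linear_cmul[OF lin] sym by metis
  qed
  have dN: "(N has_derivative DN) (at p)" unfolding DN_def by (rule Cinf_on_has_derivative[OF N(1) p(2)])
  \<comment> \<open>The orthogonal projection of the constant vector \<open>v\<close> to the tangent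
    space at \<open>x\<close>; \<open>V'\<close> is its derivative at \<open>p\<close> for tangent
    \<open>v\<close>.\<close>
  define V where "V v x = v - (a * ip v x) *\<^sub>R x + (a * ip v (N x)) *\<^sub>R N x" for v x
  define V' where "V' v u = - (a * ip v u) *\<^sub>R p + (a * ip v (DN u)) *\<^sub>R \<nu> p" for v u
  have VT: "V v x \<in> T x" if "x \<in> M" "x \<in> W" for v x
  proof -
    have Nx: "N x = \<nu> x" using N(2) that by auto
    have px: "ip x (\<nu> x) = 0" using ip_normal(2)[OF that(1)] pinner_commute[of _ x "\<nu> x"] by simp
    have "ip (V v x) x = ip v x - (a * ip v x) * a"
      unfolding V_def Nx using ip_self[OF that(1)] ip_normal(2)[OF that(1)] by (simp add: pinner_simps)
    moreover have "ip (V v x) (\<nu> x) = ip v (\<nu> x) - (a * ip v (\<nu> x)) * a"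
      unfolding V_def Nx using px ip_normal(1)[OF that(1)] by (simp add: pinner_simps)
    ultimately show ?thesis unfolding T_def
      by (simp add: mult.commute[of "a * ip v x" a] mult.commute[of "a * ip v (\<nu> x)" a])
  qed
  have Np: "N p = \<nu> p" using N(2) p by auto
  have Vp: "V v p = v" if "v \<in> T p" for v using that unfolding V_def T_def Np by simp
  have dV: "(V v has_derivative V' v) (at p)" if "v \<in> T p" for v
  proof -
    have d1: "((\<lambda>x. ip v x) has_derivative (\<lambda>u. ip v u)) (at p)"
      by (rule bounded_linear_imp_has_derivative[OF bounded_bilinear.bounded_linear_right[OF bounded_bilinear_pinner]])
    have d2: "((\<lambda>x. ip v (N x)) has_derivative (\<lambda>u. ip v (DN u))) (at p)"
      by (rule bounded_linear.has_derivative[OF bounded_bilinear.bounded_linear_right[OF bounded_bilinear_pinner] dN])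
    have "(V v has_derivative (\<lambda>u. 0 - ((a * ip v p) *\<^sub>R u + (a * ip v u) *\<^sub>R p) + ((a * ip v (N p)) *\<^sub>R DN u + (a * ip v (DN u)) *\<^sub>R N p))) (at p)"
      unfolding V_def
      by (intro has_derivative_add has_derivative_diff has_derivative_const has_derivative_scaleR
          has_derivative_mult_right d1 d2 dN has_derivative_ident)
    then show ?thesis unfolding V'_def using that by (simp add: T_def Np)
  qed
  \<comment> \<open>The mixed derivatives are built from the metric and from <v, DN u>, which is
    symmetric as the shape operator is self-adjoint.\<close>
  have V'sym: "V' v u = V' u v"
    using normal_derivative[OF ext p uv(1)] normal_derivative[OF ext p uv(2)] pinner_commute[of _ u v] unfolding V'_def DN_def
    by (simp add: pinner_simps mult_ac)
  \<comment> \<open>The identity of \<open>D x\<close> and \<open>B x\<close> on the tangent field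
    \<open>V v\<close> holds at all points of \<open>M\<close>; differentiating it along
    \<open>u\<close> brings in the second derivative of \<open>G\<close>.\<close>
  have key: "D2 u v + D p (V' v u) - (B' u v + B p (V' v u)) = 0" if "u \<in> T p" "v \<in> T p" for u v
  proof -
    have "((\<lambda>x. D x (V v x)) has_derivative (\<lambda>u. D2 u (V v p) + D p (V' v u))) (at p)"
      by (rule has_derivative_linear_apply[OF W p(2) linD dD linD2 dV[OF that(2)]])
    moreover have "((\<lambda>x. B x (V v x)) has_derivative (\<lambda>u. B' u (V v p) + B p (V' v u))) (at p)"
      by (rule has_derivative_linear_apply[OF W p(2) linB dB linB' dV[OF that(2)]])
    ultimately have "((\<lambda>x. D x (V v x) - B x (V v x)) has_derivative
        (\<lambda>u. D2 u (V v p) + D p (V' v u) - (B' u (V v p) + B p (V' v u)))) (at p)" by (rule has_derivative_diff)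
    from extension_derivative_unique[OF p(1) W p(2) _ this has_derivative_const that(1), of 0]
    show ?thesis using B VT Vp[OF that(2)] unfolding D_def by simp
  qed
  show ?thesis using key[OF uv] key[OF uv(2,1)] sym[of u v] V'sym by simp
qed

section \<open>Structure equations of Codazzi and Gauss\<close>

text \<open>Since \<lambda> - \<mu> = n (\<lambda> - H), this is the logarithmic derivative of w
  along e_n. Up to sign it is also the principal curvature of the leaves orthogonal to e_n.\<close>

definition kap :: "(real, 'm) vec \<Rightarrow> real" where
  "kap p = - Mderiv M lam p (en p) / (lam p - mu p)"

text \<open>Chosen so that the expression \<open>kap p v + <v, en p> Z p\<close> takes the value -p
  - \<mu> \<nu> at v = e_n: the acceleration of the integral curves of e_n is normal to
  \<open>M\<close>, they are geodesics.\<close>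

definition Z :: "(real, 'm) vec \<Rightarrow> (real, 'm) vec" where
  "Z p = - (a * kap p) *\<^sub>R en p - a *\<^sub>R p - (a * mu p) *\<^sub>R \<nu> p"

text \<open>The Codazzi equation: \<open>\<lambda>\<close> varies only along \<open>e\<^sub>n\<close>, and the leaves orthogonal to \<open>e\<^sub>n\<close> are umbilical.\<close>

lemma codazzi:
  assumes ext: "local_extension W N E L K" and p: "p \<in> M" "p \<in> W" and v: "v \<in> T p"
  shows "frechet_derivative L (at p) v = - a * ip v (en p) * kap p * (lam p - mu p)"
    and "frechet_derivative K (at p) v = - (real n - 1) * frechet_derivative L (at p) v"
    and "frechet_derivative E (at p) v = kap p *\<^sub>R v + ip v (en p) *\<^sub>R Z p"
proof -
  have W: "open W" and N: "Cinf_on W N" "\<And>x. x \<in> M \<inter> W \<Longrightarrow> N x = \<nu> x"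
    and E: "Cinf_on W E" "\<And>x. x \<in> M \<inter> W \<Longrightarrow> E x = en x" and L: "Cinf_on W L" "\<And>x. x \<in> M \<inter> W \<Longrightarrow> L x = lam x"
    and K: "Cinf_on W K" "\<And>x. x \<in> M \<inter> W \<Longrightarrow> K x = mu x"
    using ext unfolding local_extension_def by auto
  define DN where "DN = frechet_derivative N (at p)"
  define DL where "DL = frechet_derivative L (at p)"
  define DK where "DK = frechet_derivative K (at p)"
  define DE where "DE = frechet_derivative E (at p)"
  have dN: "(N has_derivative DN) (at p)" unfolding DN_def by (rule Cinf_on_has_derivative[OF N(1) p(2)])
  have dL: "(L has_derivative DL) (at p)" unfolding DL_def by (rule Cinf_on_has_derivative[OF L(1) p(2)])
  have dK: "(K has_derivative DK) (at p)" unfolding DK_def by (rule Cinf_on_has_derivative[OF K(1) p(2)])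
  have dE: "(E has_derivative DE) (at p)" unfolding DE_def by (rule Cinf_on_has_derivative[OF E(1) p(2)])
  have lin: "linear DN" "linear DL" "linear DK" "linear DE" using dN dL dK dE has_derivative_linear by blast+
  have at_p: "N p = \<nu> p" "E p = en p" "L p = lam p" "K p = mu p" using N E L K p by auto
  let ?e = "en p" and ?\<eta> = "lam p - mu p"
  have eta: "?\<eta> > 0" using lam_gt[OF p(1)] by simp
  have eT: "?e \<in> T p" using tangent_in_T en_tangent p by blast
  have DKv: "DK v = - (real n - 1) * DL v" if "v \<in> T p" for v
  proof (rule extension_derivative_unique[OF p(1) W p(2) _ dK _ that])
    show "K x = real n * H + - (real n - 1) * L x" if "x \<in> M \<inter> W" for x
      using K(2)[OF that] L(2)[OF that] mu_eq[of x] that by (simp only: IntD1 mult_minus_left diff_conv_add_uminus)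
    show "((\<lambda>x. real n * H + - (real n - 1) * L x) has_derivative (\<lambda>v. - (real n - 1) * DL v)) (at p)"
      using has_derivative_add[OF has_derivative_const has_derivative_mult_right[OF dL]] by simp
  qed
  have ipv: "((\<lambda>x. ip v (E x)) has_derivative (\<lambda>u. ip v (DE u))) (at p)" for v
    by (rule bounded_linear.has_derivative[OF bounded_bilinear.bounded_linear_right[OF bounded_bilinear_pinner] dE])
  define B where "B x v = - L x *\<^sub>R v + (a * (L x - K x) * ip v (E x)) *\<^sub>R E x" for x v
  define B' where "B' u v = - DL u *\<^sub>R v + ((a * ?\<eta> * ip v ?e) *\<^sub>R DE u + (a * ?\<eta> * ip v (DE u) + a * (DL u - DK u) * ip v ?e) *\<^sub>R ?e)" for u v
  \<comment> \<open>The integrability condition of \<open>normal_derivative\<close>, that is the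
    Codazzi equation. Its components in the frame are read off below.\<close>
  have cod: "B' u v = B' v u" if "u \<in> T p" "v \<in> T p" for u v
  proof (rule derivative_symmetric[OF ext p N(1) _ _ _ _ that, where B=B])
    show "frechet_derivative N (at x) v = B x v" if "x \<in> M" "x \<in> W" "v \<in> T x" for x v
      using normal_derivative[OF ext that] N E L K that unfolding B_def by simp
    show "linear (B x)" for x unfolding B_def by (rule linearI) (simp_all add: pinner_simps algebra_simps)
    show "linear (B' u)" for u unfolding B'_def by (rule linearI) (simp_all add: pinner_simps algebra_simps)
    show "((\<lambda>x. B x v) has_derivative (\<lambda>u. B' u v)) (at p)" for v
    proof -
      have "((\<lambda>x. B x v) has_derivative (\<lambda>u. - DL u *\<^sub>R v + ((a * (L p - K p) * ip v (E p)) *\<^sub>R DE u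
        + (a * (L p - K p) * ip v (DE u) + a * (DL u - DK u) * ip v (E p)) *\<^sub>R E p))) (at p)"
        unfolding B_def
        by (intro has_derivative_add has_derivative_scaleR_left has_derivative_minus has_derivative_scaleR has_derivative_mult
            has_derivative_mult_right has_derivative_diff dL dK dE ipv)
      then show ?thesis unfolding B'_def at_p .
    qed
  qed
  have ee: "ip ?e ?e = a" using en_tangent p by blast
  have DEe: "ip ?e (DE v) = 0" if "v \<in> T p" for v
  proof -
    have "((\<lambda>x. ip (E x) (E x)) has_derivative (\<lambda>u. ip (E p) (DE u) + ip (DE u) (E p))) (at p)"
      by (rule bounded_bilinear.FDERIV[OF bounded_bilinear_pinner dE dE])
    from extension_derivative_unique[OF p(1) W p(2) _ this has_derivative_const that, of a]
    have "ip (E p) (DE v) + ip (DE v) (E p) = 0" using E(2) en_tangent(2) by simp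
    then show ?thesis using at_p pinner_commute[of _ "DE v" ?e] by simp
  qed
  obtain e where e: "\<And>i. i < n \<Longrightarrow> e i \<in> tangent_space M p" "e (n - 1) = ?e"
    "\<And>i i'. i < n \<Longrightarrow> i' < n \<Longrightarrow> \<bar>ip (e i) (e i')\<bar> = (if i = i' then 1 else 0)"
    and ex: "\<And>v. v = (\<Sum>i<n. (ip v (e i) * ip (e i) (e i)) *\<^sub>R e i) + (a * ip v p) *\<^sub>R p - (a * ip v (\<nu> p)) *\<^sub>R \<nu> p"
    by (rule frame[OF p(1)]) (rule that; assumption)
  have ei: "e i \<in> T p" "ip (e i) ?e = 0" "ip ?e (e i) = 0" "ip (e i) (e i) \<noteq> 0" if "i < n - 1" for i
  proof -
    have "i < n" using that by simp
    then show "e i \<in> T p" "ip (e i) (e i) \<noteq> 0" using tangent_in_T[OF p(1) e(1)] e(3)[of i i] by auto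
    show "ip (e i) ?e = 0" "ip ?e (e i) = 0" using e(2) e(3)[of i "n-1"] e(3)[of "n-1" i] that n_gt by auto
  qed
  \<comment> \<open>Uses n > 2: another leaf direction \<open>e j\<close> exists. In the
    \<open>e j\<close>-component of the Codazzi equation for \<open>e i\<close> and
    \<open>e j\<close> only the term with \<open>DL (e i)\<close> survives.\<close>
  have DLe: "DL (e i) = 0" if i: "i < n - 1" for i
  proof -
    define j where "j = (if i = 0 then 1 else 0 :: nat)"
    have j: "j < n - 1" "j \<noteq> i" unfolding j_def using n_gt by auto
    have ij: "ip (e i) (e j) = 0" using e(3)[of i j] i j by simp
    have "ip (B' (e i) (e j)) (e j) = ip (B' (e j) (e i)) (e j)" using cod ei(1) i j by simp
    then show ?thesis unfolding B'_def using ei i j ij by (simp add: pinner_simps)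
  qed
  \<comment> \<open>The Codazzi equation for \<open>e i\<close> and e_n. Its product with e_n kills
    the left side because e_n has constant length, and this separates the two claims.\<close>
  have DEi: "DE (e i) = - (DL ?e / ?\<eta>) *\<^sub>R e i \<and> ip (e i) (DE ?e) = 0" if i: "i < n - 1" for i
  proof -
    have c: "B' (e i) ?e = B' ?e (e i)" using cod ei(1)[OF i] eT by blast
    have D0: "DL (e i) = 0" "DK (e i) = 0" using DLe[OF i] DKv[OF ei(1)[OF i]] by auto
    have "?\<eta> *\<^sub>R DE (e i) = - DL ?e *\<^sub>R e i + (a * ?\<eta> * ip (e i) (DE ?e)) *\<^sub>R ?e"
      using c unfolding B'_def using D0 ei[OF i] ee DEe[OF ei(1)[OF i]] by (simp add: mult.commute mult.left_commute)
    moreover from this have "ip ?e (?\<eta> *\<^sub>R DE (e i)) = ip ?e (- DL ?e *\<^sub>R e i + (a * ?\<eta> * ip (e i) (DE ?e)) *\<^sub>R ?e)" by simp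
    then have "ip (e i) (DE ?e) = 0"
      using DEe[OF ei(1)[OF i]] ei[OF i] ee eta a_sign by (auto simp: pinner_simps)
    ultimately have h: "?\<eta> *\<^sub>R DE (e i) = - DL ?e *\<^sub>R e i" "ip (e i) (DE ?e) = 0" by auto
    have "DE (e i) = (1 / ?\<eta>) *\<^sub>R (?\<eta> *\<^sub>R DE (e i))" using eta by simp
    then show ?thesis using h by (simp add: divide_inverse mult.commute)
  qed
  have n1: "{..<n} = insert (n-1) {..<n-1}" using n_gt by auto
  have DLv: "DL v = a * ip v ?e * DL ?e" if "v \<in> T p" for v
  proof -
    define x where "x i = ip v (e i) * ip (e i) (e i)" for i
    have vx: "v = (\<Sum>i<n. x i *\<^sub>R e i)" using ex[of v] that unfolding T_def x_def by simp
    have "DL (\<Sum>i<n. x i *\<^sub>R e i) = (\<Sum>i<n. x i * DL (e i))" by (simp add: linear_sum[OF lin(2)] linear_cmul[OF lin(2)])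
    also have "\<dots> = a * ip v ?e * DL ?e" unfolding n1 x_def using DLe e(2) ee by simp
    finally show ?thesis unfolding vx[symmetric] .
  qed
  have kap: "kap p = - DL ?e / ?\<eta>"
    unfolding kap_def using Mderiv_extension[OF p L eT] unfolding DL_def by simp
  show "frechet_derivative L (at p) v = - a * ip v (en p) * kap p * (lam p - mu p)"
    using DLv[OF v] eta unfolding DL_def[symmetric] kap by simp
  show "frechet_derivative K (at p) v = - (real n - 1) * frechet_derivative L (at p) v"
    using DKv[OF v] unfolding DL_def DK_def .
  have NE: "DN ?e = - mu p *\<^sub>R ?e" unfolding DN_def using normal_derivative[OF ext p eT] ee by (simp add: algebra_simps)
  have ip_DE_p: "ip (DE ?e) p = - a"
  proof -
    have "((\<lambda>x. ip (E x) x) has_derivative (\<lambda>u. ip (E p) u + ip (DE u) p)) (at p)"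
      by (rule bounded_bilinear.FDERIV[OF bounded_bilinear_pinner dE has_derivative_ident])
    from extension_derivative_unique[OF p(1) W p(2) _ this has_derivative_const eT, of 0]
    have "ip (E p) ?e + ip (DE ?e) p = 0" using E(2) tangent_in_T[OF _ en_tangent(1)] unfolding T_def by simp
    then show ?thesis using at_p ee by simp
  qed
  have ip_DE_nu: "ip (DE ?e) (\<nu> p) = a * mu p"
  proof -
    have "((\<lambda>x. ip (E x) (N x)) has_derivative (\<lambda>u. ip (E p) (DN u) + ip (DE u) (N p))) (at p)"
      by (rule bounded_bilinear.FDERIV[OF bounded_bilinear_pinner dE dN])
    from extension_derivative_unique[OF p(1) W p(2) _ this has_derivative_const eT, of 0]
    have "ip (E p) (DN ?e) + ip (DE ?e) (N p) = 0"
      using E(2) N(2) tangent_in_T[OF _ en_tangent(1)] unfolding T_def by simp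
    then show ?thesis using at_p ee NE by (simp add: pinner_simps mult.commute)
  qed
  \<comment> \<open>Products with the whole basis: all tangential ones vanish, and the two normal
    ones come from differentiating <e_n, x> = 0 and <e_n, \<nu>> = 0.\<close>
  have DEE: "DE ?e = - p - mu p *\<^sub>R \<nu> p"
  proof -
    have z: "ip (DE ?e) (e i) = 0" if "i < n" for i
    proof (cases "i = n - 1")
      case True then show ?thesis using e(2) DEe[OF eT] pinner_commute by metis
    next
      case False then show ?thesis using DEi[of i] that pinner_commute[of _ "DE ?e" "e i"] by simp
    qed
    have "DE ?e = (\<Sum>i<n. (ip (DE ?e) (e i) * ip (e i) (e i)) *\<^sub>R e i) + (a * ip (DE ?e) p) *\<^sub>R p - (a * ip (DE ?e) (\<nu> p)) *\<^sub>R \<nu> p"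
      by (rule ex)
    also have "\<dots> = - p - mu p *\<^sub>R \<nu> p" using z ip_DE_p ip_DE_nu by simp
    finally show ?thesis .
  qed
  show "frechet_derivative E (at p) v = kap p *\<^sub>R v + ip v (en p) *\<^sub>R Z p"
  proof -
    have v': "v = (\<Sum>i<n-1. (ip v (e i) * ip (e i) (e i)) *\<^sub>R e i) + (a * ip v ?e) *\<^sub>R ?e"
    proof -
      have "v = (\<Sum>i<n. (ip v (e i) * ip (e i) (e i)) *\<^sub>R e i)" using ex[of v] v unfolding T_def by simp
      also have "\<dots> = (\<Sum>i<n-1. (ip v (e i) * ip (e i) (e i)) *\<^sub>R e i) + (a * ip v ?e) *\<^sub>R ?e"
        unfolding n1 using e(2) ee by (simp add: mult.commute add.commute)
      finally show ?thesis .
    qed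
    define s where "s = (\<Sum>i<n-1. (ip v (e i) * ip (e i) (e i)) *\<^sub>R e i)"
    have vs: "v = s + (a * ip v ?e) *\<^sub>R ?e" using v' unfolding s_def .
    have "DE s = kap p *\<^sub>R s" unfolding s_def kap
      by (simp add: linear_sum[OF lin(4)] linear_cmul[OF lin(4)] DEi scaleR_sum_right mult.commute)
    moreover have "DE v = DE s + (a * ip v ?e) *\<^sub>R DE ?e" by (subst vs) (simp add: linear_add[OF lin(4)] linear_cmul[OF lin(4)])
    moreover have "s = v - (a * ip v ?e) *\<^sub>R ?e" using vs by (metis add_diff_cancel_right')
    ultimately have "DE v = kap p *\<^sub>R (v - (a * ip v ?e) *\<^sub>R ?e) + (a * ip v ?e) *\<^sub>R (- p - mu p *\<^sub>R \<nu> p)" using DEE by simp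
    also have "\<dots> = kap p *\<^sub>R v + ip v (en p) *\<^sub>R Z p" unfolding Z_def by (simp add: algebra_simps)
    finally show ?thesis unfolding DE_def .
  qed
qed

end

lemma Cinf_on_second_derivative:
  fixes G :: "'a::real_normed_vector \<Rightarrow> 'b::euclidean_space"
  assumes G: "Cinf_on W G" and p: "p \<in> W"
  obtains D2 where "\<And>v. ((\<lambda>x. frechet_derivative G (at x) v) has_derivative (\<lambda>u. D2 u v)) (at p)"
    "\<And>u v. D2 u v = D2 v u" "\<And>u. linear (D2 u)"
proof -
  define D2 where "D2 u v = frechet_derivative (\<lambda>x. frechet_derivative G (at x) v) (at p) u" for u v
  have dD: "((\<lambda>x. frechet_derivative G (at x) v) has_derivative (\<lambda>u. D2 u v)) (at p)" for v
    unfolding D2_def by (rule Cinf_on_has_derivative[OF Cinf_on_frechet[OF G] p])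
  have sym: "D2 u v = D2 v u" for u v
    by (rule second_derivative_symmetric_euclidean[OF Cinf_on_open[OF G] p Cinf_on_has_derivative[OF G] dD dD])
  have "linear (D2 u)" for u
  proof (rule linearI)
    have lin: "linear (\<lambda>u. D2 u v)" for v using dD has_derivative_linear by blast
    show "D2 u (x + y) = D2 u x + D2 u y" for x y using linear_add[OF lin] sym by metis
    show "D2 u (c *\<^sub>R x) = c *\<^sub>R D2 u x" for c x using linear_cmul[OF lin] sym by metis
  qed
  then show thesis using that dD sym by blast
qed

context cmc_hypersurface
begin

text \<open>The Gauss equation, as the integrability condition of the structure equation for \<open>e\<^sub>n\<close>.\<close>

lemma kap_derivative:
  assumes p: "p \<in> M"
  obtains W F D where "open W" "p \<in> W" "\<And>x. x \<in> M \<inter> W \<Longrightarrow> F x = kap x" "(F has_derivative D) (at p)"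
    "\<And>v. v \<in> T p \<Longrightarrow> D v = a * ip v (en p) * (- ((kap p)^2) - 1 + lam p * mu p)"
proof -
  obtain W N E L K where pW: "p \<in> W" and ext: "local_extension W N E L K" using local_extension_exists[OF p] by blast
  have W: "open W" and N: "Cinf_on W N" "\<And>x. x \<in> M \<inter> W \<Longrightarrow> N x = \<nu> x"
    and E: "Cinf_on W E" "\<And>x. x \<in> M \<inter> W \<Longrightarrow> E x = en x" and L: "Cinf_on W L" "\<And>x. x \<in> M \<inter> W \<Longrightarrow> L x = lam x"
    and K: "Cinf_on W K" "\<And>x. x \<in> M \<inter> W \<Longrightarrow> K x = mu x"
    using ext unfolding local_extension_def by auto
  define DN where "DN = frechet_derivative N (at p)"
  define DK where "DK = frechet_derivative K (at p)"
  define DE where "DE = frechet_derivative E (at p)"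
  define F where "F x = - frechet_derivative L (at x) (E x) / (L x - K x)" for x
  have dN: "(N has_derivative DN) (at p)" unfolding DN_def by (rule Cinf_on_has_derivative[OF N(1) pW])
  have dL: "(L has_derivative frechet_derivative L (at p)) (at p)" by (rule Cinf_on_has_derivative[OF L(1) pW])
  have dK: "(K has_derivative DK) (at p)" unfolding DK_def by (rule Cinf_on_has_derivative[OF K(1) pW])
  have dE: "(E has_derivative DE) (at p)" unfolding DE_def by (rule Cinf_on_has_derivative[OF E(1) pW])
  have at_p: "N p = \<nu> p" "E p = en p" "L p = lam p" "K p = mu p" using N E L K p pW by auto
  let ?e = "en p" and ?k = "kap p"
  have eta: "lam p - mu p > 0" using lam_gt[OF p] by simp
  have Fk: "F x = kap x" if x: "x \<in> M \<inter> W" for x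
  proof -
    have "en x \<in> T x" using tangent_in_T en_tangent x by blast
    then have "Mderiv M lam x (en x) = frechet_derivative L (at x) (en x)"
      using Mderiv_extension[of x W L lam "en x"] L x by blast
    then show ?thesis unfolding F_def kap_def using E(2)[OF x] L(2)[OF x] K(2)[OF x] by simp
  qed
  obtain D2 where D2: "\<And>v. ((\<lambda>x. frechet_derivative L (at x) v) has_derivative (\<lambda>u. D2 u v)) (at p)"
    "\<And>u v. D2 u v = D2 v u" "\<And>u. linear (D2 u)" using Cinf_on_second_derivative[OF L(1) pW] by blast
  have linL: "linear (frechet_derivative L (at x))" if "x \<in> W" for x
    using Cinf_on_has_derivative[OF L(1) that] has_derivative_linear by blast
  have "((\<lambda>x. frechet_derivative L (at x) (E x)) has_derivative (\<lambda>u. D2 u (E p) + frechet_derivative L (at p) (DE u))) (at p)"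
    by (rule has_derivative_linear_apply[OF W pW linL D2(1) D2(3) dE])
  \<comment> \<open>Only the existence of a derivative \<open>D\<close> is taken from the quotient
    rule; its values are found from integrability.\<close>
  from has_derivative_divide[OF has_derivative_minus[OF this] has_derivative_diff[OF dL dK]]
  obtain D where dF: "(F has_derivative D) (at p)" unfolding F_def using eta at_p by auto
  have linD: "linear D" using dF has_derivative_linear by blast
  have Fp: "F p = ?k" using Fk p pW by auto
  define Zx where "Zx x = (- (a * F x)) *\<^sub>R E x - a *\<^sub>R x - (a * K x) *\<^sub>R N x" for x
  define Z' where "Z' u = ((- (a * ?k)) *\<^sub>R DE u + (- (a * D u)) *\<^sub>R ?e) - a *\<^sub>R u - ((a * mu p) *\<^sub>R DN u + (a * DK u) *\<^sub>R \<nu> p)" for u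
  have dZ: "(Zx has_derivative Z') (at p)"
  proof -
    have "(Zx has_derivative (\<lambda>u. ((- (a * F p)) *\<^sub>R DE u + (- (a * D u)) *\<^sub>R E p) - a *\<^sub>R u - ((a * K p) *\<^sub>R DN u + (a * DK u) *\<^sub>R N p))) (at p)"
      unfolding Zx_def
      by (intro has_derivative_diff has_derivative_scaleR has_derivative_minus has_derivative_mult_right has_derivative_scaleR_right
          has_derivative_ident dF dE dK dN)
    then show ?thesis unfolding Z'_def[abs_def] at_p Fp .
  qed
  have Zx: "Zx x = Z x" if "x \<in> M \<inter> W" for x
    unfolding Zx_def Z_def using Fk[OF that] E(2)[OF that] K(2)[OF that] N(2)[OF that] by simp
  have ipv: "((\<lambda>x. ip v (E x)) has_derivative (\<lambda>u. ip v (DE u))) (at p)" for v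
    by (rule bounded_linear.has_derivative[OF bounded_bilinear.bounded_linear_right[OF bounded_bilinear_pinner] dE])
  have linDE: "linear DE" "linear DN" "linear DK" using dE dN dK has_derivative_linear by blast+
  define B where "B x v = F x *\<^sub>R v + ip v (E x) *\<^sub>R Zx x" for x v
  define B' where "B' u v = D u *\<^sub>R v + (ip v ?e *\<^sub>R Z' u + ip v (DE u) *\<^sub>R Z p)" for u v
  have cod: "B' u v = B' v u" if "u \<in> T p" "v \<in> T p" for u v
  proof (rule derivative_symmetric[OF ext p pW E(1) _ _ _ _ that, where B=B])
    show "frechet_derivative E (at x) v = B x v" if "x \<in> M" "x \<in> W" "v \<in> T x" for x v
      using codazzi(3)[OF ext that] Fk[of x] E(2)[of x] Zx[of x] that unfolding B_def by simp
    show "linear (B x)" for x unfolding B_def by (rule linearI) (simp_all add: pinner_simps algebra_simps)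
    show "linear (B' u)" for u unfolding B'_def by (rule linearI) (simp_all add: pinner_simps algebra_simps)
    show "((\<lambda>x. B x v) has_derivative (\<lambda>u. B' u v)) (at p)" for v
    proof -
      have "((\<lambda>x. B x v) has_derivative (\<lambda>u. D u *\<^sub>R v + (ip v (E p) *\<^sub>R Z' u + ip v (DE u) *\<^sub>R Zx p))) (at p)"
        unfolding B_def by (intro has_derivative_add has_derivative_scaleR_left has_derivative_scaleR dF ipv dZ)
      then show ?thesis unfolding B'_def at_p using Zx[of p] p pW by simp
    qed
  qed
  obtain e where e: "\<And>i. i < n \<Longrightarrow> e i \<in> tangent_space M p" "e (n - 1) = ?e"
    "\<And>i i'. i < n \<Longrightarrow> i' < n \<Longrightarrow> \<bar>ip (e i) (e i')\<bar> = (if i = i' then 1 else 0)"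
    and ex: "\<And>v. v = (\<Sum>i<n. (ip v (e i) * ip (e i) (e i)) *\<^sub>R e i) + (a * ip v p) *\<^sub>R p - (a * ip v (\<nu> p)) *\<^sub>R \<nu> p"
    by (rule frame[OF p]) (rule that; assumption)
  have ee: "ip ?e ?e = a" using en_tangent p by blast
  have eT: "?e \<in> T p" using tangent_in_T en_tangent p by blast
  have ei: "e i \<in> T p" "ip (e i) ?e = 0" "ip ?e (e i) = 0" "ip (e i) (e i) \<noteq> 0"
    "ip (e i) p = 0" "ip (e i) (\<nu> p) = 0" if "i < n - 1" for i
  proof -
    have "i < n" using that by simp
    then show "e i \<in> T p" "ip (e i) (e i) \<noteq> 0" using tangent_in_T[OF p e(1)] e(3)[of i i] by auto
    then show "ip (e i) p = 0" "ip (e i) (\<nu> p) = 0" unfolding T_def by auto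
    show "ip (e i) ?e = 0" "ip ?e (e i) = 0" using e(2) e(3)[of i "n-1"] e(3)[of "n-1" i] that n_gt by auto
  qed
  have DEi: "DE (e i) = ?k *\<^sub>R e i" if "i < n - 1" for i
    unfolding DE_def using codazzi(3)[OF ext p pW ei(1)[OF that]] ei(2)[OF that] by simp
  have ipZ: "ip (e i) (Z p) = 0" if "i < n - 1" for i
    unfolding Z_def using ei[OF that] by (simp add: pinner_simps)
  \<comment> \<open>As for \<lambda>: the component along a second leaf direction isolates
    \<open>D (e i)\<close>.\<close>
  have Di: "D (e i) = 0" if i: "i < n - 1" for i
  proof -
    define j where "j = (if i = 0 then 1 else 0 :: nat)"
    have j: "j < n - 1" "j \<noteq> i" unfolding j_def using n_gt by auto
    have ij: "ip (e i) (e j) = 0" "ip (e j) (e i) = 0" using e(3)[of i j] e(3)[of j i] i j by auto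
    have "ip (B' (e i) (e j)) (e j) = ip (B' (e j) (e i)) (e j)" using cod ei(1) i j by simp
    then show ?thesis unfolding B'_def using ei i j ij DEi by (simp add: pinner_simps)
  qed
  \<comment> \<open>The Riccati equation. It is the \<open>e 0\<close>-component of the
    integrability condition for \<open>e 0\<close> and e_n, where differentiating \<open>Zx\<close>
    along the leaf gives the terms -\<kappa>^2, -1 and \<lambda> \<mu>.\<close>
  have De: "D ?e = - (?k^2) - 1 + lam p * mu p"
  proof -
    have i: "0 < n - 1" using n_gt by simp
    let ?u = "e 0"
    have K0: "DK ?u = 0"
      unfolding DK_def using codazzi(1,2)[OF ext p pW ei(1)[OF i]] ei(2)[OF i] by simp
    have Nu: "DN ?u = - lam p *\<^sub>R ?u" unfolding DN_def
      using normal_derivative[OF ext p pW ei(1)[OF i]] ei(2)[OF i] by simp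
    have DEe: "DE ?e = ?k *\<^sub>R ?e + a *\<^sub>R Z p" unfolding DE_def using codazzi(3)[OF ext p pW eT] ee by simp
    have "B' ?u ?e = B' ?e ?u" using cod ei(1)[OF i] eT by blast
    then have "ip (B' ?u ?e) ?u = ip (B' ?e ?u) ?u" by simp
    moreover have "B' ?u ?e = a *\<^sub>R Z' ?u" unfolding B'_def using Di[OF i] ee DEi[OF i] ei[OF i] by (simp add: pinner_simps)
    moreover have "B' ?e ?u = D ?e *\<^sub>R ?u"
      unfolding B'_def using ei[OF i] DEe ipZ[OF i] by (simp add: pinner_simps)
    moreover have "a *\<^sub>R Z' ?u = (- (?k^2) - 1 + lam p * mu p) *\<^sub>R ?u"
      unfolding Z'_def K0 Nu DEi[OF i] Di[OF i] by (simp add: algebra_simps power2_eq_square)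
    ultimately show ?thesis using ei(4)[OF i] by (simp add: pinner_simps)
  qed
  have Dv: "D v = a * ip v ?e * (- (?k^2) - 1 + lam p * mu p)" if "v \<in> T p" for v
  proof -
    have n1: "{..<n} = insert (n-1) {..<n-1}" using n_gt by auto
    define x where "x i = ip v (e i) * ip (e i) (e i)" for i
    have vx: "v = (\<Sum>i<n. x i *\<^sub>R e i)" using ex[of v] that unfolding T_def x_def by simp
    have "D (\<Sum>i<n. x i *\<^sub>R e i) = (\<Sum>i<n. x i * D (e i))" by (simp add: linear_sum[OF linD] linear_cmul[OF linD])
    also have "\<dots> = a * ip v ?e * (- (?k^2) - 1 + lam p * mu p)" unfolding n1 x_def using Di e(2) ee De by simp
    finally show ?thesis unfolding vx[symmetric] .
  qed
  show thesis by (rule that[OF W pW Fk dF Dv])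
qed

subsection \<open>Evolution along curves\<close>

text \<open>The scalar fields respond only to the e_n-component \<open>m\<close> of the velocity,
  whatever the curve does inside the leaves.\<close>

lemma curve_derivatives:
  assumes S: "open S" "t \<in> S" "\<And>s. s \<in> S \<Longrightarrow> c s \<in> M" and c: "(c has_vector_derivative v) (at t)"
    and m: "m = a * ip v (en (c t))"
  shows "((\<lambda>s. lam (c s)) has_real_derivative - m * kap (c t) * (lam (c t) - mu (c t))) (at t)"
    and "((\<lambda>s. kap (c s)) has_real_derivative m * (- ((kap (c t))^2) - 1 + lam (c t) * mu (c t))) (at t)"
    and "((\<lambda>s. en (c s)) has_vector_derivative kap (c t) *\<^sub>R v + ip v (en (c t)) *\<^sub>R Z (c t)) (at t)"
    and "v \<in> T (c t)"
proof -
  have p: "c t \<in> M" using S by blast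
  show v: "v \<in> T (c t)" using tangent_in_T[OF p tangent_space_of_curve[OF S(1,2,3) c]] by simp
  obtain W N E L K where pW: "c t \<in> W" and ext: "local_extension W N E L K" using local_extension_exists[OF p] by blast
  have W: "open W" and E: "Cinf_on W E" "\<And>x. x \<in> M \<inter> W \<Longrightarrow> E x = en x" and L: "Cinf_on W L" "\<And>x. x \<in> M \<inter> W \<Longrightarrow> L x = lam x"
    using ext unfolding local_extension_def by auto
  show "((\<lambda>s. lam (c s)) has_real_derivative - m * kap (c t) * (lam (c t) - mu (c t))) (at t)"
    using extension_derivative_along_curve[OF W pW L(2) Cinf_on_has_derivative[OF L(1) pW] S c]
      codazzi(1)[OF ext p pW v] unfolding has_real_derivative_iff_has_vector_derivative m by simp
  show "((\<lambda>s. en (c s)) has_vector_derivative kap (c t) *\<^sub>R v + ip v (en (c t)) *\<^sub>R Z (c t)) (at t)"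
    using extension_derivative_along_curve[OF W pW E(2) Cinf_on_has_derivative[OF E(1) pW] S c]
      codazzi(3)[OF ext p pW v] by simp
  obtain W' F D where F: "open W'" "c t \<in> W'" "\<And>x. x \<in> M \<inter> W' \<Longrightarrow> F x = kap x" "(F has_derivative D) (at (c t))"
    "\<And>v. v \<in> T (c t) \<Longrightarrow> D v = a * ip v (en (c t)) * (- ((kap (c t))^2) - 1 + lam (c t) * mu (c t))"
    by (rule kap_derivative[OF p]) (rule that; assumption)
  show "((\<lambda>s. kap (c s)) has_real_derivative m * (- ((kap (c t))^2) - 1 + lam (c t) * mu (c t))) (at t)"
    using extension_derivative_along_curve[OF F(1-4) S c] F(5)[OF v]
    unfolding has_real_derivative_iff_has_vector_derivative m by simp
qed

section \<open>The motion of w, its conserved constant and its equilibria\<close>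

text \<open>Here \<open>w'\<close> is e_n(w), expressed through \<open>kap\<close> so that it can be
  differentiated once more, and \<open>C0\<close> is the associated constant with ad = 1 and bd = -1
  inserted.\<close>

definition w :: "(real, 'm) vec \<Rightarrow> real" where "w p = (lam p - H) powr (- 1 / real n)"
definition w' :: "(real, 'm) vec \<Rightarrow> real" where "w' p = w p * kap p"
definition C0 :: "(real, 'm) vec \<Rightarrow> real" where "C0 p = (w' p)^2 + (w p)^2 * (1 - (lam p)^2)"

lemma w_facts:
  assumes p: "p \<in> M"
  shows "w p > 0" "lam p = H + inverse (w p) ^ n" "w p * (lam p * mu p - 1) = cmc_force n H (w p)"
    "(w' p)^2 = cmc_energy n H (C0 p) (w p)"
proof -
  have pos: "lam p - H > 0" and n0: "n > 0" using lam_minus_mu[OF p] n_gt by auto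
  from powr_root_facts[OF this w_def[of p]] show "w p > 0" and l: "lam p = H + inverse (w p) ^ n" by auto
  show "w p * (lam p * mu p - 1) = cmc_force n H (w p)"
    unfolding mu_eq[OF p] l cmc_force_def by (simp add: algebra_simps del: power_inverse)
  show "(w' p)^2 = cmc_energy n H (C0 p) (w p)"
    unfolding C0_def cmc_energy_def l[symmetric] by (simp add: algebra_simps)
qed

text \<open>Multiplying \<kappa> by w removes the square from the Riccati equation: for m = 1 it
  becomes w'' = w (\<lambda> \<mu> - 1), whose energy integral is \<open>C0\<close>.\<close>

lemma w_curve_derivatives:
  assumes S: "open S" "t \<in> S" "\<And>s. s \<in> S \<Longrightarrow> c s \<in> M" and c: "(c has_vector_derivative v) (at t)"
    and m: "m = a * ip v (en (c t))"
  shows "((\<lambda>s. w (c s)) has_real_derivative m * w' (c t)) (at t)"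
    and "((\<lambda>s. w' (c s)) has_real_derivative m * cmc_force n H (w (c t))) (at t)"
    and "((\<lambda>s. C0 (c s)) has_real_derivative 0) (at t)"
proof -
  note d = curve_derivatives[OF S c m]
  have p: "c t \<in> M" using S by blast
  have pos: "lam (c t) - H > 0" and eta: "lam (c t) - mu (c t) = real n * (lam (c t) - H)" using lam_minus_mu[OF p] by auto
  have "((\<lambda>s. lam (c s) - H) has_real_derivative - m * kap (c t) * (lam (c t) - mu (c t))) (at t)"
    using DERIV_diff[OF d(1) DERIV_const] by simp
  from DERIV_chain2[OF has_real_derivative_powr[OF pos, of "- 1 / real n"] this]
  have "((\<lambda>s. w (c s)) has_real_derivative (- 1 / real n) * (lam (c t) - H) powr (- 1 / real n - 1) * (- m * kap (c t) * (lam (c t) - mu (c t)))) (at t)"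
    unfolding w_def .
  moreover have "(- 1 / real n) * (lam (c t) - H) powr (- 1 / real n - 1) * (- m * kap (c t) * (lam (c t) - mu (c t))) = m * w' (c t)"
  proof -
    have "(lam (c t) - H) powr (- 1 / real n - 1) * (lam (c t) - H) = w (c t)"
      unfolding w_def using pos by (simp add: powr_diff)
    then have e: "(lam (c t) - H) powr (- 1 / real n - 1) * (lam (c t) - mu (c t)) = real n * w (c t)"
      unfolding eta by (simp add: mult_ac)
    have "(- 1 / real n) * (lam (c t) - H) powr (- 1 / real n - 1) * (- m * kap (c t) * (lam (c t) - mu (c t)))
      = (1 / real n) * m * kap (c t) * ((lam (c t) - H) powr (- 1 / real n - 1) * (lam (c t) - mu (c t)))" by simp
    also have "\<dots> = m * w' (c t)" unfolding e w'_def using n_gt by simp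
    finally show ?thesis .
  qed
  ultimately show dw: "((\<lambda>s. w (c s)) has_real_derivative m * w' (c t)) (at t)" by simp
  let ?w = "w (c t)" and ?k = "kap (c t)" and ?l = "lam (c t)" and ?u = "mu (c t)"
  have "((\<lambda>s. w (c s) * kap (c s)) has_real_derivative m * w' (c t) * ?k + m * (- (?k^2) - 1 + ?l * ?u) * ?w) (at t)"
    by (rule DERIV_mult[OF dw d(2)])
  moreover have "m * w' (c t) * ?k + m * (- (?k^2) - 1 + ?l * ?u) * ?w = m * cmc_force n H ?w"
    unfolding w_facts(3)[OF p, symmetric] w'_def by (simp add: algebra_simps power2_eq_square)
  ultimately show dw': "((\<lambda>s. w' (c s)) has_real_derivative m * cmc_force n H (w (c t))) (at t)"
    unfolding w'_def by simp
  have "((\<lambda>s. C0 (c s)) has_real_derivative 2 * w' (c t) * (m * cmc_force n H ?w)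
      + (2 * ?w * (m * w' (c t)) * (1 - ?l^2) + ?w^2 * (- (2 * ?l * (- m * ?k * (?l - ?u)))))) (at t)"
    unfolding C0_def by (auto intro!: derivative_eq_intros dw dw' d(1))
  moreover have "2 * w' (c t) * (m * cmc_force n H ?w)
      + (2 * ?w * (m * w' (c t)) * (1 - ?l^2) + ?w^2 * (- (2 * ?l * (- m * ?k * (?l - ?u))))) = 0"
    unfolding w_facts(3)[OF p, symmetric] w'_def by (simp add: algebra_simps power2_eq_square)
  ultimately show "((\<lambda>s. C0 (c s)) has_real_derivative 0) (at t)" by simp
qed

lemma M_connected: "connected M" and M_complete: "geod_complete (sf_index k a) M"
  and lam_not_const: "\<not> (\<exists>c. \<forall>p\<in>M. lam p = c)"
  using hyps unfolding thm_hyps_def by blast+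

lemma constant_on_M:
  assumes "p \<in> M" "q \<in> M" and loc: "\<And>p. p \<in> M \<Longrightarrow> \<exists>W. open W \<and> p \<in> W \<and> (\<forall>x\<in>M \<inter> W. f x = f p)"
  shows "f p = f q"
proof (rule connected_local_const[OF M_connected assms(1,2)], rule ballI)
  fix p assume "p \<in> M"
  then obtain W where "open W" "p \<in> W" "\<forall>x\<in>M \<inter> W. f x = f p" using loc by blast
  then show "\<forall>\<^sub>F b in at p within M. f p = f b" unfolding eventually_at_topological by fastforce
qed

text \<open>The derivative vanishes along every curve, nearby points are joined by curves, and
  \<open>M\<close> is connected.\<close>

lemma C0_constant: assumes "p \<in> M" "q \<in> M" shows "C0 p = C0 q"
proof (rule constant_on_M[OF assms])
  fix p assume p: "p \<in> M"
  obtain W where W: "open W" "p \<in> W"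
    "\<And>x. x \<in> M \<inter> W \<Longrightarrow> \<exists>c c' \<delta> K. \<delta> > 0 \<and> c 0 = p \<and> c 1 = x \<and>
       (\<forall>t\<in>{-\<delta><..<1+\<delta>}. c t \<in> M \<and> (c has_vector_derivative c' t) (at t) \<and> norm (c' t) \<le> K)"
    by (rule codim2_local_paths[OF submanifold p]) (rule that; assumption)
  have "C0 x = C0 p" if x: "x \<in> M \<inter> W" for x
  proof -
    obtain c c' \<delta> K where c: "\<delta> > 0" "c 0 = p" "c 1 = x"
      "\<forall>t\<in>{-\<delta><..<1+\<delta>}. c t \<in> M \<and> (c has_vector_derivative c' t) (at t) \<and> norm (c' t) \<le> K" using W(3)[OF x] by blast
    have d: "((\<lambda>s. C0 (c s)) has_real_derivative 0) (at t)" if "0 \<le> t" "t \<le> 1" for t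
      by (rule w_curve_derivatives(3)[of "{-\<delta><..<1+\<delta>}" t c "c' t"]) (use c that in auto)
    have "C0 (c 1) = C0 (c 0)"
    proof (rule DERIV_isconst2[of 0 1 "\<lambda>s. C0 (c s)"])
      show "continuous_on {0..1} (\<lambda>s. C0 (c s))"
        by (intro continuous_at_imp_continuous_on ballI DERIV_isCont[OF d]) auto
    qed (use d in auto)
    then show ?thesis using c by simp
  qed
  then show "\<exists>W. open W \<and> p \<in> W \<and> (\<forall>x\<in>M \<inter> W. C0 x = C0 p)" using W by blast
qed

text \<open>Along an arbitrary path the pair (w, w') follows the phase flow at the bounded rate
  \<open>m\<close>. Gronwall applied to its squared distance from the equilibrium (v, 0) shows that
  being there at one end forces being there at the other.\<close>

lemma w_critical_along_path:
  fixes c :: "real \<Rightarrow> (real, 'm) vec"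
  assumes \<delta>: "\<delta> > 0" and c: "\<And>t. t \<in> {-\<delta><..<1+\<delta>} \<Longrightarrow> c t \<in> M"
    "\<And>t. t \<in> {-\<delta><..<1+\<delta>} \<Longrightarrow> (c has_vector_derivative c' t) (at t)" "\<And>t. t \<in> {-\<delta><..<1+\<delta>} \<Longrightarrow> norm (c' t) \<le> K"
    and v: "v > 0" "cmc_force n H v = 0" "cmc_energy n H (C0 (c 0)) v = 0"
  shows "w (c 0) = v \<longleftrightarrow> w (c 1) = v"
proof -
  define S where "S = {-\<delta><..<1+\<delta>}"
  have S: "open S" "\<And>t. 0 \<le> t \<Longrightarrow> t \<le> 1 \<Longrightarrow> t \<in> S" unfolding S_def using \<delta> by auto
  define m where "m t = a * ip (c' t) (en (c t))" for t
  have cM: "c t \<in> M" and dc: "(c has_vector_derivative c' t) (at t)" and nc: "norm (c' t) \<le> K" if "t \<in> S" for t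
    using c that unfolding S_def by auto
  note dw = w_curve_derivatives(1)[OF S(1) _ cM dc m_def]
  note dw' = w_curve_derivatives(2)[OF S(1) _ cM dc m_def]
  note den = curve_derivatives(3)[OF S(1) _ cM dc m_def]
  have cw: "continuous_on {0..1} (\<lambda>t. w (c t))"
    by (intro continuous_at_imp_continuous_on ballI DERIV_isCont[OF dw]) (use S in auto)
  have ce: "continuous_on {0..1} (\<lambda>t. norm (en (c t)))"
    by (intro continuous_on_norm continuous_at_imp_continuous_on ballI has_vector_derivative_continuous[OF den]) (use S in auto)
  obtain t0 where t0: "t0 \<in> {0..1}" "\<And>t. t \<in> {0..1} \<Longrightarrow> w (c t0) \<le> w (c t)"
    using continuous_attains_inf[of "{0..1}", OF _ _ cw] by auto
  have "\<exists>t1\<in>{0..1}. \<forall>t\<in>{0..1}. norm (en (c t)) \<le> norm (en (c t1))"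
    by (rule continuous_attains_sup[OF _ _ ce]) auto
  then obtain t1 where t1: "\<And>t. t \<in> {0..1} \<Longrightarrow> norm (en (c t)) \<le> norm (en (c t1))" by blast
  \<comment> \<open>A common positive lower bound for \<open>v\<close> and for w on the path, so
    that the force is Lipschitz on the range that matters.\<close>
  define lo where "lo = min v (w (c t0))"
  have lo: "lo > 0" unfolding lo_def using v(1) w_facts(1)[OF cM] S t0(1) by auto
  obtain Q where Q: "\<And>x y. lo \<le> x \<Longrightarrow> lo \<le> y \<Longrightarrow> \<bar>cmc_force n H x - cmc_force n H y\<bar> \<le> Q * \<bar>x - y\<bar>"
    using cmc_force_lipschitz[OF lo n_gt] by blast
  obtain B where B: "B > 0" "\<And>x y. \<bar>ip x y\<bar> \<le> norm x * norm y * B"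
    using bounded_bilinear.pos_bounded[OF bounded_bilinear_pinner] unfolding real_norm_def by blast
  define R where "R = \<bar>K\<bar> * norm (en (c t1)) * B"
  have R0: "R \<ge> 0" unfolding R_def using B(1) by simp
  have mR: "\<bar>m t\<bar> \<le> R" if t: "t \<in> {0..1}" for t
  proof -
    have "\<bar>m t\<bar> = \<bar>ip (c' t) (en (c t))\<bar>" unfolding m_def using a_sign by auto
    also have "\<dots> \<le> norm (c' t) * norm (en (c t)) * B" by (rule B(2))
    also have "\<dots> \<le> R" unfolding R_def using nc[of t] S(2)[of t] t1[OF t] B(1) t
      by (intro mult_right_mono mult_mono) auto
    finally show ?thesis .
  qed
  define E where "E t = (w (c t) - v)^2 + (w' (c t))^2" for t
  define E' where "E' t = 2 * (w (c t) - v) * (m t * w' (c t)) + 2 * w' (c t) * (m t * cmc_force n H (w (c t)))" for t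
  have dE: "(E has_real_derivative E' t) (at t)" if "t \<in> {0..1}" for t
    unfolding E_def E'_def using S(2)[of t] that by (auto intro!: derivative_eq_intros dw dw')
  have bd: "\<bar>E' t\<bar> \<le> R * (1 + \<bar>Q\<bar>) * E t" if t: "t \<in> {0..1}" for t
  proof -
    let ?x = "\<bar>w (c t) - v\<bar>" and ?y = "\<bar>w' (c t)\<bar>" and ?f = "\<bar>cmc_force n H (w (c t))\<bar>"
    have "?f \<le> Q * ?x" using Q[of "w (c t)" v] t0(2)[OF t] v(2) unfolding lo_def by simp
    also have "\<dots> \<le> \<bar>Q\<bar> * ?x" by (intro mult_right_mono) auto
    finally have f: "?f \<le> \<bar>Q\<bar> * ?x" .
    have "E' t = m t * (2 * (w (c t) - v) * w' (c t) + 2 * w' (c t) * cmc_force n H (w (c t)))"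
      unfolding E'_def by (simp add: algebra_simps)
    then have "\<bar>E' t\<bar> = \<bar>m t\<bar> * \<bar>2 * (w (c t) - v) * w' (c t) + 2 * w' (c t) * cmc_force n H (w (c t))\<bar>" by (simp add: abs_mult)
    also have "\<dots> \<le> R * (2 * ?x * ?y + 2 * ?y * ?f)"
    proof (rule mult_mono[OF mR[OF t]])
      show "\<bar>2 * (w (c t) - v) * w' (c t) + 2 * w' (c t) * cmc_force n H (w (c t))\<bar> \<le> 2 * ?x * ?y + 2 * ?y * ?f"
        by (rule order_trans[OF abs_triangle_ineq]) (simp only: abs_mult abs_numeral order_refl)
    qed (use R0 in auto)
    also have "\<dots> \<le> R * (2 * ?x * ?y + 2 * ?y * (\<bar>Q\<bar> * ?x))"
      using f R0 by (intro mult_left_mono add_left_mono) auto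
    also have "\<dots> = R * (1 + \<bar>Q\<bar>) * (2 * ?x * ?y)" by (simp add: algebra_simps)
    also have "\<dots> \<le> R * (1 + \<bar>Q\<bar>) * (?x^2 + ?y^2)"
      using R0 sum_squares_bound[of ?x ?y] by (intro mult_left_mono) auto
    also have "\<dots> = R * (1 + \<bar>Q\<bar>) * E t" unfolding E_def by simp
    finally show ?thesis .
  qed
  have E0: "E t \<ge> 0" for t unfolding E_def by simp
  have C: "C0 (c t) = C0 (c 0)" if "t \<in> {0..1}" for t
    by (rule C0_constant) (use cM S that in auto)
  \<comment> \<open>At w = v the conserved constant makes the energy zero, hence w' = 0; position
    alone detects the equilibrium.\<close>
  have Ev: "E t = 0 \<longleftrightarrow> w (c t) = v" if t: "t \<in> {0..1}" for t
  proof -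
    have "c t \<in> M" using cM S(2)[of t] t by auto
    from w_facts(4)[OF this] have "w' (c t) = 0" if "w (c t) = v" using v(3) C[OF t] that by simp
    then show ?thesis unfolding E_def by (auto simp: sum_power2_eq_zero_iff)
  qed
  have "E 1 = 0" if "E 0 = 0"
    by (rule gronwall_zero[OF zero_le_one dE, where K="R * (1 + \<bar>Q\<bar>)"]) (use bd E0 that in \<open>auto simp: abs_le_iff\<close>)
  moreover have "E 0 = 0" if "E 1 = 0"
  proof -
    have "(\<lambda>s. E (1 - s)) 1 = 0"
    proof (rule gronwall_zero[OF zero_le_one, where K="R * (1 + \<bar>Q\<bar>)" and E'="\<lambda>s. - E' (1 - s)" and E="\<lambda>s. E (1 - s)"])
      show "((\<lambda>s. E (1 - s)) has_real_derivative - E' (1 - t)) (at t)" if "0 \<le> t" "t \<le> 1" for t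
        by (rule DERIV_reverse[OF dE]) (use that in auto)
      show "- E' (1 - t) \<le> R * (1 + \<bar>Q\<bar>) * E (1 - t)" if "0 \<le> t" "t \<le> 1" for t
        using bd[of "1 - t"] that by (auto simp: abs_le_iff)
    qed (use E0 that in auto)
    then show ?thesis by simp
  qed
  ultimately show ?thesis using Ev[of 0] Ev[of 1] by auto
qed

text \<open>If \<open>w q\<close> is an equilibrium value, the condition w = \<open>w q\<close> is
  locally constant on the connected \<open>M\<close>. Then w and with it \<lambda> would be
  constant.\<close>

lemma w_never_critical:
  assumes p: "p \<in> M" "q \<in> M" and v: "cmc_force n H (w q) = 0" "cmc_energy n H (C0 p) (w q) = 0"
  shows False
proof -
  have "(w x = w q) = (w q = w q)" if x: "x \<in> M" for x
  proof (rule constant_on_M[OF x p(2)])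
    fix p assume p': "p \<in> M"
    obtain W where W: "open W" "p \<in> W"
      "\<And>x. x \<in> M \<inter> W \<Longrightarrow> \<exists>c c' \<delta> K. \<delta> > 0 \<and> c 0 = p \<and> c 1 = x \<and>
         (\<forall>t\<in>{-\<delta><..<1+\<delta>}. c t \<in> M \<and> (c has_vector_derivative c' t) (at t) \<and> norm (c' t) \<le> K)"
      by (rule codim2_local_paths[OF submanifold p']) (rule that; assumption)
    have "(w x = w q) = (w p = w q)" if x: "x \<in> M \<inter> W" for x
    proof -
      obtain c c' \<delta> K where c: "\<delta> > 0" "c 0 = p" "c 1 = x"
        "\<forall>t\<in>{-\<delta><..<1+\<delta>}. c t \<in> M \<and> (c has_vector_derivative c' t) (at t) \<and> norm (c' t) \<le> K" using W(3)[OF x] by blast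
      have "w (c 0) = w q \<longleftrightarrow> w (c 1) = w q"
        by (rule w_critical_along_path[of \<delta> c c' K])
           (use c v w_facts(1)[OF p(2)] C0_constant[OF p' p(1)] in auto)
      then show ?thesis using c by simp
    qed
    then show "\<exists>W. open W \<and> p \<in> W \<and> (\<forall>x\<in>M \<inter> W. (w x = w q) = (w p = w q))" using W by blast
  qed
  then have "lam x = H + inverse (w q) ^ n" if "x \<in> M" for x using w_facts(2)[OF that] that by simp
  then show False using lam_not_const by blast
qed

lemma unit_speed_motion:
  assumes p: "p \<in> M" and c: "\<And>t. c t \<in> M" "\<And>t. (c has_vector_derivative c' t) (at t)" "\<And>t. a * ip (c' t) (en (c t)) = 1"
  shows "cmc_motion n H (C0 p) (\<lambda>t. w (c t)) (\<lambda>t. w' (c t))" "never_critical n H (C0 p) (\<lambda>t. w (c t))"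
proof -
  have n0: "n > 0" using n_gt by simp
  have "((\<lambda>t. w (c t)) has_real_derivative w' (c t)) (at t)"
    "((\<lambda>t. w' (c t)) has_real_derivative cmc_force n H (w (c t))) (at t)" for t
    using w_curve_derivatives(1,2)[OF open_UNIV UNIV_I c(1) c(2) refl, of t] c(3)[of t] by simp_all
  moreover have "isCont (cmc_energy n H (C0 p)) x \<and> isCont (cmc_force n H) x" if "x > 0" for x
    using DERIV_isCont[OF DERIV_cmc_energy[OF that n0]] DERIV_isCont[OF DERIV_cmc_force[OF that n0]] by blast
  ultimately show "cmc_motion n H (C0 p) (\<lambda>t. w (c t)) (\<lambda>t. w' (c t))"
    unfolding energy_motion_def using w_facts(1,4)[OF c(1)] C0_constant[OF p c(1)] by simp
  show "never_critical n H (C0 p) (\<lambda>t. w (c t))"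
    unfolding never_critical_def using w_never_critical[OF p c(1)] by blast
qed

lemma integral_curve_motion:
  assumes p: "p \<in> M" and g: "integral_curve M en \<gamma>"
  shows "cmc_motion n H (C0 p) (\<lambda>t. w (\<gamma> t)) (\<lambda>t. w' (\<gamma> t))" "never_critical n H (C0 p) (\<lambda>t. w (\<gamma> t))"
proof -
  have g: "\<gamma> t \<in> M" "(\<gamma> has_vector_derivative en (\<gamma> t)) (at t)" for t using g unfolding integral_curve_def by auto
  have "a * ip (en (\<gamma> t)) (en (\<gamma> t)) = 1" for t using en_tangent(2)[OF g(1)] by simp
  from unit_speed_motion[OF p g this] show "cmc_motion n H (C0 p) (\<lambda>t. w (\<gamma> t)) (\<lambda>t. w' (\<gamma> t))"
    "never_critical n H (C0 p) (\<lambda>t. w (\<gamma> t))" .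
qed

text \<open>Completeness enters here. A geodesic starting in the direction \<open>e\<^sub>n\<close> keeps
  \<open>\<langle>c', e\<^sub>n\<rangle> = \<langle>e\<^sub>n, e\<^sub>n\<rangle>\<close>, so \<open>w\<close> evolves along it as along an integral curve of \<open>e\<^sub>n\<close>
  (in the indefinite case the geodesic might differ from the integral curve by a null vector,
  but this is irrelevant for \<open>w\<close>).\<close>

lemma geodesic_motion:
  assumes p: "p \<in> M"
  obtains g g' where "cmc_motion n H (C0 p) g g'" "never_critical n H (C0 p) g"
proof -
  obtain c c' c'' where c: "c 0 = p" "c' 0 = en p" "\<And>t. c t \<in> M" "\<And>t. (c has_vector_derivative c' t) (at t)"
    "\<And>t. (c' has_vector_derivative c'' t) (at t)" "\<And>t u. u \<in> tangent_space M (c t) \<Longrightarrow> ip (c'' t) u = 0"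
    using M_complete[unfolded geod_complete_def, rule_format, OF p en_tangent(1)[OF p]] by blast
  have tan: "c' t \<in> tangent_space M (c t)" for t by (rule tangent_space_of_curve[OF open_UNIV UNIV_I c(3) c(4)])
  define m where "m t = a * ip (c' t) (en (c t))" for t
  note den = curve_derivatives(3)[OF open_UNIV UNIV_I c(3) c(4) m_def]
  note dkap = curve_derivatives(2)[OF open_UNIV UNIV_I c(3) c(4) m_def]
  \<comment> \<open>The acceleration is orthogonal to \<open>M\<close>, so the self-product of the
    velocity keeps its initial value <e_n,e_n> = a.\<close>
  have speed: "ip (c' t) (c' t) = a" for t
  proof -
    have "((\<lambda>t. ip (c' t) (c' t)) has_real_derivative 0) (at t)" for t
      using pinner_has_vector_derivative[OF c(5) c(5), of "sf_index k a" t] c(6)[OF tan, of t] pinner_commute[of _ "c' t" "c'' t"]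
      unfolding has_real_derivative_iff_has_vector_derivative by simp
    then have "ip (c' t) (c' t) = ip (c' 0) (c' 0)" using DERIV_isconst_all by blast
    then show ?thesis using c(1,2) en_tangent(2)[OF p] by simp
  qed
  \<comment> \<open>This is m' = \<kappa> (1 - m^2), factored as a linear equation for m - 1 so that
    uniqueness for linear equations applies.\<close>
  have dm: "((\<lambda>t. m t - 1) has_real_derivative (- kap (c t) * (m t + 1)) * (m t - 1)) (at t)" for t
  proof -
    have T: "c' t \<in> T (c t)" using tangent_in_T[OF c(3) tan] .
    have iZ: "ip (c' t) (Z (c t)) = - kap (c t) * m t" unfolding Z_def m_def using T
      by (simp add: T_def pinner_simps)
    have ie: "ip (c' t) (en (c t)) = a * m t" unfolding m_def by simp
    have "((\<lambda>t. ip (c' t) (en (c t))) has_vector_derivative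
        (ip (c' t) (kap (c t) *\<^sub>R c' t + ip (c' t) (en (c t)) *\<^sub>R Z (c t)) + ip (c'' t) (en (c t)))) (at t)"
      by (rule pinner_has_vector_derivative[OF c(5) den])
    then have "((\<lambda>t. ip (c' t) (en (c t))) has_real_derivative a * (kap (c t) - kap (c t) * (m t)^2)) (at t)"
      unfolding has_real_derivative_iff_has_vector_derivative pinner_simps speed iZ ie c(6)[OF en_tangent(1)[OF c(3)]]
      by (simp add: algebra_simps power2_eq_square)
    from DERIV_diff[OF DERIV_cmult[OF this, of a] DERIV_const, of 1]
    show ?thesis unfolding m_def[symmetric] by (simp add: algebra_simps power2_eq_square)
  qed
  have "continuous_on UNIV (\<lambda>t. - kap (c t) * (m t + 1))"
  proof -
    have "isCont (\<lambda>t. m t - 1) t" for t by (rule DERIV_isCont[OF dm])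
    from continuous_add[OF this continuous_const, of _ 1] have "isCont m t" for t by simp
    then show ?thesis using DERIV_isCont[OF dkap] by (intro continuous_at_imp_continuous_on ballI continuous_intros)
  qed
  moreover have "m 0 - 1 = 0" unfolding m_def using c(1,2) en_tangent(2)[OF p] by simp
  ultimately have "m t - 1 = 0" for t using linear_ode_zero[of "\<lambda>t. m t - 1", OF dm] by blast
  then have "a * ip (c' t) (en (c t)) = 1" for t unfolding m_def by simp
  from unit_speed_motion[OF p c(3,4) this] show thesis using that by blast
qed

text \<open>Identifies the term e_n(w) of the associated constant with the function
  \<open>w'\<close> used in the dynamics.\<close>

lemma Mderiv_w: assumes p: "p \<in> M" shows "Mderiv M w p (en p) = w' p"
proof -
  obtain W N E L K where pW: "p \<in> W" and ext: "local_extension W N E L K" using local_extension_exists[OF p] by blast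
  have W: "open W" and L: "Cinf_on W L" "\<And>x. x \<in> M \<inter> W \<Longrightarrow> L x = lam x"
    using ext unfolding local_extension_def by auto
  define U where "U = W \<inter> L -` {H<..}"
  have cL: "continuous_on W L"
    by (intro continuous_at_imp_continuous_on ballI has_derivative_continuous[OF Cinf_on_has_derivative[OF L(1)]])
  have U: "open U" unfolding U_def by (rule continuous_open_preimage[OF cL W]) simp
  have pU: "p \<in> U" unfolding U_def using pW L(2)[of p] p lam_minus_mu(2)[OF p] by simp
  define F where "F x = (L x - H) powr (- 1 / real n)" for x
  have F: "Cinf_on U F" unfolding F_def
    by (intro Cinf_onI U Ck_on_powr Ck_on_diff Ck_on_const Ck_on_subset[OF Cinf_on_Ck[OF L(1)]]) (auto simp: U_def)
  have Fw: "F x = w x" if "x \<in> M \<inter> U" for x unfolding F_def w_def using L(2)[of x] that unfolding U_def by auto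
  have eT: "en p \<in> T p" using tangent_in_T en_tangent p by blast
  have "en p \<in> tangent_space M p" using en_tangent[OF p] by blast
  then obtain c e where c: "0 < e" "\<And>t. t \<in> {-e<..<e} \<Longrightarrow> c t \<in> M" "c 0 = p" "(c has_vector_derivative en p) (at 0)"
    unfolding tangent_space_def by blast
  have S: "open {-e<..<e}" "0 \<in> {-e<..<e}" using c(1) by auto
  have "((\<lambda>s. w (c s)) has_vector_derivative frechet_derivative F (at p) (en p)) (at 0)"
    using extension_derivative_along_curve[of U c 0 M F w, OF U _ Fw _ S c(2) c(4)] pU c(3) Cinf_on_has_derivative[OF F pU] by simp
  moreover have "((\<lambda>s. w (c s)) has_vector_derivative w' p) (at 0)"
    using w_curve_derivatives(1)[OF S c(2) c(4) refl] c(3) en_tangent(2)[OF p]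
    unfolding has_real_derivative_iff_has_vector_derivative by simp
  ultimately have "frechet_derivative F (at p) (en p) = w' p" using vector_derivative_unique_at by blast
  then show ?thesis using Mderiv_extension[OF p pU F Fw eT] by simp
qed

text \<open>No integral curve of e_n is given here, so the motion along a geodesic takes its
  place.\<close>

theorem H_range: "H \<notin> {- 2 * sqrt (real n - 1) / real n .. 1}"
proof -
  obtain p where "p \<in> M" using lam_not_const by blast
  then obtain g g' where "cmc_motion n H (C0 p) g g'" "never_critical n H (C0 p) g" using geodesic_motion by blast
  then show ?thesis using cmc_motion_H_excluded[OF n_gt] by blast
qed

end

section \<open>Global solutions of Lipschitz equations\<close>

lemma antiderivative_UNIV:
  fixes f :: "real \<Rightarrow> 'a::banach"
  assumes c: "continuous_on UNIV f"
  obtains F where "F 0 = 0" "\<And>t. (F has_vector_derivative f t) (at t)"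
proof -
  define F where "F t = integral {0..t} f - integral {t..0} f" for t
  have int: "f integrable_on {a..b}" for a b
    by (rule integrable_continuous_real[OF continuous_on_subset[OF c]]) simp
  have "(F has_vector_derivative f t) (at t)" for t
  proof -
    define T where "T = \<bar>t\<bar> + 1"
    define G where "G u = integral {-T..u} f" for u
    have FG: "F u = G u - G 0" if "u \<in> {-T<..<T}" for u
    proof (cases "u \<ge> 0")
      case True
      have "integral {-T..0} f + integral {0..u} f = integral {-T..u} f"
        by (rule Henstock_Kurzweil_Integration.integral_combine) (use that True int T_def in auto)
      moreover have "integral {u..0} f = 0" using True by (cases "u = 0") auto
      ultimately show ?thesis unfolding F_def G_def by (simp add: algebra_simps)
    next
      case False
      have "integral {-T..u} f + integral {u..0} f = integral {-T..0} f"
        by (rule Henstock_Kurzweil_Integration.integral_combine) (use that False int in auto)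
      moreover have "integral {0..u} f = 0" using False by simp
      ultimately show ?thesis unfolding F_def G_def by (simp add: algebra_simps)
    qed
    have t: "t \<in> {-T<..<T}" unfolding T_def by auto
    have "(G has_vector_derivative f t) (at t within {-T..T})" unfolding G_def
      by (rule integral_has_vector_derivative[OF continuous_on_subset[OF c]]) (use t in auto)
    then have "(G has_vector_derivative f t) (at t)"
      using t at_within_interior[of t "{-T..T}"] by (simp add: interior_atLeastAtMost_real)
    then have "((\<lambda>u. G u - G 0) has_vector_derivative f t) (at t)"
      using has_vector_derivative_diff[OF _ has_vector_derivative_const] by force
    then show ?thesis
      by (rule has_vector_derivative_transform_within_open[OF _ _ t]) (use FG in auto)
  qed
  moreover have "F 0 = 0" unfolding F_def by simp
  ultimately show thesis using that by blast
qed

text \<open>Integration divides a bound with weight exp(l |t|) by \<open>l\<close>. This gain is the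
  contraction factor in the global existence theorem below.\<close>

lemma exponential_growth_bound:
  fixes D :: "real \<Rightarrow> 'a::banach"
  assumes D: "D 0 = 0" "\<And>t. (D has_vector_derivative D' t) (at t)" and bd: "\<And>t. norm (D' t) \<le> B * exp (l * \<bar>t\<bar>)"
    and l: "l > 0" "B \<ge> 0"
  shows "norm (D t) \<le> B / l * exp (l * \<bar>t\<bar>)"
proof -
  have pos: "norm (D t) \<le> B / l * exp (l * t)" if "t \<ge> 0" and D: "D 0 = 0" "\<And>t. (D has_vector_derivative D' t) (at t)"
    and bd: "\<And>t. norm (D' t) \<le> B * exp (l * \<bar>t\<bar>)" for D D' :: "real \<Rightarrow> 'a" and t
  proof (cases "t = 0")
    case True then show ?thesis using D(1) l by simp
  next
    case False
    then have t: "0 < t" using that(1) by simp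
    have dphi: "((\<lambda>s. B / l * exp (l * s)) has_vector_derivative B * exp (l * s)) (at s)" for s
      unfolding has_real_derivative_iff_has_vector_derivative[symmetric]
      using l by (auto intro!: derivative_eq_intros)
    have "norm (D t - D 0) \<le> B / l * exp (l * t) - B / l * exp (l * 0)"
    proof (rule differentiable_bound_general[OF t])
      show "continuous_on {0..t} D"
        by (intro continuous_at_imp_continuous_on ballI has_vector_derivative_continuous[OF D(2)])
      show "continuous_on {0..t} (\<lambda>s. B / l * exp (l * s))" by (intro continuous_intros)
      show "norm (D' x) \<le> B * exp (l * x)" if "0 < x" "x < t" for x using bd[of x] that by simp
    qed (use D(2) dphi in auto)
    moreover have "B / l * exp (l * 0) \<ge> 0" using l by simp
    ultimately show ?thesis using D(1) by simp
  qed
  show ?thesis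
  proof (cases "t \<ge> 0")
    case True then show ?thesis using pos[OF True D bd] by simp
  next
    case False
    have d: "((\<lambda>s. D (- s)) has_vector_derivative - D' (- s)) (at s)" for s
    proof -
      have "((\<lambda>s. - s) has_vector_derivative - 1) (at s)" by (auto intro!: derivative_eq_intros)
      from vector_diff_chain_at[OF this, of D "D' (- s)"] D(2) show ?thesis by (simp add: o_def)
    qed
    have "norm (D (- (- t))) \<le> B / l * exp (l * (- t))"
      by (rule pos[where D="\<lambda>s. D (- s)", OF _ _ d]) (use False D(1) bd[of "- _"] in auto)
    then show ?thesis using False by simp
  qed
qed

text \<open>With the weight exp(2 L |t|) the Picard iteration halves distances on the whole line at
  once, so no continuation of local solutions is necessary.\<close>

theorem picard_global:
  fixes \<Phi> :: "'a::banach \<Rightarrow> 'a"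
  assumes lip: "\<And>x y. norm (\<Phi> x - \<Phi> y) \<le> K * norm (x - y)"
  obtains y where "y 0 = y0" "\<And>t. (y has_vector_derivative \<Phi> (y t)) (at t)"
proof -
  define L where "L = \<bar>K\<bar> + 1"
  have L: "L > 0" "\<And>x y. norm (\<Phi> x - \<Phi> y) \<le> L * norm (x - y)"
  proof -
    show "L > 0" unfolding L_def by simp
    have "K \<le> L" unfolding L_def by simp
    then show "norm (\<Phi> x - \<Phi> y) \<le> L * norm (x - y)" for x y
      by (rule order_trans[OF lip mult_right_mono[OF _ norm_ge_zero]])
  qed
  have contPhi: "continuous_on UNIV \<Phi>"
    by (rule lipschitz_on_continuous_on[OF lipschitz_onI[of UNIV \<Phi> L]]) (use L in \<open>auto simp: dist_norm\<close>)
  define anti :: "(real \<Rightarrow> 'a) \<Rightarrow> real \<Rightarrow> 'a" where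
    "anti f = (SOME F. F 0 = 0 \<and> (\<forall>t. (F has_vector_derivative f t) (at t)))" for f
  have anti: "anti f 0 = 0" "(anti f has_vector_derivative f t) (at t)" if "continuous_on UNIV f" for f t
  proof -
    have "\<exists>F. F 0 = 0 \<and> (\<forall>t. (F has_vector_derivative f t) (at t))" using antiderivative_UNIV[OF that] by metis
    from someI_ex[OF this] show "anti f 0 = 0" "(anti f has_vector_derivative f t) (at t)" unfolding anti_def by blast+
  qed
  define it where "it x t = y0 + anti (\<lambda>t. \<Phi> (x t)) t" for x t
  have it: "it x 0 = y0" "(it x has_vector_derivative \<Phi> (x t)) (at t)" if "continuous_on UNIV x" for x t
  proof -
    have c: "continuous_on UNIV (\<lambda>t. \<Phi> (x t))" by (rule continuous_on_compose2[OF contPhi that]) simp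
    show "it x 0 = y0" unfolding it_def using anti(1)[OF c] by simp
    show "(it x has_vector_derivative \<Phi> (x t)) (at t)" unfolding it_def
      using has_vector_derivative_add[OF has_vector_derivative_const anti(2)[OF c]] by simp
  qed
  have cont_it: "continuous_on UNIV (it x)" if "continuous_on UNIV x" for x
    by (intro continuous_at_imp_continuous_on ballI has_vector_derivative_continuous[OF it(2)[OF that]])
  define Y where "Y k = (it ^^ k) (\<lambda>_. y0)" for k
  have Y0: "Y 0 = (\<lambda>_. y0)" and YS: "Y (Suc k) = it (Y k)" for k unfolding Y_def by auto
  have cY: "continuous_on UNIV (Y k)" for k by (induction k) (auto simp: Y0 YS intro: cont_it)
  \<comment> \<open>Twice the Lipschitz constant, which makes the contraction factor L / l equal to
    1/2.\<close>
  define l where "l = 2 * L"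
  have l: "l > 0" unfolding l_def using L by simp
  have contract: "norm (it x t - it z t) \<le> B / 2 * exp (l * \<bar>t\<bar>)"
    if "continuous_on UNIV x" "continuous_on UNIV z" "\<And>t. norm (x t - z t) \<le> B * exp (l * \<bar>t\<bar>)" for x z B t
  proof -
    have B: "B \<ge> 0" using order_trans[OF norm_ge_zero that(3)[of 0]] by simp
    have "norm (it x t - it z t) \<le> (L * B) / l * exp (l * \<bar>t\<bar>)"
    proof (rule exponential_growth_bound[where D="\<lambda>t. it x t - it z t" and D'="\<lambda>t. \<Phi> (x t) - \<Phi> (z t)"])
      show "((\<lambda>t. it x t - it z t) has_vector_derivative \<Phi> (x t) - \<Phi> (z t)) (at t)" for t
        by (rule has_vector_derivative_diff[OF it(2)[OF that(1)] it(2)[OF that(2)]])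
      show "norm (\<Phi> (x t) - \<Phi> (z t)) \<le> L * B * exp (l * \<bar>t\<bar>)" for t
        using order_trans[OF L(2) mult_left_mono[OF that(3)[of t] less_imp_le[OF L(1)]]] by (simp add: mult.assoc)
    qed (use it(1) that l L B in auto)
    also have "(L * B) / l = B / 2" unfolding l_def using L(1) by simp
    finally show ?thesis .
  qed
  define A where "A = norm (\<Phi> y0) / l"
  have A: "A \<ge> 0" unfolding A_def using l by simp
  have step: "norm (Y (Suc k) t - Y k t) \<le> A / 2 ^ k * exp (l * \<bar>t\<bar>)" for k t
  proof (induction k arbitrary: t)
    case 0
    have "norm (Y (Suc 0) t - y0) \<le> norm (\<Phi> y0) / l * exp (l * \<bar>t\<bar>)"
    proof (rule exponential_growth_bound[where D="\<lambda>t. Y (Suc 0) t - y0" and D'="\<lambda>_. \<Phi> y0"])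
      show "((\<lambda>t. Y (Suc 0) t - y0) has_vector_derivative \<Phi> y0) (at t)" for t
        using has_vector_derivative_diff[OF it(2)[OF cY[of 0], of t] has_vector_derivative_const] unfolding YS Y0 by simp
      show "norm (\<Phi> y0) \<le> norm (\<Phi> y0) * exp (l * \<bar>t\<bar>)" for t
        using mult_left_mono[of 1 "exp (l * \<bar>t\<bar>)" "norm (\<Phi> y0)"] l by simp
    qed (use it(1)[OF cY[of 0]] l in \<open>auto simp: YS\<close>)
    then show ?case unfolding A_def by (simp add: Y0)
  next
    case (Suc k)
    have "norm (it (Y (Suc k)) t - it (Y k) t) \<le> (A / 2 ^ k) / 2 * exp (l * \<bar>t\<bar>)"
      by (rule contract[OF cY cY Suc])
    then show ?case by (simp add: YS mult.commute)
  qed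
  have tail: "norm (Y (k + m) t - Y k t) \<le> (2 * A / 2 ^ k) * exp (l * \<bar>t\<bar>)" for k m t
  proof -
    have "norm (Y (k + m) t - Y k t) \<le> (2 * A / 2 ^ k) * (1 - 1 / 2 ^ m) * exp (l * \<bar>t\<bar>)"
    proof (induction m)
      case (Suc m)
      have "norm (Y (k + Suc m) t - Y k t) \<le> norm (Y (Suc (k + m)) t - Y (k + m) t) + norm (Y (k + m) t - Y k t)"
        using norm_triangle_ineq[of "Y (Suc (k + m)) t - Y (k + m) t" "Y (k + m) t - Y k t"] by simp
      also have "\<dots> \<le> A / 2 ^ (k + m) * exp (l * \<bar>t\<bar>) + (2 * A / 2 ^ k) * (1 - 1 / 2 ^ m) * exp (l * \<bar>t\<bar>)"
        using step Suc by (intro add_mono) auto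
      also have "\<dots> = (2 * A / 2 ^ k) * (1 - 1 / 2 ^ Suc m) * exp (l * \<bar>t\<bar>)" by (simp add: power_add field_simps)
      finally show ?case .
    qed simp
    also have "\<dots> \<le> (2 * A / 2 ^ k) * 1 * exp (l * \<bar>t\<bar>)" using A by (intro mult_right_mono mult_left_mono) auto
    finally show ?thesis by simp
  qed
  have lim0: "((\<lambda>k. (2 * A / 2 ^ k) * c) \<longlonglongrightarrow> 0)" for c
  proof -
    have "(\<lambda>k. 2 * A * c * (1/2) ^ k) \<longlonglongrightarrow> 2 * A * c * 0" by (intro tendsto_intros LIMSEQ_realpow_zero) auto
    then show ?thesis by (simp add: power_divide mult_ac)
  qed
  have "Cauchy (\<lambda>k. Y k t)" for t
  proof (rule CauchyI')
    fix e :: real assume "e > 0"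
    then obtain N where N: "(2 * A / 2 ^ N) * exp (l * \<bar>t\<bar>) < e / 2"
      using order_tendstoD(2)[OF lim0[of "exp (l * \<bar>t\<bar>)"], of "e/2"] unfolding eventually_sequentially by auto
    have h: "norm (Y i t - Y N t) < e / 2" if "i \<ge> N" for i using tail[of N "i - N" t] N that by simp
    have "dist (Y i t) (Y j t) < e" if "i \<ge> N" "j > i" for i j
    proof -
      have "norm (Y i t - Y N t) < e / 2" "norm (Y j t - Y N t) < e / 2" using h that by auto
      then show ?thesis using dist_triangle2[of "Y i t" "Y j t" "Y N t"] unfolding dist_norm by linarith
    qed
    then show "\<exists>M. \<forall>m\<ge>M. \<forall>n>m. dist (Y m t) (Y n t) < e" by blast
  qed
  then have "\<exists>z. (\<lambda>k. Y k t) \<longlonglongrightarrow> z" for t using Cauchy_convergent convergent_def by blast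
  then obtain y where y: "\<And>t. (\<lambda>k. Y k t) \<longlonglongrightarrow> y t" by metis
  have err: "norm (y t - Y k t) \<le> (2 * A / 2 ^ k) * exp (l * \<bar>t\<bar>)" for k t
  proof (rule Lim_bounded[where M=k])
    show "(\<lambda>m. norm (Y m t - Y k t)) \<longlonglongrightarrow> norm (y t - Y k t)" by (intro tendsto_intros y)
    show "\<forall>m\<ge>k. norm (Y m t - Y k t) \<le> (2 * A / 2 ^ k) * exp (l * \<bar>t\<bar>)"
      using tail[of k "_ - k" t] by (metis le_add_diff_inverse)
  qed
  have "isCont y t" for t
  proof -
    have "uniform_limit (ball t 1) Y y sequentially"
    proof (rule uniform_limitI)
      fix e :: real assume "e > 0"
      then have "\<forall>\<^sub>F k in sequentially. (2 * A / 2 ^ k) * exp (l * (\<bar>t\<bar> + 1)) < e" using order_tendstoD(2)[OF lim0] by blast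
      then show "\<forall>\<^sub>F k in sequentially. \<forall>s\<in>ball t 1. dist (Y k s) (y s) < e"
      proof (rule eventually_mono, intro ballI)
        fix k s assume k: "(2 * A / 2 ^ k) * exp (l * (\<bar>t\<bar> + 1)) < e" and s: "s \<in> ball t 1"
        have "\<bar>s\<bar> \<le> \<bar>t\<bar> + 1" using s by (auto simp: dist_real_def)
        then have "(2 * A / 2 ^ k) * exp (l * \<bar>s\<bar>) \<le> (2 * A / 2 ^ k) * exp (l * (\<bar>t\<bar> + 1))"
          using A l by (intro mult_left_mono) auto
        then show "dist (Y k s) (y s) < e" using err[of s k] k by (simp add: dist_norm norm_minus_commute)
      qed
    qed
    then have "continuous_on (ball t 1) y"
      by (rule uniform_limit_theorem[rotated]) (auto intro!: always_eventually continuous_on_subset[OF cY])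
    then show "isCont y t" using continuous_on_eq_continuous_at[of "ball t 1" y] by simp
  qed
  then have cy: "continuous_on UNIV y" by (intro continuous_at_imp_continuous_on) auto
  have "y t = it y t" for t
  proof -
    have "(\<lambda>k. Y (Suc k) t - it y t) \<longlonglongrightarrow> 0"
    proof (rule tendsto_norm_zero_cancel, rule tendsto_sandwich[of "\<lambda>_. 0" _ _ "\<lambda>k. (2 * A / 2 ^ k) * (exp (l * \<bar>t\<bar>) / 2)"])
      have "norm (Y (Suc k) t - it y t) \<le> (2 * A / 2 ^ k) * (exp (l * \<bar>t\<bar>) / 2)" for k
        unfolding YS using contract[OF cY cy, of k "2 * A / 2 ^ k" t] err[of _ k] by (simp add: norm_minus_commute)
      then show "\<forall>\<^sub>F k in sequentially. norm (Y (Suc k) t - it y t) \<le> (2 * A / 2 ^ k) * (exp (l * \<bar>t\<bar>) / 2)" by simp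
      show "(\<lambda>k. (2 * A / 2 ^ k) * (exp (l * \<bar>t\<bar>) / 2)) \<longlonglongrightarrow> 0" by (rule lim0)
    qed auto
    moreover have "(\<lambda>k. Y (Suc k) t - it y t) \<longlonglongrightarrow> y t - it y t"
      by (intro tendsto_intros LIMSEQ_Suc y)
    ultimately show ?thesis using LIMSEQ_unique by fastforce
  qed
  then have "y = it y" by blast
  then show thesis using that[of y] it[OF cy] by metis
qed

corollary second_order_global:
  fixes G :: "real \<Rightarrow> real"
  assumes lip: "\<And>x y. \<bar>G x - G y\<bar> \<le> K * \<bar>x - y\<bar>"
  obtains x x' where "x 0 = x0" "x' 0 = v0" "\<And>t. (x has_real_derivative x' t) (at t)"
    "\<And>t. (x' has_real_derivative G (x t)) (at t)"
proof -
  define \<Phi> where "\<Phi> z = (snd z, G (fst z))" for z :: "real \<times> real"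
  have "norm (\<Phi> z - \<Phi> z') \<le> (1 + \<bar>K\<bar>) * norm (z - z')" for z z'
  proof -
    have 1: "\<bar>fst z - fst z'\<bar> \<le> norm (z - z')" "\<bar>snd z - snd z'\<bar> \<le> norm (z - z')"
      using norm_fst_le[of "fst z - fst z'" "snd z - snd z'"] norm_snd_le[of "snd z - snd z'" "fst z - fst z'"]
      by (simp_all add: prod_eq_iff minus_prod_def)
    have "norm (\<Phi> z - \<Phi> z') \<le> \<bar>snd z - snd z'\<bar> + \<bar>G (fst z) - G (fst z')\<bar>"
      unfolding \<Phi>_def using norm_Pair_le[of "snd z - snd z'" "G (fst z) - G (fst z')"] by simp
    also have "\<dots> \<le> norm (z - z') + \<bar>K\<bar> * norm (z - z')"
    proof (rule add_mono[OF 1(2)])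
      have "\<bar>G (fst z) - G (fst z')\<bar> \<le> K * \<bar>fst z - fst z'\<bar>" by (rule lip)
      also have "\<dots> \<le> \<bar>K\<bar> * norm (z - z')" using 1(1) by (intro mult_mono) auto
      finally show "\<bar>G (fst z) - G (fst z')\<bar> \<le> \<bar>K\<bar> * norm (z - z')" .
    qed
    finally show ?thesis by (simp add: algebra_simps)
  qed
  then obtain y where y: "y 0 = (x0, v0)" "\<And>t. (y has_vector_derivative \<Phi> (y t)) (at t)"
    using picard_global[of \<Phi> "1 + \<bar>K\<bar>" "(x0, v0)"] by blast
  have "((\<lambda>t. fst (y t)) has_real_derivative snd (y t)) (at t)" "((\<lambda>t. snd (y t)) has_real_derivative G (fst (y t))) (at t)" for t
    unfolding has_real_derivative_iff_has_vector_derivative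
    using bounded_linear.has_vector_derivative[OF bounded_linear_fst y(2), of t]
      bounded_linear.has_vector_derivative[OF bounded_linear_snd y(2), of t] unfolding \<Phi>_def by simp_all
  then show thesis using that[of "\<lambda>t. fst (y t)" "\<lambda>t. snd (y t)"] y(1) by simp
qed

text \<open>Bootstrapping: the derivative of the inverse is 1 / \<phi>'(\<eta>), which has the order
  of smoothness already known for \<eta>.\<close>

lemma smooth_inverse:
  fixes \<phi> :: "real \<Rightarrow> real"
  assumes d: "\<And>t. (\<phi> has_real_derivative \<phi>' t) (at t)" and pos: "\<And>t. \<phi>' t > 0" and sm: "\<And>k. Ck_on k UNIV \<phi>'"
  obtains \<eta> where "\<And>t. \<eta> (\<phi> t) = t" "open (range \<phi>)" "\<And>k. Ck_on k (range \<phi>) \<eta>"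
proof -
  have inc: "\<phi> s < \<phi> t" if "s < t" for s t
    by (rule DERIV_pos_imp_increasing[OF that]) (use d pos in blast)
  then have inj: "inj \<phi>" by (metis injI less_irrefl linorder_neqE)
  define \<eta> where "\<eta> = inv \<phi>"
  have \<eta>: "\<eta> (\<phi> t) = t" for t unfolding \<eta>_def using inj by (simp add: inv_f_f)
  have cont: "isCont \<phi> t" for t by (rule DERIV_isCont[OF d])
  have op: "open (range \<phi>)"
  proof (rule open_subopen[THEN iffD2], rule ballI)
    fix x assume "x \<in> range \<phi>"
    then obtain t where t: "x = \<phi> t" by blast
    have "{\<phi> (t - 1)<..<\<phi> (t + 1)} \<subseteq> range \<phi>"
    proof
      fix y assume "y \<in> {\<phi> (t - 1)<..<\<phi> (t + 1)}"
      then have "\<exists>s\<ge>t-1. s \<le> t + 1 \<and> \<phi> s = y" using cont by (intro IVT) auto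
      then show "y \<in> range \<phi>" by blast
    qed
    then show "\<exists>T. open T \<and> x \<in> T \<and> T \<subseteq> range \<phi>" using inc[of "t-1" t] inc[of t "t+1"] t
      by (intro exI[of _ "{\<phi> (t - 1)<..<\<phi> (t + 1)}"]) auto
  qed
  have d\<eta>: "(\<eta> has_vector_derivative inverse (\<phi>' (\<eta> x))) (at x)" if "x \<in> range \<phi>" for x
  proof -
    have p: "\<phi>' (\<eta> x) \<noteq> 0" using pos[of "\<eta> x"] by simp
    have "(\<eta> has_derivative (\<lambda>h. h * inverse (\<phi>' (\<eta> x)))) (at x)"
    proof (rule has_derivative_inverse_strong_x[where f=\<phi> and g=\<eta> and S=UNIV])
      show "continuous_on UNIV \<phi>" using cont by (intro continuous_at_imp_continuous_on) auto
      show "(\<phi> has_derivative (*) (\<phi>' (\<eta> x))) (at (\<eta> x))" using d unfolding has_field_derivative_def .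
      show "(*) (\<phi>' (\<eta> x)) \<circ> (\<lambda>h. h * inverse (\<phi>' (\<eta> x))) = id" using p by (auto simp: fun_eq_iff)
      show "\<phi> (\<eta> x) = x" using that \<eta> by auto
    qed (use \<eta> in auto)
    then show ?thesis unfolding has_vector_derivative_def by simp
  qed
  have "Ck_on k (range \<phi>) \<eta>" for k
  proof (induction k)
    case (Suc k)
    have "Ck_on k (range \<phi>) (\<lambda>x. inverse (\<phi>' (\<eta> x)))"
      by (intro Ck_on_inverse_pos op Ck_on_compose_real[OF op open_UNIV _ sm Suc] pos) auto
    from Ck_on_real_I[OF op _ this] d\<eta> show ?case by blast
  qed simp
  then show thesis using that \<eta> op by blast
qed

section \<open>The profile curve\<close>

lemma cmc_force_smooth: "Ck_on k {0<..} (cmc_force n H)"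
proof -
  have id: "Ck_on k {0<..} (\<lambda>v::real. v)" by (rule Ck_on_bounded_linear_id[OF _ bounded_linear_ident]) simp
  have "Ck_on k {0<..} (\<lambda>v::real. inverse v ^ n)"
    by (intro Ck_on_power Ck_on_inverse_pos id) auto
  then show ?thesis unfolding cmc_force_def[abs_def]
    by (intro Ck_on_mult Ck_on_diff Ck_on_add Ck_on_const id) auto
qed

lemma cmc_motion_smooth:
  assumes m: "cmc_motion n H C g g'" shows "Ck_on k UNIV g" "Ck_on k UNIV g'"
proof -
  note D = energy_motionD[OF m]
  have "Ck_on k UNIV g \<and> Ck_on k UNIV g'" for k
  proof (induction k)
    case (Suc k)
    have "Ck_on k UNIV (\<lambda>t. cmc_force n H (g t))"
      by (rule Ck_on_compose_real[OF open_UNIV _ _ cmc_force_smooth]) (use D(3) Suc in auto)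
    then have "Ck_on (Suc k) UNIV g'"
      by (rule Ck_on_real_I[OF open_UNIV, rotated]) (use D(5) in \<open>simp add: has_real_derivative_iff_has_vector_derivative\<close>)
    moreover have "Ck_on (Suc k) UNIV g"
      by (rule Ck_on_real_I[OF open_UNIV]) (use D(4) Suc in \<open>auto simp: has_real_derivative_iff_has_vector_derivative\<close>)
    ultimately show ?case by blast
  qed simp
  then show "Ck_on k UNIV g" "Ck_on k UNIV g'" by blast+
qed

text \<open>The force is singular at 0, so it is frozen below q1 to obtain a globally Lipschitz
  equation. With C = r1 the point q1 is an equilibrium of zero energy, and uniqueness keeps a motion
  that starts above it from ever reaching the altered region.\<close>

lemma homoclinic_motion:
  assumes n: "n > 2" and H: "H \<notin> {- 2 * sqrt (real n - 1) / real n .. 1}"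
  obtains g g' where "cmc_motion n H (r1 n H) g g'" "\<And>t. g t > q1 n H" "g' 0 > 0"
proof -
  define q where "q = q1 n H"
  define C where "C = r1 n H"
  note R = cmc_root_props[OF n H]
  have q: "q > 0" "inverse q ^ n = cmc_root1 n H" "cmc_energy n H C q = 0"
    using q_facts(1)[OF n R(2)] unfolding q_def C_def by auto
  have n0: "n > 0" using n by simp
  \<comment> \<open>A starting position with positive energy. When there is a second critical point
    q2, it has to be chosen before q2, and the midpoint is taken.\<close>
  obtain u where u: "u > q" "\<And>v. q < v \<Longrightarrow> v \<le> u \<Longrightarrow> cmc_force n H v > 0"
  proof (cases "- 1 < H \<and> H < 1")
    case False
    have "cmc_force n H v > 0" if "q < v" for v
    proof (rule cmc_force_sign(2)[OF n H _ that[unfolded q_def]])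
      show "v > 0" using q that by simp
      then have "inverse v ^ n > 0" by simp
      then show "cmc_root2 n H < inverse v ^ n" using R(4)[OF False] by linarith
    qed
    then show thesis using that[of "q + 1"] by simp
  next
    case True
    have R2: "cmc_root2 n H > 0" using R(5)[OF True] by simp
    have q2: "q2 n H > 0" "inverse (q2 n H) ^ n = cmc_root2 n H" using q_facts(2)[OF n R2] by auto
    have q12: "q < q2 n H"
    proof (rule ccontr)
      assume "\<not> ?thesis"
      then have "inverse q ^ n \<le> inverse (q2 n H) ^ n" using q2(1) by (intro power_mono) auto
      then show False unfolding q(2) q2(2) using R(3) by linarith
    qed
    have "cmc_force n H v > 0" if "q < v" "v \<le> (q + q2 n H) / 2" for v
    proof (rule cmc_force_sign(2)[OF n H _ that(1)[unfolded q_def]])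
      show v: "v > 0" using q that by simp
      have "v < q2 n H" using that q12 by simp
      then show "cmc_root2 n H < inverse v ^ n" using inverse_power_strict_antimono[OF v _ n0] q2(2) by metis
    qed
    then show thesis using that[of "(q + q2 n H) / 2"] q12 by simp
  qed
  have eu: "cmc_energy n H C u > 0"
    using cmc_energy_increasing[OF n0 q(1) u(1), of H C] u(2) q(3) by simp
  have fq: "cmc_force n H q = 0" unfolding cmc_force_factor[OF n less_imp_le[OF R(1)]] q(2) by simp
  obtain K where K: "\<And>x y. q \<le> x \<Longrightarrow> q \<le> y \<Longrightarrow> \<bar>cmc_force n H x - cmc_force n H y\<bar> \<le> K * \<bar>x - y\<bar>"
    using cmc_force_lipschitz[OF q(1) n] by blast
  \<comment> \<open>Agrees with the true force above \<open>q\<close> and is Lipschitz on the whole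
    line.\<close>
  define G where "G x = cmc_force n H (max q x)" for x
  have lipG: "\<bar>G x - G y\<bar> \<le> \<bar>K\<bar> * \<bar>x - y\<bar>" for x y
  proof -
    have "\<bar>G x - G y\<bar> \<le> K * \<bar>max q x - max q y\<bar>" unfolding G_def by (rule K) auto
    also have "\<dots> \<le> \<bar>K\<bar> * \<bar>x - y\<bar>" by (rule mult_mono) (auto simp: max_def)
    finally show ?thesis .
  qed
  obtain x x' where x: "x 0 = u" "x' 0 = sqrt (cmc_energy n H C u)" "\<And>t. (x has_real_derivative x' t) (at t)"
    "\<And>t. (x' has_real_derivative G (x t)) (at t)" using second_order_global[OF lipG] by blast
  \<comment> \<open>Only the square of the initial velocity is prescribed, so that the claim also
    applies to the time-reversed solution and covers negative times.\<close>
  have above: "x t > q \<and> (x' t)^2 = cmc_energy n H C (x t)"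
    if x: "x 0 = u" "(x' 0)^2 = cmc_energy n H C u" "\<And>t. (x has_real_derivative x' t) (at t)"
      "\<And>t. (x' has_real_derivative G (x t)) (at t)" and t: "t \<ge> 0" for x x' t
  proof -
    have cx: "isCont x s" "isCont x' s" for s using DERIV_isCont[OF x(3)] DERIV_isCont[OF x(4)] by blast+
    have conserve: "(x' s)^2 = cmc_energy n H C (x s)"
      if s: "s \<ge> 0" "\<And>r. 0 \<le> r \<Longrightarrow> r < s \<Longrightarrow> x r > q" and xs: "x s \<ge> q" for s
    proof (cases "s = 0")
      case True then show ?thesis using x by simp
    next
      case False
      then have s0: "0 < s" using s by simp
      define e where "e r = (x' r)^2 - cmc_energy n H C (x r)" for r
      have xp: "x r > 0" if "0 \<le> r" "r \<le> s" for r using s(2)[of r] xs q(1) that by (cases "r = s") auto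
      have "e s = e 0"
      proof (rule DERIV_isconst2[OF s0])
        have "isCont e r" if "0 \<le> r" "r \<le> s" for r
          unfolding e_def using isCont_o2[OF cx(1) DERIV_isCont[OF DERIV_cmc_energy[OF xp[OF that] n0]]] cx(2)
          by (intro continuous_intros) auto
        then show "continuous_on {0..s} e" by (intro continuous_at_imp_continuous_on) auto
        show "(e has_real_derivative 0) (at r)" if r: "0 < r" "r < s" for r
        proof -
          have rr: "max q (x r) = x r" using s(2)[of r] r by simp
          have "((\<lambda>r. cmc_energy n H C (x r)) has_real_derivative 2 * cmc_force n H (x r) * x' r) (at r)"
            by (rule DERIV_chain2[OF DERIV_cmc_energy[OF xp n0] x(3)]) (use r in auto)
          then have "(e has_real_derivative 2 * x' r * G (x r) - 2 * cmc_force n H (x r) * x' r) (at r)"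
            unfolding e_def by (auto intro!: derivative_eq_intros x(4))
          then show ?thesis unfolding G_def rr by (simp add: mult_ac)
        qed
      qed (use s in auto)
      then show ?thesis unfolding e_def using x by simp
    qed
    have xq: "x t > q" if "t \<ge> 0" for t
    proof (rule ccontr)
      assume nq: "\<not> x t > q"
      define S where "S = {s \<in> {0..t}. x s = q}"
      have "\<exists>s\<ge>0. s \<le> t \<and> x s = q" by (intro IVT2) (use nq that x(1) u(1) cx in auto)
      then have "S \<noteq> {}" unfolding S_def by auto
      moreover have "compact S"
      proof -
        have "closed S" unfolding S_def
          by (intro continuous_closed_preimage_constant continuous_at_imp_continuous_on ballI cx) auto
        moreover have "bounded S" by (rule bounded_subset[OF bounded_closed_interval[of 0 t]]) (auto simp: S_def)
        ultimately show ?thesis by (simp add: compact_eq_bounded_closed)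
      qed
      ultimately obtain s where s: "s \<in> S" "\<And>r. r \<in> S \<Longrightarrow> s \<le> r" using compact_attains_inf[of S] by blast
      have s0: "0 \<le> s" "s \<le> t" "x s = q" using s(1) unfolding S_def by auto
      have "x r > q" if r: "0 \<le> r" "r < s" for r
      proof (rule ccontr)
        assume "\<not> x r > q"
        then have "\<exists>r'\<ge>0. r' \<le> r \<and> x r' = q" by (intro IVT2) (use r x(1) u(1) cx in auto)
        then obtain r' where "0 \<le> r'" "r' \<le> r" "x r' = q" by blast
        then show False using s(2)[of r'] r s0 unfolding S_def by auto
      qed
      then have "(x' s)^2 = cmc_energy n H C q" using conserve[of s] s0 by simp
      then have x's: "x' s = 0" using q(3) by simp
      \<comment> \<open>At the first arrival at \<open>q\<close> conservation of energy forces zero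
        velocity, and the solution would coincide with the equilibrium from the start.\<close>
      have "x 0 = q"
      proof (rule motion_unique[where g=x and g'=x' and h="\<lambda>_. q" and h'="\<lambda>_. 0" and F=G and K="\<bar>K\<bar>", OF x(3) x(4)])
        show "((\<lambda>_. 0) has_real_derivative G q) (at t)" for t unfolding G_def using fq by simp
      qed (use lipG s0 x's in auto)
      then show False using x(1) u(1) by simp
    qed
    show ?thesis using xq conserve[of t] t by (simp add: less_imp_le)
  qed
  have all: "x t > q \<and> (x' t)^2 = cmc_energy n H C (x t)" for t
  proof (cases "t \<ge> 0")
    case True
    show ?thesis by (rule above[OF x(1) _ x(3,4) True]) (use x(2) eu in simp)
  next
    case False
    have "((\<lambda>s. x (0 - s)) has_real_derivative - x' (0 - s)) (at s)" for s by (rule DERIV_reverse[OF x(3)])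
    moreover have "((\<lambda>s. - x' (0 - s)) has_real_derivative G (x (0 - s))) (at s)" for s
      using DERIV_minus[OF DERIV_reverse[OF x(4)], of 0 s] by simp
    ultimately have "x (0 - (- t)) > q \<and> (- x' (0 - (- t)))^2 = cmc_energy n H C (x (0 - (- t)))"
      by (intro above[of "\<lambda>s. x (0 - s)" "\<lambda>s. - x' (0 - s)"]) (use False x(1,2) eu in auto)
    then show ?thesis by simp
  qed
  have "isCont (cmc_energy n H C) v \<and> isCont (cmc_force n H) v" if "v > 0" for v
    using DERIV_isCont[OF DERIV_cmc_energy[OF that n0]] DERIV_isCont[OF DERIV_cmc_force[OF that n0]] by blast
  moreover have "(x' has_real_derivative cmc_force n H (x t)) (at t)" for t
    using x(4)[of t] all[of t] unfolding G_def by (simp add: max_def)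
  moreover have "x t > 0" for t using all[of t] q(1) by linarith
  ultimately have "cmc_motion n H C x x'" unfolding energy_motion_def using x(3) all by simp
  moreover have "x' 0 > 0" using x(2) eu by simp
  ultimately show thesis using that[of x x'] all unfolding C_def q_def by blast
qed

text \<open>At q1 one has r1 = q1^2 (1 - \<lambda>^2) with \<lambda> = H + \<open>cmc_root1\<close>.
  For H > 1 this \<lambda> exceeds 1; for the other admissible H it lies strictly between -1 and
  0.\<close>

lemma r1_sign:
  assumes n: "n > 2" and H: "H \<notin> {- 2 * sqrt (real n - 1) / real n .. 1}"
  shows "H > 1 \<Longrightarrow> r1 n H < 0" and "H < 1 \<Longrightarrow> r1 n H > 0 \<and> r1 n H \<le> (q1 n H)^2 \<and> H + cmc_root1 n H < 0"
proof -
  note R = cmc_root_props[OF n H]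
  have q: "q1 n H > 0" "q1 n H powr (- real n) = cmc_root1 n H"
    using powr_root_facts[of "cmc_root1 n H" n "q1 n H"] R(2) n unfolding q1_def[folded cmc_root1_def] by auto
  define x where "x = cmc_root1 n H"
  have r: "r1 n H = (q1 n H)^2 * (1 - (H + x)^2)" unfolding r1_def q(2) x_def ..
  show "r1 n H < 0" if "H > 1"
  proof -
    have "(H + x)^2 > 1" using that R(2) unfolding x_def by (intro one_less_power) auto
    then show ?thesis unfolding r using q(1) by (intro mult_pos_neg) auto
  qed
  show "r1 n H > 0 \<and> r1 n H \<le> (q1 n H)^2 \<and> H + cmc_root1 n H < 0" if H1: "H < 1"
  proof -
    define N where "N = real n - 1"
    have N: "N \<ge> 2" "real n = N + 1" unfolding N_def using n by auto
    define s where "s = sqrt (H^2 * (real n)^2 - 4 * real n + 4)"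
    have s: "s > 0" "s^2 = H^2 * (real n)^2 - 4 * real n + 4" unfolding s_def using R(1) by auto
    have nb: "- 2 * sqrt (real n - 1) / real n < 0" using n by (simp add: divide_neg_pos)
    then have Hn: "H < 0" using H H1 by auto
    have l: "H + x = (real n * H + s) / (2 * N)" unfolding x_def cmc_root1_def s_def[symmetric] N_def[symmetric]
      using N by (simp add: field_simps)
    have "s^2 < (- (real n * H))^2" unfolding s(2) using n by (simp add: power_mult_distrib)
    then have "s < - (real n * H)" using Hn n by (intro power2_less_imp_less[of s]) (auto simp: mult_nonneg_nonpos)
    then have neg: "H + x < 0" unfolding l using N by (simp add: divide_neg_pos)
    \<comment> \<open>Equivalent to \<lambda> > -1. For H < -1 the difference of the squares is -4
      (n-1) n (H + 1) > 0; otherwise the left side is bounded by 2 - n.\<close>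
    have "- (real n * H) - 2 * N < s"
    proof (cases "H < - 1")
      case True
      show ?thesis
      proof (cases "- (real n * H) - 2 * N \<le> 0")
        case True then show ?thesis using s(1) by simp
      next
        case False
        have "s^2 - (- (real n * H) - 2 * N)^2 = - 4 * N * (real n * (H + 1))" unfolding s(2) N(2)
          by (simp add: algebra_simps power2_eq_square)
        moreover have "- 4 * N * (real n * (H + 1)) > 0" using True N n by (simp add: mult_pos_neg mult_neg_neg)
        ultimately have "(- (real n * H) - 2 * N)^2 < s^2" by linarith
        then show ?thesis by (rule power2_less_imp_less) (use s(1) in simp)
      qed
    next
      case False
      then have "real n * H \<ge> real n * (- 1)" by (intro mult_left_mono) auto
      then show ?thesis using N s(1) by simp
    qed
    then have "H + x > - 1" unfolding l using N by (simp add: pos_less_divide_eq)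
    then have "(H + x)^2 < 1" using neg by (simp add: abs_square_less_1 abs_less_iff)
    then have "r1 n H > 0" unfolding r using q(1) by simp
    moreover have "r1 n H \<le> (q1 n H)^2 * 1" unfolding r by (rule mult_left_mono) auto
    ultimately show ?thesis using neg unfolding x_def by simp
  qed
qed

section \<open>Rotation hypersurfaces\<close>

lemma directional_derivative:
  assumes "(F has_derivative D) (at x)" shows "((\<lambda>s. F (x + s *\<^sub>R v)) has_vector_derivative D v) (at 0)"
proof -
  have 1: "((\<lambda>s. x + s *\<^sub>R v) has_derivative (\<lambda>s. s *\<^sub>R v)) (at 0)" by (auto intro!: derivative_eq_intros)
  have 2: "(F has_derivative D) (at (x + 0 *\<^sub>R v))" using assms by simp
  have "D (s *\<^sub>R v) = s *\<^sub>R D v" for s using assms has_derivative_linear linear_cmul by blast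
  then show ?thesis using has_derivative_compose[OF 1 2] unfolding has_vector_derivative_def by simp
qed

text \<open>The two directions give the derivative of (F1, F2) the form of an invertible diagonal
  matrix, whence surjectivity.\<close>

lemma codim2_submanifoldI:
  fixes F1 F2 :: "(real, 'm::finite) vec \<Rightarrow> real"
  assumes F: "Cinf_on W F1" "Cinf_on W F2" and M: "M = {x\<in>W. F1 x = 0 \<and> F2 x = 0}"
    and dir: "\<And>x. x \<in> W \<Longrightarrow> \<exists>v1 v2 p q. p \<noteq> 0 \<and> q \<noteq> 0 \<and>
      ((\<lambda>s. F1 (x + s *\<^sub>R v1)) has_real_derivative p) (at 0) \<and> ((\<lambda>s. F2 (x + s *\<^sub>R v1)) has_real_derivative 0) (at 0) \<and>
      ((\<lambda>s. F1 (x + s *\<^sub>R v2)) has_real_derivative 0) (at 0) \<and> ((\<lambda>s. F2 (x + s *\<^sub>R v2)) has_real_derivative q) (at 0)"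
  shows "codim2_submanifold M"
proof -
  have W: "open W" by (rule Cinf_on_open[OF F(1)])
  define F :: "(real, 'm) vec \<Rightarrow> real^2" where "F x = F1 x *\<^sub>R axis 1 1 + F2 x *\<^sub>R axis 2 1" for x
  have FC: "Cinf_on W F" unfolding F_def
    by (intro Cinf_onI W Ck_on_add Ck_on_scaleR Ck_on_const Cinf_on_Ck[OF F(1)] Cinf_on_Ck[OF F(2)])
  have F0: "F x = 0 \<longleftrightarrow> F1 x = 0 \<and> F2 x = 0" for x
    unfolding F_def vec_eq_iff by (simp add: forall_2 axis_def)
  have "surj (frechet_derivative F (at x))" if x: "x \<in> W" for x
  proof -
    define D1 where "D1 = frechet_derivative F1 (at x)"
    define D2 where "D2 = frechet_derivative F2 (at x)"
    have d: "(F1 has_derivative D1) (at x)" "(F2 has_derivative D2) (at x)"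
      unfolding D1_def D2_def using Cinf_on_has_derivative F x by blast+
    have "(F has_derivative (\<lambda>v. D1 v *\<^sub>R axis 1 1 + D2 v *\<^sub>R axis 2 1)) (at x)"
      unfolding F_def by (intro has_derivative_add has_derivative_scaleR_left d)
    then have DF: "frechet_derivative F (at x) = (\<lambda>v. D1 v *\<^sub>R axis 1 1 + D2 v *\<^sub>R axis 2 1)"
      by (rule frechet_derivative_at[symmetric])
    obtain v1 v2 p q where v: "p \<noteq> 0" "q \<noteq> 0"
      "((\<lambda>s. F1 (x + s *\<^sub>R v1)) has_real_derivative p) (at 0)" "((\<lambda>s. F2 (x + s *\<^sub>R v1)) has_real_derivative 0) (at 0)"
      "((\<lambda>s. F1 (x + s *\<^sub>R v2)) has_real_derivative 0) (at 0)" "((\<lambda>s. F2 (x + s *\<^sub>R v2)) has_real_derivative q) (at 0)"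
      using dir[OF x] by blast
    have e: "D1 v1 = p" "D2 v1 = 0" "D1 v2 = 0" "D2 v2 = q"
      using directional_derivative[OF d(1)] directional_derivative[OF d(2)] v(3-)
      unfolding has_real_derivative_iff_has_vector_derivative by (metis vector_derivative_unique_at)+
    have lin: "linear D1" "linear D2" using d has_derivative_linear by blast+
    show ?thesis unfolding surj_def
    proof
      fix y :: "real^2"
      have "y = D1 ((y$1/p) *\<^sub>R v1 + (y$2/q) *\<^sub>R v2) *\<^sub>R axis 1 1 + D2 ((y$1/p) *\<^sub>R v1 + (y$2/q) *\<^sub>R v2) *\<^sub>R axis 2 1"
        using lin e v(1,2) unfolding vec_eq_iff by (simp add: linear_add linear_cmul forall_2 axis_def)
      then show "\<exists>z. y = frechet_derivative F (at x) z" unfolding DF by blast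
    qed
  qed
  then have "\<forall>x\<in>W. surj (frechet_derivative F (at x))" by blast
  moreover have "M \<inter> W = {x\<in>W. F x = 0}" unfolding M F0 by auto
  moreover have "M \<subseteq> W" unfolding M by blast
  ultimately show ?thesis unfolding codim2_submanifold_def using W FC by blast
qed

text \<open>Every smooth extension has the same derivative along the curve, so one explicit curve
  evaluates \<open>Mderiv\<close> without knowing an extension.\<close>

lemma Mderiv_along_curve:
  assumes f: "Cinf_fun_on M f" and c: "open S" "t \<in> S" "\<And>s. s \<in> S \<Longrightarrow> c s \<in> M" "(c has_vector_derivative v) (at t)"
    and fc: "((\<lambda>s. f (c s)) has_vector_derivative y) (at t)"
  shows "Mderiv M f (c t) v = y"
proof -
  have p: "c t \<in> M" using c by blast
  have val: "frechet_derivative F (at (c t)) v = y"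
    if "c t \<in> W" "Cinf_on W F" "\<forall>x\<in>M \<inter> W. F x = f x" for W F
  proof -
    have "((\<lambda>s. f (c s)) has_vector_derivative frechet_derivative F (at (c t)) v) (at t)"
      by (rule extension_derivative_along_curve[OF Cinf_on_open[OF that(2)] that(1) _ Cinf_on_has_derivative[OF that(2,1)] c])
         (use that(3) in auto)
    then show ?thesis using fc vector_derivative_unique_at by blast
  qed
  obtain W F where W: "open W" "c t \<in> W" "Cinf_on W F" "\<forall>x\<in>M \<inter> W. F x = f x"
    using f p unfolding Cinf_fun_on_def by blast
  show ?thesis unfolding Mderiv_def
  proof (rule the_equality)
    show "\<exists>W F. open W \<and> c t \<in> W \<and> Cinf_on W F \<and> (\<forall>x\<in>M \<inter> W. F x = f x) \<and> frechet_derivative F (at (c t)) v = y"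
      using W val[OF W(2-4)] by blast
  qed (use val in blast)
qed

definition mk :: "'m::finite \<Rightarrow> 'm \<Rightarrow> (real, 'm) vec \<Rightarrow> real \<Rightarrow> real \<Rightarrow> (real, 'm) vec" where
  "mk i1 i2 y b1 b2 = y + b1 *\<^sub>R axis i1 1 + b2 *\<^sub>R axis i2 1"

definition plane_complement :: "'m::finite \<Rightarrow> 'm \<Rightarrow> (real, 'm) vec set" where
  "plane_complement i1 i2 = {y. y $ i1 = 0 \<and> y $ i2 = 0}"

text \<open>The orbit of a profile curve under the rotations that fix the (i1, i2)-plane. Euclidean
  unit vectors are the right ones, since the forms used are multiples of the Euclidean product on
  the complement of that plane.\<close>

definition rotation_surface :: "'m::finite \<Rightarrow> 'm \<Rightarrow> (real \<Rightarrow> real) \<Rightarrow> (real \<Rightarrow> real) \<Rightarrow> (real \<Rightarrow> real) \<Rightarrow> (real, 'm) vec set" where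
  "rotation_surface i1 i2 r \<beta>1 \<beta>2 = {mk i1 i2 (r t *\<^sub>R y) (\<beta>1 t) (\<beta>2 t) | t y. y \<in> plane_complement i1 i2 \<and> norm y = 1}"

definition proj :: "'m::finite \<Rightarrow> 'm \<Rightarrow> (real, 'm) vec \<Rightarrow> (real, 'm) vec" where
  "proj i1 i2 x = x - (x $ i1) *\<^sub>R axis i1 1 - (x $ i2) *\<^sub>R axis i2 1"

lemma bounded_linear_proj: "bounded_linear (proj i1 i2)"
  unfolding proj_def
  by (intro bounded_linear_sub bounded_linear_ident bounded_linear_scaleR_const bounded_linear_vec_nth)

lemma mk_nth:
  assumes "i1 \<noteq> i2" "y \<in> plane_complement i1 i2"
  shows "mk i1 i2 y b1 b2 $ i1 = b1" "mk i1 i2 y b1 b2 $ i2 = b2" "i \<noteq> i1 \<Longrightarrow> i \<noteq> i2 \<Longrightarrow> mk i1 i2 y b1 b2 $ i = y $ i"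
    "proj i1 i2 (mk i1 i2 y b1 b2) = y"
proof -
  show 1: "mk i1 i2 y b1 b2 $ i1 = b1" "mk i1 i2 y b1 b2 $ i2 = b2"
    using assms unfolding mk_def plane_complement_def by (auto simp: axis_def)
  show "i \<noteq> i1 \<Longrightarrow> i \<noteq> i2 \<Longrightarrow> mk i1 i2 y b1 b2 $ i = y $ i" unfolding mk_def by (auto simp: axis_def)
  show "proj i1 i2 (mk i1 i2 y b1 b2) = y" unfolding proj_def 1 by (simp add: mk_def)
qed

lemma proj_complement: "i1 \<noteq> i2 \<Longrightarrow> proj i1 i2 x \<in> plane_complement i1 i2"
  and mk_proj: "mk i1 i2 (proj i1 i2 x) (x $ i1) (x $ i2) = x"
  unfolding proj_def plane_complement_def mk_def by (auto simp: axis_def)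

lemma subspace_plane_complement: "subspace (plane_complement i1 i2)"
  unfolding plane_complement_def subspace_def by auto

lemma mk_0: "mk i1 i2 y 0 0 = y"
  unfolding mk_def by simp

lemma mk_has_vector_derivative:
  assumes "(y has_vector_derivative y') (at t)" "(b1 has_real_derivative b1') (at t)" "(b2 has_real_derivative b2') (at t)"
  shows "((\<lambda>s. mk i1 i2 (y s) (b1 s) (b2 s)) has_vector_derivative mk i1 i2 y' b1' b2') (at t)"
proof -
  have s: "((\<lambda>s. b s *\<^sub>R v) has_vector_derivative b' *\<^sub>R v) (at t)" if "(b has_real_derivative b') (at t)"
    for b b' and v :: "(real, 'a) vec"
    using has_vector_derivative_scaleR[OF that has_vector_derivative_const, of v] by simp
  show ?thesis unfolding mk_def
    by (intro has_vector_derivative_add assms(1) s assms(2,3))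
qed

lemma Ck_on_mk:
  assumes "open U" "Ck_on k U y" "Ck_on k U b1" "Ck_on k U b2" shows "Ck_on k U (\<lambda>x. mk i1 i2 (y x) (b1 x) (b2 x))"
  unfolding mk_def by (intro Ck_on_add Ck_on_scaleR Ck_on_const assms)

section \<open>The hypersurface generated by a profile curve\<close>

text \<open>The radius \<open>r\<close> is w scaled so that its constant becomes \<epsilon>;
  \<open>energy\<close> and \<open>drd\<close> are the equations of motion in this scale.
  \<open>plane\<close> places the curve in the space form, \<open>db1\<close> and \<open>db2\<close>
  prescribe its part in the axis plane. \<open>lip\<close> serves the geodesic equation, and
  \<open>\<tau>\<close> recovers the profile parameter smoothly near the surface, so that the
  surface has no self-intersections.\<close>

locale cmc_profile =
  fixes n k :: nat and a \<epsilon> H :: real and i1 i2 :: "'m::{finite,linorder}"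
    and r rd l lp \<beta>1 \<beta>2 :: "real \<Rightarrow> real" and W0 :: "(real, 'm) vec set" and \<tau> :: "(real, 'm) vec \<Rightarrow> real"
  assumes card_index: "CARD('m) = n + 2" and n_gt: "n > 2" and a_sign: "a = 1 \<or> a = -1" and eps: "\<epsilon> = 1 \<or> \<epsilon> = -1"
    and i12: "i1 \<noteq> i2"
    and form: "\<And>x y. pinner (sf_index k a) x y =
      a * (\<epsilon> * (\<Sum>i\<in>UNIV - {i1, i2}. x $ i * y $ i) + x $ i1 * y $ i1 - \<epsilon> * (x $ i2 * y $ i2))"
    and r_pos: "\<And>t. r t > 0" and P_pos: "\<And>t. (r t)^2 - \<epsilon> > 0"
    and energy: "\<And>t. (rd t)^2 = \<epsilon> + (r t)^2 * ((l t)^2 - 1)"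
    and plane: "\<And>t. (\<beta>1 t)^2 - \<epsilon> * (\<beta>2 t)^2 = - \<epsilon> * ((r t)^2 - \<epsilon>)"
    and l_gt: "\<And>t. l t > H" and l_nonconst: "\<exists>s t. l s \<noteq> l t"
    and dr: "\<And>t. (r has_real_derivative rd t) (at t)"
    and drd: "\<And>t. (rd has_real_derivative r t * (l t * (real n * H - (real n - 1) * l t) - 1)) (at t)"
    and dl: "\<And>t. (l has_real_derivative lp t) (at t)" and lp: "\<And>t. r t * lp t = - rd t * (l t - (real n * H - (real n - 1) * l t))"
    and db1: "\<And>t. (\<beta>1 has_real_derivative r t * inverse ((r t)^2 - \<epsilon>) * (rd t * \<beta>1 t + l t * \<epsilon> * \<beta>2 t)) (at t)"
    and db2: "\<And>t. (\<beta>2 has_real_derivative r t * inverse ((r t)^2 - \<epsilon>) * (rd t * \<beta>2 t + l t * \<beta>1 t)) (at t)"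
    and lip: "\<exists>K. \<forall>s t. \<bar>rd s / (r s)^3 - rd t / (r t)^3\<bar> \<le> K * \<bar>s - t\<bar>"
    and smooth: "\<And>k. Ck_on k UNIV r" "\<And>k. Ck_on k UNIV rd" "\<And>k. Ck_on k UNIV l" "\<And>k. Ck_on k UNIV \<beta>1" "\<And>k. Ck_on k UNIV \<beta>2"
    and tau: "Cinf_on W0 \<tau>" "\<And>t y. y \<in> plane_complement i1 i2 \<Longrightarrow> norm y = 1 \<Longrightarrow> mk i1 i2 (r t *\<^sub>R y) (\<beta>1 t) (\<beta>2 t) \<in> W0"
      "\<And>t y. y \<in> plane_complement i1 i2 \<Longrightarrow> norm y = 1 \<Longrightarrow> \<tau> (mk i1 i2 (r t *\<^sub>R y) (\<beta>1 t) (\<beta>2 t)) = t"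
    and submanifold: "codim2_submanifold (rotation_surface i1 i2 r \<beta>1 \<beta>2)"
begin

abbreviation ip where "ip \<equiv> pinner (sf_index k a)"
abbreviation E where "E \<equiv> plane_complement i1 i2"
abbreviation M where "M \<equiv> rotation_surface i1 i2 r \<beta>1 \<beta>2"

text \<open>\<open>m\<close> is the curvature \<mu>; \<open>et\<close> is the unit profile tangent
  and \<open>nt\<close> the unit normal. Their parts in the axis plane are expanded in (\<beta>1,
  \<beta>2) and the orthogonal vector (\<epsilon> \<beta>2, \<beta>1), and \<open>Q\<close>
  normalizes by the length r^2 - \<epsilon> of these.\<close>

definition Q where "Q t = inverse ((r t)^2 - \<epsilon>)"
definition m where "m t = real n * H - (real n - 1) * l t"
definition b1d where "b1d t = r t * Q t * (rd t * \<beta>1 t + l t * \<epsilon> * \<beta>2 t)"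
definition b2d where "b2d t = r t * Q t * (rd t * \<beta>2 t + l t * \<beta>1 t)"
definition d1 where "d1 t = - Q t * (l t * (r t)^2 * \<beta>1 t + rd t * \<epsilon> * \<beta>2 t)"
definition d2 where "d2 t = - Q t * (l t * (r t)^2 * \<beta>2 t + rd t * \<beta>1 t)"

definition \<psi> where "\<psi> t y = mk i1 i2 (r t *\<^sub>R y) (\<beta>1 t) (\<beta>2 t)"
definition et where "et t y = mk i1 i2 (rd t *\<^sub>R y) (b1d t) (b2d t)"
definition nt where "nt t y = mk i1 i2 (- (l t * r t) *\<^sub>R y) (d1 t) (d2 t)"

lemma aa: "a * a = 1" and ee: "\<epsilon> * \<epsilon> = 1" "\<epsilon>^2 = 1"
  using a_sign eps by auto

lemma PQ: "((r t)^2 - \<epsilon>) * Q t = 1"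
  unfolding Q_def using P_pos[of t] by simp

lemma dQ: "(Q has_real_derivative - 2 * r t * rd t * (Q t)^2) (at t)"
proof -
  have "((\<lambda>t. inverse ((r t)^2 - \<epsilon>)) has_real_derivative - (inverse ((r t)^2 - \<epsilon>) * (2 * r t * rd t) * inverse ((r t)^2 - \<epsilon>))) (at t)"
    using P_pos[of t] by (auto intro!: derivative_eq_intros dr)
  then show ?thesis unfolding Q_def[abs_def] by (simp add: power2_eq_square algebra_simps)
qed

text \<open>The axis-plane components of the Frenet equations \<psi>' = et, et' = -\<psi> - m nt,
  nt' = -m et.\<close>

lemma frame_equations:
  shows "(\<beta>1 has_real_derivative b1d t) (at t)" "(\<beta>2 has_real_derivative b2d t) (at t)"
    "(b1d has_real_derivative - \<beta>1 t - m t * d1 t) (at t)" "(b2d has_real_derivative - \<beta>2 t - m t * d2 t) (at t)"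
    "(d1 has_real_derivative - m t * b1d t) (at t)" "(d2 has_real_derivative - m t * b2d t) (at t)"
proof -
  show B: "(\<beta>1 has_real_derivative b1d t) (at t)" "(\<beta>2 has_real_derivative b2d t) (at t)"
    using db1 db2 unfolding b1d_def b2d_def Q_def by auto
  have drd': "(rd has_real_derivative r t * (l t * m t - 1)) (at t)" using drd unfolding m_def .
  have lp': "r t * lp t = - rd t * (l t - m t)" using lp unfolding m_def .
  note rel = PQ[of t] ee(2) energy[of t] lp' b1d_def[of t] b2d_def[of t] d1_def[of t] d2_def[of t]
  have 1: "(b1d has_real_derivative rd t * Q t * (rd t * \<beta>1 t + l t * \<epsilon> * \<beta>2 t) + r t * (- 2 * r t * rd t * (Q t)^2) * (rd t * \<beta>1 t + l t * \<epsilon> * \<beta>2 t)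
      + r t * Q t * (r t * (l t * m t - 1) * \<beta>1 t + rd t * b1d t + lp t * \<epsilon> * \<beta>2 t + l t * \<epsilon> * b2d t)) (at t)"
    unfolding b1d_def[abs_def]
    by (rule DERIV_cong[OF DERIV_mult[OF DERIV_mult[OF dr dQ] DERIV_add[OF DERIV_mult[OF drd' B(1)] DERIV_mult[OF DERIV_mult[OF dl DERIV_const] B(2)]]]])
       (simp add: algebra_simps b1d_def b2d_def)
  moreover have "rd t * Q t * (rd t * \<beta>1 t + l t * \<epsilon> * \<beta>2 t) + r t * (- 2 * r t * rd t * (Q t)^2) * (rd t * \<beta>1 t + l t * \<epsilon> * \<beta>2 t)
      + r t * Q t * (r t * (l t * m t - 1) * \<beta>1 t + rd t * b1d t + lp t * \<epsilon> * \<beta>2 t + l t * \<epsilon> * b2d t) = - \<beta>1 t - m t * d1 t"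
    using rel by algebra
  ultimately show "(b1d has_real_derivative - \<beta>1 t - m t * d1 t) (at t)" by simp
  have 2: "(b2d has_real_derivative rd t * Q t * (rd t * \<beta>2 t + l t * \<beta>1 t) + r t * (- 2 * r t * rd t * (Q t)^2) * (rd t * \<beta>2 t + l t * \<beta>1 t)
      + r t * Q t * (r t * (l t * m t - 1) * \<beta>2 t + rd t * b2d t + lp t * \<beta>1 t + l t * b1d t)) (at t)"
    unfolding b2d_def[abs_def]
    by (rule DERIV_cong[OF DERIV_mult[OF DERIV_mult[OF dr dQ] DERIV_add[OF DERIV_mult[OF drd' B(2)] DERIV_mult[OF dl B(1)]]]])
       (simp add: algebra_simps b1d_def b2d_def)
  moreover have "rd t * Q t * (rd t * \<beta>2 t + l t * \<beta>1 t) + r t * (- 2 * r t * rd t * (Q t)^2) * (rd t * \<beta>2 t + l t * \<beta>1 t)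
      + r t * Q t * (r t * (l t * m t - 1) * \<beta>2 t + rd t * b2d t + lp t * \<beta>1 t + l t * b1d t) = - \<beta>2 t - m t * d2 t"
    using rel by algebra
  ultimately show "(b2d has_real_derivative - \<beta>2 t - m t * d2 t) (at t)" by simp
  have dr2: "((\<lambda>t. (r t)^2) has_real_derivative 2 * r t * rd t) (at t)" by (auto intro!: derivative_eq_intros dr)
  have 3: "(d1 has_real_derivative (2 * r t * rd t * (Q t)^2) * (l t * (r t)^2 * \<beta>1 t + rd t * \<epsilon> * \<beta>2 t)
      - Q t * (lp t * (r t)^2 * \<beta>1 t + l t * (2 * r t * rd t) * \<beta>1 t + l t * (r t)^2 * b1d t + r t * (l t * m t - 1) * \<epsilon> * \<beta>2 t + rd t * \<epsilon> * b2d t)) (at t)"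
    unfolding d1_def[abs_def]
    by (rule DERIV_cong[OF DERIV_mult[OF DERIV_minus[OF dQ] DERIV_add[OF DERIV_mult[OF DERIV_mult[OF dl dr2] B(1)] DERIV_mult[OF DERIV_mult[OF drd' DERIV_const] B(2)]]]])
       (simp add: algebra_simps)
  moreover have "(2 * r t * rd t * (Q t)^2) * (l t * (r t)^2 * \<beta>1 t + rd t * \<epsilon> * \<beta>2 t)
      - Q t * (lp t * (r t)^2 * \<beta>1 t + l t * (2 * r t * rd t) * \<beta>1 t + l t * (r t)^2 * b1d t + r t * (l t * m t - 1) * \<epsilon> * \<beta>2 t + rd t * \<epsilon> * b2d t) = - m t * b1d t"
    using rel by algebra
  ultimately show "(d1 has_real_derivative - m t * b1d t) (at t)" by simp
  have 4: "(d2 has_real_derivative (2 * r t * rd t * (Q t)^2) * (l t * (r t)^2 * \<beta>2 t + rd t * \<beta>1 t)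
      - Q t * (lp t * (r t)^2 * \<beta>2 t + l t * (2 * r t * rd t) * \<beta>2 t + l t * (r t)^2 * b2d t + r t * (l t * m t - 1) * \<beta>1 t + rd t * b1d t)) (at t)"
    unfolding d2_def[abs_def]
    by (rule DERIV_cong[OF DERIV_mult[OF DERIV_minus[OF dQ] DERIV_add[OF DERIV_mult[OF DERIV_mult[OF dl dr2] B(2)] DERIV_mult[OF drd' B(1)]]]])
       (simp add: algebra_simps)
  moreover have "(2 * r t * rd t * (Q t)^2) * (l t * (r t)^2 * \<beta>2 t + rd t * \<beta>1 t)
      - Q t * (lp t * (r t)^2 * \<beta>2 t + l t * (2 * r t * rd t) * \<beta>2 t + l t * (r t)^2 * b2d t + r t * (l t * m t - 1) * \<beta>1 t + rd t * b1d t) = - m t * b2d t"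
    using rel by algebra
  ultimately show "(d2 has_real_derivative - m t * b2d t) (at t)" by simp
qed

text \<open>The Gram matrix of position, normal and profile tangent, divided by a; the terms with
  the factor \<epsilon> and the radii come from the unit vector \<open>y\<close> of the
  orbit.\<close>

lemma plane_products:
  shows "\<epsilon> * (r t)^2 + (\<beta>1 t)^2 - \<epsilon> * (\<beta>2 t)^2 = 1"
    "\<epsilon> * (l t * r t)^2 + (d1 t)^2 - \<epsilon> * (d2 t)^2 = - 1"
    "- \<epsilon> * l t * (r t)^2 + d1 t * \<beta>1 t - \<epsilon> * (d2 t * \<beta>2 t) = 0"
    "\<epsilon> * (rd t)^2 + (b1d t)^2 - \<epsilon> * (b2d t)^2 = 1"
    "- \<epsilon> * (l t * r t * rd t) + d1 t * b1d t - \<epsilon> * (d2 t * b2d t) = 0"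
    "\<epsilon> * (r t * rd t) + \<beta>1 t * b1d t - \<epsilon> * (\<beta>2 t * b2d t) = 0"
proof -
  note rel = PQ[of t] ee(2) energy[of t] plane[of t]
  note rel' = rel b1d_def[of t] b2d_def[of t] d1_def[of t] d2_def[of t]
  show "\<epsilon> * (r t)^2 + (\<beta>1 t)^2 - \<epsilon> * (\<beta>2 t)^2 = 1" using rel by algebra
  show "\<epsilon> * (l t * r t)^2 + (d1 t)^2 - \<epsilon> * (d2 t)^2 = - 1"
  proof -
    have "(d1 t)^2 - \<epsilon> * (d2 t)^2 = (Q t)^2 * ((l t)^2 * (r t)^4 - \<epsilon> * (rd t)^2) * ((\<beta>1 t)^2 - \<epsilon> * (\<beta>2 t)^2)"
      using ee(2) d1_def[of t] d2_def[of t] by algebra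
    then show ?thesis using rel by algebra
  qed
  show "- \<epsilon> * l t * (r t)^2 + d1 t * \<beta>1 t - \<epsilon> * (d2 t * \<beta>2 t) = 0" using rel' by algebra
  show "\<epsilon> * (rd t)^2 + (b1d t)^2 - \<epsilon> * (b2d t)^2 = 1"
  proof -
    have "(b1d t)^2 - \<epsilon> * (b2d t)^2 = (r t)^2 * (Q t)^2 * ((rd t)^2 - \<epsilon> * (l t)^2) * ((\<beta>1 t)^2 - \<epsilon> * (\<beta>2 t)^2)"
      using ee(2) b1d_def[of t] b2d_def[of t] by algebra
    then show ?thesis using rel by algebra
  qed
  show "- \<epsilon> * (l t * r t * rd t) + d1 t * b1d t - \<epsilon> * (d2 t * b2d t) = 0"
  proof -
    have "d1 t * b1d t - \<epsilon> * (d2 t * b2d t) = - r t * (Q t)^2 * (l t * (r t)^2 * rd t - \<epsilon> * rd t * l t) * ((\<beta>1 t)^2 - \<epsilon> * (\<beta>2 t)^2)"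
      using ee(2) b1d_def[of t] b2d_def[of t] d1_def[of t] d2_def[of t] by algebra
    then show ?thesis using rel by algebra
  qed
  show "\<epsilon> * (r t * rd t) + \<beta>1 t * b1d t - \<epsilon> * (\<beta>2 t * b2d t) = 0" using rel' by algebra
qed

lemma ip_mk:
  assumes "y \<in> E" "z \<in> E"
  shows "ip (mk i1 i2 y b1 b2) (mk i1 i2 z c1 c2) = a * (\<epsilon> * (y \<bullet> z) + b1 * c1 - \<epsilon> * (b2 * c2))"
proof -
  have "y \<bullet> z = (\<Sum>i\<in>UNIV. y $ i * z $ i)" unfolding inner_vec_def by simp
  also have "\<dots> = (\<Sum>i\<in>UNIV - {i1, i2}. y $ i * z $ i)"
    by (rule sum.mono_neutral_right) (use assms in \<open>auto simp: plane_complement_def\<close>)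
  also have "\<dots> = (\<Sum>i\<in>UNIV - {i1, i2}. mk i1 i2 y b1 b2 $ i * mk i1 i2 z c1 c2 $ i)"
    by (rule sum.cong) (use mk_nth(3)[OF i12] assms in auto)
  finally show ?thesis unfolding form mk_nth(1,2)[OF i12 assms(1)] mk_nth(1,2)[OF i12 assms(2)] by simp
qed

lemma E_closed: "y \<in> E \<Longrightarrow> c *\<^sub>R y \<in> E" "y \<in> E \<Longrightarrow> z \<in> E \<Longrightarrow> y + z \<in> E"
  using subspace_plane_complement subspace_scale subspace_add by blast+

lemma ip_frame:
  assumes y: "y \<in> E" "norm y = 1" and u: "u \<in> E" "u \<bullet> y = 0"
  shows "ip (\<psi> t y) (\<psi> t y) = a" "ip (nt t y) (nt t y) = - a" "ip (nt t y) (\<psi> t y) = 0"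
    "ip (et t y) (et t y) = a" "ip (nt t y) (et t y) = 0" "ip (\<psi> t y) (et t y) = 0"
    "ip (nt t y) u = 0" "ip (et t y) u = 0" "ip (\<psi> t y) u = 0" "ip y u = 0" "ip y (et t y) = a * \<epsilon> * rd t"
proof -
  have yy: "y \<bullet> y = 1" using y(2) by (simp add: dot_square_norm)
  have yu: "y \<bullet> u = 0" using u(2) by (simp add: inner_commute)
  note E = E_closed(1)[OF y(1)]
  note P = plane_products[of t]
  have P': "\<epsilon> * (r t * r t) + \<beta>1 t * \<beta>1 t - \<epsilon> * (\<beta>2 t * \<beta>2 t) = 1"
    "\<epsilon> * ((l t * r t) * (l t * r t)) + d1 t * d1 t - \<epsilon> * (d2 t * d2 t) = - 1"
    "\<epsilon> * (rd t * rd t) + b1d t * b1d t - \<epsilon> * (b2d t * b2d t) = 1"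
    "- (\<epsilon> * (l t * r t * r t)) + d1 t * \<beta>1 t - \<epsilon> * (d2 t * \<beta>2 t) = 0"
    using P by (simp_all add: power2_eq_square mult_ac)
  show "ip (\<psi> t y) (\<psi> t y) = a" unfolding \<psi>_def ip_mk[OF E E] using P'(1) yy by simp
  show "ip (nt t y) (nt t y) = - a" unfolding nt_def ip_mk[OF E E] using P'(2) yy by simp
  show "ip (nt t y) (\<psi> t y) = 0" unfolding nt_def \<psi>_def ip_mk[OF E E] using P'(4) yy by (simp add: mult_ac)
  show "ip (et t y) (et t y) = a" unfolding et_def ip_mk[OF E E] using P'(3) yy by simp
  show "ip (nt t y) (et t y) = 0" unfolding nt_def et_def ip_mk[OF E E] using P(5) yy by (simp add: mult_ac)
  show "ip (\<psi> t y) (et t y) = 0" unfolding \<psi>_def et_def ip_mk[OF E E] using P(6) yy by (simp add: mult_ac)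
  have mu: "ip (mk i1 i2 z b1 b2) u = a * \<epsilon> * (z \<bullet> u)" if "z \<in> E" for z b1 b2
    using ip_mk[OF that u(1), of b1 b2 0 0] by (simp add: mk_0 mult_ac)
  show "ip (nt t y) u = 0" "ip (et t y) u = 0" "ip (\<psi> t y) u = 0"
    unfolding nt_def et_def \<psi>_def mu[OF E] using yu by simp_all
  show "ip y u = 0" using mu[OF y(1), of 0 0] yu by (simp add: mk_0)
  show "ip y (et t y) = a * \<epsilon> * rd t" unfolding et_def using ip_mk[OF y(1) E, of 0 0] yy by (simp add: mk_0 mult_ac)
qed

lemma frame_along_curve:
  assumes T: "(T has_real_derivative T') (at s)" and y: "(y has_vector_derivative y') (at s)"
  shows "((\<lambda>s. \<psi> (T s) (y s)) has_vector_derivative T' *\<^sub>R et (T s) (y s) + r (T s) *\<^sub>R y') (at s)"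
    and "((\<lambda>s. nt (T s) (y s)) has_vector_derivative (- m (T s) * T') *\<^sub>R et (T s) (y s) - (l (T s) * r (T s)) *\<^sub>R y') (at s)"
    and "((\<lambda>s. et (T s) (y s)) has_vector_derivative T' *\<^sub>R (- \<psi> (T s) (y s) - m (T s) *\<^sub>R nt (T s) (y s)) + rd (T s) *\<^sub>R y') (at s)"
proof -
  let ?t = "T s"
  note F = frame_equations[of ?t]
  have c: "((\<lambda>s. f (T s)) has_real_derivative f' * T') (at s)" if "(f has_real_derivative f') (at ?t)" for f f'
    by (rule DERIV_chain2[OF that T])
  have "((\<lambda>s. \<psi> (T s) (y s)) has_vector_derivative mk i1 i2 (r ?t *\<^sub>R y' + (rd ?t * T') *\<^sub>R y s) (b1d ?t * T') (b2d ?t * T')) (at s)"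
    unfolding \<psi>_def by (intro mk_has_vector_derivative has_vector_derivative_scaleR c dr y F)
  moreover have "mk i1 i2 (r ?t *\<^sub>R y' + (rd ?t * T') *\<^sub>R y s) (b1d ?t * T') (b2d ?t * T') = T' *\<^sub>R et ?t (y s) + r ?t *\<^sub>R y'"
    unfolding et_def mk_def by (simp add: algebra_simps)
  ultimately show "((\<lambda>s. \<psi> (T s) (y s)) has_vector_derivative T' *\<^sub>R et (T s) (y s) + r (T s) *\<^sub>R y') (at s)" by simp
  have dlr: "((\<lambda>t. - (l t * r t)) has_real_derivative - m ?t * rd ?t) (at ?t)"
  proof -
    have "((\<lambda>t. - (l t * r t)) has_real_derivative - (lp ?t * r ?t + rd ?t * l ?t)) (at ?t)"
      by (intro DERIV_minus DERIV_mult dl dr)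
    moreover have "- (lp ?t * r ?t + rd ?t * l ?t) = - m ?t * rd ?t" using lp[of ?t] unfolding m_def by (simp add: algebra_simps)
    ultimately show ?thesis by simp
  qed
  have "((\<lambda>s. nt (T s) (y s)) has_vector_derivative mk i1 i2 (- (l ?t * r ?t) *\<^sub>R y' + (- m ?t * rd ?t * T') *\<^sub>R y s) (- m ?t * b1d ?t * T') (- m ?t * b2d ?t * T')) (at s)"
    unfolding nt_def by (intro mk_has_vector_derivative has_vector_derivative_scaleR c dlr y F)
  moreover have "mk i1 i2 (- (l ?t * r ?t) *\<^sub>R y' + (- m ?t * rd ?t * T') *\<^sub>R y s) (- m ?t * b1d ?t * T') (- m ?t * b2d ?t * T')
    = (- m ?t * T') *\<^sub>R et ?t (y s) - (l ?t * r ?t) *\<^sub>R y'"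
    unfolding et_def mk_def by (simp add: algebra_simps)
  ultimately show "((\<lambda>s. nt (T s) (y s)) has_vector_derivative (- m (T s) * T') *\<^sub>R et (T s) (y s) - (l (T s) * r (T s)) *\<^sub>R y') (at s)" by simp
  have drd': "(rd has_real_derivative r ?t * (l ?t * m ?t - 1)) (at ?t)" using drd unfolding m_def .
  have "((\<lambda>s. et (T s) (y s)) has_vector_derivative mk i1 i2 (rd ?t *\<^sub>R y' + (r ?t * (l ?t * m ?t - 1) * T') *\<^sub>R y s)
      ((- \<beta>1 ?t - m ?t * d1 ?t) * T') ((- \<beta>2 ?t - m ?t * d2 ?t) * T')) (at s)"
    unfolding et_def by (intro mk_has_vector_derivative has_vector_derivative_scaleR c drd' y F)
  moreover have "mk i1 i2 (rd ?t *\<^sub>R y' + (r ?t * (l ?t * m ?t - 1) * T') *\<^sub>R y s)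
      ((- \<beta>1 ?t - m ?t * d1 ?t) * T') ((- \<beta>2 ?t - m ?t * d2 ?t) * T')
    = T' *\<^sub>R (- \<psi> ?t (y s) - m ?t *\<^sub>R nt ?t (y s)) + rd ?t *\<^sub>R y'"
    unfolding nt_def \<psi>_def mk_def by (simp add: algebra_simps)
  ultimately show "((\<lambda>s. et (T s) (y s)) has_vector_derivative T' *\<^sub>R (- \<psi> (T s) (y s) - m (T s) *\<^sub>R nt (T s) (y s)) + rd (T s) *\<^sub>R y') (at s)" by simp
qed

lemma M_iff: "x \<in> M \<longleftrightarrow> (\<exists>t y. y \<in> E \<and> norm y = 1 \<and> x = \<psi> t y)"
  unfolding rotation_surface_def \<psi>_def by blast

lemma tau_psi: "y \<in> E \<Longrightarrow> norm y = 1 \<Longrightarrow> \<tau> (\<psi> t y) = t" "y \<in> E \<Longrightarrow> norm y = 1 \<Longrightarrow> \<psi> t y \<in> W0"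
  unfolding \<psi>_def using tau(2,3) by blast+

lemma proj_psi: "y \<in> E \<Longrightarrow> proj i1 i2 (\<psi> t y) = r t *\<^sub>R y"
  unfolding \<psi>_def using mk_nth(4)[OF i12 E_closed(1)] by blast

lemma M_subset: "M \<subseteq> W0" using tau_psi(2) by (auto simp: M_iff)

text \<open>The frame fields as functions of an ambient point. On the surface \<open>proj\<close>
  yields \<open>r t\<close> times the unit vector, which explains the missing factor r in the normal
  and the division by r in the tangent.\<close>

definition nuF where "nuF x = mk i1 i2 (- l (\<tau> x) *\<^sub>R proj i1 i2 x) (d1 (\<tau> x)) (d2 (\<tau> x))"
definition enF where "enF x = mk i1 i2 ((rd (\<tau> x) / r (\<tau> x)) *\<^sub>R proj i1 i2 x) (b1d (\<tau> x)) (b2d (\<tau> x))"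
definition lamF where "lamF x = l (\<tau> x)"
definition muF where "muF x = m (\<tau> x)"

lemma fields_psi:
  assumes "y \<in> E" "norm y = 1"
  shows "nuF (\<psi> t y) = nt t y" "enF (\<psi> t y) = et t y" "lamF (\<psi> t y) = l t" "muF (\<psi> t y) = m t"
  unfolding nuF_def enF_def lamF_def muF_def nt_def et_def tau_psi(1)[OF assms] proj_psi[OF assms(1)]
  using r_pos[of t] by simp_all

lemma fields_smooth: "Cinf_fun_on M nuF" "Cinf_fun_on M enF" "Cinf_fun_on M lamF" "Cinf_fun_on M muF"
proof -
  have W: "open W0" by (rule Cinf_on_open[OF tau(1)])
  have comp: "Ck_on k W0 (\<lambda>x. f (\<tau> x))" if "Ck_on k UNIV f" for k and f :: "real \<Rightarrow> real"
    by (rule Ck_on_compose_real[OF W open_UNIV _ that Cinf_on_Ck[OF tau(1)]]) simp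
  have sQ: "Ck_on k UNIV Q" for k unfolding Q_def[abs_def]
    by (intro Ck_on_inverse_pos Ck_on_diff Ck_on_power Ck_on_const smooth) (use P_pos in auto)
  have s: "Ck_on k UNIV b1d" "Ck_on k UNIV b2d" "Ck_on k UNIV d1" "Ck_on k UNIV d2" "Ck_on k UNIV m" for k
    unfolding b1d_def[abs_def] b2d_def[abs_def] d1_def[abs_def] d2_def[abs_def] m_def[abs_def]
    by (intro Ck_on_mult Ck_on_add Ck_on_diff Ck_on_minus Ck_on_power Ck_on_const open_UNIV smooth sQ)+
  have pr: "Ck_on k W0 (proj i1 i2)" for k by (rule Ck_on_bounded_linear_id[OF W bounded_linear_proj])
  have sr: "Ck_on k UNIV (\<lambda>t. rd t / r t)" for k
    by (intro Ck_on_divide smooth open_UNIV) (use r_pos in \<open>force simp: less_le\<close>)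
  have "Cinf_on W0 nuF" "Cinf_on W0 enF" "Cinf_on W0 lamF" "Cinf_on W0 muF"
    unfolding nuF_def[abs_def] enF_def[abs_def] lamF_def[abs_def] muF_def[abs_def]
    by (intro Cinf_onI W Ck_on_mk Ck_on_scaleR Ck_on_minus comp[OF s(1)] comp[OF s(2)] comp[OF s(3)] comp[OF s(4)] comp[OF s(5)]
        comp[OF smooth(3)] comp[OF sr] pr)+
  then show "Cinf_fun_on M nuF" "Cinf_fun_on M enF" "Cinf_fun_on M lamF" "Cinf_fun_on M muF"
    using Cinf_fun_onI[OF _ M_subset] by blast+
qed

end

context cmc_profile
begin

section \<open>Tangent spaces, principal frames, connectedness and completeness\<close>

text \<open>Leaf directions: orthogonality to two axes and to \<open>y\<close> removes three of the
  n + 2 dimensions.\<close>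

lemma orthonormal_complement:
  assumes y: "y \<in> E" "norm y = 1"
  obtains u where "\<And>i. i < n - 1 \<Longrightarrow> u i \<in> E \<and> u i \<bullet> y = 0"
    "\<And>i j. i < n - 1 \<Longrightarrow> j < n - 1 \<Longrightarrow> u i \<bullet> u j = (if i = j then 1 else 0)"
proof -
  let ?X = "{axis i1 1, axis i2 1, y} :: (real, 'm) vec set"
  define S where "S = {x \<in> UNIV. \<forall>v\<in>span ?X. orthogonal v x}"
  have y0: "y $ i1 = 0" "y $ i2 = 0" using y(1) unfolding plane_complement_def by auto
  have ne: "axis i1 (1::real) \<noteq> axis i2 1" "y \<noteq> axis i1 1" "y \<noteq> axis i2 1" "y \<noteq> 0"
    using i12 y0 y(2) by (auto simp: axis_eq_axis)
  have "axis i1 (1::real) $ i2 = 0" "axis i2 (1::real) $ i1 = 0" using i12 by (simp_all add: axis_def)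
  then have "pairwise orthogonal ?X" using ne i12 y0
    by (auto simp: pairwise_def orthogonal_def inner_axis_axis inner_axis' inner_axis)
  then have ind: "independent ?X" by (rule pairwise_orthogonal_independent) (use ne in \<open>auto simp: axis_eq_0_iff\<close>)
  have "card ?X = 3" using ne by auto
  then have "dim (span ?X) = 3" using dim_span_eq_card_independent[OF ind] by simp
  moreover have "dim S + dim (span ?X) = dim (UNIV :: (real, 'm) vec set)"
    unfolding S_def by (rule dim_subspace_orthogonal_to_vectors) auto
  ultimately have dS: "dim S = n - 1" using card_index by simp
  have subS: "subspace S" unfolding S_def subspace_def by (auto simp: orthogonal_def inner_add_right)
  obtain B where B: "B \<subseteq> S" "pairwise orthogonal B" "\<And>x. x \<in> B \<Longrightarrow> norm x = 1" "independent B" "card B = dim S"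
    by (rule orthonormal_basis_subspace[OF subS]) (rule that; assumption)
  have "finite B" using B(4) independent_imp_finite by blast
  then obtain u where u: "bij_betw u {0..<card B} B" using ex_bij_betw_nat_finite by blast
  have uB: "u i \<in> B" if "i < n - 1" for i using u that B(5) dS unfolding bij_betw_def by auto
  have uS: "u i \<in> E \<and> u i \<bullet> y = 0" if "i < n - 1" for i
  proof -
    have "u i \<in> S" using uB[OF that] B(1) by blast
    then have "orthogonal v (u i)" if "v \<in> ?X" for v using that unfolding S_def by (auto intro: span_base)
    then have "axis i1 1 \<bullet> u i = 0" "axis i2 1 \<bullet> u i = 0" "y \<bullet> u i = 0" unfolding orthogonal_def by auto
    then show ?thesis unfolding plane_complement_def
      using inner_commute[of _ "u i"] by (simp add: inner_axis)
  qed
  have "u i \<bullet> u j = (if i = j then 1 else 0)" if "i < n - 1" "j < n - 1" for i j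
  proof (cases "i = j")
    case True then show ?thesis using B(3)[OF uB[OF that(1)]] by (simp add: dot_square_norm)
  next
    case False
    then have "u i \<noteq> u j" using u that B(5) dS unfolding bij_betw_def inj_on_def by auto
    then show ?thesis using B(2) uB[OF that(1)] uB[OF that(2)] False unfolding pairwise_def orthogonal_def by auto
  qed
  then show thesis using that uS by blast
qed

lemma unit_exists: obtains y where "y \<in> E" "norm y = 1"
proof -
  have "card {i1, i2} < CARD('m)" using card_index n_gt i12 by simp
  then obtain i where "i \<notin> {i1, i2}" by (metis UNIV_eq_I less_irrefl)
  then have "axis i (1::real) \<in> E" unfolding plane_complement_def by (auto simp: axis_def)
  then show thesis using that norm_axis_1 by blast
qed

lemma unit_orthogonal: assumes "y \<in> E" "norm y = 1" obtains u where "u \<in> E" "norm u = 1" "u \<bullet> y = 0"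
proof -
  obtain u where u: "\<And>i. i < n - 1 \<Longrightarrow> u i \<in> E \<and> u i \<bullet> y = 0"
    "\<And>i j. i < n - 1 \<Longrightarrow> j < n - 1 \<Longrightarrow> u i \<bullet> u j = (if i = j then 1 else 0)"
    by (rule orthonormal_complement[OF assms]) (rule that; assumption)
  have "norm (u 0) = 1" using u(2)[of 0 0] n_gt by (simp add: norm_eq_1)
  then show thesis using that[of "u 0"] u(1)[of 0] n_gt by simp
qed

lemma great_circle:
  assumes y: "y \<in> E" "norm y = 1" and u: "u \<in> E" "norm u = 1" "u \<bullet> y = 0"
    and yc: "yc = (\<lambda>x. cos x *\<^sub>R y + sin x *\<^sub>R u)" and uc: "uc = (\<lambda>x. - sin x *\<^sub>R y + cos x *\<^sub>R u)"
  shows "yc x \<in> E" "norm (yc x) = 1" "uc x \<in> E" "uc x \<bullet> yc x = 0"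
    "(f has_real_derivative f') (at s) \<Longrightarrow> ((\<lambda>s. yc (f s)) has_vector_derivative f' *\<^sub>R uc (f s)) (at s)"
    "(f has_real_derivative f') (at s) \<Longrightarrow> ((\<lambda>s. uc (f s)) has_vector_derivative - f' *\<^sub>R yc (f s)) (at s)"
proof -
  have n: "y \<bullet> y = 1" "u \<bullet> u = 1" "y \<bullet> u = 0" using y u by (simp_all add: dot_square_norm inner_commute)
  show "yc x \<in> E" "uc x \<in> E" unfolding yc uc by (intro E_closed y(1) u(1))+
  have "yc x \<bullet> yc x = (cos x)^2 + (sin x)^2" unfolding yc using n u(3)
    by (simp add: inner_add_left inner_add_right power2_eq_square)
  then show "norm (yc x) = 1" by (simp add: norm_eq_1)
  show "uc x \<bullet> yc x = 0" unfolding yc uc using n u(3)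
    by (simp add: inner_add_left inner_add_right inner_diff_left inner_diff_right)
  show "((\<lambda>s. yc (f s)) has_vector_derivative f' *\<^sub>R uc (f s)) (at s)" if f: "(f has_real_derivative f') (at s)"
  proof -
    have "((\<lambda>s. cos (f s)) has_real_derivative - sin (f s) * f') (at s)" "((\<lambda>s. sin (f s)) has_real_derivative cos (f s) * f') (at s)"
      using f by (auto intro!: derivative_eq_intros)
    from has_vector_derivative_add[OF has_vector_derivative_scaleR[OF this(1) has_vector_derivative_const]
        has_vector_derivative_scaleR[OF this(2) has_vector_derivative_const], of y u]
    show ?thesis unfolding yc uc by (simp add: algebra_simps)
  qed
  show "((\<lambda>s. uc (f s)) has_vector_derivative - f' *\<^sub>R yc (f s)) (at s)" if f: "(f has_real_derivative f') (at s)"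
  proof -
    have "((\<lambda>s. - sin (f s)) has_real_derivative - (cos (f s) * f')) (at s)" "((\<lambda>s. cos (f s)) has_real_derivative - sin (f s) * f') (at s)"
      using f by (auto intro!: derivative_eq_intros)
    from has_vector_derivative_add[OF has_vector_derivative_scaleR[OF this(1) has_vector_derivative_const]
        has_vector_derivative_scaleR[OF this(2) has_vector_derivative_const], of y u]
    show ?thesis unfolding yc uc by (simp add: algebra_simps)
  qed
qed

lemma psi_in_M: "y \<in> E \<Longrightarrow> norm y = 1 \<Longrightarrow> \<psi> t y \<in> M"
  using M_iff by blast

lemma leaf_curve:
  assumes y: "y \<in> E" "norm y = 1" and u: "u \<in> E" "norm u = 1" "u \<bullet> y = 0"
  obtains c where "\<And>s. c s \<in> M" "c 0 = \<psi> t y" "(c has_vector_derivative u) (at 0)"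
    "((\<lambda>s. nuF (c s)) has_vector_derivative - l t *\<^sub>R u) (at 0)"
proof -
  define yc where "yc = (\<lambda>x. cos x *\<^sub>R y + sin x *\<^sub>R u)"
  define uc where "uc = (\<lambda>x. - sin x *\<^sub>R y + cos x *\<^sub>R u)"
  note G = great_circle[OF y u yc_def uc_def]
  \<comment> \<open>The great circle is run through at angular speed 1/r, so that the curve on the
    surface has velocity exactly \<open>u\<close>.\<close>
  define c where "c s = \<psi> t (yc (s / r t))" for s
  have r: "r t \<noteq> 0" using r_pos[of t] by simp
  have d: "((\<lambda>s. s / r t) has_real_derivative 1 / r t) (at 0)" using r by (auto intro!: derivative_eq_intros)
  have u0: "uc (0 / r t) = u" "yc (0 / r t) = y" unfolding uc_def yc_def by auto
  note F = frame_along_curve[OF DERIV_const G(5)[OF d], of t]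
  have "(c has_vector_derivative u) (at 0)" using F(1) unfolding c_def[abs_def] u0 using r by simp
  moreover have "((\<lambda>s. nuF (c s)) has_vector_derivative - l t *\<^sub>R u) (at 0)"
    using F(2) unfolding c_def u0 fields_psi(1)[OF G(1,2)] using r by simp
  moreover have "c s \<in> M" for s unfolding c_def using psi_in_M G by blast
  moreover have "c 0 = \<psi> t y" unfolding c_def u0 ..
  ultimately show thesis using that by blast
qed

lemma profile_derivatives:
  assumes y: "y \<in> E" "norm y = 1"
  shows "((\<lambda>s. \<psi> s y) has_vector_derivative et t y) (at t)"
    "((\<lambda>s. nuF (\<psi> s y)) has_vector_derivative - m t *\<^sub>R et t y) (at t)"
  using frame_along_curve(1,2)[OF DERIV_ident has_vector_derivative_const, of y t] unfolding fields_psi(1)[OF y]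
  by simp_all

lemma et_tangent: "y \<in> E \<Longrightarrow> norm y = 1 \<Longrightarrow> et t y \<in> tangent_space M (\<psi> t y)"
  by (rule tangent_space_of_curve[OF open_UNIV UNIV_I _ profile_derivatives(1)]) (rule psi_in_M)

text \<open>Along any differentiable curve in the surface the profile parameter is differentiable
  through \<open>\<tau>\<close>. Differentiating both axis coordinates and the squared radius
  determines the velocity up to a vector tangent to the orbit sphere.\<close>

lemma tangent_decomposition:
  assumes y: "y \<in> E" "norm y = 1" and v: "v \<in> tangent_space M (\<psi> t y)"
  obtains \<alpha> u where "u \<in> E" "u \<bullet> y = 0" "v = \<alpha> *\<^sub>R et t y + u"
proof -
  obtain c e where c: "0 < e" "\<And>s. s \<in> {-e<..<e} \<Longrightarrow> c s \<in> M" "c 0 = \<psi> t y" "(c has_vector_derivative v) (at 0)"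
    using v unfolding tangent_space_def by blast
  have S: "open {-e<..<e}" "0 \<in> {-e<..<e}" using c(1) by auto
  have pW: "\<psi> t y \<in> W0" using tau_psi[OF y] by blast
  define T where "T s = \<tau> (c s)" for s
  define \<alpha> where "\<alpha> = frechet_derivative \<tau> (at (\<psi> t y)) v"
  have "((\<lambda>s. \<tau> (c s)) has_vector_derivative \<alpha>) (at 0)" unfolding \<alpha>_def
    by (rule extension_derivative_along_curve[where F=\<tau> and W=W0, OF Cinf_on_open[OF tau(1)] _ _ _ S c(2) c(4)])
       (use pW c(3) Cinf_on_has_derivative[OF tau(1) pW] in auto)
  then have dT: "(T has_real_derivative \<alpha>) (at 0)" unfolding T_def[abs_def] has_real_derivative_iff_has_vector_derivative .
  have T0: "T 0 = t" unfolding T_def c(3) using tau_psi[OF y] by blast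
  have cs: "c s $ i1 = \<beta>1 (T s) \<and> c s $ i2 = \<beta>2 (T s) \<and> proj i1 i2 (c s) \<bullet> proj i1 i2 (c s) = (r (T s))^2"
    if hs: "s \<in> {-e<..<e}" for s
  proof -
    obtain t' y' where y': "y' \<in> E" "norm y' = 1" "c s = \<psi> t' y'" using c(2)[OF hs] unfolding M_iff by blast
    have "T s = t'" unfolding T_def y'(3) using tau_psi y' by blast
    moreover have "c s $ i1 = \<beta>1 t'" "c s $ i2 = \<beta>2 t'" unfolding y'(3) \<psi>_def using mk_nth(1,2)[OF i12 E_closed(1)[OF y'(1)]] by auto
    moreover have "proj i1 i2 (c s) \<bullet> proj i1 i2 (c s) = (r t')^2" unfolding y'(3) proj_psi[OF y'(1)]
      using y'(2) by (simp add: dot_square_norm power2_eq_square)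
    ultimately show ?thesis by simp
  qed
  have chain: "((\<lambda>s. f (T s)) has_vector_derivative f' * \<alpha>) (at 0)" if "(f has_real_derivative f') (at t)" for f f'
    unfolding has_real_derivative_iff_has_vector_derivative[symmetric] by (rule DERIV_chain2[OF _ dT]) (use that T0 in simp)
  have "((\<lambda>s. c s $ i1) has_vector_derivative v $ i1) (at 0)" "((\<lambda>s. c s $ i2) has_vector_derivative v $ i2) (at 0)"
    using bounded_linear.has_vector_derivative[OF bounded_linear_vec_nth c(4)] by blast+
  then have "((\<lambda>s. \<beta>1 (T s)) has_vector_derivative v $ i1) (at 0)" "((\<lambda>s. \<beta>2 (T s)) has_vector_derivative v $ i2) (at 0)"
    using has_vector_derivative_transform_within_open[OF _ S] cs by (metis (no_types, lifting))+
  then have v12: "v $ i1 = b1d t * \<alpha>" "v $ i2 = b2d t * \<alpha>"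
    using chain[OF frame_equations(1)] chain[OF frame_equations(2)] vector_derivative_unique_at by blast+
  have dp: "((\<lambda>s. proj i1 i2 (c s)) has_vector_derivative proj i1 i2 v) (at 0)"
    by (rule bounded_linear.has_vector_derivative[OF bounded_linear_proj c(4)])
  have "((\<lambda>s. proj i1 i2 (c s) \<bullet> proj i1 i2 (c s)) has_vector_derivative
      (proj i1 i2 (c 0) \<bullet> proj i1 i2 v + proj i1 i2 v \<bullet> proj i1 i2 (c 0))) (at 0)"
    by (rule bounded_bilinear.has_vector_derivative[OF bounded_bilinear_inner dp dp])
  then have "((\<lambda>s. (r (T s))^2) has_vector_derivative (proj i1 i2 (c 0) \<bullet> proj i1 i2 v + proj i1 i2 v \<bullet> proj i1 i2 (c 0))) (at 0)"
    by (rule has_vector_derivative_transform_within_open[OF _ S]) (use cs in blast)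
  moreover have "((\<lambda>s. (r (T s))^2) has_vector_derivative (2 * r t * rd t) * \<alpha>) (at 0)"
    by (rule chain) (auto intro!: derivative_eq_intros dr)
  ultimately have "proj i1 i2 (c 0) \<bullet> proj i1 i2 v + proj i1 i2 v \<bullet> proj i1 i2 (c 0) = 2 * r t * rd t * \<alpha>"
    using vector_derivative_unique_at by blast
  then have "r t * (y \<bullet> proj i1 i2 v) = r t * (rd t * \<alpha>)" unfolding c(3) proj_psi[OF y(1)] by (simp add: inner_commute)
  then have yv: "y \<bullet> proj i1 i2 v = rd t * \<alpha>" using r_pos[of t] by simp
  define u where "u = proj i1 i2 v - (rd t * \<alpha>) *\<^sub>R y"
  have "u \<in> E" unfolding u_def using proj_complement[OF i12] y(1) subspace_diff[OF subspace_plane_complement] E_closed(1) by blast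
  moreover have "u \<bullet> y = 0" unfolding u_def using yv y(2) by (simp add: inner_diff_left inner_diff_right inner_commute dot_square_norm)
  moreover have "v = \<alpha> *\<^sub>R et t y + u"
  proof -
    have "v = mk i1 i2 (proj i1 i2 v) (b1d t * \<alpha>) (b2d t * \<alpha>)" using mk_proj[of i1 i2 v] v12 by simp
    also have "\<dots> = \<alpha> *\<^sub>R et t y + u" unfolding et_def u_def mk_def by (simp add: algebra_simps)
    finally show ?thesis .
  qed
  ultimately show thesis using that by blast
qed

lemma ip_tangent_zero:
  assumes y: "y \<in> E" "norm y = 1" and v: "v \<in> tangent_space M (\<psi> t y)"
  shows "ip (nt t y) v = 0" "ip (\<psi> t y) v = 0"
proof -
  obtain \<alpha> u where u: "u \<in> E" "u \<bullet> y = 0" "v = \<alpha> *\<^sub>R et t y + u"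
    by (rule tangent_decomposition[OF y v]) (rule that; assumption)
  show "ip (nt t y) v = 0" "ip (\<psi> t y) v = 0" unfolding u(3) using ip_frame[OF y u(1,2)] by (simp_all add: pinner_simps)
qed

lemma frame_exists:
  assumes y: "y \<in> E" "norm y = 1" and p: "p = \<psi> t y"
  shows "\<exists>e. (\<forall>i<n. e i \<in> tangent_space M p) \<and>
          (\<forall>i<n. \<forall>i'<n. \<bar>ip (e i) (e i')\<bar> = (if i = i' then 1 else 0)) \<and>
          e (n - 1) = enF p \<and>
          (\<forall>i<n - 1. shape_op M nuF p (e i) = lamF p *\<^sub>R e i) \<and>
          shape_op M nuF p (enF p) = muF p *\<^sub>R enF p"
proof -
  obtain u where u: "\<And>i. i < n - 1 \<Longrightarrow> u i \<in> E \<and> u i \<bullet> y = 0"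
    "\<And>i j. i < n - 1 \<Longrightarrow> j < n - 1 \<Longrightarrow> u i \<bullet> u j = (if i = j then 1 else 0)"
    by (rule orthonormal_complement[OF y]) (rule that; assumption)
  have nu: "norm (u i) = 1" if "i < n - 1" for i using u(2)[OF that that] by (simp add: norm_eq_1)
  define e where "e i = (if i < n - 1 then u i else et t y)" for i
  have leaf: "u i \<in> tangent_space M p \<and> shape_op M nuF p (u i) = l t *\<^sub>R u i" if i: "i < n - 1" for i
  proof -
    obtain c where c: "\<And>s. c s \<in> M" "c 0 = \<psi> t y" "(c has_vector_derivative u i) (at 0)"
      "((\<lambda>s. nuF (c s)) has_vector_derivative - l t *\<^sub>R u i) (at 0)"
      by (rule leaf_curve[OF y _ nu[OF i], of t]) (use u(1)[OF i] that in \<open>blast+\<close>)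
    have "u i \<in> tangent_space M (c 0)" by (rule tangent_space_of_curve[OF open_UNIV UNIV_I c(1) c(3)])
    moreover have "Mderiv M nuF (c 0) (u i) = - l t *\<^sub>R u i"
      by (rule Mderiv_along_curve[OF fields_smooth(1) open_UNIV UNIV_I c(1) c(3) c(4)])
    ultimately show ?thesis unfolding shape_op_def p c(2) by simp
  qed
  have "Mderiv M nuF (\<psi> t y) (et t y) = - m t *\<^sub>R et t y"
    by (rule Mderiv_along_curve[OF fields_smooth(1) open_UNIV UNIV_I psi_in_M[OF y] profile_derivatives[OF y]])
  then have sh: "shape_op M nuF p (et t y) = m t *\<^sub>R et t y" unfolding shape_op_def p by simp
  have uu: "ip (u i) (u j) = a * \<epsilon> * (if i = j then 1 else 0)" if "i < n - 1" "j < n - 1" for i j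
    using ip_mk[of "u i" "u j" 0 0 0 0] u that by (simp add: mk_0)
  have ue: "ip (et t y) (u i) = 0" "ip (u i) (et t y) = 0" if "i < n - 1" for i
    using ip_frame(8)[OF y, of "u i" t] u(1)[OF that] pinner_commute[of _ "u i" "et t y"] by auto
  have eet: "ip (et t y) (et t y) = a" 
  proof (rule ip_frame(4)[OF y])
    show "(0 :: (real, 'm) vec) \<in> E" by (rule subspace_0[OF subspace_plane_complement])
  qed simp
  have "\<bar>ip (e i) (e i')\<bar> = (if i = i' then 1 else 0)" if "i < n" "i' < n" for i i'
    using that uu[of i i'] ue[of i] ue[of i'] eet a_sign eps unfolding e_def by (auto simp: abs_mult)
  moreover have "e i \<in> tangent_space M p" if "i < n" for i
    unfolding e_def using leaf et_tangent[OF y, of t] p by auto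
  moreover have "e (n - 1) = enF p" unfolding e_def p fields_psi[OF y] by simp
  moreover have "shape_op M nuF p (e i) = lamF p *\<^sub>R e i" if "i < n - 1" for i
    using leaf[OF that] that unfolding e_def p fields_psi[OF y] by simp
  moreover have "shape_op M nuF p (enF p) = muF p *\<^sub>R enF p" using sh unfolding p fields_psi[OF y] .
  ultimately show ?thesis by blast
qed

text \<open>The surface is a continuous image of the product of the line with E minus the origin,
  and E is not collinear, so removing a point leaves it connected.\<close>

lemma connected_M: "connected M"
proof -
  have conv: "convex E" by (rule subspace_imp_convex[OF subspace_plane_complement])
  obtain y where y: "y \<in> E" "norm y = 1" by (rule unit_exists)
  obtain u where u: "u \<in> E" "norm u = 1" "u \<bullet> y = 0" by (rule unit_orthogonal[OF y])
  have "\<not> collinear E"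
  proof
    assume "collinear E"
    then have "collinear {0, y, u}"
      by (rule collinear_subset) (use y u subspace_0[OF subspace_plane_complement] in auto)
    then obtain c where "u = c *\<^sub>R y" using y(2) u(2) by (auto simp: collinear_lemma)
    then show False using u y by (auto simp: dot_square_norm)
  qed
  then have "path_connected (E - {0})" by (intro path_connected_convex_diff_countable conv) auto
  then have "connected ((UNIV :: real set) \<times> (E - {0}))"
    by (intro connected_Times path_connected_imp_connected connected_UNIV)
  moreover have cont: "continuous_on ((UNIV :: real set) \<times> (E - {0})) (\<lambda>z. \<psi> (fst z) (inverse (norm (snd z)) *\<^sub>R snd z))"
  proof -
    have c: "continuous_on UNIV r" "continuous_on UNIV \<beta>1" "continuous_on UNIV \<beta>2"
      using DERIV_isCont[OF dr] DERIV_isCont[OF db1] DERIV_isCont[OF db2] by (auto intro: continuous_at_imp_continuous_on)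
    show ?thesis unfolding \<psi>_def mk_def
      by (intro continuous_intros continuous_on_compose2[OF c(1)] continuous_on_compose2[OF c(2)] continuous_on_compose2[OF c(3)]) auto
  qed
  ultimately have "connected ((\<lambda>z. \<psi> (fst z) (inverse (norm (snd z)) *\<^sub>R snd z)) ` (UNIV \<times> (E - {0})))"
    by (rule connected_continuous_image[rotated])
  moreover have "(\<lambda>z. \<psi> (fst z) (inverse (norm (snd z)) *\<^sub>R snd z)) ` (UNIV \<times> (E - {0})) = M"
  proof
    show "(\<lambda>z. \<psi> (fst z) (inverse (norm (snd z)) *\<^sub>R snd z)) ` (UNIV \<times> (E - {0})) \<subseteq> M"
    proof
      fix x assume "x \<in> (\<lambda>z. \<psi> (fst z) (inverse (norm (snd z)) *\<^sub>R snd z)) ` (UNIV \<times> (E - {0}))"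
      then obtain z where z: "z \<in> UNIV \<times> (E - {0})" "x = \<psi> (fst z) (inverse (norm (snd z)) *\<^sub>R snd z)"
        by (rule imageE)
      show "x \<in> M" unfolding z(2)
      proof (rule psi_in_M[OF E_closed(1)])
        have "norm (snd z) \<noteq> 0" using z(1) by auto
        then show "norm (inverse (norm (snd z)) *\<^sub>R snd z) = 1" by simp
      qed (use z(1) in auto)
    qed
    show "M \<subseteq> (\<lambda>z. \<psi> (fst z) (inverse (norm (snd z)) *\<^sub>R snd z)) ` (UNIV \<times> (E - {0}))"
    proof
      fix x assume "x \<in> M"
      then obtain t y where y: "y \<in> E" "norm y = 1" "x = \<psi> t y" unfolding M_iff by blast
      then show "x \<in> (\<lambda>z. \<psi> (fst z) (inverse (norm (snd z)) *\<^sub>R snd z)) ` (UNIV \<times> (E - {0}))"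
        by (intro image_eqI[of _ _ "(t, y)"]) auto
    qed
  qed
  ultimately show ?thesis by simp
qed

text \<open>Geodesics are found from the conserved angular momentum \<open>L\<close>: the leaf component runs along a great
  circle with angular velocity \<open>L / r\<^sup>2\<close>, and the profile parameter obeys \<open>T'' = \<epsilon> L\<^sup>2 r' / r\<^sup>3\<close>.\<close>

lemma complete_M: "geod_complete (sf_index k a) M"
  unfolding geod_complete_def
proof (intro ballI)
  fix p v assume p: "p \<in> M" and v: "v \<in> tangent_space M p"
  obtain t y where y: "y \<in> E" "norm y = 1" and py: "p = \<psi> t y" using p unfolding M_iff by blast
  obtain \<alpha> u0 where u0: "u0 \<in> E" "u0 \<bullet> y = 0" "v = \<alpha> *\<^sub>R et t y + u0"
    by (rule tangent_decomposition[OF y v[unfolded py]]) (rule that; assumption)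
  \<comment> \<open>The direction of the great circle. If the leaf component vanishes, any unit
    vector orthogonal to \<open>y\<close> will do.\<close>
  obtain u where u: "u \<in> E" "norm u = 1" "u \<bullet> y = 0" and u0u: "u0 = norm u0 *\<^sub>R u"
  proof (cases "u0 = 0")
    case True
    obtain u where "u \<in> E" "norm u = 1" "u \<bullet> y = 0" by (rule unit_orthogonal[OF y])
    then show thesis using that[of u] True by simp
  next
    case False
    show thesis by (rule that[of "inverse (norm u0) *\<^sub>R u0"]) (use False u0 E_closed(1) in auto)
  qed
  \<comment> \<open>Angular momentum r^2 \<phi>' at the start, the initial angular velocity being
    \<open>norm u0\<close> / r.\<close>
  define L where "L = r t * norm u0"
  define G where "G T = \<epsilon> * L^2 * (rd T / (r T)^3)" for T
  obtain K where K: "\<And>s t. \<bar>rd s / (r s)^3 - rd t / (r t)^3\<bar> \<le> K * \<bar>s - t\<bar>" using lip by blast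
  have "\<bar>G x - G y\<bar> \<le> (L^2 * K) * \<bar>x - y\<bar>" for x y
  proof -
    have "G x - G y = \<epsilon> * L^2 * (rd x / (r x)^3 - rd y / (r y)^3)" unfolding G_def by (simp add: algebra_simps)
    then have "\<bar>G x - G y\<bar> = L^2 * \<bar>rd x / (r x)^3 - rd y / (r y)^3\<bar>" using eps by (auto simp: abs_mult)
    also have "\<dots> \<le> L^2 * (K * \<bar>x - y\<bar>)" using K by (intro mult_left_mono) auto
    finally show ?thesis by (simp add: mult.assoc)
  qed
  then obtain T T' where T: "T 0 = t" "T' 0 = \<alpha>" "\<And>s. (T has_real_derivative T' s) (at s)" "\<And>s. (T' has_real_derivative G (T s)) (at s)"
    using second_order_global[of G "L^2 * K" t \<alpha>] by blast
  have cT: "isCont (\<lambda>s. L / (r (T s))^2) s" for s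
    using isCont_o2[OF DERIV_isCont[OF T(3)] DERIV_isCont[OF dr]] r_pos[of "T s"] by (intro continuous_intros) auto
  obtain \<phi> where \<phi>: "\<phi> 0 = 0" "\<And>s. (\<phi> has_vector_derivative L / (r (T s))^2) (at s)"
    using antiderivative_UNIV[of "\<lambda>s. L / (r (T s))^2"] cT continuous_at_imp_continuous_on by blast
  have d\<phi>: "(\<phi> has_real_derivative L / (r (T s))^2) (at s)" for s
    using \<phi>(2) unfolding has_real_derivative_iff_has_vector_derivative .
  define yc where "yc = (\<lambda>x. cos x *\<^sub>R y + sin x *\<^sub>R u)"
  define uc where "uc = (\<lambda>x. - sin x *\<^sub>R y + cos x *\<^sub>R u)"
  note C = great_circle[OF y u yc_def uc_def]
  define c where "c s = \<psi> (T s) (yc (\<phi> s))" for s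
  define c' where "c' s = T' s *\<^sub>R et (T s) (yc (\<phi> s)) + (L / r (T s)) *\<^sub>R uc (\<phi> s)" for s
  define c'' where "c'' s = G (T s) *\<^sub>R et (T s) (yc (\<phi> s))
     + (T' s)^2 *\<^sub>R (- \<psi> (T s) (yc (\<phi> s)) - m (T s) *\<^sub>R nt (T s) (yc (\<phi> s))) - (L^2 / (r (T s))^3) *\<^sub>R yc (\<phi> s)" for s
  have yc0: "yc 0 = y" "uc 0 = u" unfolding yc_def uc_def by auto
  have "c 0 = p" unfolding c_def T \<phi> yc0 py ..
  moreover have "c' 0 = v"
  proof -
    have "L / r t = norm u0" unfolding L_def using r_pos[of t] by simp
    then show ?thesis unfolding c'_def T \<phi> yc0 u0(3) using u0u by simp
  qed
  moreover have "c s \<in> M \<and> (c has_vector_derivative c' s) (at s) \<and> (c' has_vector_derivative c'' s) (at s) \<and>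
      (\<forall>w\<in>tangent_space M (c s). ip (c'' s) w = 0)" for s
  proof (intro conjI ballI)
    let ?T = "T s" and ?y = "yc (\<phi> s)" and ?u = "uc (\<phi> s)"
    have r: "r ?T > 0" by (rule r_pos)
    show "c s \<in> M" unfolding c_def by (rule psi_in_M[OF C(1,2)])
    have "((\<lambda>s. \<psi> (T s) (yc (\<phi> s))) has_vector_derivative T' s *\<^sub>R et ?T ?y + r ?T *\<^sub>R ((L / (r ?T)^2) *\<^sub>R ?u)) (at s)"
      by (rule frame_along_curve(1)[OF T(3) C(5)[OF d\<phi>]])
    moreover have "r ?T * (L / (r ?T)^2) = L / r ?T" using r by (simp add: power2_eq_square)
    ultimately show "(c has_vector_derivative c' s) (at s)" unfolding c_def[abs_def] c'_def by simp
    have 1: "((\<lambda>s. et (T s) (yc (\<phi> s))) has_vector_derivative T' s *\<^sub>R (- \<psi> ?T ?y - m ?T *\<^sub>R nt ?T ?y) + rd ?T *\<^sub>R ((L / (r ?T)^2) *\<^sub>R ?u)) (at s)"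
      by (rule frame_along_curve(3)[OF T(3) C(5)[OF d\<phi>]])
    have 2: "((\<lambda>s. L / r (T s)) has_real_derivative - (L * (rd ?T * T' s)) / (r ?T)^2) (at s)"
      using r by (auto intro!: derivative_eq_intros DERIV_chain2[OF dr T(3)] simp: power2_eq_square)
    have "(c' has_vector_derivative (T' s *\<^sub>R (T' s *\<^sub>R (- \<psi> ?T ?y - m ?T *\<^sub>R nt ?T ?y) + rd ?T *\<^sub>R ((L / (r ?T)^2) *\<^sub>R ?u)) + G ?T *\<^sub>R et ?T ?y)
       + ((L / r ?T) *\<^sub>R (- (L / (r ?T)^2) *\<^sub>R ?y) + (- (L * (rd ?T * T' s)) / (r ?T)^2) *\<^sub>R ?u)) (at s)"
      unfolding c'_def by (intro has_vector_derivative_add has_vector_derivative_scaleR T(4) 1 2 C(6) d\<phi>)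
    moreover have "(T' s *\<^sub>R (T' s *\<^sub>R (- \<psi> ?T ?y - m ?T *\<^sub>R nt ?T ?y) + rd ?T *\<^sub>R ((L / (r ?T)^2) *\<^sub>R ?u)) + G ?T *\<^sub>R et ?T ?y)
       + ((L / r ?T) *\<^sub>R (- (L / (r ?T)^2) *\<^sub>R ?y) + (- (L * (rd ?T * T' s)) / (r ?T)^2) *\<^sub>R ?u) = c'' s"
    proof -
      have gen: "(x *\<^sub>R (x *\<^sub>R A + d *\<^sub>R (k *\<^sub>R u)) + g *\<^sub>R e) + (q *\<^sub>R (- k *\<^sub>R y) + (- (x * (d * k))) *\<^sub>R u)
          = g *\<^sub>R e + x^2 *\<^sub>R A - (q * k) *\<^sub>R y" for x d k g q :: real and A u e y :: "(real, 'm) vec"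
        by (simp add: algebra_simps power2_eq_square)
      have e1: "- (L * (rd ?T * T' s)) / (r ?T)^2 = - (T' s * (rd ?T * (L / (r ?T)^2)))" by simp
      have e2: "(L / r ?T) * (L / (r ?T)^2) = L^2 / (r ?T)^3" by (simp add: power2_eq_square power3_eq_cube)
      show ?thesis unfolding e1 gen e2 c''_def ..
    qed
    ultimately show "(c' has_vector_derivative c'' s) (at s)" by simp
    fix w assume "w \<in> tangent_space M (c s)"
    then obtain \<alpha>' u' where w: "u' \<in> E" "u' \<bullet> ?y = 0" "w = \<alpha>' *\<^sub>R et ?T ?y + u'"
      unfolding c_def by (rule tangent_decomposition[OF C(1,2)]) (rule that; assumption)
    \<comment> \<open>Against the tangent space only the \<open>et\<close>-direction contributes,
      and \<open>G\<close> was chosen to balance the centrifugal term L^2 / r^3 there.\<close>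
    have "ip (c'' s) w = a * \<alpha>' * (G ?T - (L^2 / (r ?T)^3) * (\<epsilon> * rd ?T))"
      unfolding c''_def w(3) pinner_simps ip_frame[OF C(1,2) w(1,2)] by (simp add: algebra_simps)
    also have "\<dots> = 0" unfolding G_def by simp
    finally show "ip (c'' s) w = 0" .
  qed
  ultimately show "\<exists>c c' c''. c 0 = p \<and> c' 0 = v \<and> (\<forall>t. c t \<in> M \<and> (c has_vector_derivative c' t) (at t) \<and>
      (c' has_vector_derivative c'' t) (at t) \<and> (\<forall>u\<in>tangent_space M (c t). ip (c'' t) u = 0))" by blast
qed

theorem satisfies_hyps: "thm_hyps k a M nuF enF lamF muF (- a) a H"
proof -
  have z: "(0 :: (real, 'm) vec) \<in> E" "0 \<bullet> y = 0" for y :: "(real, 'm) vec"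
    using subspace_0[OF subspace_plane_complement] by auto
  have n2: "CARD('m) - 2 = n" using card_index by simp
  have SF: "M \<subseteq> SF k a"
  proof
    fix x assume "x \<in> M"
    then obtain t y where y: "y \<in> E" "norm y = 1" "x = \<psi> t y" unfolding M_iff by blast
    have "ip x x = a" unfolding y(3) by (rule ip_frame(1)[OF y(1,2) z])
    then show "x \<in> SF k a" using a_sign unfolding SF_def sf_index_def by auto
  qed
  have nu: "ip (nuF p) (nuF p) = - a \<and> ip (nuF p) p = 0 \<and> (\<forall>v\<in>tangent_space M p. ip (nuF p) v = 0)" if hp: "p \<in> M" for p
  proof -
    obtain t y where y: "y \<in> E" "norm y = 1" and p: "p = \<psi> t y" using hp unfolding M_iff by blast
    show ?thesis unfolding p fields_psi[OF y] using ip_frame(2,3)[OF y z] ip_tangent_zero(1)[OF y] by blast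
  qed
  have en: "enF p \<in> tangent_space M p \<and> ip (enF p) (enF p) = a" if hp: "p \<in> M" for p
  proof -
    obtain t y where y: "y \<in> E" "norm y = 1" and p: "p = \<psi> t y" using hp unfolding M_iff by blast
    show ?thesis unfolding p fields_psi[OF y] using ip_frame(4)[OF y z] et_tangent[OF y] by blast
  qed
  have lm: "lamF p > muF p" "(real n - 1) * lamF p + muF p = real n * H" for p
  proof -
    have "real n * (l (\<tau> p) - H) > 0" using l_gt[of "\<tau> p"] n_gt by simp
    then show "lamF p > muF p" unfolding lamF_def muF_def m_def by (simp add: algebra_simps)
    show "(real n - 1) * lamF p + muF p = real n * H" unfolding lamF_def muF_def m_def by simp
  qed
  have "two_pc_hypersurface k a M nuF enF lamF muF (- a) a"
    unfolding two_pc_hypersurface_def Let_def n2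
  proof (intro conjI ballI)
    show "\<exists>e. (\<forall>i<n. e i \<in> tangent_space M p) \<and>
          (\<forall>i<n. \<forall>i'<n. \<bar>ip (e i) (e i')\<bar> = (if i = i' then 1 else 0)) \<and>
          e (n - 1) = enF p \<and>
          (\<forall>i<n - 1. shape_op M nuF p (e i) = lamF p *\<^sub>R e i) \<and>
          shape_op M nuF p (enF p) = muF p *\<^sub>R enF p" if "p \<in> M" for p
      using frame_exists that unfolding M_iff by blast
    show "lamF p \<noteq> muF p" for p using lm(1)[of p] by simp
  qed (use a_sign SF submanifold fields_smooth nu en in auto)
  moreover have lnc: "\<not> (\<exists>c. \<forall>p\<in>M. lamF p = c)"
  proof
    assume "\<exists>c. \<forall>p\<in>M. lamF p = c"
    then obtain c where c: "\<And>p. p \<in> M \<Longrightarrow> lamF p = c" by blast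
    obtain y where y: "y \<in> E" "norm y = 1" by (rule unit_exists)
    have "l t = c" for t using c[OF psi_in_M[OF y]] fields_psi(3)[OF y] by simp
    then show False using l_nonconst by simp
  qed
  moreover have "\<not> (\<exists>c. \<forall>p\<in>M. muF p = c)"
  proof
    assume "\<exists>c. \<forall>p\<in>M. muF p = c"
    then obtain c where c: "\<And>p. p \<in> M \<Longrightarrow> muF p = c" by blast
    have "lamF p = (real n * H - c) / (real n - 1)" if "p \<in> M" for p
      using lm(2)[of p] c[OF that] n_gt by (simp add: field_simps)
    then show False using lnc by blast
  qed
  ultimately show ?thesis unfolding thm_hyps_def n2
    using connected_M complete_M lm aa by (intro conjI ballI) simp_all
qed

end

subsection \<open>Choice of the signature\<close>

text \<open>Counting smaller indices is an order isomorphism onto the initial segment of the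
  naturals.\<close>

lemma card_first_idx:
  assumes "j \<le> CARD('m::{finite,linorder})"
  shows "card {i :: 'm. first_idx j i} = j"
proof -
  define f where "f i = card {i' :: 'm. i' < i}" for i
  have mono: "f i < f i'" if "i < i'" for i i'
    unfolding f_def by (rule psubset_card_mono) (use that less_trans[OF _ that] in \<open>auto simp: psubset_eq set_eq_iff\<close>)
  have inj: "inj f" using mono by (intro linorder_injI) (metis less_irrefl)
  have "f i < CARD('m)" for i unfolding f_def by (rule psubset_card_mono) auto
  then have "range f \<subseteq> {..<CARD('m)}" by auto
  moreover have "card (range f) = CARD('m)" using card_image[OF inj] by simp
  ultimately have rng: "range f = {..<CARD('m)}" by (intro card_subset_eq) auto
  have "f ` {i. first_idx j i} = {..<j}"
  proof
    show "f ` {i. first_idx j i} \<subseteq> {..<j}" unfolding first_idx_def f_def by auto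
    show "{..<j} \<subseteq> f ` {i. first_idx j i}"
    proof
      fix x assume x: "x \<in> {..<j}"
      then have "x \<in> range f" using rng assms by auto
      then obtain i where "x = f i" by blast
      then show "x \<in> f ` {i. first_idx j i}" using x unfolding first_idx_def f_def by auto
    qed
  qed
  moreover have "card (f ` {i. first_idx j i}) = card {i :: 'm. first_idx j i}" by (rule card_image[OF inj_on_subset[OF inj subset_UNIV]])
  ultimately show ?thesis by simp
qed

lemma pinner_split:
  assumes "i1 \<noteq> i2" and s: "\<And>i. (if first_idx j i then - 1 else 1) = (if i = i1 then a else if i = i2 then - (a * \<epsilon>) else a * \<epsilon>)"
  shows "pinner j x y = a * (\<epsilon> * (\<Sum>i\<in>UNIV - {i1, i2}. x $ i * y $ i) + x $ i1 * y $ i1 - \<epsilon> * (x $ i2 * y $ i2))"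
proof -
  let ?s = "\<lambda>i. if i = i1 then a else if i = i2 then - (a * \<epsilon>) else a * \<epsilon>"
  have "pinner j x y = (\<Sum>i\<in>UNIV. ?s i * (x $ i * y $ i))" unfolding pinner_def s ..
  also have "\<dots> = (\<Sum>i\<in>UNIV - {i1, i2}. ?s i * (x $ i * y $ i)) + (\<Sum>i\<in>{i1, i2}. ?s i * (x $ i * y $ i))"
    by (rule sum.subset_diff) auto
  also have "(\<Sum>i\<in>UNIV - {i1, i2}. ?s i * (x $ i * y $ i)) = (\<Sum>i\<in>UNIV - {i1, i2}. a * \<epsilon> * (x $ i * y $ i))"
    by (rule sum.cong) auto
  also have "(\<Sum>i\<in>{i1, i2}. ?s i * (x $ i * y $ i)) = a * (x $ i1 * y $ i1) - a * \<epsilon> * (x $ i2 * y $ i2)" using assms(1) by simp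
  finally show ?thesis by (simp add: sum_distrib_left algebra_simps)
qed

text \<open>The form needs the sign a \<epsilon> on n coordinates, a on \<open>i1\<close> and -a
  \<epsilon> on \<open>i2\<close>. In the four cases it has 1, n + 1, n and 2 negative coordinates;
  as the ambient index is k + 1 when a = -1, this gives k = 1, n, n and 1.\<close>

lemma signature_exists:
  assumes card: "CARD('m::{finite,linorder}) = n + 2" and n: "n > 2" and a: "a = 1 \<or> a = -1" and e: "\<epsilon> = 1 \<or> \<epsilon> = -1"
  obtains k and i1 i2 :: "'m::{finite,linorder}" where "k \<le> n + 1" "i1 \<noteq> i2" "\<And>x y. pinner (sf_index k a) x y =
      a * (\<epsilon> * (\<Sum>i\<in>UNIV - {i1, i2}. x $ i * y $ i) + x $ i1 * y $ i1 - \<epsilon> * (x $ i2 * y $ i2))"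
proof -
  have compl: "card {i :: 'm. \<not> first_idx j i} = n + 2 - j" if "j \<le> n + 2" for j
  proof -
    have "{i :: 'm. \<not> first_idx j i} = UNIV - {i. first_idx j i}" by auto
    then show ?thesis using card_first_idx[of j, where 'm='m] that card by (simp add: card_Diff_subset)
  qed
  have "\<exists>k i1 i2. k \<le> n + 1 \<and> i1 \<noteq> i2 \<and> (\<forall>i::'m. (if first_idx (sf_index k a) i then - 1 else 1) =
      (if i = i1 then a else if i = i2 then - (a * \<epsilon>) else a * \<epsilon>))"
  proof -
    consider "\<epsilon> = 1" "a = 1" | "\<epsilon> = 1" "a = -1" | "\<epsilon> = -1" "a = 1" | "\<epsilon> = -1" "a = -1" using a e by blast
    then show ?thesis
    proof cases
      case 1
      have "card {i :: 'm. first_idx 1 i} = 1" by (rule card_first_idx) (use card in simp)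
      then obtain i2 where i2: "{i :: 'm. first_idx 1 i} = {i2}" by (auto simp: card_1_singleton_iff)
      have "card {i2} < CARD('m)" using card by simp
      then have "\<exists>i1. i1 \<noteq> i2" by (metis UNIV_eq_I singletonI less_irrefl)
      then obtain i1 where "i1 \<noteq> i2" by blast
      moreover have "first_idx (sf_index 1 a) i \<longleftrightarrow> i = i2" for i using i2 1 by (auto simp: sf_index_def)
      moreover have "1 \<le> n + 1" by simp
      ultimately show ?thesis using 1 by (intro exI[of _ 1] exI[of _ i1] exI[of _ i2] conjI allI) simp_all
    next
      case 2
      have "card {i :: 'm. \<not> first_idx (n + 1) i} = 1" using compl[of "n + 1"] by simp
      then obtain i2 where i2: "{i :: 'm. \<not> first_idx (n + 1) i} = {i2}" by (auto simp: card_1_singleton_iff)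
      have "card {i2} < CARD('m)" using card by simp
      then have "\<exists>i1. i1 \<noteq> i2" by (metis UNIV_eq_I singletonI less_irrefl)
      then obtain i1 where "i1 \<noteq> i2" by blast
      moreover have "first_idx (sf_index n a) i \<longleftrightarrow> i \<noteq> i2" for i using i2 2 by (auto simp: sf_index_def)
      ultimately show ?thesis using 2 by (intro exI[of _ n] exI[of _ i1] exI[of _ i2] conjI allI) simp_all
    next
      case 3
      have "card {i :: 'm. \<not> first_idx n i} = 2" using compl[of n] by simp
      then obtain i1 i2 where i: "{i :: 'm. \<not> first_idx n i} = {i1, i2}" "i1 \<noteq> i2" by (auto simp: card_2_iff)
      then have "first_idx (sf_index n a) i \<longleftrightarrow> i \<noteq> i1 \<and> i \<noteq> i2" for i using 3 by (auto simp: sf_index_def)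
      then show ?thesis using 3 i(2) by (intro exI[of _ n] exI[of _ i1] exI[of _ i2] conjI allI) simp_all
    next
      case 4
      have "card {i :: 'm. first_idx 2 i} = 2" by (rule card_first_idx) (use card in simp)
      then obtain i1 i2 where i: "{i :: 'm. first_idx 2 i} = {i1, i2}" "i1 \<noteq> i2" by (auto simp: card_2_iff)
      moreover have "sf_index 1 a = 2" using 4 by (simp add: sf_index_def)
      ultimately have "first_idx (sf_index 1 a) i \<longleftrightarrow> i = i1 \<or> i = i2" for i by auto
      then show ?thesis using 4 i(2) by (intro exI[of _ 1] exI[of _ i1] exI[of _ i2] conjI allI) simp_all
    qed
  qed
  then obtain k and i1 i2 :: 'm where k: "k \<le> n + 1" "i1 \<noteq> i2"
    and s: "\<forall>i::'m. (if first_idx (sf_index k a) i then - 1 else 1) = (if i = i1 then a else if i = i2 then - (a * \<epsilon>) else a * \<epsilon>)" by blast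
  show thesis by (rule that[OF k pinner_split[OF k(2)]]) (use s in blast)
qed

subsection \<open>Embedding the rotation hypersurfaces\<close>

lemma Ck_on_trig:
  "Ck_on k UNIV (sin :: real \<Rightarrow> real)" "Ck_on k UNIV (cos :: real \<Rightarrow> real)"
  "Ck_on k UNIV (sinh :: real \<Rightarrow> real)" "Ck_on k UNIV (cosh :: real \<Rightarrow> real)"
proof -
  have d: "(sin has_vector_derivative cos x) (at x)" "(cos has_vector_derivative - sin x) (at x)"
    "(sinh has_vector_derivative cosh x) (at x)" "(cosh has_vector_derivative sinh x) (at x)" for x :: real
    unfolding has_real_derivative_iff_has_vector_derivative[symmetric] by (auto intro!: derivative_eq_intros)
  have "Ck_on k UNIV (sin :: real \<Rightarrow> real) \<and> Ck_on k UNIV (cos :: real \<Rightarrow> real) \<and>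
    Ck_on k UNIV (sinh :: real \<Rightarrow> real) \<and> Ck_on k UNIV (cosh :: real \<Rightarrow> real)" for k
  proof (induction k)
    case (Suc k)
    then have s: "Ck_on k UNIV (sin :: real \<Rightarrow> real)" "Ck_on k UNIV (cos :: real \<Rightarrow> real)"
      "Ck_on k UNIV (sinh :: real \<Rightarrow> real)" "Ck_on k UNIV (cosh :: real \<Rightarrow> real)" by blast+
    show ?case
      using Ck_on_real_I[OF open_UNIV d(1) s(2)] Ck_on_real_I[OF open_UNIV d(2) Ck_on_minus[OF open_UNIV s(1)]]
        Ck_on_real_I[OF open_UNIV d(3) s(4)] Ck_on_real_I[OF open_UNIV d(4) s(3)] by blast
  qed simp
  then show "Ck_on k UNIV (sin :: real \<Rightarrow> real)" "Ck_on k UNIV (cos :: real \<Rightarrow> real)"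
    "Ck_on k UNIV (sinh :: real \<Rightarrow> real)" "Ck_on k UNIV (cosh :: real \<Rightarrow> real)" by blast+
qed

lemma proj_shift:
  assumes "i1 \<noteq> i2"
  shows "proj i1 i2 (x + s *\<^sub>R proj i1 i2 x) = (1 + s) *\<^sub>R proj i1 i2 x"
    "(x + s *\<^sub>R proj i1 i2 x) $ i1 = x $ i1" "(x + s *\<^sub>R proj i1 i2 x) $ i2 = x $ i2"
    "proj i1 i2 (x + s *\<^sub>R (x - proj i1 i2 x)) = proj i1 i2 x"
    "(x + s *\<^sub>R (x - proj i1 i2 x)) $ i1 = (1 + s) * x $ i1" "(x + s *\<^sub>R (x - proj i1 i2 x)) $ i2 = (1 + s) * x $ i2"
    "proj i1 i2 (x + s *\<^sub>R axis i1 1) = proj i1 i2 x" "proj i1 i2 (x + s *\<^sub>R axis i2 1) = proj i1 i2 x"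
proof -
  have lin: "linear (proj i1 i2 :: (real, 'a) vec \<Rightarrow> _)" using bounded_linear_proj bounded_linear.linear by blast
  have z: "proj i1 i2 x $ i1 = 0" "proj i1 i2 x $ i2 = 0"
    using proj_complement[OF assms, of x] unfolding plane_complement_def by auto
  then have pp: "proj i1 i2 (proj i1 i2 x) = proj i1 i2 x" unfolding proj_def[of i1 i2 "proj i1 i2 x"] by simp
  have ax: "proj i1 i2 (axis i1 1) = 0" "proj i1 i2 (axis i2 1) = 0"
    using assms unfolding proj_def by (simp_all add: axis_def)
  show "proj i1 i2 (x + s *\<^sub>R proj i1 i2 x) = (1 + s) *\<^sub>R proj i1 i2 x"
    "proj i1 i2 (x + s *\<^sub>R (x - proj i1 i2 x)) = proj i1 i2 x"
    "proj i1 i2 (x + s *\<^sub>R axis i1 1) = proj i1 i2 x" "proj i1 i2 (x + s *\<^sub>R axis i2 1) = proj i1 i2 x"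
    using lin pp ax by (simp_all add: linear_add linear_cmul linear_diff algebra_simps)
  show "(x + s *\<^sub>R proj i1 i2 x) $ i1 = x $ i1" "(x + s *\<^sub>R proj i1 i2 x) $ i2 = x $ i2"
    "(x + s *\<^sub>R (x - proj i1 i2 x)) $ i1 = (1 + s) * x $ i1" "(x + s *\<^sub>R (x - proj i1 i2 x)) $ i2 = (1 + s) * x $ i2"
    using z by (simp_all add: algebra_simps)
qed

lemma Ck_on_nth: "open U \<Longrightarrow> Ck_on k U (\<lambda>x::(real, 'm::finite) vec. x $ i)"
  by (rule Ck_on_bounded_linear_id[OF _ bounded_linear_vec_nth])

lemma Ck_on_proj_inner: "open U \<Longrightarrow> Ck_on k U (\<lambda>x. proj i1 i2 x \<bullet> proj i1 i2 x)"
  by (intro Ck_on_bilinear[OF _ bounded_bilinear_inner] Ck_on_bounded_linear_id bounded_linear_proj)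

lemma Ck_on_imp_continuous_on: "Ck_on (Suc 0) U f \<Longrightarrow> continuous_on U f"
  by (intro continuous_at_imp_continuous_on ballI has_derivative_continuous[OF Ck_on_has_derivative])

text \<open>If the profile turns monotonically about the axis, the hyperbolic angle serves as profile parameter.\<close>

lemma hyperbolic_chart:
  fixes i1 i2 :: "'m::finite" and r \<beta>1 \<beta>2 :: "real \<Rightarrow> real"
  assumes i12: "i1 \<noteq> i2" and r: "\<And>t. r t > 0" "\<And>t. (r t)^2 - 1 > 0" "\<And>k. Ck_on k UNIV r"
    and th: "\<And>t. (\<theta> has_real_derivative \<theta>' t) (at t)" "\<And>t. \<theta>' t < 0" "\<And>k. Ck_on k UNIV \<theta>" "\<And>k. Ck_on k UNIV \<theta>'"
    and b: "\<beta>1 = (\<lambda>t. sqrt ((r t)^2 - 1) * sinh (\<theta> t))" "\<beta>2 = (\<lambda>t. sqrt ((r t)^2 - 1) * cosh (\<theta> t))"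
  obtains W0 and \<tau> :: "(real, 'm) vec \<Rightarrow> real" where "Cinf_on W0 \<tau>"
    "\<And>t y. y \<in> plane_complement i1 i2 \<Longrightarrow> norm y = 1 \<Longrightarrow> mk i1 i2 (r t *\<^sub>R y) (\<beta>1 t) (\<beta>2 t) \<in> W0"
    "\<And>t y. y \<in> plane_complement i1 i2 \<Longrightarrow> norm y = 1 \<Longrightarrow> \<tau> (mk i1 i2 (r t *\<^sub>R y) (\<beta>1 t) (\<beta>2 t)) = t"
    "codim2_submanifold (rotation_surface i1 i2 r \<beta>1 \<beta>2)"
proof -
  \<comment> \<open>Minus the hyperbolic tangent of the angle: a smooth increasing function of the
    parameter, and readable from a point as minus the quotient of its two axis coordinates.\<close>
  define \<phi> where "\<phi> t = - (sinh (\<theta> t) / cosh (\<theta> t))" for t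
  define \<phi>' where "\<phi>' t = - \<theta>' t * inverse ((cosh (\<theta> t))^2)" for t
  have ch: "cosh (x::real) \<noteq> 0" "cosh x > 0" for x :: real using cosh_real_pos[of x] by auto
  have d\<phi>: "(\<phi> has_real_derivative \<phi>' t) (at t)" for t
  proof -
    have "(\<phi> has_real_derivative - ((cosh (\<theta> t) * \<theta>' t * cosh (\<theta> t) - sinh (\<theta> t) * (sinh (\<theta> t) * \<theta>' t)) / (cosh (\<theta> t) * cosh (\<theta> t)))) (at t)"
      unfolding \<phi>_def using ch by (auto intro!: derivative_eq_intros th(1))
    moreover have "cosh (\<theta> t) * \<theta>' t * cosh (\<theta> t) - sinh (\<theta> t) * (sinh (\<theta> t) * \<theta>' t) = \<theta>' t"
      using hyperbolic_pythagoras[of "\<theta> t"] by algebra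
    ultimately show ?thesis unfolding \<phi>'_def by (simp add: divide_inverse power2_eq_square)
  qed
  have p\<phi>: "\<phi>' t > 0" for t unfolding \<phi>'_def using th(2)[of t] ch by (simp add: mult_neg_pos)
  have comp: "Ck_on k UNIV (\<lambda>t. f (\<theta> t))" if "Ck_on k UNIV f" for f :: "real \<Rightarrow> real" and k
    by (rule Ck_on_compose_real[OF open_UNIV open_UNIV _ that th(3)]) simp
  have s\<phi>: "Ck_on k UNIV \<phi>'" for k unfolding \<phi>'_def[abs_def]
    by (intro Ck_on_mult Ck_on_minus Ck_on_inverse Ck_on_power comp[OF Ck_on_trig(4)] th(4) open_UNIV) (use ch in auto)
  obtain \<eta> where \<eta>: "\<And>t. \<eta> (\<phi> t) = t" "open (range \<phi>)" "\<And>k. Ck_on k (range \<phi>) \<eta>"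
    using smooth_inverse[OF d\<phi> p\<phi> s\<phi>] by blast
  \<comment> \<open>The open sector of the axis plane in which the hyperbolic angle is defined, away
    from the axis plane itself.\<close>
  define W1 :: "(real, 'm) vec set" where "W1 = {x. \<bar>x $ i1\<bar> < x $ i2} \<inter> {x. proj i1 i2 x \<noteq> 0}"
  have oW1: "open W1" unfolding W1_def
    by (intro open_Int open_Collect_less open_Collect_neq continuous_intros linear_continuous_on[OF bounded_linear_proj])
  have x2: "x $ i2 > 0" if "x \<in> W1" for x using that unfolding W1_def by auto
  define q where "q x = - (x $ i1 / x $ i2)" for x :: "(real, 'm) vec"
  have sq: "Ck_on k W1 q" for k unfolding q_def[abs_def]
    by (intro Ck_on_minus Ck_on_divide Ck_on_nth oW1) (use x2 in force)
  define W0 where "W0 = W1 \<inter> q -` range \<phi>"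
  have oW0: "open W0" unfolding W0_def
    by (rule continuous_open_preimage[OF Ck_on_imp_continuous_on[OF sq] oW1 \<eta>(2)])
  define \<tau> where "\<tau> x = \<eta> (q x)" for x
  have W01: "W0 \<subseteq> W1" unfolding W0_def by blast
  have s\<tau>: "Ck_on k W0 \<tau>" for k unfolding \<tau>_def
    by (rule Ck_on_compose_real[OF oW0 \<eta>(2) _ \<eta>(3) Ck_on_subset[OF sq W01]]) (auto simp: W0_def)
  have C\<tau>: "Cinf_on W0 \<tau>" by (rule Cinf_onI[OF oW0 s\<tau>])
  have \<rho>: "sqrt ((r t)^2 - 1) > 0" "(sqrt ((r t)^2 - 1))^2 = (r t)^2 - 1" for t using r(2)[of t] by auto
  have at_psi: "mk i1 i2 (r t *\<^sub>R y) (\<beta>1 t) (\<beta>2 t) \<in> W0 \<and> \<tau> (mk i1 i2 (r t *\<^sub>R y) (\<beta>1 t) (\<beta>2 t)) = t \<and>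
      (\<beta>2 t)^2 - (\<beta>1 t)^2 = (r t)^2 - 1"
    if y: "y \<in> plane_complement i1 i2" "norm y = 1" for t y
  proof -
    have E: "r t *\<^sub>R y \<in> plane_complement i1 i2" using y subspace_plane_complement subspace_scale by blast
    note nth = mk_nth(1,2,4)[OF i12 E, where ?b1.0 = "\<beta>1 t" and ?b2.0 = "\<beta>2 t"]
    have qx: "q (mk i1 i2 (r t *\<^sub>R y) (\<beta>1 t) (\<beta>2 t)) = \<phi> t" unfolding q_def nth unfolding \<phi>_def b using \<rho>(1)[of t] by simp
    have "\<bar>sinh (\<theta> t)\<bar> < cosh (\<theta> t)"
      by (rule power2_less_imp_less) (use hyperbolic_pythagoras[of "\<theta> t"] ch(2)[of "\<theta> t"] in \<open>auto simp: power2_abs less_imp_le\<close>)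
    then have "\<bar>\<beta>1 t\<bar> < \<beta>2 t" unfolding b using \<rho>(1)[of t] by (simp add: abs_mult)
    moreover have "r t *\<^sub>R y \<noteq> 0" using r(1)[of t] y(2) by auto
    ultimately have "mk i1 i2 (r t *\<^sub>R y) (\<beta>1 t) (\<beta>2 t) \<in> W0" unfolding W0_def W1_def using nth qx by auto
    moreover have "(\<beta>2 t)^2 - (\<beta>1 t)^2 = (r t)^2 - 1" unfolding b power_mult_distrib \<rho>(2)
      using hyperbolic_pythagoras[of "\<theta> t"] by algebra
    ultimately show ?thesis unfolding \<tau>_def qx \<eta>(1) by blast
  qed
  have comp\<tau>: "Ck_on k W0 (\<lambda>x. f (\<tau> x))" if "Ck_on k UNIV f" for f :: "real \<Rightarrow> real" and k
    by (rule Ck_on_compose_real[OF oW0 open_UNIV _ that s\<tau>]) simp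
  \<comment> \<open>With the angle fixing the parameter, the surface is cut out by prescribing the
    radius in the complement and the hyperbolic radius in the axis plane.\<close>
  define F1 where "F1 x = proj i1 i2 x \<bullet> proj i1 i2 x - (r (\<tau> x))^2" for x
  define F2 where "F2 x = (x $ i2)^2 - (x $ i1)^2 - ((r (\<tau> x))^2 - 1)" for x
  have "codim2_submanifold (rotation_surface i1 i2 r \<beta>1 \<beta>2)"
  proof (rule codim2_submanifoldI[of W0 F1 F2])
    show "Cinf_on W0 F1" unfolding F1_def[abs_def]
      by (intro Cinf_onI oW0 Ck_on_diff Ck_on_proj_inner Ck_on_power comp\<tau> r)
    show "Cinf_on W0 F2" unfolding F2_def[abs_def]
      by (intro Cinf_onI oW0 Ck_on_diff Ck_on_nth Ck_on_power comp\<tau> r Ck_on_const)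
    show "rotation_surface i1 i2 r \<beta>1 \<beta>2 = {x\<in>W0. F1 x = 0 \<and> F2 x = 0}"
    proof (intro equalityI subsetI)
      fix x assume "x \<in> rotation_surface i1 i2 r \<beta>1 \<beta>2"
      then obtain t y where y: "y \<in> plane_complement i1 i2" "norm y = 1" and x: "x = mk i1 i2 (r t *\<^sub>R y) (\<beta>1 t) (\<beta>2 t)"
        unfolding rotation_surface_def by blast
      have E: "r t *\<^sub>R y \<in> plane_complement i1 i2" using y subspace_plane_complement subspace_scale by blast
      note A = at_psi[OF y, of t]
      have "F1 x = 0" unfolding F1_def using A unfolding x mk_nth(4)[OF i12 E]
        using y(2) by (simp add: dot_square_norm power2_eq_square)
      moreover have "F2 x = 0" unfolding F2_def using A unfolding x mk_nth(1,2)[OF i12 E] by simp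
      ultimately show "x \<in> {x\<in>W0. F1 x = 0 \<and> F2 x = 0}" using A x by blast
    next
      fix x assume "x \<in> {x\<in>W0. F1 x = 0 \<and> F2 x = 0}"
      then have x: "x \<in> W0" "F1 x = 0" "F2 x = 0" by auto
      define t where "t = \<tau> x"
      obtain t' where "q x = \<phi> t'" using x(1) unfolding W0_def by blast
      then have qt: "q x = \<phi> t" unfolding t_def \<tau>_def using \<eta>(1) by simp
      have p2: "x $ i2 > 0" using x2 x(1) W01 by blast
      then have x1: "x $ i1 * cosh (\<theta> t) = x $ i2 * sinh (\<theta> t)" using qt ch(1)[of "\<theta> t"] unfolding q_def \<phi>_def by (simp add: frac_eq_eq)
      have F2: "(x $ i2)^2 - (x $ i1)^2 = (r t)^2 - 1" using x(3) unfolding F2_def t_def by simp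
      have "(x $ i2)^2 = (\<beta>2 t)^2"
      proof -
        have "(x $ i2)^2 = ((x $ i2)^2 - (x $ i1)^2) * (cosh (\<theta> t))^2" using x1 hyperbolic_pythagoras[of "\<theta> t"] by algebra
        then show ?thesis unfolding F2 b power_mult_distrib \<rho>(2) .
      qed
      moreover have "\<beta>2 t > 0" unfolding b using \<rho>(1)[of t] ch(2)[of "\<theta> t"] by simp
      ultimately have b2: "x $ i2 = \<beta>2 t" using p2 by (simp add: power2_eq_iff_nonneg)
      have "x $ i1 * cosh (\<theta> t) = \<beta>1 t * cosh (\<theta> t)" unfolding x1 b2 unfolding b by simp
      then have b1: "x $ i1 = \<beta>1 t" using ch(1) by simp
      define y where "y = inverse (r t) *\<^sub>R proj i1 i2 x"
      have "proj i1 i2 x \<bullet> proj i1 i2 x = (r t)^2" using x(2) unfolding F1_def t_def by simp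
      then have "norm (proj i1 i2 x) = r t" using r(1)[of t] by (simp add: norm_eq_sqrt_inner)
      then have "norm y = 1" unfolding y_def using r(1)[of t] by simp
      moreover have "y \<in> plane_complement i1 i2" unfolding y_def
        using proj_complement[OF i12] subspace_plane_complement subspace_scale by blast
      moreover have "x = mk i1 i2 (r t *\<^sub>R y) (\<beta>1 t) (\<beta>2 t)"
        using mk_proj[of i1 i2 x] r(1)[of t] unfolding y_def b1 b2 by simp
      ultimately show "x \<in> rotation_surface i1 i2 r \<beta>1 \<beta>2" unfolding rotation_surface_def by blast
    qed
    fix x assume x: "x \<in> W0"
    \<comment> \<open>Scaling the orbit part or the axis part of \<open>x\<close> preserves the
      angle, hence \<open>\<tau>\<close>, and changes only one of \<open>F1\<close> and
      \<open>F2\<close>.\<close>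
    define v1 where "v1 = proj i1 i2 x"
    define v2 where "v2 = x - proj i1 i2 x"
    note P = proj_shift[OF i12, of x]
    have xW: "\<bar>x $ i1\<bar> < x $ i2" "proj i1 i2 x \<noteq> 0" using x W01 unfolding W1_def by auto
    have t1: "\<tau> (x + s *\<^sub>R v1) = \<tau> x" for s unfolding \<tau>_def q_def v1_def P ..
    have t2: "\<tau> (x + s *\<^sub>R v2) = \<tau> x" if "s \<in> {-1<..<1}" for s
      unfolding \<tau>_def q_def v2_def P using that by simp
    define N where "N = proj i1 i2 x \<bullet> proj i1 i2 x"
    have "((\<lambda>s. (1 + s)^2 * N - (r (\<tau> x))^2) has_real_derivative 2 * N) (at 0)" by (auto intro!: derivative_eq_intros)
    moreover have "F1 (x + s *\<^sub>R v1) = (1 + s)^2 * N - (r (\<tau> x))^2" for s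
      unfolding F1_def t1 unfolding v1_def P N_def by (simp add: power2_eq_square)
    ultimately have a1: "((\<lambda>s. F1 (x + s *\<^sub>R v1)) has_real_derivative 2 * N) (at 0)" by simp
    have "F2 (x + s *\<^sub>R v1) = F2 x" for s unfolding F2_def t1 unfolding v1_def P ..
    then have a2: "((\<lambda>s. F2 (x + s *\<^sub>R v1)) has_real_derivative 0) (at 0)" by simp
    have S: "open {-1<..<(1::real)}" "(0::real) \<in> {-1<..<1}" by auto
    have e3: "F1 x = F1 (x + s *\<^sub>R v2)" if "s \<in> {-1<..<1}" for s unfolding F1_def t2[OF that] unfolding v2_def P ..
    have a3: "((\<lambda>s. F1 (x + s *\<^sub>R v2)) has_real_derivative 0) (at 0)"
      by (rule has_field_derivative_transform_within_open[OF DERIV_const S e3])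
    have d4: "((\<lambda>s. (1 + s)^2 * ((x $ i2)^2 - (x $ i1)^2) - ((r (\<tau> x))^2 - 1)) has_real_derivative 2 * ((x $ i2)^2 - (x $ i1)^2)) (at 0)"
      by (auto intro!: derivative_eq_intros)
    have e4: "(1 + s)^2 * ((x $ i2)^2 - (x $ i1)^2) - ((r (\<tau> x))^2 - 1) = F2 (x + s *\<^sub>R v2)" if "s \<in> {-1<..<1}" for s
      unfolding F2_def t2[OF that] unfolding v2_def P by (simp only: power_mult_distrib right_diff_distrib)
    have a4: "((\<lambda>s. F2 (x + s *\<^sub>R v2)) has_real_derivative 2 * ((x $ i2)^2 - (x $ i1)^2)) (at 0)"
      by (rule has_field_derivative_transform_within_open[OF d4 S e4])
    have "N \<noteq> 0" unfolding N_def using xW(2) by simp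
    moreover have "(x $ i1)^2 < (x $ i2)^2" using power_strict_mono[OF xW(1), of 2] by simp
    ultimately show "\<exists>v1 v2 p q. p \<noteq> 0 \<and> q \<noteq> 0 \<and>
      ((\<lambda>s. F1 (x + s *\<^sub>R v1)) has_real_derivative p) (at 0) \<and> ((\<lambda>s. F2 (x + s *\<^sub>R v1)) has_real_derivative 0) (at 0) \<and>
      ((\<lambda>s. F1 (x + s *\<^sub>R v2)) has_real_derivative 0) (at 0) \<and> ((\<lambda>s. F2 (x + s *\<^sub>R v2)) has_real_derivative q) (at 0)"
      using a1 a2 a3 a4 by (intro exI[of _ v1] exI[of _ v2] exI[of _ "2 * N"] exI[of _ "2 * ((x $ i2)^2 - (x $ i1)^2)"]) auto
  qed
  then show thesis using that[OF C\<tau>] at_psi by blast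
qed

text \<open>If the radius is monotone, it serves as profile parameter and the hypersurface is a graph.\<close>

lemma radial_chart:
  fixes i1 i2 :: "'m::finite" and r \<beta>1 \<beta>2 :: "real \<Rightarrow> real"
  assumes i12: "i1 \<noteq> i2" and r: "\<And>t. r t > 0" "\<And>t. (r has_real_derivative rd t) (at t)" "\<And>t. rd t > 0" "\<And>k. Ck_on k UNIV rd"
    and b: "\<And>k. Ck_on k UNIV \<beta>1" "\<And>k. Ck_on k UNIV \<beta>2"
  obtains W0 and \<tau> :: "(real, 'm) vec \<Rightarrow> real" where "Cinf_on W0 \<tau>"
    "\<And>t y. y \<in> plane_complement i1 i2 \<Longrightarrow> norm y = 1 \<Longrightarrow> mk i1 i2 (r t *\<^sub>R y) (\<beta>1 t) (\<beta>2 t) \<in> W0"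
    "\<And>t y. y \<in> plane_complement i1 i2 \<Longrightarrow> norm y = 1 \<Longrightarrow> \<tau> (mk i1 i2 (r t *\<^sub>R y) (\<beta>1 t) (\<beta>2 t)) = t"
    "codim2_submanifold (rotation_surface i1 i2 r \<beta>1 \<beta>2)"
proof -
  obtain \<eta> where \<eta>: "\<And>t. \<eta> (r t) = t" "open (range r)" "\<And>k. Ck_on k (range r) \<eta>"
    using smooth_inverse[OF r(2,3,4)] by blast
  define W1 :: "(real, 'm) vec set" where "W1 = {x. proj i1 i2 x \<noteq> 0}"
  have oW1: "open W1" unfolding W1_def
    by (intro open_Collect_neq continuous_intros linear_continuous_on[OF bounded_linear_proj])
  define q where "q x = norm (proj i1 i2 x)" for x :: "(real, 'm) vec"
  have sq: "Ck_on k W1 q" for k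
  proof (rule Ck_on_cong[OF oW1])
    show "Ck_on k W1 (\<lambda>x. (proj i1 i2 x \<bullet> proj i1 i2 x) powr (1/2))"
      by (intro Ck_on_powr oW1 Ck_on_proj_inner) (simp add: W1_def)
    show "(proj i1 i2 x \<bullet> proj i1 i2 x) powr (1/2) = q x" for x
      unfolding q_def by (simp add: powr_half_sqrt norm_eq_sqrt_inner)
  qed
  define W0 where "W0 = W1 \<inter> q -` range r"
  have oW0: "open W0" unfolding W0_def
    by (rule continuous_open_preimage[OF Ck_on_imp_continuous_on[OF sq] oW1 \<eta>(2)])
  define \<tau> where "\<tau> x = \<eta> (q x)" for x
  have W01: "W0 \<subseteq> W1" unfolding W0_def by blast
  have s\<tau>: "Ck_on k W0 \<tau>" for k unfolding \<tau>_def
    by (rule Ck_on_compose_real[OF oW0 \<eta>(2) _ \<eta>(3) Ck_on_subset[OF sq W01]]) (auto simp: W0_def)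
  have C\<tau>: "Cinf_on W0 \<tau>" by (rule Cinf_onI[OF oW0 s\<tau>])
  have at_psi: "mk i1 i2 (r t *\<^sub>R y) (\<beta>1 t) (\<beta>2 t) \<in> W0 \<and> \<tau> (mk i1 i2 (r t *\<^sub>R y) (\<beta>1 t) (\<beta>2 t)) = t"
    if y: "y \<in> plane_complement i1 i2" "norm y = 1" for t y
  proof -
    have E: "r t *\<^sub>R y \<in> plane_complement i1 i2" using y subspace_plane_complement subspace_scale by blast
    have qx: "q (mk i1 i2 (r t *\<^sub>R y) (\<beta>1 t) (\<beta>2 t)) = r t" unfolding q_def mk_nth(4)[OF i12 E] using r(1)[of t] y(2) by simp
    have "r t *\<^sub>R y \<noteq> 0" using r(1)[of t] y(2) by auto
    then show ?thesis unfolding W0_def W1_def \<tau>_def using mk_nth(4)[OF i12 E] qx \<eta>(1) by auto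
  qed
  have comp\<tau>: "Ck_on k W0 (\<lambda>x. f (\<tau> x))" if "Ck_on k UNIV f" for f :: "real \<Rightarrow> real" and k
    by (rule Ck_on_compose_real[OF oW0 open_UNIV _ that s\<tau>]) simp
  \<comment> \<open>Moves along the two axes leave the radius and hence \<open>\<tau>\<close>
    unchanged, so the derivative is diagonal in these directions.\<close>
  define F1 where "F1 x = x $ i1 - \<beta>1 (\<tau> x)" for x
  define F2 where "F2 x = x $ i2 - \<beta>2 (\<tau> x)" for x
  have "codim2_submanifold (rotation_surface i1 i2 r \<beta>1 \<beta>2)"
  proof (rule codim2_submanifoldI[of W0 F1 F2])
    show "Cinf_on W0 F1" "Cinf_on W0 F2" unfolding F1_def[abs_def] F2_def[abs_def]
      by (intro Cinf_onI oW0 Ck_on_diff Ck_on_nth comp\<tau> b)+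
    show "rotation_surface i1 i2 r \<beta>1 \<beta>2 = {x\<in>W0. F1 x = 0 \<and> F2 x = 0}"
    proof (intro equalityI subsetI)
      fix x assume "x \<in> rotation_surface i1 i2 r \<beta>1 \<beta>2"
      then obtain t y where y: "y \<in> plane_complement i1 i2" "norm y = 1" and x: "x = mk i1 i2 (r t *\<^sub>R y) (\<beta>1 t) (\<beta>2 t)"
        unfolding rotation_surface_def by blast
      have E: "r t *\<^sub>R y \<in> plane_complement i1 i2" using y subspace_plane_complement subspace_scale by blast
      show "x \<in> {x\<in>W0. F1 x = 0 \<and> F2 x = 0}"
        using at_psi[OF y, of t] mk_nth(1,2)[OF i12 E, of "\<beta>1 t" "\<beta>2 t"] unfolding x F1_def F2_def by simp
    next
      fix x assume "x \<in> {x\<in>W0. F1 x = 0 \<and> F2 x = 0}"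
      then have x: "x \<in> W0" "F1 x = 0" "F2 x = 0" by auto
      define t where "t = \<tau> x"
      obtain t' where "q x = r t'" using x(1) unfolding W0_def by blast
      then have qt: "norm (proj i1 i2 x) = r t" unfolding t_def \<tau>_def using \<eta>(1) q_def by simp
      have b12: "x $ i1 = \<beta>1 t" "x $ i2 = \<beta>2 t" using x(2,3) unfolding F1_def F2_def t_def by auto
      define y where "y = inverse (r t) *\<^sub>R proj i1 i2 x"
      have "norm y = 1" unfolding y_def using r(1)[of t] qt by simp
      moreover have "y \<in> plane_complement i1 i2" unfolding y_def
        using proj_complement[OF i12] subspace_plane_complement subspace_scale by blast
      moreover have "x = mk i1 i2 (r t *\<^sub>R y) (\<beta>1 t) (\<beta>2 t)"
        using mk_proj[of i1 i2 x] r(1)[of t] unfolding y_def b12 by simp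
      ultimately show "x \<in> rotation_surface i1 i2 r \<beta>1 \<beta>2" unfolding rotation_surface_def by blast
    qed
    fix x assume x: "x \<in> W0"
    have ax: "axis i1 (1::real) $ i2 = 0" "axis i2 (1::real) $ i1 = 0" using i12 by (simp_all add: axis_def)
    note P = proj_shift[OF i12, of x]
    have F: "F1 (x + s *\<^sub>R axis i1 1) = F1 x + s" "F2 (x + s *\<^sub>R axis i1 1) = F2 x"
      "F1 (x + s *\<^sub>R axis i2 1) = F1 x" "F2 (x + s *\<^sub>R axis i2 1) = F2 x + s" for s
      unfolding F1_def F2_def \<tau>_def q_def P using ax by simp_all
    show "\<exists>v1 v2 p q. p \<noteq> 0 \<and> q \<noteq> 0 \<and>
      ((\<lambda>s. F1 (x + s *\<^sub>R v1)) has_real_derivative p) (at 0) \<and> ((\<lambda>s. F2 (x + s *\<^sub>R v1)) has_real_derivative 0) (at 0) \<and>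
      ((\<lambda>s. F1 (x + s *\<^sub>R v2)) has_real_derivative 0) (at 0) \<and> ((\<lambda>s. F2 (x + s *\<^sub>R v2)) has_real_derivative q) (at 0)"
      by (rule exI[of _ "axis i1 1"], rule exI[of _ "axis i2 1"], rule exI[of _ 1], rule exI[of _ 1])
         (auto simp: F intro!: derivative_eq_intros)
  qed
  then show thesis using that[OF C\<tau>] at_psi by blast
qed

section \<open>Profiles for all admissible values of H\<close>

text \<open>Given the radius from the homoclinic motion, one quadrature for the angle in the axis
  plane completes the profile. The sign of r1 decides between circular and hyperbolic
  angles.\<close>

lemma cmc_profile_exists:
  assumes card: "CARD('m::{finite,linorder}) = n + 2" and n: "n > 2" and a: "a = 1 \<or> a = -1"
    and H: "H \<notin> {- 2 * sqrt (real n - 1) / real n .. 1}"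
  obtains k \<epsilon> and i1 i2 :: "'m::{finite,linorder}" and r rd l lp \<beta>1 \<beta>2 W0 \<tau>
  where "k \<le> n + 1" "cmc_profile n k a \<epsilon> H i1 i2 r rd l lp \<beta>1 \<beta>2 W0 \<tau>"
proof -
  note R = cmc_root_props[OF n H] and S = r1_sign[OF n H]
  obtain w w' where m: "cmc_motion n H (r1 n H) w w'" and wq: "\<And>t. w t > q1 n H" and w0: "w' 0 > 0"
    by (rule homoclinic_motion[OF n H]) (rule that; assumption)
  note D = energy_motionD[OF m]
  have q: "q1 n H > 0" "inverse (q1 n H) ^ n = cmc_root1 n H" using q_facts(1)[OF n R(2)] by auto
  have wpos: "w t > 0" for t using wq[of t] q(1) by linarith
  have nb: "- 2 * sqrt (real n - 1) / real n < 0" using n by (simp add: divide_neg_pos)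
  have Hcase: "H < 0 \<or> H > 1" using H nb by auto
  define \<epsilon> :: real where "\<epsilon> = (if H > 1 then - 1 else 1)"
  have eps: "\<epsilon> = 1 \<or> \<epsilon> = - 1" unfolding \<epsilon>_def by auto
  \<comment> \<open>Scaling w by \<open>s\<close> turns the constant r1 into \<epsilon>, as the unit
    spheres of the orbits require.\<close>
  define s where "s = sqrt \<bar>r1 n H\<bar>"
  have s: "s > 0" "r1 n H = \<epsilon> * s^2" unfolding s_def \<epsilon>_def using S Hcase by auto
  obtain k and i1 i2 :: 'm where k: "k \<le> n + 1" and i12: "i1 \<noteq> i2"
    and form: "\<And>x y. pinner (sf_index k a) x y =
      a * (\<epsilon> * (\<Sum>i\<in>UNIV - {i1, i2}. x $ i * y $ i) + x $ i1 * y $ i1 - \<epsilon> * (x $ i2 * y $ i2))"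
    by (rule signature_exists[OF card n a eps]) (rule that; assumption)
  define X where "X t = inverse (w t) ^ n" for t
  define l where "l t = H + X t" for t
  define r where "r t = w t / s" for t
  define rd where "rd t = w' t / s" for t
  define lp where "lp t = - real n * X t / w t * w' t" for t
  have X: "X t > 0" "X t < cmc_root1 n H" for t
    unfolding X_def q(2)[symmetric] using wpos[of t] wq[of t] q(1) n by (auto intro!: power_strict_mono)
  have r_pos: "r t > 0" for t unfolding r_def using wpos s(1) by simp
  have P_pos: "(r t)^2 - \<epsilon> > 0" for t
  proof (cases "H > 1")
    case True then show ?thesis unfolding \<epsilon>_def by (simp add: add_nonneg_pos)
  next
    case False
    \<comment> \<open>Here s^2 = r1 \<le> q1^2 < w^2, hence r > 1 and the axis part has nonzero
      length.\<close>
    then have "s^2 \<le> (q1 n H)^2" using S(2) Hcase s(2) unfolding \<epsilon>_def by auto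
    also have "\<dots> < (w t)^2" using wq[of t] q(1) by (intro power_strict_mono) auto
    finally have "1 < (r t)^2" unfolding r_def power_divide using s(1) by (simp add: less_divide_eq)
    then show ?thesis using False unfolding \<epsilon>_def by simp
  qed
  have energy: "(rd t)^2 = \<epsilon> + (r t)^2 * ((l t)^2 - 1)" for t
    unfolding rd_def r_def power_divide D(6) cmc_energy_def X_def[symmetric] l_def[symmetric] s(2)
    using s(1) by (simp add: field_simps)
  have dr: "(r has_real_derivative rd t) (at t)" for t unfolding r_def[abs_def] rd_def
    by (intro DERIV_cdivide D(4))
  have drd: "(rd has_real_derivative r t * (l t * (real n * H - (real n - 1) * l t) - 1)) (at t)" for t
  proof -
    have e: "real n * H - (real n - 1) * l t = H - (real n - 1) * X t" unfolding l_def by (simp add: algebra_simps)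
    have "cmc_force n H (w t) / s = r t * (l t * (real n * H - (real n - 1) * l t) - 1)"
      unfolding cmc_force_def X_def[symmetric] r_def e unfolding l_def by simp
    then show ?thesis unfolding rd_def[abs_def] using DERIV_cdivide[OF D(5)[of t], of s] by simp
  qed
  have dl: "(l has_real_derivative lp t) (at t)" for t
  proof -
    have "n > 0" using n by simp
    note DERIV_chain2[OF DERIV_inverse_power[OF wpos[of t] this] D(4)]
    then have "(X has_real_derivative lp t) (at t)" unfolding X_def[abs_def] lp_def .
    then show ?thesis unfolding l_def[abs_def] using DERIV_add[OF DERIV_const[of H]] by fastforce
  qed
  have lp: "r t * lp t = - rd t * (l t - (real n * H - (real n - 1) * l t))" for t
    unfolding r_def lp_def rd_def l_def using wpos[of t] by (simp add: field_simps)
  have l_gt: "l t > H" for t unfolding l_def using X by simp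
  have l_nonconst: "\<exists>x y. l x \<noteq> l y"
  proof (rule ccontr)
    assume "\<not> ?thesis"
    then have "l = (\<lambda>t. l 0)" by auto
    then have "(l has_real_derivative 0) (at 0)" using DERIV_const[of "l 0"] by metis
    then have "lp 0 = 0" using dl DERIV_unique by blast
    then show False unfolding lp_def using w0 X(1)[of 0] wpos[of 0] n by simp
  qed
  \<comment> \<open>The derivative of rd / r^3 is expressed through \<lambda>, \<mu> and 1/r by
    means of \<open>energy\<close>; all three are bounded since w stays above q1 > 0, although r
    itself need not be bounded.\<close>
  have lip: "\<exists>K. \<forall>x y. \<bar>rd x / (r x)^3 - rd y / (r y)^3\<bar> \<le> K * \<bar>x - y\<bar>"
  proof -
    define I L where "I = s / q1 n H" and "L = \<bar>H\<bar> + real n * cmc_root1 n H"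
    define h' where "h' t = (l t * (real n * H - (real n - 1) * l t) - 1) * (inverse (r t))^2
      - 3 * (\<epsilon> * (inverse (r t))^4 + ((l t)^2 - 1) * (inverse (r t))^2)" for t
    have dh: "((\<lambda>t. rd t / (r t)^3) has_real_derivative h' t) (at t)" for t
    proof -
      define R Y where "R = r t" and "Y = l t * (real n * H - (real n - 1) * l t) - 1"
      have R0: "R > 0" unfolding R_def using r_pos .
      have "((\<lambda>t. rd t / (r t)^3) has_real_derivative (R * Y * R^3 - rd t * (3 * R^2 * rd t)) / (R^3 * R^3)) (at t)"
        unfolding R_def Y_def using r_pos[of t] by (auto intro!: derivative_eq_intros dr drd)
      moreover have "(R * Y * R^3 - rd t * (3 * R^2 * rd t)) / (R^3 * R^3) = Y * (inverse R)^2 - 3 * ((rd t)^2 * (inverse R)^4)"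
        using R0 by (simp add: field_simps power2_eq_square power3_eq_cube power4_eq_xxxx)
      moreover have "(rd t)^2 * (inverse R)^4 = \<epsilon> * (inverse R)^4 + ((l t)^2 - 1) * (inverse R)^2"
        unfolding energy R_def[symmetric] using R0 by (simp add: field_simps power2_eq_square power4_eq_xxxx)
      ultimately show ?thesis unfolding h'_def R_def[symmetric] Y_def[symmetric] by simp
    qed
    have bd: "\<bar>h' t\<bar> \<le> (L * L + 1) * I^2 + 3 * (1 * I^4 + (L^2 + 1) * I^2)" for t
    proof -
      have i: "0 < inverse (r t)" "inverse (r t) \<le> I"
        unfolding I_def r_def using wq[of t] wpos[of t] q(1) s(1) by (auto intro!: divide_left_mono)
      have X1: "X t * 1 \<le> cmc_root1 n H * real n" by (rule mult_mono) (use X[of t] n in auto)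
      have Ll: "\<bar>l t\<bar> \<le> L" unfolding l_def L_def using X[of t] X1 by (simp add: mult.commute)
      have "real n * H - (real n - 1) * l t = H - (real n - 1) * X t" unfolding l_def by (simp add: algebra_simps)
      moreover have "\<bar>H - (real n - 1) * X t\<bar> \<le> \<bar>H\<bar> + (real n - 1) * X t"
        using abs_triangle_ineq4[of H "(real n - 1) * X t"] X(1)[of t] n by simp
      moreover have "(real n - 1) * X t \<le> real n * cmc_root1 n H" by (rule mult_mono) (use X[of t] n in auto)
      ultimately have Lm: "\<bar>real n * H - (real n - 1) * l t\<bar> \<le> L" unfolding L_def by linarith
      have L0: "L \<ge> 0" using Ll by linarith
      have i2: "\<bar>(inverse (r t))^2\<bar> \<le> I^2" "\<bar>(inverse (r t))^4\<bar> \<le> I^4"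
        using power_mono[OF i(2), of 2] power_mono[OF i(2), of 4] i(1) by auto
      have "\<bar>l t * (real n * H - (real n - 1) * l t)\<bar> \<le> L * L" unfolding abs_mult by (rule mult_mono[OF Ll Lm L0]) simp
      then have A: "\<bar>l t * (real n * H - (real n - 1) * l t) - 1\<bar> \<le> L * L + 1" by linarith
      have "(l t)^2 \<le> L^2" using power_mono[OF Ll abs_ge_zero, of 2] by simp
      moreover have "(l t)^2 \<ge> 0" by simp
      ultimately have B: "\<bar>(l t)^2 - 1\<bar> \<le> L^2 + 1" by linarith
      have e: "\<bar>\<epsilon>\<bar> \<le> 1" using eps by auto
      have "\<bar>(l t * (real n * H - (real n - 1) * l t) - 1) * (inverse (r t))^2\<bar> \<le> (L * L + 1) * I^2"
        unfolding abs_mult[of _ "(inverse (r t))^2"] by (rule mult_mono[OF A i2(1)]) (use L0 in simp_all)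
      moreover have "\<bar>\<epsilon> * (inverse (r t))^4\<bar> \<le> 1 * I^4" unfolding abs_mult by (rule mult_mono[OF e i2(2)]) simp_all
      moreover have "\<bar>((l t)^2 - 1) * (inverse (r t))^2\<bar> \<le> (L^2 + 1) * I^2"
        unfolding abs_mult[of _ "(inverse (r t))^2"] by (rule mult_mono[OF B i2(1)]) simp_all
      moreover have "\<bar>x - 3 * (y + z)\<bar> \<le> a1 + 3 * (a2 + a3)" if "\<bar>x\<bar> \<le> a1" "\<bar>y\<bar> \<le> a2" "\<bar>z\<bar> \<le> a3" for x y z a1 a2 a3 :: real
      proof -
        have "\<bar>x - 3 * (y + z)\<bar> \<le> \<bar>x\<bar> + \<bar>3 * (y + z)\<bar>" by (rule abs_triangle_ineq4)
        moreover have "\<bar>3 * (y + z)\<bar> = 3 * \<bar>y + z\<bar>" unfolding abs_mult by simp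
        moreover have "\<bar>y + z\<bar> \<le> \<bar>y\<bar> + \<bar>z\<bar>" by (rule abs_triangle_ineq)
        ultimately show ?thesis using that by simp
      qed
      ultimately show ?thesis unfolding h'_def by blast
    qed
    have "norm (rd x / (r x)^3 - rd y / (r y)^3) \<le> ((L * L + 1) * I^2 + 3 * (1 * I^4 + (L^2 + 1) * I^2)) * norm (x - y)" for x y
      by (rule field_differentiable_bound[OF convex_UNIV dh]) (use bd in auto)
    then show ?thesis unfolding real_norm_def by blast
  qed
  have sw: "Ck_on k UNIV w" "Ck_on k UNIV w'" for k using cmc_motion_smooth[OF m] by auto
  have sr: "Ck_on k UNIV r" "Ck_on k UNIV rd" for k unfolding r_def[abs_def] rd_def[abs_def]
    by (intro Ck_on_divide sw Ck_on_const open_UNIV; use s(1) in simp)+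
  have sl: "Ck_on k UNIV l" for k unfolding l_def[abs_def] X_def
    by (intro Ck_on_add Ck_on_const Ck_on_power Ck_on_inverse sw open_UNIV) (use wpos less_irrefl in metis)
  have sP: "Ck_on k UNIV (\<lambda>t. (r t)^2 - \<epsilon>)" for k by (intro Ck_on_diff Ck_on_power sr Ck_on_const open_UNIV)
  \<comment> \<open>The angular velocity in the axis plane: \<open>db1\<close> and
    \<open>db2\<close> consist of a radial part and of this multiple of the generator of the
    rotations or boosts of the plane.\<close>
  define \<theta>' where "\<theta>' t = r t * l t * inverse ((r t)^2 - \<epsilon>)" for t
  have s\<theta>': "Ck_on k UNIV \<theta>'" for k unfolding \<theta>'_def[abs_def]
    by (intro Ck_on_mult sr sl Ck_on_inverse_pos sP P_pos open_UNIV)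
  obtain \<theta> where \<theta>: "\<And>t. (\<theta> has_vector_derivative \<theta>' t) (at t)"
    using antiderivative_UNIV[OF Ck_on_imp_continuous_on[OF s\<theta>']] by blast
  have s\<theta>: "Ck_on k UNIV \<theta>" for k
    by (rule Ck_on_mono[OF Ck_on_real_I[OF open_UNIV \<theta> s\<theta>']])
  have d\<theta>: "(\<theta> has_real_derivative \<theta>' t) (at t)" for t
    unfolding has_real_derivative_iff_has_vector_derivative by (rule \<theta>)
  \<comment> \<open>A common notation for the circular and the hyperbolic case: (c, sn) parametrizes
    the curve x^2 - \<epsilon> y^2 = -\<epsilon>.\<close>
  define c sn :: "real \<Rightarrow> real" where "c = (if H > 1 then cos else sinh)" and "sn = (if H > 1 then sin else cosh)"
  have dc: "(c has_real_derivative \<epsilon> * sn x) (at x)" "(sn has_real_derivative c x) (at x)" for x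
    unfolding c_def sn_def \<epsilon>_def by (auto intro!: derivative_eq_intros)
  have sc: "Ck_on k UNIV c" "Ck_on k UNIV sn" for k unfolding c_def sn_def using Ck_on_trig by auto
  have cs: "(c x)^2 - \<epsilon> * (sn x)^2 = - \<epsilon>" for x
    unfolding c_def sn_def \<epsilon>_def using hyperbolic_pythagoras[of x] sin_cos_squared_add[of x] by auto
  define \<rho> where "\<rho> t = sqrt ((r t)^2 - \<epsilon>)" for t
  have \<rho>: "\<rho> t > 0" "(\<rho> t)^2 = (r t)^2 - \<epsilon>" for t unfolding \<rho>_def using P_pos[of t] by auto
  have s\<rho>: "Ck_on k UNIV \<rho>" for k
  proof (rule Ck_on_cong[OF open_UNIV])
    show "Ck_on k UNIV (\<lambda>t. ((r t)^2 - \<epsilon>) powr (1/2))" by (rule Ck_on_powr[OF open_UNIV sP P_pos])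
    show "((r t)^2 - \<epsilon>) powr (1/2) = \<rho> t" for t unfolding \<rho>_def using P_pos[of t] by (simp add: powr_half_sqrt)
  qed
  have d\<rho>: "(\<rho> has_real_derivative r t * rd t / \<rho> t) (at t)" for t
  proof -
    have "((\<lambda>t. (r t)^2 - \<epsilon>) has_real_derivative 2 * r t * rd t) (at t)" by (auto intro!: derivative_eq_intros dr)
    from DERIV_chain2[OF DERIV_real_sqrt[OF P_pos] this] show ?thesis
      unfolding \<rho>_def[abs_def] by (simp add: field_simps)
  qed
  define \<beta>1 \<beta>2 where "\<beta>1 = (\<lambda>t. \<rho> t * c (\<theta> t))" and "\<beta>2 = (\<lambda>t. \<rho> t * sn (\<theta> t))"
  have plane: "(\<beta>1 t)^2 - \<epsilon> * (\<beta>2 t)^2 = - \<epsilon> * ((r t)^2 - \<epsilon>)" for t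
    unfolding \<beta>1_def \<beta>2_def power_mult_distrib \<rho>(2)[symmetric] using cs[of "\<theta> t"] by algebra
  have inv: "\<rho> t * inverse ((r t)^2 - \<epsilon>) = 1 / \<rho> t" for t
    unfolding \<rho>(2)[symmetric] using \<rho>(1)[of t] by (simp add: field_simps power2_eq_square)
  have db1: "(\<beta>1 has_real_derivative r t * inverse ((r t)^2 - \<epsilon>) * (rd t * \<beta>1 t + l t * \<epsilon> * \<beta>2 t)) (at t)" for t
  proof -
    have "(\<beta>1 has_real_derivative r t * rd t / \<rho> t * c (\<theta> t) + \<epsilon> * sn (\<theta> t) * \<theta>' t * \<rho> t) (at t)"
      unfolding \<beta>1_def by (rule DERIV_mult[OF d\<rho> DERIV_chain2[OF dc(1) d\<theta>]])
    moreover have "r t * rd t / \<rho> t * c (\<theta> t) = r t * rd t * c (\<theta> t) * (\<rho> t * inverse ((r t)^2 - \<epsilon>))" unfolding inv by simp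
    ultimately show ?thesis unfolding \<theta>'_def \<beta>1_def \<beta>2_def by (simp add: algebra_simps)
  qed
  have db2: "(\<beta>2 has_real_derivative r t * inverse ((r t)^2 - \<epsilon>) * (rd t * \<beta>2 t + l t * \<beta>1 t)) (at t)" for t
  proof -
    have "(\<beta>2 has_real_derivative r t * rd t / \<rho> t * sn (\<theta> t) + c (\<theta> t) * \<theta>' t * \<rho> t) (at t)"
      unfolding \<beta>2_def by (rule DERIV_mult[OF d\<rho> DERIV_chain2[OF dc(2) d\<theta>]])
    moreover have "r t * rd t / \<rho> t * sn (\<theta> t) = r t * rd t * sn (\<theta> t) * (\<rho> t * inverse ((r t)^2 - \<epsilon>))" unfolding inv by simp
    ultimately show ?thesis unfolding \<theta>'_def \<beta>1_def \<beta>2_def by (simp add: algebra_simps)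
  qed
  have comp: "Ck_on k UNIV (\<lambda>t. f (\<theta> t))" if "Ck_on k UNIV f" for f :: "real \<Rightarrow> real" and k
    by (rule Ck_on_compose_real[OF open_UNIV open_UNIV _ that s\<theta>]) simp
  have sb: "Ck_on k UNIV \<beta>1" "Ck_on k UNIV \<beta>2" for k unfolding \<beta>1_def \<beta>2_def
    by (intro Ck_on_mult s\<rho> comp sc open_UNIV)+
  obtain W0 and \<tau> :: "(real, 'm) vec \<Rightarrow> real" where tau: "Cinf_on W0 \<tau>"
    "\<And>t y. y \<in> plane_complement i1 i2 \<Longrightarrow> norm y = 1 \<Longrightarrow> mk i1 i2 (r t *\<^sub>R y) (\<beta>1 t) (\<beta>2 t) \<in> W0"
    "\<And>t y. y \<in> plane_complement i1 i2 \<Longrightarrow> norm y = 1 \<Longrightarrow> \<tau> (mk i1 i2 (r t *\<^sub>R y) (\<beta>1 t) (\<beta>2 t)) = t"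
    "codim2_submanifold (rotation_surface i1 i2 r \<beta>1 \<beta>2)"
  proof (cases "H > 1")
    case True
    \<comment> \<open>For H > 1 there is no critical point above q1, so the energy has no zero on
      the orbit and the radius is strictly increasing.\<close>
    then have "cmc_root2 n H \<le> 0" using R(4) by simp
    then have f: "cmc_force n H v > 0" if "v > q1 n H" for v
      using cmc_force_sign(2)[OF n H, of v] that q(1) by (simp add: le_less_trans)
    have dw': "(w' has_real_derivative cmc_force n H (w t)) (at t)" for t by (rule D(5))
    have nz: "w' t \<noteq> 0" for t
    proof
      assume z: "w' t = 0"
      have "cmc_energy n H (r1 n H) (w t) > cmc_energy n H (r1 n H) (q1 n H)"
        by (rule cmc_energy_increasing) (use n q(1) wq f in auto)
      then have "cmc_energy n H (r1 n H) (w t) > 0" using q_facts(1)[OF n R(2)] by simp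
      then show False using D(6)[of t] z by simp
    qed
    have "w' t > 0" for t
      by (rule nonzero_const_sign[of w' UNIV 0 t, OF DERIV_isCont[OF dw'] nz is_interval_univ UNIV_I UNIV_I w0])
    then have rdp: "rd t > 0" for t unfolding rd_def using s(1) by simp
    show thesis by (rule radial_chart[OF i12 r_pos dr rdp sr(2) sb]) (rule that; assumption)
  next
    case False
    then have e1: "\<epsilon> = 1" unfolding \<epsilon>_def by simp
    \<comment> \<open>X stays below \<open>cmc_root1\<close> and H + \<open>cmc_root1\<close> < 0,
      so \<lambda> is negative throughout and the angle strictly decreases.\<close>
    have "l t < 0" for t unfolding l_def using S(2) X(2)[of t] False Hcase by linarith
    then have \<theta>n: "\<theta>' t < 0" for t unfolding \<theta>'_def using r_pos[of t] P_pos[of t] by (simp add: mult_pos_neg mult_neg_pos)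
    have b: "\<beta>1 = (\<lambda>t. sqrt ((r t)^2 - 1) * sinh (\<theta> t))" "\<beta>2 = (\<lambda>t. sqrt ((r t)^2 - 1) * cosh (\<theta> t))"
      unfolding \<beta>1_def \<beta>2_def \<rho>_def c_def sn_def e1 using False by simp_all
    show thesis by (rule hyperbolic_chart[OF i12 r_pos P_pos[unfolded e1] sr(1) d\<theta> \<theta>n s\<theta> s\<theta>' b]) (rule that; assumption)
  qed
  have "cmc_profile n k a \<epsilon> H i1 i2 r rd l lp \<beta>1 \<beta>2 W0 \<tau>"
    by (rule cmc_profile.intro[OF card n a eps i12 form r_pos P_pos energy plane l_gt l_nonconst dr drd dl lp db1 db2 lip
      sr sl sb tau])
  with k show thesis by (rule that)
qed

context cmc_hypersurface
begin

lemma associated_constant_eq: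
  assumes "p \<in> M"
  shows "(Mderiv M (\<lambda>x. (lam x - H) powr (- 1 / real n)) p (en p))^2
      + d * ((lam p - H) powr (- 1 / real n))^2 * (a + b * (lam p)^2) = C0 p"
proof -
  have "(\<lambda>x. (lam x - H) powr (- 1 / real n)) = w" unfolding w_def[abs_def] ..
  moreover have "d * (w p)^2 * (a + b * (lam p)^2) = (a * a) * ((w p)^2 * (1 - (lam p)^2))"
    unfolding d_eq b_eq by (simp only: algebra_simps)
  ultimately show ?thesis unfolding C0_def w_def[symmetric] Mderiv_w[OF assms] by simp
qed

end

theorem mainTheorem10:
  fixes n :: nat and a :: real
  assumes "CARD('m::{finite,linorder}) = n + 2" and "n > 2" and "a = 1 \<or> a = -1"
  shows
   "(\<forall>k (M :: ((real, 'm) vec) set) \<nu> en lam mu b d H.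
       thm_hyps k a M \<nu> en lam mu b d H \<longrightarrow>
        H \<notin> {- 2 * sqrt (real n - 1) / real n .. 1} \<and>
        (\<forall>p\<in>M. \<forall>\<gamma>. integral_curve M en \<gamma> \<longrightarrow>
          (let w = (\<lambda>x. (lam x - H) powr (- 1 / real n));
               C = (Mderiv M w p (en p))^2 + d * (w p)^2 * (a + b * (lam p)^2);
               g = w \<circ> \<gamma>
           in (H < -1 \<longrightarrow> C \<le> r1 n H \<and> (C = r1 n H \<longrightarrow> g_type2 g) \<and> (C < r1 n H \<longrightarrow> g_type3 g)) \<and>
              (H = -1 \<longrightarrow> 0 < C \<and> C \<le> r1 n (-1) \<and> (C < r1 n (-1) \<longrightarrow> g_type3 g) \<and>
                         (C = r1 n (-1) \<longrightarrow> g_type2 g)) \<and>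
              (-1 < H \<and> H < - 2 * sqrt (real n - 1) / real n \<longrightarrow>
                 r2 n H < C \<and> C \<le> r1 n H \<and> (C = r1 n H \<longrightarrow> g_type5 g) \<and>
                 (r2 n H < C \<and> C < r1 n H \<longrightarrow> g_type1 g)) \<and>
              (H > 1 \<longrightarrow> C \<le> r1 n H \<and> (C = r1 n H \<longrightarrow> g_type2 g) \<and> (C < r1 n H \<longrightarrow> g_type3 g)))))
    \<and> (\<forall>H. H \<notin> {- 2 * sqrt (real n - 1) / real n .. 1} \<longrightarrow>
          (\<exists>k (M :: ((real, 'm) vec) set) \<nu> en lam mu b d. k \<le> n + 1 \<and> thm_hyps k a M \<nu> en lam mu b d H))"
proof (intro conjI allI impI ballI)
  fix k and M :: "((real, 'm) vec) set" and \<nu> en lam mu b d H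
  assume "thm_hyps k a M \<nu> en lam mu b d H"
  then interpret cmc_hypersurface n k a b d H M \<nu> en lam mu by (rule cmc_hypersurface.intro[OF assms])
  show "H \<notin> {- 2 * sqrt (real n - 1) / real n .. 1}" by (rule H_range)
  fix p \<gamma> assume p: "p \<in> M" and g: "integral_curve M en \<gamma>"
  note K = cmc_motion_classification[OF n_gt integral_curve_motion[OF p g]]
  have e: "(\<lambda>x. (lam x - H) powr (- 1 / real n)) \<circ> \<gamma> = (\<lambda>t. w (\<gamma> t))" unfolding w_def comp_def by (rule refl)
  have t: "- 2 * sqrt (real n - 1) / real n < 1" by (rule order_le_less_trans[of _ 0]) (use n_gt in simp_all)
  have out: "\<not> (- 1 < H \<and> H < - 2 * sqrt (real n - 1) / real n)" if "H \<le> - 1 \<or> 1 < H" using that t by linarith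
  show "let w = (\<lambda>x. (lam x - H) powr (- 1 / real n));
               C = (Mderiv M w p (en p))^2 + d * (w p)^2 * (a + b * (lam p)^2);
               g = w \<circ> \<gamma>
           in (H < -1 \<longrightarrow> C \<le> r1 n H \<and> (C = r1 n H \<longrightarrow> g_type2 g) \<and> (C < r1 n H \<longrightarrow> g_type3 g)) \<and>
              (H = -1 \<longrightarrow> 0 < C \<and> C \<le> r1 n (-1) \<and> (C < r1 n (-1) \<longrightarrow> g_type3 g) \<and>
                         (C = r1 n (-1) \<longrightarrow> g_type2 g)) \<and>
              (-1 < H \<and> H < - 2 * sqrt (real n - 1) / real n \<longrightarrow>
                 r2 n H < C \<and> C \<le> r1 n H \<and> (C = r1 n H \<longrightarrow> g_type5 g) \<and>
                 (r2 n H < C \<and> C < r1 n H \<longrightarrow> g_type1 g)) \<and>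
              (H > 1 \<longrightarrow> C \<le> r1 n H \<and> (C = r1 n H \<longrightarrow> g_type2 g) \<and> (C < r1 n H \<longrightarrow> g_type3 g))"
    unfolding Let_def associated_constant_eq[OF p] e
  proof (intro conjI)
    show "H < -1 \<longrightarrow> C0 p \<le> r1 n H \<and> (C0 p = r1 n H \<longrightarrow> g_type2 (\<lambda>t. w (\<gamma> t))) \<and> (C0 p < r1 n H \<longrightarrow> g_type3 (\<lambda>t. w (\<gamma> t)))"
      using K(1) out order_less_imp_le by blast
    show "H = -1 \<longrightarrow> 0 < C0 p \<and> C0 p \<le> r1 n (-1) \<and> (C0 p < r1 n (-1) \<longrightarrow> g_type3 (\<lambda>t. w (\<gamma> t))) \<and> (C0 p = r1 n (-1) \<longrightarrow> g_type2 (\<lambda>t. w (\<gamma> t)))"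
    proof
      assume H: "H = - 1"
      then show "0 < C0 p \<and> C0 p \<le> r1 n (-1) \<and> (C0 p < r1 n (-1) \<longrightarrow> g_type3 (\<lambda>t. w (\<gamma> t))) \<and> (C0 p = r1 n (-1) \<longrightarrow> g_type2 (\<lambda>t. w (\<gamma> t)))"
        using K(1)[OF out] K(2)[OF H] by (simp only: H) auto
    qed
    show "-1 < H \<and> H < - 2 * sqrt (real n - 1) / real n \<longrightarrow> r2 n H < C0 p \<and> C0 p \<le> r1 n H \<and>
        (C0 p = r1 n H \<longrightarrow> g_type5 (\<lambda>t. w (\<gamma> t))) \<and> (r2 n H < C0 p \<and> C0 p < r1 n H \<longrightarrow> g_type1 (\<lambda>t. w (\<gamma> t)))"
      using K(3) by blast
    show "H > 1 \<longrightarrow> C0 p \<le> r1 n H \<and> (C0 p = r1 n H \<longrightarrow> g_type2 (\<lambda>t. w (\<gamma> t))) \<and> (C0 p < r1 n H \<longrightarrow> g_type3 (\<lambda>t. w (\<gamma> t)))"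
      using K(1) out by blast
  qed
next
  fix H assume "H \<notin> {- 2 * sqrt (real n - 1) / real n .. 1}"
  then obtain k \<epsilon> and i1 i2 :: 'm and r rd l lp \<beta>1 \<beta>2 W0 \<tau>
    where k: "k \<le> n + 1" and "cmc_profile n k a \<epsilon> H i1 i2 r rd l lp \<beta>1 \<beta>2 W0 \<tau>"
    by (rule cmc_profile_exists[OF assms]) (rule that; assumption)
  from k cmc_profile.satisfies_hyps[OF this(2)]
  show "\<exists>k (M :: ((real, 'm) vec) set) \<nu> en lam mu b d. k \<le> n + 1 \<and> thm_hyps k a M \<nu> en lam mu b d H" by blast
qed

end
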